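(* Let $0<\alpha<1$ and $\Gamma\in C^{0,\alpha}([-1,0])$, and let the wave speed $c>0$ and a fixed mean water depth $d>0$ be given. Suppose that for some $\lambda^*>-\Gamma_{\min}$ there exists a weak solution $0\not\equiv M\in C^{1,\alpha}([-1,0])$ of the Sturm--Liouville problem $$(a^3 M_p)_p=d^2 a M \ \text{ in } -1<p<0,\qquad a^3M_p=\frac{gd^3}{p_0^2}M\ \text{ at } p=0,\qquad M=0\ \text{ at } p=-1,$$ where $a=a(\lambda^*,p)=\sqrt{\Gamma(p)+\lambda^*}$. Then for all sufficiently small $\varepsilon>0$ there exists a $C^1$-curve $$\mathcal C_{loc}=\{(\lambda^s,h^s)\in\mathbb R\times C^{1,\alpha}_{per}(\overline R): |s|<\varepsilon\}$$ such that, for each $|s|<\varepsilon$, $h^s$ is a solution of the water wave problem $$\left\{-\frac{1+d^2h_q^2}{2d^2(1+h_p)^2}+\frac{\Gamma(p)}{2d^2}\right\}_p+\left\{\frac{h_q}{1+h_p}\right\}_q=0\quad\text{in } -1<p<0,$$ $$-\frac{1+d^2h_q^2}{2d^2(1+h_p)^2}-\frac{gd(h+1)}{p_0^2}+\frac{Q}{2p_0^2}=0\quad\text{on } p=0,\qquad h=0\quad\text{on } p=-1,$$ with $Q=Q(\lambda^s)$, subject to $h_p+1>0$ in $\overline R$. The curve $\mathcal C_{loc}$ contains precisely one function independent of $q$, namely at $s=0$, where $(\lambda^0,h^0)=(\lambda^*,H(\cdot\,;\lambda^* ))$. Moreover, for $|s|<\varepsilon$, $$h^s(q,p)=H(p;\lambda^s)+s\,M(p)\cos(q)+o(s)\quad\text{in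 } C^{1,\alpha}(\overline R),$$ where $M$ is the solution of the Sturm--Liouville problem $(a^3 M_p)_p=d^2 a M$ in $-1<p<0$, $a^3M_p=\frac{gd^3}{p_0^2}M$ at $p=0$, $M=0$ at $p=-1$, with $a=a(\lambda^*,p)=\sqrt{\Gamma(p)+\lambda^*}$, normalized by $M(0)=1$.
   Context: Constants: $g>0$ (gravity), $d>0$ (mean depth), $p_0<0$ (relative mass flux) are fixed. The wave speed $c$ does not appear explicitly in the equations in the claim. The function $\Gamma:[-1,0]\to\mathbb R$ encodes the vorticity function $\gamma$ through $\Gamma(p)=2\int_0^p \frac{d^2\gamma(s)}{p_0}\,ds$, so in particular $\Gamma(0)=0$; $\Gamma_{\min}=\min_{p\in[-1,0]}\Gamma(p)$. $R=[-\pi,\pi]\times[-1,0]$ with coordinates $(q,p)$. $C^{1,\alpha}_{per}(\overline R)$ denotes the $C^{1,\alpha}$ functions which are even and $2\pi$-periodic in $q$. A solution $h\in C^{1,\alpha}_{per}(\overline R)$ of the water wave problem satisfies the divergence-form equation in $-1<p<0$ in the sense of distributions, and the boundary conditions on $p=0$ and $p=-1$ in the classical sense. Likewise a weak solution $M\in C^{1,\alpha}([-1,0])$ of the Sturm--Liouville problem satisfies the differential equation in the sense of distributions and the boundary conditions classically. For $\lambda>-\Gamma_{\min}$, the laminar ($q$-independent) solution is $$H(p;\lambda)=\int_{-1}^p\frac{ds}{\sqrt{\lambda+\Gamma(s)}}-(p+1),\qquad p\in[-1,0],$$ and $Q$ is specified in terms of $\lambda$ by $$Q(\lambda)=2gd\int_{-1}^0\frac{ds}{\sqrt{\lambda+\Gamma(s)}}+\frac{p_0^2}{d^2}\lambda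 .$$ *)

theory Defs
  imports "HOL-Analysis.Analysis" "HOL-Library.Landau_Symbols"
begin

section \<open>Hoelder spaces\<close>

text \<open>Partial derivative in the direction \<open>b\<close>, taken within \<open>S\<close>; at the boundary of a closed
  interval or strip it is the one-sided derivative.\<close>

definition pd_on :: "'a::euclidean_space set \<Rightarrow> 'a \<Rightarrow> ('a \<Rightarrow> real) \<Rightarrow> 'a \<Rightarrow> real" where
  "pd_on S b f x = frechet_derivative f (at x within S) b"

definition holder :: "real \<Rightarrow> 'a::euclidean_space set \<Rightarrow> ('a \<Rightarrow> real) set" where
  "holder \<alpha> S = {f. bounded (f ` S) \<and>
     (\<exists>C. \<forall>x\<in>S. \<forall>y\<in>S. \<bar>f x - f y\<bar> \<le> C * dist x y powr \<alpha>)}"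

definition C1_holder :: "real \<Rightarrow> 'a::euclidean_space set \<Rightarrow> ('a \<Rightarrow> real) set" where
  "C1_holder \<alpha> S = {f. f differentiable_on S \<and> bounded (f ` S) \<and>
     (\<forall>b\<in>Basis. pd_on S b f \<in> holder \<alpha> S)}"

definition sup_norm_on :: "'a::euclidean_space set \<Rightarrow> ('a \<Rightarrow> real) \<Rightarrow> real" where
  "sup_norm_on S f = (SUP x\<in>S. \<bar>f x\<bar>)"

text \<open>Pairs with \<open>x = y\<close> contribute \<open>0 / 0 = 0\<close>.\<close>

definition holder_seminorm :: "real \<Rightarrow> 'a::euclidean_space set \<Rightarrow> ('a \<Rightarrow> real) \<Rightarrow> real" where
  "holder_seminorm \<alpha> S f = (SUP (x, y)\<in>S \<times> S. \<bar>f x - f y\<bar> / dist x y powr \<alpha>)"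

definition C1_holder_norm :: "real \<Rightarrow> 'a::euclidean_space set \<Rightarrow> ('a \<Rightarrow> real) \<Rightarrow> real" where
  "C1_holder_norm \<alpha> S f = sup_norm_on S f +
     (\<Sum>b\<in>Basis. sup_norm_on S (pd_on S b f) + holder_seminorm \<alpha> S (pd_on S b f))"


section \<open>Equations in the sense of distributions\<close>

coinductive smooth :: "('a::euclidean_space \<Rightarrow> real) \<Rightarrow> bool" where
  "\<lbrakk>\<And>x. f differentiable (at x);
    \<And>b. b \<in> Basis \<Longrightarrow> smooth (\<lambda>x. frechet_derivative f (at x) b)\<rbrakk> \<Longrightarrow> smooth f"

definition test_function :: "'a::euclidean_space set \<Rightarrow> ('a \<Rightarrow> real) \<Rightarrow> bool" where
  "test_function \<Omega> \<phi> \<longleftrightarrow> smooth \<phi> \<and> (\<exists>K. compact K \<and> K \<subseteq> \<Omega> \<and> (\<forall>x. x \<notin> K \<longrightarrow> \<phi> x = 0))"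

text \<open>The equation \<open>div F = f\<close> in the open set \<open>\<Omega>\<close>, for fields that are continuous (or at least
  locally integrable) on \<open>\<Omega>\<close>; the integrand on the left is the inner product of \<open>F\<close> with the
  gradient of the test function.\<close>

definition distrib_div_eq :: "'a::euclidean_space set \<Rightarrow> ('a \<Rightarrow> 'a) \<Rightarrow> ('a \<Rightarrow> real) \<Rightarrow> bool" where
  "distrib_div_eq \<Omega> F f \<longleftrightarrow> (\<forall>\<phi>. test_function \<Omega> \<phi> \<longrightarrow>
     (LINT x:\<Omega>|lborel. frechet_derivative \<phi> (at x) (F x)) = - (LINT x:\<Omega>|lborel. f x * \<phi> x))"


section \<open>Laminar flows and the Sturm--Liouville problem\<close>

definition Gamma_min :: "(real \<Rightarrow> real) \<Rightarrow> real" where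
  "Gamma_min \<Gamma> = (INF p\<in>{-1..0}. \<Gamma> p)"

definition laminar :: "(real \<Rightarrow> real) \<Rightarrow> real \<Rightarrow> real \<Rightarrow> real" where
  "laminar \<Gamma> l p = integral {-1..p} (\<lambda>s. 1 / sqrt (l + \<Gamma> s)) - (p + 1)"

definition Q_of :: "real \<Rightarrow> real \<Rightarrow> real \<Rightarrow> (real \<Rightarrow> real) \<Rightarrow> real \<Rightarrow> real" where
  "Q_of g d p0 \<Gamma> l =
     2 * g * d * integral {-1..0} (\<lambda>s. 1 / sqrt (l + \<Gamma> s)) + p0\<^sup>2 / d\<^sup>2 * l"

definition SL_coeff :: "(real \<Rightarrow> real) \<Rightarrow> real \<Rightarrow> real \<Rightarrow> real" where
  "SL_coeff \<Gamma> l p = sqrt (\<Gamma> p + l)"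

definition SL_solution ::
    "real \<Rightarrow> real \<Rightarrow> real \<Rightarrow> real \<Rightarrow> (real \<Rightarrow> real) \<Rightarrow> real \<Rightarrow> (real \<Rightarrow> real) \<Rightarrow> bool" where
  "SL_solution \<alpha> g d p0 \<Gamma> l M \<longleftrightarrow>
     (let a = SL_coeff \<Gamma> l; M' = pd_on {-1..0} 1 M in
       M \<in> C1_holder \<alpha> {-1..0} \<and>
       distrib_div_eq {-1<..<0} (\<lambda>p. a p ^ 3 * M' p) (\<lambda>p. d\<^sup>2 * a p * M p) \<and>
       a 0 ^ 3 * M' 0 = g * d ^ 3 / p0\<^sup>2 * M 0 \<and>
       M (-1) = 0)"


section \<open>The water wave problem\<close>

text \<open>Points are pairs \<open>(q, p)\<close>. Functions in \<open>C1_holder_per\<close> live on the whole closed strip, so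
  that the periodic extension itself (and not only its restriction to one period) is
  \<open>C\<^sup>1\<^sup>,\<^sup>\<alpha>\<close>; norms are taken over the period cell \<open>cell\<close>.\<close>

definition strip :: "(real \<times> real) set" where
  "strip = UNIV \<times> {-1..0}"

definition open_strip :: "(real \<times> real) set" where
  "open_strip = UNIV \<times> {-1<..<0}"

definition cell :: "(real \<times> real) set" where
  "cell = {-pi..pi} \<times> {-1..0}"

definition C1_holder_per :: "real \<Rightarrow> (real \<times> real \<Rightarrow> real) set" where
  "C1_holder_per \<alpha> = {h \<in> C1_holder \<alpha> strip.
     \<forall>q. \<forall>p\<in>{-1..0}. h (-q, p) = h (q, p) \<and> h (q + 2 * pi, p) = h (q, p)}"

definition q_independent :: "(real \<times> real \<Rightarrow> real) \<Rightarrow> bool" where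
  "q_independent h \<longleftrightarrow> (\<forall>q q'. \<forall>p\<in>{-1..0}. h (q, p) = h (q', p))"

definition water_wave_solution ::
    "real \<Rightarrow> real \<Rightarrow> real \<Rightarrow> real \<Rightarrow> (real \<Rightarrow> real) \<Rightarrow> real \<Rightarrow> (real \<times> real \<Rightarrow> real) \<Rightarrow> bool" where
  "water_wave_solution \<alpha> g d p0 \<Gamma> Q h \<longleftrightarrow>
     (let hq = pd_on strip (1, 0) h; hp = pd_on strip (0, 1) h;
          E = (\<lambda>x. - (1 + d\<^sup>2 * (hq x)\<^sup>2) / (2 * d\<^sup>2 * (1 + hp x)\<^sup>2)) in
       h \<in> C1_holder_per \<alpha> \<and>
       (\<forall>x\<in>strip. hp x + 1 > 0) \<and>
       distrib_div_eq open_strip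
         (\<lambda>x. (hq x / (1 + hp x), E x + \<Gamma> (snd x) / (2 * d\<^sup>2))) (\<lambda>x. 0) \<and>
       (\<forall>q. E (q, 0) - g * d * (h (q, 0) + 1) / p0\<^sup>2 + Q / (2 * p0\<^sup>2) = 0) \<and>
       (\<forall>q. h (q, -1) = 0))"

text \<open>Continuously differentiable maps from an interval into the space \<open>C1_holder_per\<close> with its
  norm: difference quotients converge in norm to \<open>h'\<close>, which is continuous in norm.\<close>

definition C1_curve_per :: "real \<Rightarrow> real set \<Rightarrow> (real \<Rightarrow> real \<times> real \<Rightarrow> real) \<Rightarrow> bool" where
  "C1_curve_per \<alpha> I h \<longleftrightarrow> (\<forall>s\<in>I. h s \<in> C1_holder_per \<alpha>) \<and>
     (\<exists>h'. (\<forall>s\<in>I. h' s \<in> C1_holder_per \<alpha>) \<and>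
       (\<forall>s\<in>I. ((\<lambda>t. C1_holder_norm \<alpha> cell (\<lambda>x. (h t x - h s x) / (t - s) - h' s x)) \<longlongrightarrow> 0)
                (at s within I)) \<and>
       (\<forall>s\<in>I. ((\<lambda>t. C1_holder_norm \<alpha> cell (\<lambda>x. h' t x - h' s x)) \<longlongrightarrow> 0) (at s within I)))"

end

theory Submission
  imports Defs
begin

text \<open>
  In the height formulation the solution is sought as a double series in powers of \<open>s\<close> and in
  \<open>cos (k q)\<close>, whose coefficients are functions of \<open>p\<close>; with geometric weights such series form a
  Banach algebra, and no Schauder theory is needed, since \<open>q\<close>-derivatives are multiplications by \<open>k\<close>
  and the weight of the Hoelder seminorm is smaller than that of the supremum norm.

  Write \<open>h\<^sub>p + 1 = 1 / e + s u\<close> and \<open>h\<^sub>q = - s v\<close>, where \<open>e\<^sup>2 = \<Gamma> + \<lambda>\<close> is the squared speed of the laminar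
  flow with parameter \<open>\<lambda> = l + s m\<close>.  After integration of the divergence equation in \<open>p\<close>, the pair \<open>(u, v)\<close>
  solves a linear problem with a right-hand side of size \<open>s\<close>.  The problem decouples into Fourier modes.  By
  Sturm comparison, only the mode \<open>k = 1\<close> is resonant, with kernel spanned by \<open>M\<close>; its solvability condition is
  met by the choice of \<open>m\<close>, because the derivative of the linear problem in \<open>\<lambda>\<close> has a nonzero projection
  (the transversality condition of Crandall and Rabinowitz).  For the corrections of order \<open>s\<close>, as series in
  \<open>s / \<epsilon>\<close> with \<open>\<epsilon>\<close> small, this is a fixed point problem for a contraction.  A single fixed point in the
  space of series gives the whole curve, which is analytic in \<open>s\<close>.
\<close>

section \<open>Sequence spaces with values in a Banach space\<close>

text \<open>Two norms share the fixed point argument. Contraction is measured only in the l1 norm of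
  suprema; Hoelder bounds (\<open>hb\<close>) are merely preserved, on a set that is closed, hence
  complete, for the weaker norm. Difference estimates never involve Hoelder quotients. The parameter
  s acts as a grading: multiplication by s is \<open>\<epsilon>\<close> times an index shift, and
  evaluation at \<open>s / \<epsilon>\<close> restores the factor s. Every factor s in the remainder
  terms thus becomes a factor \<open>\<epsilon>\<close> of a Lipschitz constant. The obstacle is
  that \<open>\<Gamma>\<close> is only Hoelder continuous, so the terms of the vertical flux have no
  derivative in p. All equations are kept in integrated form, as first-order systems for value and
  flux; the weak equation is recovered from an identity that writes the whole flux as an integral.
  Square root and reciprocals are traded for extra unknowns with polynomial equations, because the
  algebra of series offers products only. The multiplier m needs no separate scalar equation: in the
  resonant mode the solution operator itself adds the load that makes its data admissible, and
  reports the multiplier.\<close>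

no_notation Infinite_Set_Sum.abs_summable_on (infix \<open>abs'_summable'_on\<close> 50)

typedef (overloaded) ('i, 'e) l1 = "{f :: 'i \<Rightarrow> 'e::real_normed_vector. f abs_summable_on UNIV}"
  morphisms coord Abs_l1
  by (rule exI[of _ "\<lambda>_. 0"]) simp

lemma coord_summable: "(\<lambda>i. norm (coord x i)) summable_on UNIV"
  using coord[of x] by simp

lemma l1_eqI: "(\<And>i. coord x i = coord y i) \<Longrightarrow> x = y"
  by (metis coord_inject ext)

lemma coord_Abs_l1: "f abs_summable_on UNIV \<Longrightarrow> coord (Abs_l1 f) = f"
  by (simp add: Abs_l1_inverse)

lemma abs_summable_plus:
  fixes f g :: "'i \<Rightarrow> 'e::real_normed_vector"
  assumes "f abs_summable_on A" "g abs_summable_on A"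
  shows "(\<lambda>i. f i + g i) abs_summable_on A"
  by (rule summable_on_comparison_test[OF summable_on_add[OF assms]]) (auto intro: norm_triangle_ineq)

instantiation l1 :: (type, real_normed_vector) real_vector
begin
definition "0 = Abs_l1 (\<lambda>_. 0)"
definition "x + y = Abs_l1 (\<lambda>i. coord x i + coord y i)"
definition "- x = Abs_l1 (\<lambda>i. - coord x i)"
definition "x - y = Abs_l1 (\<lambda>i. coord x i - coord y i)"
definition "r *\<^sub>R x = Abs_l1 (\<lambda>i. r *\<^sub>R coord x i)"

lemma coord_zero [simp]: "coord 0 i = 0"
  by (simp add: zero_l1_def coord_Abs_l1)
lemma coord_add [simp]: "coord (x + y) i = coord x i + coord y i"
  unfolding plus_l1_def by (subst coord_Abs_l1) (auto intro: abs_summable_plus coord_summable)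
lemma coord_uminus [simp]: "coord (- x) i = - coord x i"
  unfolding uminus_l1_def by (subst coord_Abs_l1) (auto intro: coord_summable)
lemma coord_diff [simp]: "coord (x - y) i = coord x i - coord y i"
  unfolding minus_l1_def using abs_summable_plus[of "coord x" UNIV "\<lambda>i. - coord y i"]
  by (subst coord_Abs_l1) (auto intro: coord_summable)
lemma coord_scaleR [simp]: "coord (r *\<^sub>R x) i = r *\<^sub>R coord x i"
  unfolding scaleR_l1_def
  by (subst coord_Abs_l1) (auto intro: coord_summable summable_on_cmult_right)

instance by standard (auto intro!: l1_eqI simp: algebra_simps)
end

instantiation l1 :: (type, real_normed_vector) real_normed_vector
begin
definition "norm x = (\<Sum>\<^sub>\<infinity>i. norm (coord x i))"
definition "dist (x :: ('a, 'b) l1) y = norm (x - y)"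
definition "sgn (x :: ('a, 'b) l1) = x /\<^sub>R norm x"
definition "uniformity = (INF e\<in>{0<..}. principal {(x :: ('a, 'b) l1, y). dist x y < e})"
definition "open (U :: ('a, 'b) l1 set) \<longleftrightarrow> (\<forall>x\<in>U. \<forall>\<^sub>F (x', y) in uniformity. x' = x \<longrightarrow> y \<in> U)"

instance
proof
  fix x y :: "('a, 'b) l1" and r :: real
  show "dist x y = norm (x - y)" by (rule dist_l1_def)
  show "sgn x = x /\<^sub>R norm x" by (rule sgn_l1_def)
  show "uniformity = (INF e\<in>{0<..}. principal {(x :: ('a, 'b) l1, y). dist x y < e})"
    by (rule uniformity_l1_def)
  show "open U \<longleftrightarrow> (\<forall>x\<in>U. \<forall>\<^sub>F (x', y) in uniformity. x' = x \<longrightarrow> y \<in> U)" for U :: "('a, 'b) l1 set"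
    by (rule open_l1_def)
  show "norm x = 0 \<longleftrightarrow> x = 0"
  proof
    assume "norm x = 0"
    then have "norm (coord x i) = 0" for i
      using nonneg_infsum_le_0D[of "\<lambda>i. norm (coord x i)" UNIV i] coord_summable[of x]
      by (simp add: norm_l1_def)
    then show "x = 0" by (auto intro: l1_eqI)
  qed (simp add: norm_l1_def)
  have "norm (x + y) \<le> (\<Sum>\<^sub>\<infinity>i. norm (coord x i) + norm (coord y i))"
    unfolding norm_l1_def coord_add
    by (intro infsum_mono abs_summable_plus summable_on_add coord_summable)
       (auto intro: norm_triangle_ineq)
  then show "norm (x + y) \<le> norm x + norm y"
    by (simp add: norm_l1_def infsum_add coord_summable)
  show "norm (r *\<^sub>R x) = \<bar>r\<bar> * norm x"
    by (simp add: norm_l1_def infsum_cmult_right')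
qed
end

lemma norm_coord_le: "norm (coord x i) \<le> norm x"
  using finite_sum_le_infsum[OF coord_summable[of x], of "{i}"] by (simp add: norm_l1_def)

lemma sum_norm_coord_le: "finite J \<Longrightarrow> (\<Sum>i\<in>J. norm (coord x i)) \<le> norm x"
  using finite_sum_le_infsum[OF coord_summable[of x], of J] by (simp add: norm_l1_def)

lemma bounded_linear_coord: "bounded_linear (\<lambda>x. coord x i)"
  by (rule bounded_linear_intro[where K = 1]) (auto simp: norm_coord_le)

lemma l1_boundI:
  fixes f :: "'i \<Rightarrow> 'e::real_normed_vector"
  assumes "\<And>J. finite J \<Longrightarrow> (\<Sum>i\<in>J. norm (f i)) \<le> K"
  shows "f abs_summable_on UNIV" and "norm (Abs_l1 f) \<le> K"
proof -
  show s: "f abs_summable_on UNIV"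
    by (rule nonneg_bdd_above_summable_on) (auto intro!: bdd_aboveI2[where M = K] assms)
  show "norm (Abs_l1 f) \<le> K"
    unfolding norm_l1_def coord_Abs_l1[OF s]
    by (rule infsum_le_finite_sums[OF s]) (use assms in auto)
qed

text \<open>Coordinatewise limits exist. The Cauchy estimate for finite partial sums passes to the
  limit uniformly in the finite set, which gives both summability of the limit and convergence in
  norm.\<close>

instance l1 :: (type, banach) banach
proof
  fix X :: "nat \<Rightarrow> ('a, 'b) l1"
  assume X: "Cauchy X"
  have "Cauchy (\<lambda>n. coord (X n) i)" for i
    using bounded_linear.Cauchy[OF bounded_linear_coord X] .
  then have "\<exists>l. (\<lambda>n. coord (X n) i) \<longlonglongrightarrow> l" for i
    by (simp add: Cauchy_convergent_iff convergent_def)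
  then obtain L where L: "\<And>i. (\<lambda>n. coord (X n) i) \<longlonglongrightarrow> L i" by metis
  have close: "(\<Sum>i\<in>J. norm (L i - coord (X n) i)) \<le> e"
    if "\<And>m. m \<ge> n \<Longrightarrow> norm (X m - X n) \<le> e" "finite J" for J n e
  proof (rule tendsto_upperbound)
    show "(\<lambda>m. \<Sum>i\<in>J. norm (coord (X m) i - coord (X n) i)) \<longlonglongrightarrow> (\<Sum>i\<in>J. norm (L i - coord (X n) i))"
      by (intro tendsto_intros L)
    show "\<forall>\<^sub>F m in sequentially. (\<Sum>i\<in>J. norm (coord (X m) i - coord (X n) i)) \<le> e"
      using eventually_ge_at_top[of n]
    proof eventually_elim
      case (elim m)
      then show ?case
        using sum_norm_coord_le[OF that(2), of "X m - X n"] that(1)[of m] by simp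
    qed
  qed auto
  have ex: "\<exists>N. \<forall>m\<ge>N. \<forall>n\<ge>N. norm (X m - X n) \<le> e" if "e > 0" for e
    using X that by (metis Cauchy_iff less_imp_le)
  obtain N where "\<forall>m\<ge>N. norm (X m - X N) \<le> 1" using ex[of 1] by auto
  then have "(\<lambda>i. L i - coord (X N) i) abs_summable_on UNIV"
    using close[of N 1] by (intro l1_boundI(1)) auto
  from abs_summable_plus[OF this coord_summable[of "X N"]]
  have Ls: "L abs_summable_on UNIV" by simp
  have "X \<longlonglongrightarrow> Abs_l1 L"
  proof (rule metric_LIMSEQ_I)
    fix r :: real assume r: "r > 0"
    then obtain N where N: "\<forall>m\<ge>N. \<forall>n\<ge>N. norm (X m - X n) \<le> r / 2" using ex[of "r/2"] by auto
    have "dist (X n) (Abs_l1 L) < r" if "n \<ge> N" for n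
    proof -
      have "Abs_l1 L - X n = Abs_l1 (\<lambda>i. L i - coord (X n) i)"
        using abs_summable_plus[OF Ls coord_summable[of "- X n"]]
        by (auto intro!: l1_eqI simp: coord_Abs_l1[OF Ls] coord_Abs_l1)
      also have "norm \<dots> \<le> r / 2"
        by (rule l1_boundI(2)) (use close[of n "r/2"] N that in auto)
      finally show ?thesis using r by (simp add: dist_norm norm_minus_commute)
    qed
    then show "\<exists>no. \<forall>n\<ge>no. dist (X n) (Abs_l1 L) < r" by blast
  qed
  then show "convergent X" by (rule convergentI)
qed

definition single :: "'i \<Rightarrow> 'e \<Rightarrow> ('i, 'e::real_normed_vector) l1" where
  "single i e = Abs_l1 (\<lambda>j. if j = i then e else 0)"

lemma single_summable: "(\<lambda>j. if j = i then e else 0 :: 'e::real_normed_vector) abs_summable_on UNIV"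
  by (rule summable_on_cong_neutral[where S = "{i}", THEN iffD1, rotated 3, OF summable_on_finite]) auto

lemma coord_single: "coord (single i e) j = (if j = i then e else 0)"
  unfolding single_def by (subst coord_Abs_l1[OF single_summable]) simp

lemma coord_single_same [simp]: "coord (single i e) i = e"
  by (simp add: coord_single)

lemma norm_single [simp]: "norm (single i e) = norm e"
proof -
  have "(\<Sum>\<^sub>\<infinity>j. norm (coord (single i e) j)) = (\<Sum>\<^sub>\<infinity>j\<in>{i}. norm e)"
    by (rule infsum_cong_neutral) (auto simp: coord_single)
  then show ?thesis by (simp add: norm_l1_def)
qed

lemma bounded_linear_single: "bounded_linear (single i)"
  by (rule bounded_linear_intro[where K = 1]) (auto intro!: l1_eqI simp: coord_single)

lemma infsum_bl:
  assumes "bounded_linear h" "f summable_on A"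
  shows "infsum (\<lambda>x. h (f x)) A = h (infsum f A)"
  by (metis assms has_sum_bounded_linear has_sum_infsum infsumI o_def)

lemma abs_summable_scaleI:
  fixes f :: "'i \<Rightarrow> 'e::real_normed_vector"
  assumes "\<And>i. norm (f i) \<le> C * g i" "g summable_on A"
  shows "f abs_summable_on A"
  by (rule summable_on_comparison_test[OF summable_on_cmult_right[OF assms(2), of C]]) (auto simp: assms(1))

text \<open>Extension of a uniformly bounded family of linear maps between the coordinates to \<open>l1\<close>;
  the image of coordinate \<open>i\<close> is stored at position \<open>\<pi> i\<close>.\<close>

definition modemap :: "('i \<Rightarrow> 'j) \<Rightarrow> ('i \<Rightarrow> 'e \<Rightarrow> 'f) \<Rightarrow> ('i, 'e::real_normed_vector) l1 \<Rightarrow> ('j, 'f::banach) l1" where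
  "modemap \<pi> L x = (\<Sum>\<^sub>\<infinity>i. single (\<pi> i) (L i (coord x i)))"

locale modes =
  fixes \<pi> :: "'i \<Rightarrow> 'j" and L :: "'i \<Rightarrow> 'e::real_normed_vector \<Rightarrow> 'f::banach" and C :: real
  assumes lin: "\<And>i. linear (L i)" and bd: "\<And>i e. norm (L i e) \<le> C * norm e"
begin

lemma abs_summable: "(\<lambda>i. single (\<pi> i) (L i (coord x i))) abs_summable_on UNIV"
  by (rule abs_summable_scaleI[where C = C and g = "\<lambda>i. norm (coord x i)"]) (auto simp: bd coord_summable)

lemma summable: "(\<lambda>i. single (\<pi> i) (L i (coord x i))) summable_on UNIV"
  by (rule abs_summable_summable[OF abs_summable])

lemma norm_le: "norm (modemap \<pi> L x) \<le> C * norm x"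
proof -
  have "norm (modemap \<pi> L x) \<le> (\<Sum>\<^sub>\<infinity>i. norm (single (\<pi> i) (L i (coord x i))))"
    unfolding modemap_def by (rule norm_infsum_bound[OF abs_summable])
  also have "\<dots> \<le> (\<Sum>\<^sub>\<infinity>i. C * norm (coord x i))"
    by (rule infsum_mono[OF abs_summable]) (auto simp: bd coord_summable intro!: summable_on_cmult_right)
  finally show ?thesis by (simp add: infsum_cmult_right' norm_l1_def)
qed

lemma bounded_linear: "bounded_linear (modemap \<pi> L)"
proof (rule bounded_linear_intro[where K = C])
  show "modemap \<pi> L (x + y) = modemap \<pi> L x + modemap \<pi> L y" for x y
    unfolding modemap_def
    by (simp add: infsum_add[symmetric] summable linear_add[OF lin]
        bounded_linear.linear[OF bounded_linear_single, THEN linear_add])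
  show "modemap \<pi> L (r *\<^sub>R x) = r *\<^sub>R modemap \<pi> L x" for x r
    unfolding modemap_def
    by (simp add: infsum_scaleR_right linear_scale[OF lin]
        bounded_linear.linear[OF bounded_linear_single, THEN linear_scale])
qed (use norm_le in \<open>simp add: mult.commute\<close>)

lemma coord_modemap: "inj \<pi> \<Longrightarrow> coord (modemap \<pi> L x) (\<pi> i) = L i (coord x i)"
proof -
  assume "inj \<pi>"
  then have "infsum (\<lambda>j. coord (single (\<pi> j) (L j (coord x j))) (\<pi> i)) UNIV
      = infsum (\<lambda>j. L j (coord x j)) {i}"
    by (intro infsum_cong_neutral) (auto simp: coord_single inj_eq)
  then show ?thesis
    unfolding modemap_def using infsum_bl[OF bounded_linear_coord summable] by simp
qed

lemma eval_modemap:
  assumes "bounded_linear h"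
  shows "h (modemap \<pi> L x) = (\<Sum>\<^sub>\<infinity>i. h (single (\<pi> i) (L i (coord x i))))"
  unfolding modemap_def using infsum_bl[OF assms summable] by simp

end

section \<open>Coefficient functions and weighted Hoelder bounds of their series\<close>

instance bcontfun :: (metric_space, banach) banach ..

type_synonym cfun = "real \<Rightarrow>\<^sub>C real"
type_synonym wiener = "(nat \<times> nat, cfun) l1"

lemma apply_bcontfun_add [simp]: "apply_bcontfun (f + g) x = apply_bcontfun f x + apply_bcontfun g x"
  for f g :: "'a::topological_space \<Rightarrow>\<^sub>C 'b::real_normed_vector"
  by (simp add: plus_bcontfun.rep_eq)
lemma apply_bcontfun_scaleR [simp]: "apply_bcontfun (r *\<^sub>R f) x = r *\<^sub>R apply_bcontfun f x"
  for f :: "'a::topological_space \<Rightarrow>\<^sub>C 'b::real_normed_vector"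
  by (simp add: scaleR_bcontfun.rep_eq)

lemma bounded_linear_apply_bcontfun: "bounded_linear (\<lambda>f::'a::topological_space \<Rightarrow>\<^sub>C 'b::real_normed_vector. apply_bcontfun f x)"
  by (rule bounded_linear_intro[where K = 1]) (auto simp: norm_bounded)

lemma abs_apply_le: "\<bar>apply_bcontfun f x\<bar> \<le> norm f" for f :: cfun
  using norm_bounded[of f x] by simp

definition bmul :: "cfun \<Rightarrow> cfun \<Rightarrow> cfun" where
  "bmul f g = Bcontfun (\<lambda>x. f x * g x)"

lemma bmul_apply [simp]: "apply_bcontfun (bmul f g) x = f x * g x"
proof -
  have "(\<lambda>x. f x * g x) \<in> bcontfun"
    by (rule bcontfun_normI[where b = "norm f * norm g"])
       (auto intro!: continuous_intros mult_mono simp: abs_mult abs_apply_le)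
  then show ?thesis by (simp add: bmul_def Bcontfun_inverse)
qed

lemma norm_bmul: "norm (bmul f g) \<le> norm f * norm g"
  by (rule norm_bound) (auto simp: abs_mult intro!: mult_mono abs_apply_le)

lemma bounded_bilinear_bmul: "bounded_bilinear bmul"
proof
  show "\<exists>K. \<forall>a b. norm (bmul a b) \<le> norm a * norm b * K"
    by (rule exI[of _ 1]) (simp add: norm_bmul)
qed (auto intro!: bcontfun_eqI simp: algebra_simps)

definition holder_term :: "real \<Rightarrow> nat \<Rightarrow> cfun \<Rightarrow> real \<Rightarrow> real \<Rightarrow> real" where
  "holder_term \<alpha> k e p q = norm e + (1/2) ^ k * (\<bar>e p - e q\<bar> / \<bar>p - q\<bar> powr \<alpha>)"

text \<open>Coefficients are functions on the whole line, but only points of the depth interval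
  enter the Hoelder part. The pair of points stays explicit instead of a supremum, so that each
  single condition is closed under limits.\<close>

definition eb :: "real \<Rightarrow> nat \<Rightarrow> cfun \<Rightarrow> real \<Rightarrow> bool" where
  "eb \<alpha> k e c \<longleftrightarrow> (\<forall>p\<in>{-1..0}. \<forall>q\<in>{-1..0}. holder_term \<alpha> k e p q \<le> c)"

text \<open>The Hoelder seminorm of the \<open>k\<close>-th mode carries the smaller weight \<open>2\<^sup>k\<close> (against \<open>4\<^sup>k\<close> for the
  supremum norm): the boundary layers of the solution operators have Hoelder seminorms that grow
  with \<open>k\<close>.\<close>

definition hb :: "real \<Rightarrow> wiener \<Rightarrow> real \<Rightarrow> bool" where
  "hb \<alpha> x K \<longleftrightarrow> (\<forall>J P Q. finite J \<longrightarrow> (\<forall>i. P i \<in> {-1..0} \<and> Q i \<in> {-1..0}) \<longrightarrow>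
     (\<Sum>i\<in>J. holder_term \<alpha> (snd i) (coord x i) (P i) (Q i)) \<le> K)"

lemma holder_term_nonneg: "0 \<le> holder_term \<alpha> k e p q"
  by (simp add: holder_term_def)

lemma half_power_mult_le_iff: "(1/2) ^ k * X \<le> c \<longleftrightarrow> X \<le> 2 ^ k * c" for X c :: real
  by (simp add: power_one_over field_simps)

lemma eb_nonneg: "eb \<alpha> k e c \<Longrightarrow> 0 \<le> c"
  unfolding eb_def by (rule order_trans[OF holder_term_nonneg[of \<alpha> k e 0 0]]) simp

lemma eb_D:
  assumes "eb \<alpha> k e c"
  shows "norm e \<le> c"
    and "p \<in> {-1..0} \<Longrightarrow> q \<in> {-1..0} \<Longrightarrow> \<bar>e p - e q\<bar> \<le> 2 ^ k * c * \<bar>p - q\<bar> powr \<alpha>"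
proof -
  show n: "norm e \<le> c"
    using assms[unfolded eb_def, rule_format, of 0 0] by (simp add: holder_term_def)
  assume pq: "p \<in> {-1..0}" "q \<in> {-1..0}"
  show "\<bar>e p - e q\<bar> \<le> 2 ^ k * c * \<bar>p - q\<bar> powr \<alpha>"
  proof (cases "p = q")
    case True
    then show ?thesis using eb_nonneg[OF assms] by simp
  next
    case False
    have "(1/2) ^ k * (\<bar>e p - e q\<bar> / \<bar>p - q\<bar> powr \<alpha>) \<le> c"
      using assms[unfolded eb_def, rule_format, of p q] pq norm_ge_zero[of e]
      unfolding holder_term_def by linarith
    then have "\<bar>e p - e q\<bar> / \<bar>p - q\<bar> powr \<alpha> \<le> 2 ^ k * c" by (simp only: half_power_mult_le_iff)
    then show ?thesis using False by (simp add: divide_le_eq)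
  qed
qed

lemma eb_I:
  fixes e :: cfun
  assumes "norm e \<le> A" "0 \<le> B"
    "\<And>p q. p \<in> {-1..0} \<Longrightarrow> q \<in> {-1..0} \<Longrightarrow> \<bar>e p - e q\<bar> \<le> 2 ^ k * B * \<bar>p - q\<bar> powr \<alpha>"
    "A + B \<le> c"
  shows "eb \<alpha> k e c"
  unfolding eb_def
proof safe
  fix p q :: real assume pq: "p \<in> {-1..0}" "q \<in> {-1..0}"
  have "(1/2) ^ k * (\<bar>e p - e q\<bar> / \<bar>p - q\<bar> powr \<alpha>) \<le> B"
  proof (cases "p = q")
    case True
    then show ?thesis using assms(2) by simp
  next
    case False
    then have "\<bar>e p - e q\<bar> / \<bar>p - q\<bar> powr \<alpha> \<le> 2 ^ k * B"
      using assms(3)[OF pq] by (simp add: divide_le_eq)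
    then show ?thesis by (simp only: half_power_mult_le_iff)
  qed
  then show "holder_term \<alpha> k e p q \<le> c" using assms(1,4) by (simp add: holder_term_def)
qed

lemma hb_norm: "hb \<alpha> x K \<Longrightarrow> norm x \<le> K"
  unfolding norm_l1_def
proof (rule infsum_le_finite_sums[OF coord_summable])
  fix F :: "(nat \<times> nat) set" assume "hb \<alpha> x K" "finite F"
  then show "(\<Sum>i\<in>F. norm (coord x i)) \<le> K"
    unfolding hb_def by (elim allE[of _ F] allE[of _ "\<lambda>_. 0"]) (simp add: holder_term_def)
qed

lemma hb_nonneg: "hb \<alpha> x K \<Longrightarrow> 0 \<le> K"
  using hb_norm norm_ge_zero order_trans by blast

lemma hb_mono: "hb \<alpha> x K \<Longrightarrow> K \<le> L \<Longrightarrow> hb \<alpha> x L"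
  unfolding hb_def by (meson order_trans)

lemma hb_use:
  assumes "hb \<alpha> x K" "finite J" "\<forall>i. P i \<in> {-1..0} \<and> Q i \<in> {-1..0}"
  shows "(\<Sum>i\<in>J. holder_term \<alpha> (snd i) (coord x i) (P i) (Q i)) \<le> K"
  using assms unfolding hb_def by blast

lemma hb_I:
  assumes "\<And>i. eb \<alpha> (snd i) (coord x i) (c i)" "c summable_on UNIV" "infsum c UNIV \<le> K"
  shows "hb \<alpha> x K"
  unfolding hb_def
proof (intro allI impI)
  fix J :: "(nat \<times> nat) set" and P Q :: "nat \<times> nat \<Rightarrow> real"
  assume J: "finite J"
    and PQ: "\<forall>i. P i \<in> {-1..0::real} \<and> Q i \<in> {-1..0::real}"
  have "(\<Sum>i\<in>J. holder_term \<alpha> (snd i) (coord x i) (P i) (Q i)) \<le> sum c J"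
    using assms(1) PQ by (intro sum_mono) (auto simp: eb_def)
  also have "\<dots> \<le> infsum c UNIV"
    by (rule finite_sum_le_infsum[OF assms(2) J]) (use eb_nonneg[OF assms(1)] in auto)
  finally show "(\<Sum>i\<in>J. holder_term \<alpha> (snd i) (coord x i) (P i) (Q i)) \<le> K" using assms(3) by simp
qed

text \<open>The points for different indices are chosen independently, so nothing is lost by
  maximising each term separately; the induction moves one index at a time to the right-hand side.
  This turns a bound over all selections into a bound for suprema.\<close>

lemma sum_SUP_le:
  fixes f :: "'i \<Rightarrow> 'a \<Rightarrow> real"
  assumes "finite J" "S \<noteq> {}" "\<And>P. (\<And>i. P i \<in> S) \<Longrightarrow> (\<Sum>i\<in>J. f i (P i)) \<le> K"
  shows "(\<Sum>i\<in>J. SUP a\<in>S. f i a) \<le> K"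
  using assms(1,3)
proof (induction J arbitrary: K rule: finite_induct)
  case (insert j J)
  have "f j a \<le> K - (\<Sum>i\<in>J. SUP a\<in>S. f i a)" if a: "a \<in> S" for a
  proof -
    have "(\<Sum>i\<in>J. f i (P i)) \<le> K - f j a" if "\<And>i. P i \<in> S" for P
    proof -
      have "(\<Sum>i\<in>insert j J. f i ((P(j := a)) i)) \<le> K"
        by (rule insert.prems) (use that a in auto)
      also have "(\<Sum>i\<in>insert j J. f i ((P(j := a)) i)) = f j a + (\<Sum>i\<in>J. f i (P i))"
        using insert.hyps by (auto intro!: sum.cong)
      finally show ?thesis by simp
    qed
    then show ?thesis using insert.IH[of "K - f j a"] by simp
  qed
  then have "(SUP a\<in>S. f j a) \<le> K - (\<Sum>i\<in>J. SUP a\<in>S. f i a)"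
    by (intro cSUP_least assms(2))
  then show ?case using insert.hyps by simp
qed (use assms(2) in fastforce)

text \<open>Converse of \<open>hb_I\<close>: the suprema of the single terms form a summable
  majorant. Estimates work mode by mode with this majorant, whereas the quantification over
  selections in \<open>hb\<close> is what makes it closed.\<close>

lemma hb_D:
  assumes "hb \<alpha> x K"
  obtains c where "\<And>i. eb \<alpha> (snd i) (coord x i) (c i)" "c summable_on UNIV" "infsum c UNIV \<le> K"
proof
  define S where "S = {-1..0::real} \<times> {-1..0::real}"
  define f where "f i = (\<lambda>(p, q). holder_term \<alpha> (snd i) (coord x i) p q)" for i
  define c where "c i = (SUP a\<in>S. f i a)" for i
  have fin: "(\<Sum>i\<in>J. f i (P i)) \<le> K" if "finite J" "\<And>i. P i \<in> S" for J P
  proof -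
    have "\<forall>i. fst (P i) \<in> {-1..0} \<and> snd (P i) \<in> {-1..0}"
      using that(2) unfolding S_def mem_Times_iff by blast
    then have "(\<Sum>i\<in>J. holder_term \<alpha> (snd i) (coord x i) (fst (P i)) (snd (P i))) \<le> K"
      by (rule hb_use[OF assms that(1)])
    then show ?thesis by (simp add: f_def case_prod_unfold)
  qed
  have bdd: "bdd_above (f i ` S)" for i
  proof (rule bdd_aboveI2)
    fix a assume "a \<in> S"
    then show "f i a \<le> K" using fin[of "{i}" "\<lambda>_. a"] by simp
  qed
  show eb: "eb \<alpha> (snd i) (coord x i) (c i)" for i
    unfolding eb_def
  proof safe
    fix p q :: real assume "p \<in> {-1..0}" "q \<in> {-1..0}"
    then have "(p, q) \<in> S" by (simp add: S_def)
    from cSUP_upper[OF this bdd] show "holder_term \<alpha> (snd i) (coord x i) p q \<le> c i"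
      by (simp add: f_def c_def)
  qed
  have c: "sum c J \<le> K" if "finite J" for J
    unfolding c_def by (rule sum_SUP_le[OF that]) (use fin[OF that] in \<open>auto simp: S_def\<close>)
  have "(\<lambda>i. norm (c i)) summable_on UNIV"
    using l1_boundI(1)[of c K] c eb_nonneg[OF eb] by simp
  then show s: "c summable_on UNIV" by (rule abs_summable_summable)
  show "infsum c UNIV \<le> K" by (rule infsum_le_finite_sums[OF s]) (use c in auto)
qed

text \<open>For fixed \<open>J\<close> and fixed points the sum is continuous in the coordinates,
  although the l1 norm does not control Hoelder quotients. Hence an \<open>hb\<close> ball is
  complete in the weaker norm, as Banach's theorem requires.\<close>

lemma closed_hb: "closed {x. hb \<alpha> x K}"
proof -
  have "{x. hb \<alpha> x K} = (\<Inter>(J, P, Q)\<in>{(J, P, Q). finite J \<and> (\<forall>i. P i \<in> {-1..0} \<and> Q i \<in> {-1..0})}.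
     {x. (\<Sum>i\<in>J. holder_term \<alpha> (snd i) (coord x i) (P i) (Q i)) \<le> K})"
    unfolding hb_def by fastforce
  moreover have "continuous_on UNIV (\<lambda>x::wiener. apply_bcontfun (coord x i) p)" for i and p :: real
    by (rule linear_continuous_on[OF bounded_linear_compose[OF bounded_linear_apply_bcontfun[of p] bounded_linear_coord[of i]]])
  then have "closed {x. (\<Sum>i\<in>J. holder_term \<alpha> (snd i) (coord x i) (P i) (Q i)) \<le> K}"
    for J and P Q :: "nat \<times> nat \<Rightarrow> real"
    unfolding holder_term_def divide_inverse
    by (intro closed_Collect_le continuous_on_sum continuous_on_add continuous_on_mult continuous_on_const
        continuous_on_norm continuous_on_rabs continuous_on_diff linear_continuous_on[OF bounded_linear_coord])
  ultimately show ?thesis by (simp add: closed_INT case_prod_unfold)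
qed

lemma hb_zero [simp]: "hb \<alpha> 0 0"
  by (simp add: hb_def holder_term_def)

lemma hb_add:
  assumes "hb \<alpha> x K" "hb \<alpha> y L"
  shows "hb \<alpha> (x + y) (K + L)"
  unfolding hb_def
proof (intro allI impI)
  fix J :: "(nat \<times> nat) set" and P Q :: "nat \<times> nat \<Rightarrow> real"
  assume JPQ: "finite J" "\<forall>i. P i \<in> {-1..0} \<and> Q i \<in> {-1..0}"
  have "holder_term \<alpha> k (e + f) p q \<le> holder_term \<alpha> k e p q + holder_term \<alpha> k f p q" for k e f p q
  proof -
    have "\<bar>(e + f) p - (e + f) q\<bar> / \<bar>p - q\<bar> powr \<alpha>
        \<le> (\<bar>e p - e q\<bar> + \<bar>f p - f q\<bar>) / \<bar>p - q\<bar> powr \<alpha>"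
      by (intro divide_right_mono) auto
    then have "(1/2) ^ k * (\<bar>(e + f) p - (e + f) q\<bar> / \<bar>p - q\<bar> powr \<alpha>)
        \<le> (1/2) ^ k * (\<bar>e p - e q\<bar> / \<bar>p - q\<bar> powr \<alpha> + \<bar>f p - f q\<bar> / \<bar>p - q\<bar> powr \<alpha>)"
      by (intro mult_left_mono) (auto simp: add_divide_distrib)
    then show ?thesis using norm_triangle_ineq[of e f] by (simp add: holder_term_def algebra_simps)
  qed
  then have "(\<Sum>i\<in>J. holder_term \<alpha> (snd i) (coord (x + y) i) (P i) (Q i))
     \<le> (\<Sum>i\<in>J. holder_term \<alpha> (snd i) (coord x i) (P i) (Q i)) + (\<Sum>i\<in>J. holder_term \<alpha> (snd i) (coord y i) (P i) (Q i))"
    by (simp add: sum.distrib[symmetric] sum_mono)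
  then show "(\<Sum>i\<in>J. holder_term \<alpha> (snd i) (coord (x + y) i) (P i) (Q i)) \<le> K + L"
    using hb_use[OF assms(1) JPQ] hb_use[OF assms(2) JPQ] by linarith
qed

lemma hb_scaleR:
  assumes "hb \<alpha> x K"
  shows "hb \<alpha> (r *\<^sub>R x) (\<bar>r\<bar> * K)"
  unfolding hb_def
proof (intro allI impI)
  fix J :: "(nat \<times> nat) set" and P Q :: "nat \<times> nat \<Rightarrow> real"
  assume JPQ: "finite J" "\<forall>i. P i \<in> {-1..0} \<and> Q i \<in> {-1..0}"
  have "holder_term \<alpha> k (r *\<^sub>R e) p q = \<bar>r\<bar> * holder_term \<alpha> k e p q" for k e p q
    unfolding holder_term_def apply_bcontfun_scaleR real_scaleR_def right_diff_distrib[symmetric] abs_mult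
    by (simp add: algebra_simps)
  then have "(\<Sum>i\<in>J. holder_term \<alpha> (snd i) (coord (r *\<^sub>R x) i) (P i) (Q i))
     = \<bar>r\<bar> * (\<Sum>i\<in>J. holder_term \<alpha> (snd i) (coord x i) (P i) (Q i))"
    by (simp add: sum_distrib_left)
  then show "(\<Sum>i\<in>J. holder_term \<alpha> (snd i) (coord (r *\<^sub>R x) i) (P i) (Q i)) \<le> \<bar>r\<bar> * K"
    using hb_use[OF assms JPQ] by (simp add: mult_left_mono)
qed

lemma hb_single:
  assumes "eb \<alpha> (snd i) e c"
  shows "hb \<alpha> (single i e) c"
proof (rule hb_I[where c = "\<lambda>j. if j = i then c else 0"])
  show "eb \<alpha> (snd j) (coord (single i e) j) (if j = i then c else 0)" for j
    using assms by (auto simp: coord_single eb_def holder_term_def)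
  have "(\<lambda>j. if j = i then c else 0) summable_on UNIV \<longleftrightarrow> (\<lambda>j. c) summable_on {i}"
    by (rule summable_on_cong_neutral) auto
  then show "(\<lambda>j. if j = i then c else 0) summable_on UNIV" by simp
  have "infsum (\<lambda>j. if j = i then c else 0) UNIV = infsum (\<lambda>j. c) {i}"
    by (rule infsum_cong_neutral) auto
  then show "infsum (\<lambda>j. if j = i then c else 0) UNIV \<le> c" by simp
qed

lemma hb_sum:
  assumes "finite F" "\<And>j. j \<in> F \<Longrightarrow> hb \<alpha> (X j) (c j)"
  shows "hb \<alpha> (sum X F) (sum c F)"
  using assms by (induction F) (auto intro: hb_add)

text \<open>The partial sums obey the bound by \<open>hb_sum\<close>, and \<open>closed_hb\<close>
  carries it over to the limit.\<close>

lemma hb_infsum: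
  assumes "\<And>j. hb \<alpha> (X j) (c j)" "c summable_on UNIV"
  shows "X abs_summable_on UNIV" "hb \<alpha> (infsum X UNIV) (infsum c UNIV)"
proof -
  show s: "X abs_summable_on UNIV"
    by (rule summable_on_comparison_test[OF assms(2)]) (auto intro: hb_norm[OF assms(1)])
  have "(X has_sum infsum X UNIV) UNIV" by (rule has_sum_infsum[OF abs_summable_summable[OF s]])
  then have l: "(sum X \<longlongrightarrow> infsum X UNIV) (finite_subsets_at_top UNIV)" by (simp add: has_sum_def)
  have "\<forall>\<^sub>F F in finite_subsets_at_top UNIV. sum X F \<in> {x. hb \<alpha> x (infsum c UNIV)}"
  proof (rule eventually_finite_subsets_at_top_weakI, simp)
    fix F :: "'a set" assume F: "finite F"
    have "sum c F \<le> infsum c UNIV"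
      by (rule finite_sum_le_infsum[OF assms(2) F]) (use hb_nonneg[OF assms(1)] in auto)
    then show "hb \<alpha> (sum X F) (infsum c UNIV)" by (rule hb_mono[OF hb_sum[OF F assms(1)]])
  qed
  from Lim_in_closed_set[OF closed_hb this _ l] show "hb \<alpha> (infsum X UNIV) (infsum c UNIV)"
    by simp
qed

lemma hb_modemap:
  fixes x :: wiener
  assumes e: "\<And>i e c. eb \<alpha> (snd i) e c \<Longrightarrow> eb \<alpha> (snd (p i)) (l i e) (D * c)"
    and x: "hb \<alpha> x K" and D: "0 \<le> D"
  shows "hb \<alpha> (modemap p l x) (D * K)"
proof -
  obtain c where c: "\<And>i. eb \<alpha> (snd i) (coord x i) (c i)" "c summable_on UNIV" "infsum c UNIV \<le> K"
    using hb_D[OF x] by metis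
  have "hb \<alpha> (infsum (\<lambda>i. single (p i) (l i (coord x i))) UNIV) (infsum (\<lambda>i. D * c i) UNIV)"
    by (intro hb_infsum hb_single e c summable_on_cmult_right)
  then have "hb \<alpha> (modemap p l x) (D * infsum c UNIV)" by (simp add: modemap_def infsum_cmult_right')
  then show ?thesis using c(3) D by (meson hb_mono mult_left_mono)
qed

section \<open>The algebra of cosine and sine series\<close>

lemma summable_product_real:
  fixes f :: "'i \<Rightarrow> real" and g :: "'j \<Rightarrow> real"
  assumes "f abs_summable_on UNIV" "g abs_summable_on UNIV"
  shows "(\<lambda>(i, j). f i * g j) summable_on UNIV"
    and "(\<Sum>\<^sub>\<infinity>(i, j). f i * g j) = infsum f UNIV * infsum g UNIV"
proof -
  have "(\<lambda>(i, j). f i * g j) abs_summable_on UNIV \<times> UNIV"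
  proof (rule iffD2[OF Infinite_Sum.abs_summable_on_Sigma_iff], intro conjI ballI)
    show "(\<lambda>j. case (i, j) of (i, j) \<Rightarrow> f i * g j) abs_summable_on UNIV" for i
      using assms(2) by (auto simp: abs_mult intro: summable_on_cmult_right)
    show "(\<lambda>i. \<Sum>\<^sub>\<infinity>j. norm (case (i, j) of (i, j) \<Rightarrow> f i * g j)) abs_summable_on UNIV"
      using assms(1) by (auto simp: abs_mult infsum_cmult_right' intro: summable_on_cmult_left)
  qed
  then show s: "(\<lambda>(i, j). f i * g j) summable_on UNIV"
    unfolding UNIV_Times_UNIV by (rule abs_summable_summable)
  have "((\<lambda>(i, j). f i * g j) has_sum (infsum f UNIV * infsum g UNIV)) (UNIV \<times> UNIV)"
  proof (rule has_sum_SigmaI[where g = "\<lambda>i. f i * infsum g UNIV"])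
    show "((\<lambda>j. (\<lambda>(i, j). f i * g j) (i, j)) has_sum f i * infsum g UNIV) UNIV" for i
      using has_sum_cmult_right[OF has_sum_infsum[OF abs_summable_summable[OF assms(2)]]] by simp
    show "((\<lambda>i. f i * infsum g UNIV) has_sum infsum f UNIV * infsum g UNIV) UNIV"
      using has_sum_cmult_left[OF has_sum_infsum[OF abs_summable_summable[OF assms(1)]]] by simp
  qed (use s in simp)
  then show "(\<Sum>\<^sub>\<infinity>(i, j). f i * g j) = infsum f UNIV * infsum g UNIV"
    by (intro infsumI) simp
qed

definition ndist :: "nat \<Rightarrow> nat \<Rightarrow> nat" where "ndist k m = (if k \<le> m then m - k else k - m)"

definition prod_term :: "real \<Rightarrow> (nat \<Rightarrow> nat \<Rightarrow> real) \<Rightarrow> wiener \<Rightarrow> wiener \<Rightarrow> (nat \<times> nat) \<times> (nat \<times> nat) \<Rightarrow> wiener" where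
  "prod_term \<tau> \<sigma> x y = (\<lambda>((n, k), (m, l)).
     single (n + m, k + l) ((\<tau> / 2) *\<^sub>R bmul (coord x (n, k)) (coord y (m, l)))
   + single (n + m, ndist k l) ((\<sigma> k l / 2 * (4 ^ ndist k l / 4 ^ (k + l))) *\<^sub>R bmul (coord x (n, k)) (coord y (m, l))))"

text \<open>The coefficient of \<open>s\<^sup>n cos (k q)\<close> (or \<open>s\<^sup>n sin (k q)\<close>) represented by \<open>x\<close> is
  \<open>coord x (n, k) / 4\<^sup>k\<close>; the signs select the product formula for two cosines, two sines, or a
  cosine and a sine.\<close>

definition sprod :: "real \<Rightarrow> (nat \<Rightarrow> nat \<Rightarrow> real) \<Rightarrow> wiener \<Rightarrow> wiener \<Rightarrow> wiener" where
  "sprod \<tau> \<sigma> x y = infsum (prod_term \<tau> \<sigma> x y) UNIV"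

text \<open>Product rule for difference quotients: the three resulting terms appear among the four
  nonnegative terms of the product on the right. Each mixed term needs the weight of one factor
  only, hence two separate weight hypotheses. The factor 1/2 is there because a product of two modes
  yields two modes.\<close>

lemma holder_term_bmul:
  assumes "\<bar>c\<bar> \<le> 1/2" "\<bar>c\<bar> * (1/2) ^ m \<le> 1/2 * (1/2) ^ k" "\<bar>c\<bar> * (1/2) ^ m \<le> 1/2 * (1/2) ^ l"
  shows "holder_term \<alpha> m (c *\<^sub>R bmul e f) p q \<le> 1/2 * (holder_term \<alpha> k e p q * holder_term \<alpha> l f p q)"
proof -
  define E where "E = \<bar>e p - e q\<bar> / \<bar>p - q\<bar> powr \<alpha>"
  define F where "F = \<bar>f p - f q\<bar> / \<bar>p - q\<bar> powr \<alpha>"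
  have [simp]: "E \<ge> 0" "F \<ge> 0" by (auto simp: E_def F_def)
  have "\<bar>e p * f p - e q * f q\<bar> \<le> \<bar>e p - e q\<bar> * norm f + norm e * \<bar>f p - f q\<bar>"
  proof -
    have "e p * f p - e q * f q = (e p - e q) * f p + e q * (f p - f q)" by (simp add: algebra_simps)
    also have "\<bar>\<dots>\<bar> \<le> \<bar>e p - e q\<bar> * \<bar>f p\<bar> + \<bar>e q\<bar> * \<bar>f p - f q\<bar>"
      unfolding abs_mult[symmetric] by (rule abs_triangle_ineq)
    also have "\<dots> \<le> \<bar>e p - e q\<bar> * norm f + norm e * \<bar>f p - f q\<bar>"
      by (intro add_mono mult_mono abs_apply_le) auto
    finally show ?thesis .
  qed
  then have 1: "\<bar>e p * f p - e q * f q\<bar> / \<bar>p - q\<bar> powr \<alpha> \<le> E * norm f + norm e * F"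
    using divide_right_mono[of _ _ "\<bar>p - q\<bar> powr \<alpha>"]
    by (fastforce simp: E_def F_def add_divide_distrib)
  have "holder_term \<alpha> m (c *\<^sub>R bmul e f) p q
      = \<bar>c\<bar> * norm (bmul e f) + (\<bar>c\<bar> * (1/2) ^ m) * (\<bar>e p * f p - e q * f q\<bar> / \<bar>p - q\<bar> powr \<alpha>)"
    unfolding holder_term_def apply_bcontfun_scaleR bmul_apply real_scaleR_def right_diff_distrib[symmetric] abs_mult
    by simp
  also have "\<dots> \<le> \<bar>c\<bar> * (norm e * norm f) + (\<bar>c\<bar> * (1/2) ^ m) * (E * norm f + norm e * F)"
    by (intro add_mono mult_left_mono norm_bmul 1) auto
  also have "\<dots> = \<bar>c\<bar> * (norm e * norm f) + (\<bar>c\<bar> * (1/2) ^ m) * (E * norm f) + (\<bar>c\<bar> * (1/2) ^ m) * (norm e * F)"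
    by (simp add: algebra_simps)
  also have "\<dots> \<le> 1/2 * (norm e * norm f) + (1/2 * (1/2) ^ k) * (E * norm f) + (1/2 * (1/2) ^ l) * (norm e * F)"
    by (intro add_mono mult_right_mono assms) auto
  also have "\<dots> \<le> 1/2 * ((norm e + (1/2) ^ k * E) * (norm f + (1/2) ^ l * F))"
    by (simp add: algebra_simps)
  finally show ?thesis by (simp add: holder_term_def E_def F_def)
qed

lemma hb_add_split:
  assumes "eb \<alpha> k e a" "eb \<alpha> l f b" "\<And>p q. holder_term \<alpha> m g p q \<le> 1/2 * (holder_term \<alpha> k e p q * holder_term \<alpha> l f p q)"
  shows "eb \<alpha> m g (1/2 * (a * b))"
  unfolding eb_def
proof safe
  fix p q :: real assume "p \<in> {-1..0}" "q \<in> {-1..0}"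
  then have "holder_term \<alpha> k e p q * holder_term \<alpha> l f p q \<le> a * b"
    using assms(1,2) by (intro mult_mono holder_term_nonneg eb_nonneg[OF assms(1)]) (auto simp: eb_def)
  then show "holder_term \<alpha> m g p q \<le> 1/2 * (a * b)" using assms(3)[of p q] by linarith
qed

lemma ndist_le: "ndist k l \<le> k + l"
  by (auto simp: ndist_def)

lemma weight_le: "(4::real) ^ ndist k l / 4 ^ (k + l) \<le> 1"
  by (simp add: divide_le_eq ndist_le power_increasing)

text \<open>With d the difference frequency, the left side is \<open>2 ^ d / 4 ^ (k + l)\<close>,
  and d is at most k + l. The difference mode is therefore never more expensive than the sum
  mode.\<close>

lemma weight_le': "(4::real) ^ ndist k l / 4 ^ (k + l) * (1/2) ^ ndist k l \<le> (1/2) ^ (k + l)"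
proof -
  have "(4::real) ^ ndist k l * (1/2) ^ ndist k l = 2 ^ ndist k l"
    by (simp add: power_mult_distrib[symmetric])
  also have "\<dots> \<le> 2 ^ (k + l)" by (intro power_increasing ndist_le) simp
  also have "\<dots> = (1/2) ^ (k + l) * 4 ^ (k + l)" by (simp add: power_mult_distrib[symmetric])
  finally show ?thesis by (simp add: field_simps)
qed

text \<open>The estimates see the trigonometric product formulas only through the size of their
  signs; one development serves cosine by cosine, sine by sine and cosine by sine.\<close>

locale signs =
  fixes \<tau> :: real and \<sigma> :: "nat \<Rightarrow> nat \<Rightarrow> real"
  assumes \<tau>: "\<bar>\<tau>\<bar> \<le> 1" and \<sigma>: "\<And>k l. \<bar>\<sigma> k l\<bar> \<le> 1"
begin

lemma coeff_bounds:
  "\<bar>\<sigma> k l / 2 * (4 ^ ndist k l / 4 ^ (k + l))\<bar> \<le> 1/2"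
  "\<bar>\<sigma> k l / 2 * (4 ^ ndist k l / 4 ^ (k + l))\<bar> * (1/2) ^ ndist k l \<le> 1/2 * (1/2) ^ (k + l)"
proof -
  have "\<bar>\<sigma> k l\<bar> * (4 ^ ndist k l / 4 ^ (k + l)) \<le> 1 * 1"
    by (intro mult_mono \<sigma> weight_le) auto
  then show "\<bar>\<sigma> k l / 2 * (4 ^ ndist k l / 4 ^ (k + l))\<bar> \<le> 1/2" by (simp add: abs_mult)
  have "\<bar>\<sigma> k l\<bar> * (4 ^ ndist k l / 4 ^ (k + l) * (1/2) ^ ndist k l) \<le> 1 * (1/2) ^ (k + l)"
    by (intro mult_mono \<sigma> weight_le') auto
  then show "\<bar>\<sigma> k l / 2 * (4 ^ ndist k l / 4 ^ (k + l))\<bar> * (1/2) ^ ndist k l \<le> 1/2 * (1/2) ^ (k + l)"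
    by (simp add: abs_mult mult.assoc)
qed

lemma norm_prod_term: "norm (prod_term \<tau> \<sigma> x y (i, j)) \<le> norm (coord x i) * norm (coord y j)"
proof (cases i, cases j)
  fix n k m l assume [simp]: "i = (n, k)" "j = (m, l)"
  define B where "B = bmul (coord x i) (coord y j)"
  have "norm (prod_term \<tau> \<sigma> x y (i, j)) \<le> \<bar>\<tau> / 2\<bar> * norm B + \<bar>\<sigma> k l / 2 * (4 ^ ndist k l / 4 ^ (k + l))\<bar> * norm B"
    unfolding prod_term_def by (simp add: B_def norm_triangle_le)
  also have "\<dots> \<le> 1/2 * norm B + 1/2 * norm B"
    using \<tau> by (intro add_mono mult_right_mono coeff_bounds) auto
  also have "\<dots> \<le> norm (coord x i) * norm (coord y j)" using norm_bmul by (simp add: B_def)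
  finally show ?thesis .
qed

lemma hb_prod_term:
  assumes "eb \<alpha> (snd i) (coord x i) a" "eb \<alpha> (snd j) (coord y j) b"
  shows "hb \<alpha> (prod_term \<tau> \<sigma> x y (i, j)) (a * b)"
proof (cases i, cases j)
  fix n k m l assume [simp]: "i = (n, k)" "j = (m, l)"
  have e: "eb \<alpha> k (coord x (n, k)) a" "eb \<alpha> l (coord y (m, l)) b" using assms by simp_all
  have p: "(1/2::real) ^ (k + l) \<le> (1/2) ^ k" "(1/2::real) ^ (k + l) \<le> (1/2) ^ l"
    by (simp_all add: power_add mult_left_le mult_left_le_one_le power_le_one)
  have "eb \<alpha> (k + l) ((\<tau> / 2) *\<^sub>R bmul (coord x (n, k)) (coord y (m, l))) (1/2 * (a * b))"
  proof (intro hb_add_split[OF e] holder_term_bmul)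
    have "\<bar>\<tau> / 2\<bar> * (1/2) ^ (k + l) \<le> 1/2 * (1/2) ^ k" "\<bar>\<tau> / 2\<bar> * (1/2) ^ (k + l) \<le> 1/2 * (1/2) ^ l"
      using \<tau> p by (intro mult_mono; simp)+
    then show "\<bar>\<tau> / 2\<bar> * (1/2) ^ (k + l) \<le> 1/2 * (1/2) ^ k" "\<bar>\<tau> / 2\<bar> * (1/2) ^ (k + l) \<le> 1/2 * (1/2) ^ l"
      by auto
  qed (use \<tau> in simp)
  moreover have "eb \<alpha> (ndist k l) ((\<sigma> k l / 2 * (4 ^ ndist k l / 4 ^ (k + l))) *\<^sub>R bmul (coord x (n, k)) (coord y (m, l))) (1/2 * (a * b))"
    by (intro hb_add_split[OF e] holder_term_bmul coeff_bounds(1) order_trans[OF coeff_bounds(2)] mult_left_mono p) auto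
  ultimately have "hb \<alpha> (prod_term \<tau> \<sigma> x y ((n, k), (m, l))) (1/2 * (a * b) + 1/2 * (a * b))"
    unfolding prod_term_def prod.case by (intro hb_add hb_single) (simp_all only: snd_conv)
  then show ?thesis by simp
qed

lemma norm_coord_prod:
  "(\<lambda>(i, j). norm (coord x i) * norm (coord y j)) summable_on UNIV"
  "(\<Sum>\<^sub>\<infinity>(i, j). norm (coord x i) * norm (coord y j)) = norm x * norm y" for x y :: wiener
proof -
  have "(\<lambda>i. norm (norm (coord x i))) summable_on UNIV" "(\<lambda>i. norm (norm (coord y i))) summable_on UNIV"
    by (simp_all add: coord_summable)
  from summable_product_real[OF this]
  show "(\<lambda>(i, j). norm (coord x i) * norm (coord y j)) summable_on UNIV"
    "(\<Sum>\<^sub>\<infinity>(i, j). norm (coord x i) * norm (coord y j)) = norm x * norm y"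
    by (simp_all only: norm_l1_def)
qed

lemma prod_term_summable: "prod_term \<tau> \<sigma> x y abs_summable_on UNIV"
  by (rule summable_on_comparison_test[OF norm_coord_prod(1)[of x y]]) (use norm_prod_term in auto)

lemma norm_sprod: "norm (sprod \<tau> \<sigma> x y) \<le> norm x * norm y"
proof -
  have "norm (sprod \<tau> \<sigma> x y) \<le> infsum (\<lambda>z. norm (prod_term \<tau> \<sigma> x y z)) UNIV"
    unfolding sprod_def by (rule norm_infsum_bound[OF prod_term_summable])
  also have "\<dots> \<le> (\<Sum>\<^sub>\<infinity>(i, j). norm (coord x i) * norm (coord y j))"
    by (rule infsum_mono[OF prod_term_summable norm_coord_prod(1)]) (use norm_prod_term in auto)
  also have "\<dots> = norm x * norm y"
    by (rule norm_coord_prod(2))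
  finally show ?thesis .
qed

lemma hb_sprod:
  assumes "hb \<alpha> x K" "hb \<alpha> y L"
  shows "hb \<alpha> (sprod \<tau> \<sigma> x y) (K * L)"
proof -
  obtain c where c: "\<And>i. eb \<alpha> (snd i) (coord x i) (c i)" "c summable_on UNIV" "infsum c UNIV \<le> K"
    using hb_D[OF assms(1)] by metis
  obtain d where d: "\<And>i. eb \<alpha> (snd i) (coord y i) (d i)" "d summable_on UNIV" "infsum d UNIV \<le> L"
    using hb_D[OF assms(2)] by metis
  note cd = eb_nonneg[OF c(1)] eb_nonneg[OF d(1)]
  have "c abs_summable_on UNIV" "d abs_summable_on UNIV" using c(2) d(2) cd by simp_all
  note s = summable_product_real[OF this]
  have "hb \<alpha> (infsum (prod_term \<tau> \<sigma> x y) UNIV) (\<Sum>\<^sub>\<infinity>(i, j). c i * d j)"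
  proof (rule hb_infsum[OF _ s(1)])
    fix z :: "(nat \<times> nat) \<times> (nat \<times> nat)"
    show "hb \<alpha> (prod_term \<tau> \<sigma> x y z) (case z of (i, j) \<Rightarrow> c i * d j)"
      by (cases z) (simp only: prod.case hb_prod_term[OF c(1) d(1)])
  qed
  moreover have "infsum c UNIV * infsum d UNIV \<le> K * L"
    by (intro mult_mono c(3) d(3) infsum_nonneg cd hb_nonneg[OF assms(1)])
  ultimately show ?thesis unfolding s(2) sprod_def by (rule hb_mono)
qed

lemma bounded_bilinear_sprod: "bounded_bilinear (sprod \<tau> \<sigma>)"
proof
  note bl = bounded_linear.linear[OF bounded_linear_single]
  note bm = bounded_bilinear.add_left[OF bounded_bilinear_bmul] bounded_bilinear.add_right[OF bounded_bilinear_bmul]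
    bounded_bilinear.scaleR_left[OF bounded_bilinear_bmul] bounded_bilinear.scaleR_right[OF bounded_bilinear_bmul]
  note sm = abs_summable_summable[OF prod_term_summable]
  show "sprod \<tau> \<sigma> (x + x') y = sprod \<tau> \<sigma> x y + sprod \<tau> \<sigma> x' y" for x x' y
    unfolding sprod_def infsum_add[OF sm sm, symmetric]
    by (rule infsum_cong) (auto simp: prod_term_def bm scaleR_add_right linear_add[OF bl])
  show "sprod \<tau> \<sigma> x (y + y') = sprod \<tau> \<sigma> x y + sprod \<tau> \<sigma> x y'" for x y y'
    unfolding sprod_def infsum_add[OF sm sm, symmetric]
    by (rule infsum_cong) (auto simp: prod_term_def bm scaleR_add_right linear_add[OF bl])
  have c: "r *\<^sub>R single i e = single i (r *\<^sub>R e)" for r i and e :: cfun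
    by (simp add: linear_scale[OF bl])
  show "sprod \<tau> \<sigma> (r *\<^sub>R x) y = r *\<^sub>R sprod \<tau> \<sigma> x y" for r x y
    unfolding sprod_def infsum_scaleR_right[symmetric]
    by (rule infsum_cong) (auto simp: prod_term_def bm scaleR_add_right c mult.commute)
  show "sprod \<tau> \<sigma> x (r *\<^sub>R y) = r *\<^sub>R sprod \<tau> \<sigma> x y" for r x y
    unfolding sprod_def infsum_scaleR_right[symmetric]
    by (rule infsum_cong) (auto simp: prod_term_def bm scaleR_add_right c mult.commute)
  show "\<exists>K. \<forall>a b. norm (sprod \<tau> \<sigma> a b) \<le> norm a * norm b * K"
    by (rule exI[of _ 1]) (simp add: norm_sprod)
qed

end

text \<open>Evaluation at \<open>s = t\<close>, with \<open>g k\<close> the value of \<open>cos (k q)\<close> or of \<open>sin (k q)\<close>.\<close>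

definition ev :: "(nat \<Rightarrow> real) \<Rightarrow> real \<Rightarrow> real \<Rightarrow> wiener \<Rightarrow> real" where
  "ev g t p x = (\<Sum>\<^sub>\<infinity>(n, k). t ^ n * g k / 4 ^ k * coord x (n, k) p)"

locale evaluation =
  fixes g :: "nat \<Rightarrow> real" and t :: real
  assumes g: "\<And>k. \<bar>g k\<bar> \<le> 1" and t: "\<bar>t\<bar> \<le> 1"
begin

lemma coeff_le: "\<bar>t ^ n * g k / 4 ^ k\<bar> \<le> 1"
proof -
  have "\<bar>t ^ n\<bar> * \<bar>g k\<bar> \<le> 1 * 1" by (intro mult_mono g) (auto simp: power_abs power_le_one t)
  also have "\<dots> \<le> 4 ^ k" by simp
  finally show ?thesis by (simp add: abs_mult divide_le_eq)
qed

lemma term_le: "\<bar>t ^ n * g k / 4 ^ k * coord x (n, k) p\<bar> \<le> norm (coord x (n, k))" for x :: wiener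
proof -
  have "\<bar>t ^ n * g k / 4 ^ k\<bar> * \<bar>apply_bcontfun (coord x (n, k)) p\<bar> \<le> 1 * norm (coord x (n, k))"
    by (intro mult_mono coeff_le abs_apply_le) auto
  then show ?thesis by (simp add: abs_mult)
qed

lemma ev_summable: "(\<lambda>(n, k). t ^ n * g k / 4 ^ k * coord x (n, k) p) abs_summable_on UNIV" for x :: wiener
  by (rule summable_on_comparison_test[OF coord_summable[of x]]) (use term_le[of _ _ x p] in auto)

lemma abs_ev_le: "\<bar>ev g t p x\<bar> \<le> norm x"
proof -
  have "\<bar>ev g t p x\<bar> \<le> (\<Sum>\<^sub>\<infinity>i. norm (case i of (n, k) \<Rightarrow> t ^ n * g k / 4 ^ k * coord x (n, k) p))"
    unfolding ev_def using norm_infsum_bound[OF ev_summable] by simp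
  also have "\<dots> \<le> norm x"
    unfolding norm_l1_def by (rule infsum_mono[OF ev_summable coord_summable]) (use term_le[of _ _ x p] in auto)
  finally show ?thesis .
qed

lemma bounded_linear_ev: "bounded_linear (ev g t p)"
proof (rule bounded_linear_intro[where K = 1])
  note s = abs_summable_summable[OF ev_summable]
  show "ev g t p (x + y) = ev g t p x + ev g t p y" for x y
    unfolding ev_def infsum_add[OF s s, symmetric] by (rule infsum_cong) (auto simp: algebra_simps)
  show "ev g t p (r *\<^sub>R x) = r *\<^sub>R ev g t p x" for r x
    unfolding ev_def infsum_scaleR_right[symmetric] by (rule infsum_cong) (auto simp: algebra_simps)
qed (use abs_ev_le in simp)

lemmas ev_add = linear_add[OF bounded_linear.linear[OF bounded_linear_ev]]
lemmas ev_scaleR = linear_scale[OF bounded_linear.linear[OF bounded_linear_ev], unfolded real_scaleR_def]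

lemma ev_single: "ev g t p (single (n, k) e) = t ^ n * g k / 4 ^ k * e p"
proof -
  have "ev g t p (single (n, k) e) = infsum (\<lambda>_. t ^ n * g k / 4 ^ k * e p) {(n, k)}"
    unfolding ev_def by (rule infsum_cong_neutral) (auto simp: coord_single split: if_splits)
  then show ?thesis by simp
qed

end

text \<open>The hypothesis \<open>prod\<close> is the trigonometric product formula. The factor
  \<open>4 ^ ndist k l / 4 ^ (k + l)\<close> in \<open>prod_term\<close> cancels the change of
  weight in \<open>ev\<close>, and absolute convergence lets the double sum factorise.\<close>

lemma ev_sprod:
  assumes "signs \<tau> \<sigma>" "evaluation g1 t" "evaluation g2 t" "evaluation g3 t"
    and prod: "\<And>k l. g1 k * g2 l = \<tau> / 2 * g3 (k + l) + \<sigma> k l / 2 * g3 (ndist k l)"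
  shows "ev g3 t p (sprod \<tau> \<sigma> x y) = ev g1 t p x * ev g2 t p y"
proof -
  interpret signs \<tau> \<sigma> by fact
  interpret g1: evaluation g1 t by fact
  interpret g2: evaluation g2 t by fact
  interpret g3: evaluation g3 t by fact
  have "ev g3 t p (sprod \<tau> \<sigma> x y) = (\<Sum>\<^sub>\<infinity>z. ev g3 t p (prod_term \<tau> \<sigma> x y z))"
    unfolding sprod_def
    by (rule infsum_bl[OF g3.bounded_linear_ev abs_summable_summable[OF prod_term_summable], symmetric])
  also have "\<dots> = (\<Sum>\<^sub>\<infinity>(i, j). (case i of (n, k) \<Rightarrow> t ^ n * g1 k / 4 ^ k * coord x (n, k) p)
      * (case j of (n, k) \<Rightarrow> t ^ n * g2 k / 4 ^ k * coord y (n, k) p))"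
  proof (rule infsum_cong)
    fix z :: "(nat \<times> nat) \<times> (nat \<times> nat)"
    obtain n k m l where z: "z = ((n, k), (m, l))" by (metis surj_pair)
    define X where "X = apply_bcontfun (coord x (n, k)) p * apply_bcontfun (coord y (m, l)) p"
    have "ev g3 t p (prod_term \<tau> \<sigma> x y z) = t ^ (n + m) * g3 (k + l) / 4 ^ (k + l) * (\<tau> / 2 * X)
        + t ^ (n + m) * g3 (ndist k l) / 4 ^ ndist k l * (\<sigma> k l / 2 * (4 ^ ndist k l / 4 ^ (k + l)) * X)"
      by (simp only: z prod_term_def prod.case g3.ev_add g3.ev_single X_def apply_bcontfun_scaleR bmul_apply real_scaleR_def)
    also have "\<dots> = t ^ (n + m) * X / 4 ^ (k + l) * (\<tau> / 2 * g3 (k + l) + \<sigma> k l / 2 * g3 (ndist k l))"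
      by (simp add: field_simps)
    also have "\<dots> = (t ^ n * g1 k / 4 ^ k) * (t ^ m * g2 l / 4 ^ l) * X"
      unfolding prod[symmetric] by (simp add: power_add)
    finally show "ev g3 t p (prod_term \<tau> \<sigma> x y z) = (case z of (i, j) \<Rightarrow>
        (case i of (n, k) \<Rightarrow> t ^ n * g1 k / 4 ^ k * coord x (n, k) p)
      * (case j of (n, k) \<Rightarrow> t ^ n * g2 k / 4 ^ k * coord y (n, k) p))"
      by (simp add: z X_def mult.commute mult.left_commute)
  qed
  also have "\<dots> = ev g1 t p x * ev g2 t p y"
    unfolding ev_def by (rule summable_product_real(2)[OF g1.ev_summable g2.ev_summable])
  finally show ?thesis .
qed

definition cc :: "wiener \<Rightarrow> wiener \<Rightarrow> wiener" (infixl "\<odot>" 70) where "cc = sprod 1 (\<lambda>_ _. 1)"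
definition ss :: "wiener \<Rightarrow> wiener \<Rightarrow> wiener" where "ss = sprod (-1) (\<lambda>_ _. 1)"
definition cs :: "wiener \<Rightarrow> wiener \<Rightarrow> wiener" where "cs = sprod 1 (\<lambda>k l. if k \<le> l then 1 else -1)"

definition ec :: "real \<Rightarrow> real \<Rightarrow> real \<Rightarrow> wiener \<Rightarrow> real" where "ec t q = ev (\<lambda>k. cos (real k * q)) t"
definition es :: "real \<Rightarrow> real \<Rightarrow> real \<Rightarrow> wiener \<Rightarrow> real" where "es t q = ev (\<lambda>k. sin (real k * q)) t"

lemma signs_instances: "signs 1 (\<lambda>_ _. 1)" "signs (-1) (\<lambda>_ _. 1)" "signs 1 (\<lambda>k l. if k \<le> l then 1 else -1)"
  by (unfold_locales; simp)+

lemma evaluation_instances: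
  "\<bar>t\<bar> \<le> 1 \<Longrightarrow> evaluation (\<lambda>k. cos (real k * q)) t" "\<bar>t\<bar> \<le> 1 \<Longrightarrow> evaluation (\<lambda>k. sin (real k * q)) t"
  by (unfold_locales; simp)+

lemma cos_add_ndist:
  "cos (real k * q) * cos (real l * q) = 1 / 2 * cos (real (k + l) * q) + 1 / 2 * cos (real (ndist k l) * q)"
  "sin (real k * q) * sin (real l * q) = -1 / 2 * cos (real (k + l) * q) + 1 / 2 * cos (real (ndist k l) * q)"
  "cos (real k * q) * sin (real l * q) = 1 / 2 * sin (real (k + l) * q)
     + (if k \<le> l then 1 else -1) / 2 * sin (real (ndist k l) * q)"
proof -
  define a b where "a = real k * q" and "b = real l * q"
  have nd: "real (ndist k l) * q = (if k \<le> l then b - a else a - b)"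
    by (simp add: ndist_def a_def b_def of_nat_diff left_diff_distrib)
  have pl: "real (k + l) * q = a + b" by (simp add: a_def b_def distrib_right)
  show "cos (real k * q) * cos (real l * q) = 1 / 2 * cos (real (k + l) * q) + 1 / 2 * cos (real (ndist k l) * q)"
    "sin (real k * q) * sin (real l * q) = -1 / 2 * cos (real (k + l) * q) + 1 / 2 * cos (real (ndist k l) * q)"
    "cos (real k * q) * sin (real l * q) = 1 / 2 * sin (real (k + l) * q)
     + (if k \<le> l then 1 else -1) / 2 * sin (real (ndist k l) * q)"
    unfolding nd pl a_def[symmetric] b_def[symmetric]
    by (auto simp: cos_add cos_diff sin_add sin_diff field_simps)
qed

lemma ec_cc: "\<bar>t\<bar> \<le> 1 \<Longrightarrow> ec t q p (x \<odot> y) = ec t q p x * ec t q p y"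
  unfolding ec_def cc_def by (intro ev_sprod signs_instances evaluation_instances cos_add_ndist)
lemma ec_ss: "\<bar>t\<bar> \<le> 1 \<Longrightarrow> ec t q p (ss x y) = es t q p x * es t q p y"
  unfolding ec_def es_def ss_def by (intro ev_sprod signs_instances evaluation_instances cos_add_ndist)
lemma es_cs: "\<bar>t\<bar> \<le> 1 \<Longrightarrow> es t q p (cs x y) = ec t q p x * es t q p y"
  unfolding ec_def es_def cs_def by (intro ev_sprod signs_instances evaluation_instances cos_add_ndist)

section \<open>Linear operators bounded in both norms\<close>

text \<open>Both bounds are asked for: the one in the l1 norm serves the contraction, the one for
  \<open>hb\<close> the invariance of the ball.\<close>

definition hop :: "real \<Rightarrow> (wiener \<Rightarrow> wiener) \<Rightarrow> bool" where
  "hop \<alpha> L \<longleftrightarrow> bounded_linear L \<and> (\<exists>C\<ge>0. \<forall>x K. hb \<alpha> x K \<longrightarrow> hb \<alpha> (L x) (C * K))"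

lemma hop_modemap:
  assumes "\<And>i. linear (L i)" "0 \<le> C" "\<And>i e. norm (L i e) \<le> C * norm e"
    and "\<And>i e c. eb \<alpha> (snd i) e c \<Longrightarrow> eb \<alpha> (snd (\<pi> i)) (L i e) (C * c)"
  shows "hop \<alpha> (modemap \<pi> L)"
proof -
  interpret modes \<pi> L C by (intro modes.intro assms)
  have "hb \<alpha> (modemap \<pi> L x) (C * K)" if "hb \<alpha> x K" for x K
    by (rule hb_modemap[OF _ that assms(2)]) (rule assms(4))
  then show ?thesis unfolding hop_def using bounded_linear assms(2) by blast
qed

definition shift :: "wiener \<Rightarrow> wiener" where
  "shift = modemap (\<lambda>(n, k). (Suc n, k)) (\<lambda>_ e. e)"

definition mulE :: "cfun \<Rightarrow> wiener \<Rightarrow> wiener" where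
  "mulE f = modemap (\<lambda>i. i) (\<lambda>_. bmul f)"

lemma modes_shift: "modes (\<lambda>_ e. e :: cfun) 1"
  by unfold_locales (auto simp: linear_id[unfolded id_def])

lemma modes_mulE: "modes (\<lambda>_. bmul f) (norm f)"
  by unfold_locales (simp_all add: norm_bmul bounded_bilinear.add_right[OF bounded_bilinear_bmul]
      bounded_bilinear.scaleR_right[OF bounded_bilinear_bmul])

text \<open>A factor that does not depend on q has frequency 0 and leaves the frequency of the other
  factor alone, so no weight is lost. The scalar 1/2 is inserted only to meet the form of
  \<open>holder_term_bmul\<close>.\<close>

lemma eb_bmul: 
  assumes "eb \<alpha> 0 f C" "eb \<alpha> k e c"
  shows "eb \<alpha> k (bmul f e) (C * c)"
proof -
  have "eb \<alpha> k ((1/2) *\<^sub>R bmul f e) (1/2 * (C * c))"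
    by (intro hb_add_split[OF assms] holder_term_bmul) (auto simp: power_le_one)
  then show ?thesis
    unfolding eb_def holder_term_def apply_bcontfun_scaleR real_scaleR_def right_diff_distrib[symmetric] abs_mult
    by (force simp: algebra_simps)
qed

lemma hop_mulE: "eb \<alpha> 0 f C \<Longrightarrow> hop \<alpha> (mulE f)"
  unfolding mulE_def
  by (intro hop_modemap[where C = C] modes.lin[OF modes_mulE] order_trans[OF norm_bmul mult_right_mono] eb_bmul)
     (auto dest: eb_D(1) eb_nonneg)

lemma hop_shift: "hop \<alpha> shift"
  unfolding shift_def by (rule hop_modemap[where C = 1]) (auto simp: linear_id[unfolded id_def])

lemma coord_mulE [simp]: "coord (mulE f x) i = bmul f (coord x i)"
  unfolding mulE_def by (rule modes.coord_modemap[OF modes_mulE]) simp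

lemma coord_shift [simp]: "coord (shift x) (Suc n, k) = coord x (n, k)"
  unfolding shift_def using modes.coord_modemap[OF modes_shift, of "\<lambda>(n, k). (Suc n, k)" x "(n, k)"]
  by (auto simp: inj_def)

lemma coord_shift_0 [simp]: "coord (shift x) (0, k) = 0"
proof -
  interpret modes "\<lambda>(n, k). (Suc n, k)" "\<lambda>_ e. e :: cfun" 1 by (rule modes_shift)
  show ?thesis
    unfolding shift_def using eval_modemap[OF bounded_linear_coord[of "(0, k)"], of x]
    by (simp add: coord_single case_prod_unfold)
qed

context evaluation begin

lemma ev_mulE: "ev g t p (mulE f x) = f p * ev g t p x"
  unfolding ev_def infsum_cmult_right'[symmetric]
  by (rule infsum_cong) (auto simp: algebra_simps)

lemma ev_shift: "ev g t p (shift x) = t * ev g t p x"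
proof -
  have "ev g t p (shift x) = (\<Sum>\<^sub>\<infinity>i. t * (case i of (n, k) \<Rightarrow> t ^ n * g k / 4 ^ k * coord x (n, k) p))"
    unfolding shift_def modes.eval_modemap[OF modes_shift bounded_linear_ev]
    by (rule infsum_cong) (auto simp: ev_single)
  then show ?thesis by (simp add: ev_def infsum_cmult_right')
qed

end

section \<open>Functions on the depth interval\<close>

abbreviation I :: "real set" where "I \<equiv> {-1..0}"

definition cl :: "real \<Rightarrow> real" where "cl p = max (-1) (min 0 p)"

lemma cl_in [simp]: "cl p \<in> I" and cl_ge [simp]: "-1 \<le> cl p" and cl_le [simp]: "cl p \<le> 0"
  by (auto simp: cl_def)

lemma cl_id [simp]: "p \<in> I \<Longrightarrow> cl p = p"
  by (auto simp: cl_def)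

text \<open>A function on the depth interval is continued by its end values. For continuous
  functions this changes neither the supremum nor the values on the interval, so the Banach space of
  bounded continuous functions on the line can hold the coefficients.\<close>

definition mkc :: "(real \<Rightarrow> real) \<Rightarrow> cfun" where "mkc g = Bcontfun (\<lambda>p. g (cl p))"

lemma mkc_apply:
  assumes "continuous_on I g"
  shows "apply_bcontfun (mkc g) p = g (cl p)"
proof -
  have "continuous_on UNIV (\<lambda>p. g (cl p))"
    by (rule continuous_on_compose2[OF assms]) (auto simp: cl_def intro!: continuous_intros)
  moreover have "bounded (range (\<lambda>p. g (cl p)))"
    by (rule bounded_subset[OF compact_imp_bounded[OF compact_continuous_image[OF assms compact_Icc]]]) auto
  ultimately show ?thesis by (simp add: mkc_def bcontfun_def Bcontfun_inverse)
qed

definition clinv :: "cfun \<Rightarrow> bool" where "clinv e \<longleftrightarrow> (\<forall>p. e p = e (cl p))"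

lemma clinv_mkc: "continuous_on I g \<Longrightarrow> clinv (mkc g)"
  by (simp add: clinv_def mkc_apply)

lemma clinv_bmul: "clinv e \<Longrightarrow> clinv f \<Longrightarrow> clinv (bmul e f)"
  unfolding clinv_def by simp

lemma clinv_add: "clinv e \<Longrightarrow> clinv f \<Longrightarrow> clinv (e + f)"
  unfolding clinv_def by simp

lemma clinv_scaleR: "clinv e \<Longrightarrow> clinv (r *\<^sub>R e)"
  unfolding clinv_def by simp

lemma clinv_norm_le:
  assumes "clinv e" "\<And>p. p \<in> I \<Longrightarrow> \<bar>e p\<bar> \<le> K"
  shows "norm e \<le> K"
  by (rule norm_bound) (use assms(1)[unfolded clinv_def] assms(2)[OF cl_in] in \<open>metis real_norm_def\<close>)

definition IL :: "cfun \<Rightarrow> cfun" where "IL f = mkc (\<lambda>p. integral {-1..p} f)"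
text \<open>The integral of \<open>f\<close> from p up to the surface. It carries data prescribed at
  p = 0 in the way \<open>IL\<close> carries data at the bottom.\<close>

definition IR :: "cfun \<Rightarrow> cfun" where "IR f = const_bcontfun (IL f 0) - IL f"

definition D :: "cfun \<Rightarrow> cfun \<Rightarrow> bool" where
  "D e f \<longleftrightarrow> (\<forall>p\<in>I. (apply_bcontfun e has_real_derivative f p) (at p within I))"

lemma cfun_integrable: "(f :: cfun) integrable_on {x..y}"
  by (rule integrable_continuous_interval) simp

lemma continuous_on_integral_Icc: "continuous_on I g \<Longrightarrow> continuous_on I (\<lambda>p. integral {-1..p} g)" for g :: "real \<Rightarrow> real"
  by (rule indefinite_integral_continuous_1) (rule integrable_continuous_interval)

lemma IL_apply: "IL f p = integral {-1..cl p} f"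
  unfolding IL_def by (rule mkc_apply[OF continuous_on_integral_Icc]) simp

lemma const_bcontfun_apply [simp]: "apply_bcontfun (const_bcontfun r) p = r"
  by (simp add: const_bcontfun.rep_eq)

lemma bcontfun_diff_apply [simp]: "apply_bcontfun (f - g) x = apply_bcontfun f x - apply_bcontfun g x"
  for f g :: "'a::topological_space \<Rightarrow>\<^sub>C 'b::real_normed_vector"
  by (simp add: minus_bcontfun.rep_eq)

lemma bcontfun_uminus_apply [simp]: "apply_bcontfun (- f) x = - apply_bcontfun f x"
  for f :: "'a::topological_space \<Rightarrow>\<^sub>C 'b::real_normed_vector"
  by (simp add: uminus_bcontfun.rep_eq)

lemma bcontfun_zero_apply [simp]: "apply_bcontfun (0 :: 'a::topological_space \<Rightarrow>\<^sub>C 'b::real_normed_vector) x = 0"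
  by (simp add: zero_bcontfun.rep_eq)

lemma clinv_IL: "clinv (IL f)" by (simp add: clinv_def IL_apply)
lemma clinv_IR: "clinv (IR f)" by (simp add: clinv_def IL_apply IR_def)

lemma IL_left [simp]: "IL f (-1) = 0" by (simp add: IL_apply)
lemma IR_right [simp]: "IR f 0 = 0" by (simp add: IR_def)

lemma D_IL: "D (IL f) f"
proof -
  have *: "((\<lambda>p. integral {-1..p} f) has_real_derivative f p) (at p within I)" if "p \<in> I" for p
    by (rule integral_has_real_derivative) (use that in auto)
  show ?thesis
    unfolding D_def
    by (intro ballI has_field_derivative_transform_within[OF *, where d = 1]) (simp_all add: IL_apply)
qed

lemma D_diff: "D e f \<Longrightarrow> D e' f' \<Longrightarrow> D (e - e') (f - f')"
  unfolding D_def minus_bcontfun.rep_eq by (auto intro: DERIV_diff)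
lemma D_add: "D e f \<Longrightarrow> D e' f' \<Longrightarrow> D (e + e') (f + f')"
  unfolding D_def plus_bcontfun.rep_eq by (auto intro: DERIV_add)
lemma D_scaleR: "D e f \<Longrightarrow> D (r *\<^sub>R e) (r *\<^sub>R f)"
  unfolding D_def scaleR_bcontfun.rep_eq by (auto intro: DERIV_cmult)
lemma D_const: "D (const_bcontfun r) 0"
  unfolding D_def const_bcontfun.rep_eq by auto
lemma D_IR: "D (IR f) (- f)"
  using D_diff[OF D_const D_IL] by (simp add: IR_def)

lemma linear_IL: "linear IL"
proof (rule linearI; rule bcontfun_eqI)
  show "IL (f + g) p = (IL f + IL g) p" for f g p
    using integral_add[OF cfun_integrable cfun_integrable] by (simp add: IL_apply plus_bcontfun.rep_eq)
  show "IL (r *\<^sub>R f) p = (r *\<^sub>R IL f) p" for r f p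
    using integral_cmul[of "{-1..cl p}" r f] by (simp add: IL_apply scaleR_bcontfun.rep_eq)
qed

lemma linear_IR: "linear IR"
  by (rule linearI; rule bcontfun_eqI) (simp_all add: IR_def linear_add[OF linear_IL] linear_scale[OF linear_IL] algebra_simps)

section \<open>Mean value estimates and initial value problems on the depth interval\<close>

lemma mvt_I:
  assumes "\<And>p. p \<in> I \<Longrightarrow> (f has_real_derivative f' p) (at p within I)" "-1 \<le> p" "p < q" "q \<le> 0"
  obtains r where "p < r" "r < q" "f q - f p = f' r * (q - p)"
proof -
  have d: "(f has_derivative (*) (f' x)) (at x within {p..q})" if "p \<le> x" "x \<le> q" for x
  proof -
    have "x \<in> I" "{p..q} \<subseteq> I" using that assms(2,4) by auto
    then show ?thesis
      using DERIV_subset[OF assms(1)] by (simp add: has_field_derivative_def)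
  qed
  from mvt_simple[OF assms(3) d] obtain r where "r \<in> {p<..<q}" "f q - f p = f' r * (q - p)" by blast
  then show ?thesis by (intro that[of r]) auto
qed

lemma mono_I:
  assumes "\<And>p. p \<in> I \<Longrightarrow> (f has_real_derivative f' p) (at p within I)" "\<And>p. p \<in> I \<Longrightarrow> 0 \<le> f' p"
    "-1 \<le> p" "p \<le> q" "q \<le> 0"
  shows "f p \<le> f q"
proof (cases "p = q")
  case False
  then have "p < q" using assms(4) by simp
  obtain r where "p < r" "r < q" "f q - f p = f' r * (q - p)"
    by (rule mvt_I[OF assms(1) assms(3) \<open>p < q\<close> assms(5)])
  moreover have "0 \<le> f' r * (q - p)" using assms calculation by (intro mult_nonneg_nonneg) auto
  ultimately show ?thesis by linarith
qed simp

lemma Lip_I: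
  assumes "\<And>p. p \<in> I \<Longrightarrow> (f has_real_derivative f' p) (at p within I)" "\<And>p. p \<in> I \<Longrightarrow> \<bar>f' p\<bar> \<le> K"
    "p \<in> I" "q \<in> I"
  shows "\<bar>f p - f q\<bar> \<le> K * \<bar>p - q\<bar>"
proof -
  have *: "\<bar>f q - f p\<bar> \<le> K * \<bar>q - p\<bar>" if pq: "p < q" "p \<in> I" "q \<in> I" for p q
  proof -
    obtain r where r: "p < r" "r < q" "f q - f p = f' r * (q - p)"
      by (rule mvt_I[OF assms(1), of p q]) (use pq in auto)
    then show ?thesis using assms(2)[of r] pq by (auto simp: abs_mult intro!: mult_right_mono)
  qed
  show ?thesis using *[of p q] *[of q p] assms(3,4) by (cases p q rule: linorder_cases) (auto simp: abs_minus_commute)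
qed

lemma D_zero_const: "D e 0 \<Longrightarrow> p \<in> I \<Longrightarrow> q \<in> I \<Longrightarrow> e p = e q"
  using Lip_I[of e "\<lambda>_. 0" 0 p q] by (auto simp: D_def)

text \<open>Volterra estimate in an exponentially weighted norm: the weight replaces the length of
  the interval by \<open>1 / L\<close>, which can be made small without shortening the
  interval.\<close>

lemma exp_integral_bound:
  fixes h :: cfun
  assumes "L > 0" "p \<in> I" "continuous_on I w" "\<And>s. s \<in> I \<Longrightarrow> \<bar>w s\<bar> \<le> K"
  shows "\<bar>exp (- L * p) * integral {-1..p} (\<lambda>s. exp (L * s) * w s)\<bar> \<le> K / L"
proof -
  have K: "0 \<le> K" using assms(2,4) abs_ge_zero order_trans by blast
  have c: "continuous_on {-1..p} w" by (rule continuous_on_subset[OF assms(3)]) (use assms(2) in auto)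
  have hi: "((\<lambda>s. K * exp (L * s)) has_integral (K * exp (L * p) / L - K * exp (L * -1) / L)) {-1..p}"
    by (rule fundamental_theorem_of_calculus)
       (use assms in \<open>auto intro!: derivative_eq_intros simp: has_real_derivative_iff_has_vector_derivative[symmetric]\<close>)
  have "norm (integral {-1..p} (\<lambda>s. exp (L * s) * w s)) \<le> integral {-1..p} (\<lambda>s. K * exp (L * s))"
  proof (rule integral_norm_bound_integral)
    show "(\<lambda>s. exp (L * s) * w s) integrable_on {-1..p}"
      by (intro integrable_continuous_interval continuous_intros c)
    show "(\<lambda>s. K * exp (L * s)) integrable_on {-1..p}" using hi by blast
    show "norm (exp (L * s) * w s) \<le> K * exp (L * s)" if "s \<in> {-1..p}" for s
      using assms(4)[of s] that assms(2) by (auto simp: abs_mult)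
  qed
  also have "\<dots> \<le> K * exp (L * p) / L"
    using integral_unique[OF hi] K assms(1) by simp
  finally have "\<bar>exp (- L * p)\<bar> * \<bar>integral {-1..p} (\<lambda>s. exp (L * s) * w s)\<bar> \<le> exp (- L * p) * (K * exp (L * p) / L)"
    by (intro mult_mono) auto
  also have "\<dots> = K / L" by (simp add: exp_minus)
  finally show ?thesis by (simp add: abs_mult)
qed

text \<open>Eliminating \<open>v\<close> leaves a double Volterra equation for \<open>u\<close>.
  With weight rate \<open>L = 2 * K\<close> each integration halves distances, so a single
  contraction gives the solution on the whole interval.\<close>

lemma linear_ivp:
  fixes g h :: cfun
  obtains u v :: cfun where "clinv u" "clinv v" "D u (bmul g v)" "D v (bmul h u)" "u (-1) = 1" "v (-1) = 0"
proof -
  define K where "K = norm g + norm h + 1"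
  define L where "L = 2 * K"
  have L: "L > 0" and K: "norm g \<le> K" "norm h \<le> K" "K > 0"
    unfolding L_def K_def by (auto intro!: add_nonneg_pos)
  define vol where "vol f z = mkc (\<lambda>p. exp (- L * p) * integral {-1..p} (\<lambda>s. exp (L * s) * (f s * z s)))"
    for f z :: cfun
  have ci: "continuous_on I (\<lambda>p. exp (- L * p) * integral {-1..p} (\<lambda>s. exp (L * s) * (f s * z s)))" for f z :: cfun
    by (intro continuous_intros continuous_on_integral_Icc continuous_on_apply_bcontfun)
  note vol_apply = mkc_apply[OF ci, folded vol_def]
  have vol: "dist (vol f z) (vol f z') \<le> 1/2 * dist z z'" if f: "norm f \<le> K" for f z z'
    unfolding dist_norm
  proof (rule clinv_norm_le)
    show "clinv (vol f z - vol f z')" by (simp add: clinv_def vol_apply)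
    fix p :: real assume p: "p \<in> I"
    have i: "(\<lambda>s. exp (L * s) * (f s * y s)) integrable_on {-1..p}" for y :: cfun
      by (intro integrable_continuous_interval continuous_intros continuous_on_apply_bcontfun)
    have "(vol f z - vol f z') p = exp (- L * p) * integral {-1..p} (\<lambda>s. exp (L * s) * (f s * z s) - exp (L * s) * (f s * z' s))"
      by (simp only: bcontfun_diff_apply vol_apply Henstock_Kurzweil_Integration.integral_diff[OF i i] cl_id[OF p] right_diff_distrib)
    also have "\<dots> = exp (- L * p) * integral {-1..p} (\<lambda>s. exp (L * s) * (f s * (z - z') s))"
      by (simp add: algebra_simps)
    also have "\<bar>\<dots>\<bar> \<le> (K * norm (z - z')) / L"
    proof (rule exp_integral_bound[OF L p])
      show "continuous_on I (\<lambda>s. f s * (z - z') s)" by (intro continuous_intros continuous_on_apply_bcontfun)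
      show "\<bar>f s * (z - z') s\<bar> \<le> K * norm (z - z')" for s
        unfolding abs_mult by (intro mult_mono order_trans[OF abs_apply_le f] abs_apply_le) (use K in auto)
    qed
    also have "\<dots> = 1/2 * norm (z - z')" using K by (simp add: L_def)
    finally show "\<bar>(vol f z - vol f z') p\<bar> \<le> 1/2 * norm (z - z')" .
  qed
  have cE: "continuous_on I (\<lambda>p. exp (- L * (p + 1)))" by (intro continuous_intros)
  \<comment> \<open>The unknown is \<open>z p = exp (- L * (p + 1)) * u p\<close>; the inhomogeneous
    term is the weighted initial value 1.\<close>
  have "\<exists>!z. mkc (\<lambda>p. exp (- L * (p + 1))) + vol g (vol h z) = z"
  proof (rule banach_fix_type[where c = "1/2"], safe)
    fix z z' :: cfun
    have "dist (vol g (vol h z)) (vol g (vol h z')) \<le> 1/2 * (1/2 * dist z z')"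
      using vol[OF K(1), of "vol h z" "vol h z'"] vol[OF K(2), of z z'] by linarith
    then show "dist (mkc (\<lambda>p. exp (- L * (p + 1))) + vol g (vol h z)) (mkc (\<lambda>p. exp (- L * (p + 1))) + vol g (vol h z')) \<le> 1/2 * dist z z'"
      using zero_le_dist[of z z'] by (simp add: dist_add_cancel del: zero_le_dist)
  qed auto
  then obtain z where z: "mkc (\<lambda>p. exp (- L * (p + 1))) + vol g (vol h z) = z" by blast
  have zp: "z p = exp (- L * (p + 1)) + vol g (vol h z) p" if "p \<in> I" for p
    using arg_cong[OF z, of "\<lambda>z. apply_bcontfun z p"] that
    by (simp only: apply_bcontfun_add mkc_apply[OF cE] cl_id)
  define e where "e = mkc (\<lambda>p. exp (L * p))"
  have e: "e p = exp (L * cl p)" for p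
    unfolding e_def by (rule mkc_apply) (intro continuous_intros)
  define v where "v = IL (bmul h (bmul e z))"
  have ev: "v p = (bmul e (vol h z)) p" if "p \<in> I" for p
  proof -
    have "integral {-1..p} (bmul h (bmul e z)) = integral {-1..p} (\<lambda>s. exp (L * s) * (h s * z s))"
      by (rule integral_cong) (use that in \<open>auto simp: e\<close>)
    then show ?thesis using that by (simp add: v_def IL_apply vol_apply e exp_minus)
  qed
  have eu: "1 * exp (- L) + IL (bmul g v) p = (bmul e z) p" if "p \<in> I" for p
  proof -
    have "integral {-1..p} (bmul g v) = integral {-1..p} (\<lambda>s. exp (L * s) * (g s * vol h z s))"
      by (rule integral_cong) (use that ev in \<open>auto simp: e\<close>)
    then show ?thesis using that by (simp add: IL_apply vol_apply e zp algebra_simps exp_minus flip: exp_add)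
  qed
  define U where "U = const_bcontfun 1 + exp L *\<^sub>R IL (bmul g v)"
  define V where "V = exp L *\<^sub>R v"
  have U: "U p = exp L * (bmul e z) p" if "p \<in> I" for p
    using eu[OF that] by (simp add: U_def exp_minus field_simps)
  show thesis
  proof
    show "clinv U" "clinv V"
      by (auto simp: U_def V_def v_def clinv_def IL_apply)
    have "D U (0 + exp L *\<^sub>R bmul g v)" unfolding U_def by (intro D_add D_const D_scaleR D_IL)
    then show "D U (bmul g V)" by (simp add: D_def V_def algebra_simps)
    have "D V (exp L *\<^sub>R bmul h (bmul e z))" unfolding V_def v_def by (intro D_scaleR D_IL)
    then show "D V (bmul h U)" by (simp add: D_def U algebra_simps)
    show "U (-1) = 1" "V (-1) = 0" by (simp_all add: U_def V_def v_def)
  qed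
qed

text \<open>The product of \<open>u\<close> and \<open>v\<close> has derivative
  \<open>g v^2 + h u^2\<close>, hence is nonnegative; then the square of \<open>u\<close> cannot
  decrease below 1 and \<open>u\<close> cannot change sign.\<close>

lemma ivp_positive:
  fixes u v g h :: cfun
  assumes "D u (bmul g v)" "D v (bmul h u)" "u (-1) = 1" "v (-1) = 0"
    "\<And>p. p \<in> I \<Longrightarrow> 0 \<le> g p" "\<And>p. p \<in> I \<Longrightarrow> 0 \<le> h p" "p \<in> I"
  shows "1 \<le> u p" "0 \<le> v p"
proof -
  note du = assms(1)[unfolded D_def bmul_apply, rule_format]
  note dv = assms(2)[unfolded D_def bmul_apply, rule_format]
  have uv: "0 \<le> u p * v p" if p: "p \<in> I" for p
  proof -
    have "u (-1) * v (-1) \<le> u p * v p"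
    proof (rule mono_I[where f = "\<lambda>p. u p * v p" and f' = "\<lambda>p. g p * (v p)\<^sup>2 + h p * (u p)\<^sup>2"])
      show "((\<lambda>p. u p * v p) has_real_derivative g p * (v p)\<^sup>2 + h p * (u p)\<^sup>2) (at p within I)" if "p \<in> I" for p
        by (rule derivative_eq_intros du dv that refl)+ (simp add: power2_eq_square algebra_simps)
    qed (use p assms in auto)
    then show ?thesis using assms by simp
  qed
  have u2: "1 \<le> (u p)\<^sup>2" if p: "p \<in> I" for p
  proof -
    have "(u (-1))\<^sup>2 \<le> (u p)\<^sup>2"
    proof (rule mono_I[where f = "\<lambda>p. (u p)\<^sup>2" and f' = "\<lambda>p. 2 * g p * (u p * v p)"])
      show "((\<lambda>p. (u p)\<^sup>2) has_real_derivative 2 * g p * (u p * v p)) (at p within I)" if "p \<in> I" for p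
        by (rule derivative_eq_intros du dv that refl)+ (simp add: algebra_simps)
    qed (use p assms uv in auto)
    then show ?thesis using assms by simp
  qed
  have "0 < u p"
  proof (rule ccontr)
    assume n: "\<not> 0 < u p"
    have "\<exists>x\<ge>-1. x \<le> p \<and> u x = 0"
      by (rule IVT2') (use n assms in auto)
    then obtain r where r: "-1 \<le> r" "r \<le> p" "u r = 0" by blast
    then have "r \<in> I" using assms(7) by simp
    then show False using u2[of r] r by simp
  qed
  moreover have "1 \<le> \<bar>u p\<bar>" using u2[OF assms(7)] abs_le_square_iff[of 1 "u p"] by simp
  ultimately show "1 \<le> u p" by linarith
  then show "0 \<le> v p" using uv[OF assms(7)] by (simp add: zero_le_mult_iff)
qed

section \<open>Linear problems for the modes\<close>

definition reflect :: "cfun \<Rightarrow> cfun" where "reflect e = mkc (\<lambda>p. e (-1 - p))"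

lemma reflect_apply: "p \<in> I \<Longrightarrow> reflect e p = e (-1 - p)"
proof -
  have "continuous_on I (\<lambda>p. e (-1 - p))"
    by (rule continuous_on_compose2[OF continuous_on_apply_bcontfun[of UNIV e]]) (auto intro!: continuous_intros)
  then show "p \<in> I \<Longrightarrow> reflect e p = e (-1 - p)" by (simp add: reflect_def mkc_apply)
qed

lemma clinv_reflect: "clinv (reflect e)"
proof -
  have "continuous_on I (\<lambda>p. e (-1 - p))"
    by (rule continuous_on_compose2[OF continuous_on_apply_bcontfun[of UNIV e]]) (auto intro!: continuous_intros)
  then show ?thesis by (simp add: reflect_def clinv_mkc)
qed

lemma D_reflect:
  assumes "D e f"
  shows "D (reflect e) (- reflect f)"
  unfolding D_def
proof
  fix p :: real assume p: "p \<in> I"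
  have img: "(\<lambda>p. -1 - p) ` I = I" by (auto simp: image_def intro: bexI[of _ "-1 - x" for x])
  have "(apply_bcontfun e has_real_derivative f (-1 - p)) (at (-1 - p) within (\<lambda>p. -1 - p) ` I)"
    unfolding img using assms p by (simp add: D_def)
  then have "((apply_bcontfun e \<circ> (\<lambda>p. -1 - p)) has_real_derivative f (-1 - p) * (-1)) (at p within I)"
    by (rule DERIV_image_chain) (auto intro!: derivative_eq_intros)
  then have "((apply_bcontfun e \<circ> (\<lambda>p. -1 - p)) has_real_derivative (- reflect f) p) (at p within I)"
    using p by (simp add: reflect_apply)
  then show "(apply_bcontfun (reflect e) has_real_derivative (- reflect f) p) (at p within I)"
    by (rule has_field_derivative_transform_within[where d = 1]) (use p in \<open>auto simp: reflect_apply\<close>)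
qed

lemma D_cong: "D e f \<Longrightarrow> (\<And>p. p \<in> I \<Longrightarrow> f p = f' p) \<Longrightarrow> D e f'" for f f' :: cfun
  by (simp add: D_def)

lemma D_unique:
  assumes "D e f" "D e' f" "e (-1) = e' (-1)" "p \<in> I"
  shows "e p = e' p"
proof -
  have "D (e - e') 0" using D_diff[OF assms(1,2)] by simp
  from D_zero_const[OF this assms(4), of "-1"] show ?thesis using assms(3) by simp
qed

text \<open>\<open>\<phi>F\<close> and \<open>\<psi>F\<close> are the fluxes, that is, derivatives
  divided by \<open>b\<close>. Working with value and flux avoids differentiating \<open>b\<close>,
  which is only continuous. \<open>\<phi>\<close> obeys the bottom condition and grows upwards,
  \<open>\<psi>\<close> has no flux at the surface and grows downwards.\<close>

definition fundamental_system :: "cfun \<Rightarrow> cfun \<Rightarrow> real \<Rightarrow> cfun \<Rightarrow> cfun \<Rightarrow> cfun \<Rightarrow> cfun \<Rightarrow> bool" where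
  "fundamental_system b c k \<phi> \<phi>F \<psi> \<psi>F \<longleftrightarrow>
     clinv \<phi> \<and> clinv \<phi>F \<and> clinv \<psi> \<and> clinv \<psi>F \<and>
     D \<phi> (bmul b \<phi>F) \<and> D \<phi>F (k\<^sup>2 *\<^sub>R bmul c \<phi>) \<and> D \<psi> (bmul b \<psi>F) \<and> D \<psi>F (k\<^sup>2 *\<^sub>R bmul c \<psi>) \<and>
     \<phi> (-1) = 0 \<and> \<phi>F (-1) = 1 \<and> \<psi> 0 = 1 \<and> \<psi>F 0 = 0 \<and>
     (\<forall>p\<in>I. 0 \<le> \<phi> p \<and> 1 \<le> \<phi>F p \<and> 1 \<le> \<psi> p \<and> \<psi>F p \<le> 0)"

text \<open>The second solution comes from the same initial value problem by the reflection
  \<open>p \<mapsto> -1 - p\<close>, which exchanges the ends and reverses the sign of the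
  flux.\<close>

lemma fundamental_system_exists:
  fixes b c :: cfun
  assumes b: "\<And>p. p \<in> I \<Longrightarrow> 0 \<le> b p" and c: "\<And>p. p \<in> I \<Longrightarrow> 0 \<le> c p"
  obtains \<phi> \<phi>F \<psi> \<psi>F where "fundamental_system b c k \<phi> \<phi>F \<psi> \<psi>F"
proof -
  define ck where "ck = k\<^sup>2 *\<^sub>R c"
  have ck: "0 \<le> ck p" if "p \<in> I" for p using c[OF that] by (simp add: ck_def)
  have ckm: "bmul ck e = k\<^sup>2 *\<^sub>R bmul c e" for e
    by (rule bcontfun_eqI) (simp add: ck_def)
  obtain \<phi>F \<phi> where 1: "clinv \<phi>F" "clinv \<phi>" "D \<phi>F (bmul ck \<phi>)" "D \<phi> (bmul b \<phi>F)" "\<phi>F (-1) = 1" "\<phi> (-1) = 0"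
    by (rule linear_ivp)
  obtain u v where 2: "clinv u" "clinv v" "D u (bmul (reflect b) v)" "D v (bmul (reflect ck) u)" "u (-1) = 1" "v (-1) = 0"
    by (rule linear_ivp)
  have rI: "-1 - p \<in> I" if "p \<in> I" for p :: real using that by auto
  have pos: "1 \<le> u p" "0 \<le> v p" if "p \<in> I" for p
    using ivp_positive[OF 2(3,4,5,6) _ _ that] b[OF rI] ck[OF rI] by (simp_all add: reflect_apply)
  show thesis
  proof
    have "D (- reflect v) (reflect (bmul (reflect ck) u))"
      using D_scaleR[OF D_reflect[OF 2(4)], of "-1"] by simp
    then have d1: "D (- reflect v) (bmul ck (reflect u))"
      by (rule D_cong) (simp add: reflect_apply rI)
    have d2: "D (reflect u) (bmul b (- reflect v))"
      using D_reflect[OF 2(3)] by (rule D_cong) (simp add: reflect_apply rI)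
    show "fundamental_system b c k \<phi> \<phi>F (reflect u) (- reflect v)"
      unfolding fundamental_system_def
      using 1 2 d1 d2 ivp_positive[OF 1(3,4,5,6) ck b] pos[OF rI] clinv_reflect clinv_scaleR[OF clinv_reflect, of "-1" v]
      by (auto simp: ckm reflect_apply)
  qed
qed

lemma powr_le_Lip:
  fixes x :: real
  assumes "0 \<le> x" "x \<le> 1" "0 < \<alpha>" "\<alpha> \<le> 1"
  shows "x \<le> x powr \<alpha>"
proof (cases "x = 0")
  case False
  then show ?thesis using powr_mono'[of \<alpha> 1 x] assms by simp
qed simp

text \<open>Solutions of the k-th mode have slopes of order k, and \<open>k <= 2 ^ k\<close> is
  exactly what the weight of the Hoelder part in \<open>eb\<close> absorbs.\<close>

lemma eb_Lip:
  fixes e :: cfun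
  assumes "norm e \<le> A" "\<And>p. p \<in> I \<Longrightarrow> (apply_bcontfun e has_real_derivative e' p) (at p within I)"
    "\<And>p. p \<in> I \<Longrightarrow> \<bar>e' p\<bar> \<le> real k * B" "0 \<le> B" "A + B \<le> K" "0 < \<alpha>" "\<alpha> \<le> 1"
  shows "eb \<alpha> k e K"
proof (rule eb_I[OF assms(1) assms(4) _ assms(5)])
  fix p q :: real assume pq: "p \<in> I" "q \<in> I"
  have "\<bar>e p - e q\<bar> \<le> real k * B * \<bar>p - q\<bar>" by (rule Lip_I[OF assms(2,3) pq])
  also have "\<dots> \<le> 2 ^ k * B * \<bar>p - q\<bar> powr \<alpha>"
  proof (intro mult_mono powr_le_Lip)
    have "k \<le> 2 ^ k" by (simp add: less_imp_le)
    then show "real k \<le> 2 ^ k" by (metis of_nat_le_iff of_nat_numeral of_nat_power)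
  qed (use assms pq in auto)
  finally show "\<bar>e p - e q\<bar> \<le> 2 ^ k * B * \<bar>p - q\<bar> powr \<alpha>" .
qed

section \<open>Solution operators of the single modes, with bounds uniform in k\<close>

text \<open>\<open>c0\<close> and \<open>C0\<close> bracket the square root of \<open>c / b\<close>.
  Through them the ratio of flux to value of the k-th solutions is compared with k, and no constant
  in the later bounds depends on k.\<close>

locale modal =
  fixes b c :: cfun and \<phi> \<phi>F \<psi> \<psi>F :: "nat \<Rightarrow> cfun" and c0 C0 cm :: real
  assumes clb: "clinv b" and clc: "clinv c" and c0: "0 < c0" and cm: "0 < cm" and C0: "0 \<le> C0"
    and cone: "\<And>p. p \<in> I \<Longrightarrow> c0\<^sup>2 * b p \<le> c p" "\<And>p. p \<in> I \<Longrightarrow> c p \<le> C0\<^sup>2 * b p"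
    and bpos: "\<And>p. p \<in> I \<Longrightarrow> 0 < b p" and cmin: "\<And>p. p \<in> I \<Longrightarrow> cm \<le> c p"
    and fund: "\<And>k. fundamental_system b c (real k) (\<phi> k) (\<phi>F k) (\<psi> k) (\<psi>F k)"
begin

lemma fs_clinv: "clinv (\<phi> k)" "clinv (\<phi>F k)" "clinv (\<psi> k)" "clinv (\<psi>F k)"
  and fs_D: "D (\<phi> k) (bmul b (\<phi>F k))" "D (\<phi>F k) ((real k)\<^sup>2 *\<^sub>R bmul c (\<phi> k))"
     "D (\<psi> k) (bmul b (\<psi>F k))" "D (\<psi>F k) ((real k)\<^sup>2 *\<^sub>R bmul c (\<psi> k))"
  and fs_init [simp]: "\<phi> k (-1) = 0" "\<phi>F k (-1) = 1" "\<psi> k 0 = 1" "\<psi>F k 0 = 0"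
  and fs_sign: "\<And>p. p \<in> I \<Longrightarrow> 0 \<le> \<phi> k p" "\<And>p. p \<in> I \<Longrightarrow> 1 \<le> \<phi>F k p" "\<And>p. p \<in> I \<Longrightarrow> 1 \<le> \<psi> k p" "\<And>p. p \<in> I \<Longrightarrow> \<psi>F k p \<le> 0"
  using fund[of k] unfolding fundamental_system_def by blast+

lemmas fs_d = fs_D[unfolded D_def bmul_apply apply_bcontfun_scaleR real_scaleR_def, rule_format]

definition W where "W k = \<phi>F k 0"

lemma W_ge: "1 \<le> W k" unfolding W_def by (rule fs_sign) simp
lemma W_pos: "0 < W k" using W_ge[of k] by linarith

lemma wronskian: "p \<in> I \<Longrightarrow> \<phi>F k p * \<psi> k p - \<phi> k p * \<psi>F k p = W k"
proof -
  have d: "((\<lambda>p. \<phi>F k p * \<psi> k p - \<phi> k p * \<psi>F k p) has_real_derivative 0) (at p within I)" if "p \<in> I" for p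
    by (rule derivative_eq_intros fs_d that refl)+ (simp add: algebra_simps)
  assume p: "p \<in> I"
  show ?thesis using Lip_I[OF d, where K = 0, of p 0] p by (auto simp: W_def)
qed

text \<open>Both terms of the Wronskian are nonnegative. The growth of one solution is compensated
  by the decay of the other, so exponentials never have to be estimated.\<close>

lemma psi_phiF_le: "p \<in> I \<Longrightarrow> \<psi> k p * \<phi>F k p \<le> W k"
  using wronskian[of p k] mult_nonneg_nonpos[OF fs_sign(1,4)[of p k]] by (simp add: mult.commute)

text \<open>Invariant cone: the difference of squares equals 1 at the bottom, and its derivative is
  nonnegative because \<open>c0\<^sup>2 * b\<close> lies below \<open>c\<close>.\<close>

lemma phi_cone: 
  assumes p: "p \<in> I"
  shows "c0 * real k * \<phi> k p \<le> \<phi>F k p"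
proof -
  have "(\<phi>F k (-1))\<^sup>2 - (c0 * real k * \<phi> k (-1))\<^sup>2 \<le> (\<phi>F k p)\<^sup>2 - (c0 * real k * \<phi> k p)\<^sup>2"
  proof (rule mono_I[where f = "\<lambda>p. (\<phi>F k p)\<^sup>2 - (c0 * real k * \<phi> k p)\<^sup>2"
        and f' = "\<lambda>p. 2 * (real k)\<^sup>2 * (\<phi> k p * \<phi>F k p) * (c p - c0\<^sup>2 * b p)"])
    show "((\<lambda>p. (\<phi>F k p)\<^sup>2 - (c0 * real k * \<phi> k p)\<^sup>2) has_real_derivative
         2 * (real k)\<^sup>2 * (\<phi> k p * \<phi>F k p) * (c p - c0\<^sup>2 * b p)) (at p within I)" if "p \<in> I" for p
      by (rule derivative_eq_intros fs_d that refl)+ (simp add: algebra_simps power2_eq_square)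
    show "0 \<le> 2 * (real k)\<^sup>2 * (\<phi> k p * \<phi>F k p) * (c p - c0\<^sup>2 * b p)" if "p \<in> I" for p
      using fs_sign(1,2)[OF that, of k] cone(1)[OF that] by (intro mult_nonneg_nonneg) auto
  qed (use p in auto)
  moreover have "(\<phi>F k (-1))\<^sup>2 - (c0 * real k * \<phi> k (-1))\<^sup>2 = 1" by simp
  ultimately have "(c0 * real k * \<phi> k p)\<^sup>2 \<le> (\<phi>F k p)\<^sup>2" by linarith
  moreover have "0 \<le> \<phi>F k p" using fs_sign(2)[OF p, of k] by linarith
  ultimately show ?thesis by (rule power2_le_imp_le)
qed

text \<open>The mirror image of \<open>phi_cone\<close>, run from the surface downwards, where the
  flux vanishes. Here the flux is bounded by the value, so the upper bracket \<open>C0\<close> is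
  the one needed.\<close>

lemma psi_cone: 
  assumes p: "p \<in> I"
  shows "- \<psi>F k p \<le> C0 * real k * \<psi> k p"
proof -
  have "(\<psi>F k p)\<^sup>2 - (C0 * real k * \<psi> k p)\<^sup>2 \<le> (\<psi>F k 0)\<^sup>2 - (C0 * real k * \<psi> k 0)\<^sup>2"
  proof (rule mono_I[where f = "\<lambda>p. (\<psi>F k p)\<^sup>2 - (C0 * real k * \<psi> k p)\<^sup>2"
        and f' = "\<lambda>p. 2 * (real k)\<^sup>2 * (\<psi> k p * (- \<psi>F k p)) * (C0\<^sup>2 * b p - c p)"])
    show "((\<lambda>p. (\<psi>F k p)\<^sup>2 - (C0 * real k * \<psi> k p)\<^sup>2) has_real_derivative
         2 * (real k)\<^sup>2 * (\<psi> k p * (- \<psi>F k p)) * (C0\<^sup>2 * b p - c p)) (at p within I)" if "p \<in> I" for p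
      by (rule derivative_eq_intros fs_d that refl)+ (simp add: algebra_simps power2_eq_square)
    show "0 \<le> 2 * (real k)\<^sup>2 * (\<psi> k p * (- \<psi>F k p)) * (C0\<^sup>2 * b p - c p)" if "p \<in> I" for p
      using fs_sign(3,4)[OF that, of k] cone(2)[OF that] by (intro mult_nonneg_nonneg) auto
  qed (use p in auto)
  moreover have "0 \<le> (C0 * real k * \<psi> k 0)\<^sup>2" "(\<psi>F k 0)\<^sup>2 = 0" by simp_all
  ultimately have "(\<psi>F k p)\<^sup>2 \<le> (C0 * real k * \<psi> k p)\<^sup>2" by linarith
  then have "(- \<psi>F k p)\<^sup>2 \<le> (C0 * real k * \<psi> k p)\<^sup>2" by simp
  moreover have "0 \<le> C0 * real k * \<psi> k p" using fs_sign(3)[OF p, of k] C0 by simp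
  ultimately show ?thesis by (rule power2_le_imp_le)
qed

text \<open>Variation of constants for \<open>w' = b (F + f)\<close>, \<open>F' = k\<^sup>2 c w + k g\<close>, \<open>w (-1) = 0\<close>, \<open>F 0 = 0\<close>.\<close>

definition alpha :: "nat \<Rightarrow> cfun \<Rightarrow> cfun \<Rightarrow> cfun" where
  "alpha k f g = IR ((1 / W k) *\<^sub>R bmul (bmul b (\<psi>F k)) f - (real k / W k) *\<^sub>R bmul (\<psi> k) g)"
definition beta :: "nat \<Rightarrow> cfun \<Rightarrow> cfun \<Rightarrow> cfun" where
  "beta k f g = IL ((1 / W k) *\<^sub>R bmul (bmul b (\<phi>F k)) f - (real k / W k) *\<^sub>R bmul (\<phi> k) g)"
definition nw :: "nat \<Rightarrow> cfun \<Rightarrow> cfun \<Rightarrow> cfun" where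
  "nw k f g = bmul (\<phi> k) (alpha k f g) + bmul (\<psi> k) (beta k f g)"
definition nF :: "nat \<Rightarrow> cfun \<Rightarrow> cfun \<Rightarrow> cfun" where
  "nF k f g = bmul (\<phi>F k) (alpha k f g) + bmul (\<psi>F k) (beta k f g)"

lemma clinv_n: "clinv (nw k f g)" "clinv (nF k f g)"
  unfolding nw_def nF_def alpha_def beta_def
  by (intro clinv_add clinv_bmul fs_clinv clinv_IL clinv_IR)+

lemma alpha_d: "p \<in> I \<Longrightarrow> (apply_bcontfun (alpha k f g) has_real_derivative
    (real k * \<psi> k p * g p - b p * \<psi>F k p * f p) / W k) (at p within I)"
  using D_IR[of "(1 / W k) *\<^sub>R bmul (bmul b (\<psi>F k)) f - (real k / W k) *\<^sub>R bmul (\<psi> k) g", folded alpha_def,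
      unfolded D_def, rule_format, of p]
  by (simp add: diff_divide_distrib mult.assoc)

lemma beta_d: "p \<in> I \<Longrightarrow> (apply_bcontfun (beta k f g) has_real_derivative
    (b p * \<phi>F k p * f p - real k * \<phi> k p * g p) / W k) (at p within I)"
  using D_IL[of "(1 / W k) *\<^sub>R bmul (bmul b (\<phi>F k)) f - (real k / W k) *\<^sub>R bmul (\<phi> k) g", folded beta_def,
      unfolded D_def, rule_format, of p]
  by (simp add: diff_divide_distrib mult.assoc)

lemma alpha_0 [simp]: "alpha k f g 0 = 0" and beta_left [simp]: "beta k f g (-1) = 0"
  by (simp_all add: alpha_def beta_def)

lemma n_init [simp]: "nw k f g (-1) = 0" "nF k f g 0 = 0" "nw k f g 0 = beta k f g 0"
  by (simp_all add: nw_def nF_def)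

lemma D_nw: "D (nw k f g) (bmul b (nF k f g + f))"
  unfolding D_def
proof
  fix p :: real assume p: "p \<in> I"
  have [simp]: "W k \<noteq> 0" using W_pos[of k] by simp
  have "\<phi> k p * ((real k * \<psi> k p * g p - b p * \<psi>F k p * f p) / W k)
      + \<psi> k p * ((b p * \<phi>F k p * f p - real k * \<phi> k p * g p) / W k)
      = b p * f p * ((\<phi>F k p * \<psi> k p - \<phi> k p * \<psi>F k p) / W k)"
    by (simp add: add_divide_distrib[symmetric]) (simp add: algebra_simps)
  then have key: "\<phi> k p * ((real k * \<psi> k p * g p - b p * \<psi>F k p * f p) / W k)
      + \<psi> k p * ((b p * \<phi>F k p * f p - real k * \<phi> k p * g p) / W k) = b p * f p"
    using wronskian[OF p, of k] by simp
  have eq: "apply_bcontfun (nw k f g) = (\<lambda>p. \<phi> k p * alpha k f g p + \<psi> k p * beta k f g p)"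
    by (auto simp: nw_def)
  show "(apply_bcontfun (nw k f g) has_real_derivative bmul b (nF k f g + f) p) (at p within I)"
    unfolding eq
    apply (rule derivative_eq_intros fs_d alpha_d beta_d p refl)+
    using key by (simp add: nF_def algebra_simps)
qed

lemma D_nF: "D (nF k f g) ((real k)\<^sup>2 *\<^sub>R bmul c (nw k f g) + real k *\<^sub>R g)"
  unfolding D_def
proof
  fix p :: real assume p: "p \<in> I"
  have [simp]: "W k \<noteq> 0" using W_pos[of k] by simp
  have "\<phi>F k p * ((real k * \<psi> k p * g p - b p * \<psi>F k p * f p) / W k)
      + \<psi>F k p * ((b p * \<phi>F k p * f p - real k * \<phi> k p * g p) / W k)
      = real k * g p * ((\<phi>F k p * \<psi> k p - \<phi> k p * \<psi>F k p) / W k)"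
    by (simp add: add_divide_distrib[symmetric]) (simp add: algebra_simps)
  then have key: "\<phi>F k p * ((real k * \<psi> k p * g p - b p * \<psi>F k p * f p) / W k)
      + \<psi>F k p * ((b p * \<phi>F k p * f p - real k * \<phi> k p * g p) / W k) = real k * g p"
    using wronskian[OF p, of k] by simp
  have eq: "apply_bcontfun (nF k f g) = (\<lambda>p. \<phi>F k p * alpha k f g p + \<psi>F k p * beta k f g p)"
    by (auto simp: nF_def)
  show "(apply_bcontfun (nF k f g) has_real_derivative ((real k)\<^sup>2 *\<^sub>R bmul c (nw k f g) + real k *\<^sub>R g) p) (at p within I)"
    unfolding eq
    apply (rule derivative_eq_intros fs_d alpha_d beta_d p refl)+
    using key by (simp add: nw_def algebra_simps power2_eq_square)
qed

end

lemma compare_I: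
  assumes f: "\<And>p. p \<in> I \<Longrightarrow> (f has_real_derivative f' p) (at p within I)"
    and g: "\<And>p. p \<in> I \<Longrightarrow> (g has_real_derivative g' p) (at p within I)"
    and le: "\<And>p. p \<in> I \<Longrightarrow> \<bar>f' p\<bar> \<le> g' p" and pq: "-1 \<le> p" "p \<le> q" "q \<le> 0"
  shows "\<bar>f q - f p\<bar> \<le> g q - g p"
proof -
  have "g p - f p \<le> g q - f q"
    by (rule mono_I[where f = "\<lambda>p. g p - f p" and f' = "\<lambda>p. g' p - f' p", OF DERIV_diff[OF g f] _ pq])
       (use le in \<open>auto simp: abs_le_iff\<close>)
  moreover have "g p + f p \<le> g q + f q"
    by (rule mono_I[where f = "\<lambda>p. g p + f p" and f' = "\<lambda>p. g' p + f' p", OF DERIV_add[OF g f] _ pq])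
       (use le in \<open>force simp: abs_le_iff\<close>)+
  ultimately show ?thesis by linarith
qed

context modal begin

text \<open>The redundant factor k on the right makes \<open>(real k)\<^sup>2 * c\<close>, and thus
  the derivative of a flux, visible. For k = 0 the quotient is 0 by convention and the inequality
  still holds.\<close>

lemma kc: "p \<in> I \<Longrightarrow> real k \<le> (real k)\<^sup>2 * c p / (real k * cm)"
  using cmin[of p] cm by (cases "k = 0") (auto simp: field_simps power2_eq_square)

text \<open>The integrand is dominated by the derivative of an explicit combination of
  \<open>\<psi>F\<close> and \<open>\<psi>\<close>: the datum \<open>g\<close> by the change of the
  flux, the datum \<open>f\<close> by the change of the value. The integral is thereby bounded by
  end values.\<close>

lemma alpha_bound:
  assumes fg: "norm f \<le> m" "norm g \<le> m" and p: "p \<in> I"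
  shows "\<bar>alpha k f g p\<bar> \<le> m / W k * ((1 + C0 / cm) * \<psi> k p)"
proof -
  have m: "0 \<le> m / W k" using order_trans[OF norm_ge_zero fg(1)] W_pos[of k] by simp
  have "\<bar>alpha k f g 0 - alpha k f g p\<bar> \<le> m / W k * (\<psi>F k 0 / (real k * cm) - \<psi> k 0) - m / W k * (\<psi>F k p / (real k * cm) - \<psi> k p)"
  proof (rule compare_I[where g = "\<lambda>p. m / W k * (\<psi>F k p / (real k * cm) - \<psi> k p)"
        and g' = "\<lambda>p. m / W k * ((real k)\<^sup>2 * (c p * \<psi> k p) / (real k * cm) - b p * \<psi>F k p)", OF alpha_d])
    fix q assume q: "q \<in> I"
    show "((\<lambda>p. m / W k * (\<psi>F k p / (real k * cm) - \<psi> k p)) has_real_derivative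
        m / W k * ((real k)\<^sup>2 * (c q * \<psi> k q) / (real k * cm) - b q * \<psi>F k q)) (at q within I)"
      by (intro DERIV_cmult DERIV_diff DERIV_cdivide fs_d q)
    have "\<bar>real k * \<psi> k q * g q - b q * \<psi>F k q * f q\<bar> \<le> \<bar>real k * \<psi> k q * g q\<bar> + \<bar>b q * \<psi>F k q * f q\<bar>"
      by (rule abs_triangle_ineq4)
    also have "\<dots> = real k * \<psi> k q * \<bar>g q\<bar> + b q * (- \<psi>F k q) * \<bar>f q\<bar>"
      using fs_sign[OF q, of k] bpos[OF q] by (simp add: abs_mult)
    also have "\<dots> \<le> (real k)\<^sup>2 * c q / (real k * cm) * \<psi> k q * m + b q * (- \<psi>F k q) * m"
      using fs_sign[OF q, of k] bpos[OF q] kc[OF q, of k] cmin[OF q] cm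
      by (intro add_mono mult_mono order_trans[OF abs_apply_le] fg)
         (auto intro!: mult_nonneg_nonneg divide_nonneg_nonneg mult_nonneg_nonpos)
    also have "\<dots> = m * ((real k)\<^sup>2 * (c q * \<psi> k q) / (real k * cm) - b q * \<psi>F k q)"
      by (simp add: algebra_simps)
    finally show "\<bar>(real k * \<psi> k q * g q - b q * \<psi>F k q * f q) / W k\<bar>
        \<le> m / W k * ((real k)\<^sup>2 * (c q * \<psi> k q) / (real k * cm) - b q * \<psi>F k q)"
      using W_pos[of k] by (simp add: divide_right_mono)
  qed (use p in auto)
  then have "\<bar>alpha k f g p\<bar> \<le> m / W k * (\<psi> k p - 1 - \<psi>F k p / (real k * cm))"
    by (simp add: algebra_simps)
  also have "\<dots> \<le> m / W k * ((1 + C0 / cm) * \<psi> k p)"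
  proof (rule mult_left_mono[OF _ m])
    have "- \<psi>F k p / (real k * cm) \<le> C0 * real k * \<psi> k p / (real k * cm)"
      using psi_cone[OF p, of k] cm by (intro divide_right_mono) auto
    also have "\<dots> \<le> C0 / cm * \<psi> k p"
      using fs_sign(3)[OF p, of k] C0 cm by (cases "k = 0") auto
    finally show "\<psi> k p - 1 - \<psi>F k p / (real k * cm) \<le> (1 + C0 / cm) * \<psi> k p"
      by (simp add: algebra_simps)
  qed
  finally show ?thesis .
qed

lemma beta_bound:
  assumes fg: "norm f \<le> m" "norm g \<le> m" and p: "p \<in> I"
  shows "\<bar>beta k f g p\<bar> \<le> m / W k * (\<phi> k p + \<phi>F k p / (real k * cm))"
proof -
  have m: "0 \<le> m / W k" using order_trans[OF norm_ge_zero fg(1)] W_pos[of k] by simp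
  have "\<bar>beta k f g p - beta k f g (-1)\<bar> \<le> m / W k * (\<phi>F k p / (real k * cm) + \<phi> k p) - m / W k * (\<phi>F k (-1) / (real k * cm) + \<phi> k (-1))"
  proof (rule compare_I[where g = "\<lambda>p. m / W k * (\<phi>F k p / (real k * cm) + \<phi> k p)"
        and g' = "\<lambda>p. m / W k * ((real k)\<^sup>2 * (c p * \<phi> k p) / (real k * cm) + b p * \<phi>F k p)", OF beta_d])
    fix q assume q: "q \<in> I"
    show "((\<lambda>p. m / W k * (\<phi>F k p / (real k * cm) + \<phi> k p)) has_real_derivative
        m / W k * ((real k)\<^sup>2 * (c q * \<phi> k q) / (real k * cm) + b q * \<phi>F k q)) (at q within I)"
      by (intro DERIV_cmult DERIV_add DERIV_cdivide fs_d q)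
    have "\<bar>b q * \<phi>F k q * f q - real k * \<phi> k q * g q\<bar> \<le> \<bar>b q * \<phi>F k q * f q\<bar> + \<bar>real k * \<phi> k q * g q\<bar>"
      by (rule abs_triangle_ineq4)
    also have "\<dots> = b q * \<phi>F k q * \<bar>f q\<bar> + real k * \<phi> k q * \<bar>g q\<bar>"
      using fs_sign[OF q, of k] bpos[OF q] by (simp add: abs_mult)
    also have "\<dots> \<le> b q * \<phi>F k q * m + (real k)\<^sup>2 * c q / (real k * cm) * \<phi> k q * m"
      using fs_sign[OF q, of k] bpos[OF q] kc[OF q, of k] cmin[OF q] cm
      by (intro add_mono mult_mono order_trans[OF abs_apply_le] fg)
         (auto intro!: mult_nonneg_nonneg divide_nonneg_nonneg)
    also have "\<dots> = m * ((real k)\<^sup>2 * (c q * \<phi> k q) / (real k * cm) + b q * \<phi>F k q)"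
      by (simp add: algebra_simps)
    finally show "\<bar>(b q * \<phi>F k q * f q - real k * \<phi> k q * g q) / W k\<bar>
        \<le> m / W k * ((real k)\<^sup>2 * (c q * \<phi> k q) / (real k * cm) + b q * \<phi>F k q)"
      using W_pos[of k] by (simp add: divide_right_mono)
  qed (use p in auto)
  then have "\<bar>beta k f g p\<bar> \<le> m / W k * (\<phi> k p + \<phi>F k p / (real k * cm)) - m / W k * (1 / (real k * cm))"
    by (simp add: algebra_simps)
  also have "\<dots> \<le> m / W k * (\<phi> k p + \<phi>F k p / (real k * cm))"
    using mult_nonneg_nonneg[OF m, of "1 / (real k * cm)"] cm by simp
  finally show ?thesis .
qed

definition Cb :: real where "Cb = 1 / c0 + 1 / cm"

lemma Cb_nonneg: "0 \<le> Cb" using c0 cm by (simp add: Cb_def)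

lemma beta_bound':
  assumes fg: "norm f \<le> m" "norm g \<le> m" and p: "p \<in> I"
  shows "real k * \<psi> k p * \<bar>beta k f g p\<bar> \<le> m * Cb"
proof -
  have m: "0 \<le> m / W k" using order_trans[OF norm_ge_zero fg(1)] W_pos[of k] by simp
  have "real k * \<psi> k p * \<bar>beta k f g p\<bar> \<le> real k * \<psi> k p * (m / W k * (\<phi> k p + \<phi>F k p / (real k * cm)))"
    using fs_sign(3)[OF p, of k] by (intro mult_left_mono beta_bound fg p) auto
  also have "\<dots> = m / W k * ((real k * \<phi> k p) * \<psi> k p + (real k / (real k * cm)) * (\<psi> k p * \<phi>F k p))"
    by (simp add: algebra_simps)
  also have "\<dots> \<le> m / W k * ((\<phi>F k p / c0) * \<psi> k p + (1 / cm) * (\<psi> k p * \<phi>F k p))"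
    using phi_cone[OF p, of k] fs_sign(2,3)[OF p, of k] c0 cm
    by (intro mult_left_mono[OF _ m] add_mono mult_right_mono) (auto simp: field_simps)
  also have "\<dots> = m / W k * (\<psi> k p * \<phi>F k p) * Cb"
    unfolding Cb_def by (simp only: divide_inverse distrib_left mult_1_left mult_ac)
  also have "\<dots> \<le> m / W k * W k * Cb"
    by (intro mult_right_mono mult_left_mono psi_phiF_le p m Cb_nonneg)
  also have "\<dots> = m * Cb" using W_pos[of k] by simp
  finally show ?thesis .
qed

lemma alpha_bound':
  assumes fg: "norm f \<le> m" "norm g \<le> m" and p: "p \<in> I"
  shows "\<phi>F k p * \<bar>alpha k f g p\<bar> \<le> m * (1 + C0 / cm)"
proof -
  have m: "0 \<le> m / W k" using order_trans[OF norm_ge_zero fg(1)] W_pos[of k] by simp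
  have "\<phi>F k p * \<bar>alpha k f g p\<bar> \<le> \<phi>F k p * (m / W k * ((1 + C0 / cm) * \<psi> k p))"
    using fs_sign(2)[OF p, of k] by (intro mult_left_mono alpha_bound fg p) auto
  also have "\<dots> = m / W k * (\<psi> k p * \<phi>F k p) * (1 + C0 / cm)" by (simp only: mult_ac)
  also have "\<dots> \<le> m / W k * W k * (1 + C0 / cm)"
    using C0 cm by (intro mult_right_mono mult_left_mono psi_phiF_le p m) auto
  also have "\<dots> = m * (1 + C0 / cm)" using W_pos[of k] by simp
  finally show ?thesis .
qed

definition Cw :: real where "Cw = (1 + C0 / cm) / c0 + Cb"
definition CF :: real where "CF = 1 + C0 / cm + C0 * Cb"

lemma Cw_nonneg: "0 \<le> Cw" and CF_nonneg: "0 \<le> CF"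
  using Cb_nonneg C0 c0 cm by (simp_all add: Cw_def CF_def)

text \<open>\<open>k * nw\<close> is the coefficient of the q-derivative of the mode. Its bound by
  the data, uniform in k, replaces an elliptic estimate.\<close>

lemma nw_bound:
  assumes fg: "norm f \<le> m" "norm g \<le> m" and p: "p \<in> I"
  shows "real k * \<bar>nw k f g p\<bar> \<le> m * Cw"
proof -
  have "real k * \<bar>nw k f g p\<bar> \<le> real k * (\<phi> k p * \<bar>alpha k f g p\<bar> + \<psi> k p * \<bar>beta k f g p\<bar>)"
    using fs_sign[OF p, of k] by (intro mult_left_mono) (auto simp: nw_def abs_mult intro: order_trans[OF abs_triangle_ineq])
  also have "\<dots> = (real k * \<phi> k p) * \<bar>alpha k f g p\<bar> + real k * \<psi> k p * \<bar>beta k f g p\<bar>"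
    by (simp add: algebra_simps)
  also have "\<dots> \<le> (\<phi>F k p / c0) * \<bar>alpha k f g p\<bar> + m * Cb"
    using phi_cone[OF p, of k] c0 by (intro add_mono mult_right_mono beta_bound' fg p) (auto simp: field_simps)
  also have "\<dots> = (\<phi>F k p * \<bar>alpha k f g p\<bar>) / c0 + m * Cb" by simp
  also have "\<dots> \<le> m * (1 + C0 / cm) / c0 + m * Cb"
    using alpha_bound'[OF fg p] c0 by (simp add: divide_right_mono)
  also have "\<dots> = m * Cw" by (simp add: Cw_def algebra_simps)
  finally show ?thesis .
qed

lemma nF_bound:
  assumes fg: "norm f \<le> m" "norm g \<le> m" and p: "p \<in> I"
  shows "\<bar>nF k f g p\<bar> \<le> m * CF"
proof -
  have "\<bar>nF k f g p\<bar> \<le> \<phi>F k p * \<bar>alpha k f g p\<bar> + (- \<psi>F k p) * \<bar>beta k f g p\<bar>"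
    using fs_sign[OF p, of k] by (auto simp: nF_def abs_mult intro: order_trans[OF abs_triangle_ineq])
  also have "\<dots> \<le> m * (1 + C0 / cm) + (C0 * real k * \<psi> k p) * \<bar>beta k f g p\<bar>"
    by (intro add_mono mult_right_mono alpha_bound' fg p psi_cone) auto
  also have "\<dots> = m * (1 + C0 / cm) + C0 * (real k * \<psi> k p * \<bar>beta k f g p\<bar>)" by simp
  also have "\<dots> \<le> m * (1 + C0 / cm) + C0 * (m * Cb)"
    by (intro add_left_mono mult_left_mono beta_bound' fg p C0)
  also have "\<dots> = m * CF" by (simp add: CF_def algebra_simps)
  finally show ?thesis .
qed

definition Cn :: real where "Cn = Cw + \<phi> 0 0"

lemma Cn_nonneg: "0 \<le> Cn" using Cw_nonneg fs_sign(1)[of 0 0] by (simp add: Cn_def)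

lemma nw_right_bound:
  assumes fg: "norm f \<le> m" "norm g \<le> m"
  shows "\<bar>nw k f g 0\<bar> \<le> m * Cn"
proof -
  have m: "0 \<le> m" using order_trans[OF norm_ge_zero fg(1)] .
  have phi: "0 \<le> \<phi> 0 0" using fs_sign(1)[of 0 0] by simp
  show ?thesis
  proof (cases "k = 0")
    case True
    \<comment> \<open>\<open>nw_bound\<close> says nothing for k = 0. The summand
      \<open>\<phi> 0 0\<close> of \<open>Cn\<close> covers this one mode.\<close>
    have "\<bar>nw k f g 0\<bar> \<le> m / W 0 * \<phi> 0 0"
      using beta_bound[OF fg, of 0 0] by (simp add: True)
    also have "\<dots> \<le> m / 1 * \<phi> 0 0"
      using W_ge[of 0] m phi by (intro mult_right_mono divide_left_mono) auto
    also have "\<dots> \<le> m * Cn" using Cw_nonneg m by (simp add: Cn_def mult_left_mono)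
    finally show ?thesis .
  next
    case False
    have "1 * \<bar>nw k f g 0\<bar> \<le> real k * \<bar>nw k f g 0\<bar>" using False by (intro mult_right_mono) auto
    also have "\<dots> \<le> m * Cw" by (intro nw_bound fg) auto
    also have "\<dots> \<le> m * Cn" using phi m by (simp add: Cn_def mult_left_mono)
    finally show ?thesis by simp
  qed
qed

lemma linear_n:
  "nw k (f + f') (g + g') = nw k f g + nw k f' g'" "nw k (r *\<^sub>R f) (r *\<^sub>R g) = r *\<^sub>R nw k f g"
  "nF k (f + f') (g + g') = nF k f g + nF k f' g'" "nF k (r *\<^sub>R f) (r *\<^sub>R g) = r *\<^sub>R nF k f g"
proof -
  note bm = bounded_bilinear.add_right[OF bounded_bilinear_bmul]
    bounded_bilinear.scaleR_right[OF bounded_bilinear_bmul] bounded_bilinear.diff_right[OF bounded_bilinear_bmul]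
  note li = linear_add[OF linear_IL] linear_scale[OF linear_IL] linear_add[OF linear_IR] linear_scale[OF linear_IR]
   linear_diff[OF linear_IL] linear_diff[OF linear_IR]
  have "alpha k (f + f') (g + g') = alpha k f g + alpha k f' g'" "alpha k (r *\<^sub>R f) (r *\<^sub>R g) = r *\<^sub>R alpha k f g"
    "beta k (f + f') (g + g') = beta k f g + beta k f' g'" "beta k (r *\<^sub>R f) (r *\<^sub>R g) = r *\<^sub>R beta k f g"
    by (simp_all add: alpha_def beta_def bm li scaleR_add_right scaleR_diff_right mult.commute)
  then show "nw k (f + f') (g + g') = nw k f g + nw k f' g'" "nw k (r *\<^sub>R f) (r *\<^sub>R g) = r *\<^sub>R nw k f g"
  "nF k (f + f') (g + g') = nF k f g + nF k f' g'" "nF k (r *\<^sub>R f) (r *\<^sub>R g) = r *\<^sub>R nF k f g"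
    by (simp_all add: nw_def nF_def bm scaleR_add_right)
qed

lemma phi_pos: "-1 < p \<Longrightarrow> p \<le> 0 \<Longrightarrow> 0 < \<phi> k p"
proof -
  assume p: "-1 < p" "p \<le> 0"
  obtain r where r: "-1 < r" "r < p" "\<phi> k p - \<phi> k (-1) = b r * \<phi>F k r * (p - (-1))"
    by (rule mvt_I[OF fs_d(1)[of _ k], of "-1" p]) (use p in auto)
  then have "r \<in> I" using p by auto
  then have "0 < b r * \<phi>F k r * (p - (-1))" using bpos[of r] fs_sign(2)[of r k] p by (intro mult_pos_pos) auto
  then show ?thesis using r by simp
qed

text \<open>Sturm comparison: the mixed Wronskian vanishes at the bottom and has a positive
  derivative above it. So the ratio of flux to value at the surface increases strictly with k and
  equals \<open>G\<close> for at most one k.\<close>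

lemma comparison:
  assumes "k < j"
  shows "\<phi> j 0 * \<phi>F k 0 < \<phi>F j 0 * \<phi> k 0"
proof -
  define f where "f p = \<phi>F j p * \<phi> k p - \<phi> j p * \<phi>F k p" for p
  have d: "(f has_real_derivative ((real j)\<^sup>2 - (real k)\<^sup>2) * (c p * (\<phi> j p * \<phi> k p))) (at p within I)" if "p \<in> I" for p
    unfolding f_def by (rule derivative_eq_intros fs_d that refl)+ (simp add: algebra_simps)
  obtain r where r: "-1 < r" "r < 0" "f 0 - f (-1) = ((real j)\<^sup>2 - (real k)\<^sup>2) * (c r * (\<phi> j r * \<phi> k r)) * (0 - (-1))"
    by (rule mvt_I[OF d, of "-1" 0]) auto
  have "(real k)\<^sup>2 < (real j)\<^sup>2" using assms by (simp add: power_strict_mono)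
  moreover have "0 < c r" using cmin[of r] cm r by auto
  ultimately have "0 < ((real j)\<^sup>2 - (real k)\<^sup>2) * (c r * (\<phi> j r * \<phi> k r)) * (0 - (-1))"
    using phi_pos[of r j] phi_pos[of r k] r by (intro mult_pos_pos) auto
  then have "f (-1) < f 0" using r by linarith
  then show ?thesis by (simp add: f_def)
qed

end

text \<open>Single modes inherit their linear structure from the rules already proved for
  \<open>hb\<close>.\<close>

lemma eb_iff_hb: "eb \<alpha> k e c \<longleftrightarrow> hb \<alpha> (single (0, k) e) c"
proof
  assume "hb \<alpha> (single (0, k) e) c"
  from hb_use[OF this, of "{(0, k)}" "\<lambda>_. p" "\<lambda>_. q" for p q] show "eb \<alpha> k e c"
    by (auto simp: eb_def)
qed (simp add: hb_single)

lemma eb_add: "eb \<alpha> k e a \<Longrightarrow> eb \<alpha> k f d \<Longrightarrow> eb \<alpha> k (e + f) (a + d)"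
  unfolding eb_iff_hb linear_add[OF bounded_linear.linear[OF bounded_linear_single]] by (rule hb_add)

lemma eb_scaleR: "eb \<alpha> k e a \<Longrightarrow> eb \<alpha> k (r *\<^sub>R e) (\<bar>r\<bar> * a)"
  unfolding eb_iff_hb linear_scale[OF bounded_linear.linear[OF bounded_linear_single]] by (rule hb_scaleR)

lemma eb_mono: "eb \<alpha> k e a \<Longrightarrow> a \<le> d \<Longrightarrow> eb \<alpha> k e d"
  unfolding eb_iff_hb by (rule hb_mono)

lemma eb_zero: "0 \<le> a \<Longrightarrow> eb \<alpha> k 0 a"
  by (simp add: eb_def holder_term_def)

lemma eb_weaken:
  assumes "eb \<alpha> 0 e a"
  shows "eb \<alpha> k e a"
  unfolding eb_def
proof safe
  fix p q :: real assume pq: "p \<in> {-1..0}" "q \<in> {-1..0}"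
  have "(1/2) ^ k * (\<bar>e p - e q\<bar> / \<bar>p - q\<bar> powr \<alpha>) \<le> 1 * (\<bar>e p - e q\<bar> / \<bar>p - q\<bar> powr \<alpha>)"
    by (intro mult_right_mono) (auto simp: power_le_one)
  then have "holder_term \<alpha> k e p q \<le> holder_term \<alpha> 0 e p q" by (simp add: holder_term_def)
  then show "holder_term \<alpha> k e p q \<le> a" using assms pq unfolding eb_def by (meson order_trans)
qed

section \<open>The Robin condition at the surface and the resonant mode\<close>

locale modal_robin = modal +
  fixes G :: real and d1 d2 :: cfun and \<alpha> :: real
  assumes resonance: "\<phi>F 1 0 = G * \<phi> 1 0"
    and nonresonant_load: "nw 1 d1 d2 0 \<noteq> 0"
    and \<alpha>: "0 < \<alpha>" "\<alpha> \<le> 1"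
    and eb_fin: "\<exists>K. eb \<alpha> 0 b K" "\<exists>K. eb \<alpha> 0 d1 K" "\<exists>K. eb \<alpha> 0 d2 K"
begin

text \<open>Defect of the homogeneous solution in the Robin condition. It vanishes for k = 1 by
  \<open>resonance\<close> and, by \<open>comparison\<close>, for no other k.\<close>

definition \<Delta> where "\<Delta> k = \<phi>F k 0 - G * \<phi> k 0"
text \<open>Chosen so that adding \<open>\<mu>\<close> times the load makes the surface value of
  \<open>nw 1\<close> vanish. Since the flux \<open>nF\<close> is 0 at the surface, this is
  precisely the solvability condition of the resonant mode.\<close>

definition \<mu> where "\<mu> f g = - nw 1 f g 0 / nw 1 d1 d2 0"
definition ef where "ef k f g = f + (if k = 1 then \<mu> f g else 0) *\<^sub>R d1" for k :: nat
definition eg where "eg k f g = g + (if k = 1 then \<mu> f g else 0) *\<^sub>R d2" for k :: nat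
text \<open>Amount of the homogeneous solution that corrects the Robin condition. In the resonant
  mode the numerator vanishes once the load is included (\<open>nw_e_zero\<close>), so no multiple
  of the kernel is added.\<close>

definition \<theta> where "\<theta> k f g = G * nw k f g 0 / \<Delta> k"
definition tw where "tw k f g = nw k (ef k f g) (eg k f g) + \<theta> k (ef k f g) (eg k f g) *\<^sub>R \<phi> k"
definition tF where "tF k f g = nF k (ef k f g) (eg k f g) + \<theta> k (ef k f g) (eg k f g) *\<^sub>R \<phi>F k"
definition Tu where "Tu k f g = bmul b (tF k f g + ef k f g)"
definition Tv where "Tv k f g = real k *\<^sub>R tw k f g"

lemma G_pos: "0 < G"
proof -
  have "0 < G * \<phi> 1 0" using fs_sign(2)[of 0 1] resonance by simp
  then show ?thesis using phi_pos[of 0 1] by (simp add: zero_less_mult_iff)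
qed

text \<open>For k at least 2, comparison with k = 2 gives
  \<open>G * \<phi> k 0 \<le> \<rho> * \<phi>F k 0\<close> with one \<open>\<rho>\<close> below 1; k
  = 0 lies on the other side of the resonance and contributes a single number. A bound relative to
  \<open>\<phi>F k 0\<close> is the right one, since this quantity may grow with k.\<close>

lemma Delta_bound:
  obtains \<delta> where "0 < \<delta>" "\<And>k. k \<noteq> 1 \<Longrightarrow> \<delta> * \<phi>F k 0 \<le> \<bar>\<Delta> k\<bar>"
proof -
  have F: "0 < \<phi>F k 0" for k using W_pos[of k] by (simp add: W_def)
  have P: "0 < \<phi> k 0" for k by (rule phi_pos) auto
  have "\<phi> 1 0 * \<phi>F 0 0 < \<phi> 1 0 * (G * \<phi> 0 0)"
    using comparison[of 0 1] resonance by (simp add: mult.commute mult.left_commute)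
  then have D0: "\<Delta> 0 < 0" using P[of 1] by (simp add: \<Delta>_def)
  have "\<phi> 1 0 * (G * \<phi> 2 0) < \<phi> 1 0 * \<phi>F 2 0"
    using comparison[of 1 2] resonance by (simp add: mult.commute mult.left_commute)
  then have D2: "G * \<phi> 2 0 < \<phi>F 2 0" using P[of 1] by simp
  define \<rho> where "\<rho> = G * \<phi> 2 0 / \<phi>F 2 0"
  have \<rho>: "\<rho> < 1" using D2 F[of 2] by (simp add: \<rho>_def)
  define \<delta> where "\<delta> = min (1 - \<rho>) (\<bar>\<Delta> 0\<bar> / \<phi>F 0 0)"
  show thesis
  proof
    have "0 < \<bar>\<Delta> 0\<bar> / \<phi>F 0 0" using D0 F[of 0] by (intro divide_pos_pos) auto
    then show "0 < \<delta>" using \<rho> by (simp add: \<delta>_def)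
    fix k :: nat assume k: "k \<noteq> 1"
    show "\<delta> * \<phi>F k 0 \<le> \<bar>\<Delta> k\<bar>"
    proof (cases "k = 0")
      case True
      have "\<delta> * \<phi>F 0 0 \<le> \<bar>\<Delta> 0\<bar> / \<phi>F 0 0 * \<phi>F 0 0"
        using F[of 0] by (intro mult_right_mono) (auto simp: \<delta>_def)
      then show ?thesis using F[of 0] True by simp
    next
      case False
      then have "2 \<le> k" using k by simp
      then have "\<phi> k 0 * \<phi>F 2 0 \<le> \<phi>F k 0 * \<phi> 2 0"
        using comparison[of 2 k] by (cases "k = 2") (auto simp: mult.commute)
      then have "G * (\<phi> k 0 * \<phi>F 2 0) \<le> G * (\<phi>F k 0 * \<phi> 2 0)" using G_pos by (intro mult_left_mono) auto
      then have "G * \<phi> k 0 \<le> \<rho> * \<phi>F k 0" using F[of 2] by (simp add: \<rho>_def field_simps)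
      then have "(1 - \<rho>) * \<phi>F k 0 \<le> \<Delta> k" by (simp add: \<Delta>_def algebra_simps)
      moreover have "\<delta> * \<phi>F k 0 \<le> (1 - \<rho>) * \<phi>F k 0" using F[of k] by (intro mult_right_mono) (auto simp: \<delta>_def)
      ultimately show ?thesis by linarith
    qed
  qed
qed

lemma Delta_nonzero: "k \<noteq> 1 \<Longrightarrow> \<Delta> k \<noteq> 0"
proof -
  assume k: "k \<noteq> 1"
  obtain \<delta> where "0 < \<delta>" "\<And>k. k \<noteq> 1 \<Longrightarrow> \<delta> * \<phi>F k 0 \<le> \<bar>\<Delta> k\<bar>" by (rule Delta_bound) (rule that)
  then have "0 < \<delta> * \<phi>F k 0" "\<delta> * \<phi>F k 0 \<le> \<bar>\<Delta> k\<bar>" using W_pos[of k] k by (simp_all add: W_def)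
  then show ?thesis by auto
qed

lemma linear_mu: "\<mu> (f + f') (g + g') = \<mu> f g + \<mu> f' g'" "\<mu> (r *\<^sub>R f) (r *\<^sub>R g) = r * \<mu> f g"
  by (simp_all add: \<mu>_def linear_n diff_divide_distrib add_divide_distrib)

lemma linear_e: "ef k (f + f') (g + g') = ef k f g + ef k f' g'" "ef k (r *\<^sub>R f) (r *\<^sub>R g) = r *\<^sub>R ef k f g"
  "eg k (f + f') (g + g') = eg k f g + eg k f' g'" "eg k (r *\<^sub>R f) (r *\<^sub>R g) = r *\<^sub>R eg k f g"
  by (simp_all add: ef_def eg_def linear_mu scaleR_add_right scaleR_add_left)

lemma linear_theta: "\<theta> k (f + f') (g + g') = \<theta> k f g + \<theta> k f' g'" "\<theta> k (r *\<^sub>R f) (r *\<^sub>R g) = r * \<theta> k f g"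
  by (simp_all add: \<theta>_def linear_n add_divide_distrib distrib_left)

lemma linear_T: "Tu k (f + f') (g + g') = Tu k f g + Tu k f' g'" "Tu k (r *\<^sub>R f) (r *\<^sub>R g) = r *\<^sub>R Tu k f g"
  "Tv k (f + f') (g + g') = Tv k f g + Tv k f' g'" "Tv k (r *\<^sub>R f) (r *\<^sub>R g) = r *\<^sub>R Tv k f g"
  by (simp_all add: Tu_def Tv_def tw_def tF_def linear_e linear_theta linear_n scaleR_add_right scaleR_add_left
      bounded_bilinear.add_right[OF bounded_bilinear_bmul] bounded_bilinear.scaleR_right[OF bounded_bilinear_bmul]
      mult.commute)

lemma nw_e_zero: "nw 1 (ef 1 f g) (eg 1 f g) 0 = 0"
  using nonresonant_load by (simp only: ef_def eg_def if_True linear_n apply_bcontfun_add apply_bcontfun_scaleR) (simp add: \<mu>_def)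

lemma D_tw: "D (tw k f g) (Tu k f g)"
proof -
  have "D (tw k f g) (bmul b (nF k (ef k f g) (eg k f g) + ef k f g) + \<theta> k (ef k f g) (eg k f g) *\<^sub>R bmul b (\<phi>F k))"
    unfolding tw_def by (intro D_add D_nw D_scaleR fs_D)
  then show ?thesis by (rule D_cong) (simp add: Tu_def tF_def algebra_simps)
qed

lemma D_tF: "D (tF k f g) (real k *\<^sub>R (bmul c (Tv k f g) + eg k f g))"
proof -
  have "D (tF k f g) ((real k)\<^sup>2 *\<^sub>R bmul c (nw k (ef k f g) (eg k f g)) + real k *\<^sub>R eg k f g
      + \<theta> k (ef k f g) (eg k f g) *\<^sub>R ((real k)\<^sup>2 *\<^sub>R bmul c (\<phi> k)))"
    unfolding tF_def by (intro D_add D_nF D_scaleR fs_D)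
  then show ?thesis by (rule D_cong) (simp add: Tv_def tw_def algebra_simps power2_eq_square)
qed

lemma tw_left: "tw k f g (-1) = 0"
  by (simp add: tw_def)

text \<open>As \<open>nF\<close> vanishes at the surface, the condition reads
  \<open>\<theta> * \<Delta> = G * nw\<close>. For k different from 1 this defines
  \<open>\<theta>\<close>; for k = 1 the kernel fulfils the Robin condition and \<open>nw\<close>
  has been made to vanish.\<close>

lemma robin: "tF k f g 0 = G * tw k f g 0"
proof (cases "k = 1")
  case True
  then show ?thesis using nw_e_zero[of f g] by (simp add: tF_def tw_def \<theta>_def)
next
  case False
  define n where "n = nw k (ef k f g) (eg k f g) 0"
  have "G * n / \<Delta> k * \<phi>F k 0 = G * n + G * (G * n / \<Delta> k * \<phi> k 0)"
    using Delta_nonzero[OF False] by (simp add: field_simps) (simp add: \<Delta>_def algebra_simps)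
  then show ?thesis by (simp add: tF_def tw_def \<theta>_def n_def distrib_left)
qed

lemma tw_eq_IL: "p \<in> I \<Longrightarrow> tw k f g p = IL (Tu k f g) p"
  by (rule D_unique[OF D_tw D_IL]) (simp_all add: tw_left)

text \<open>The Robin problem for the \<open>k\<close>-th mode in integrated form; in the resonant mode the load
  \<open>(d1, d2)\<close> is added with the multiplier that makes it solvable.\<close>

lemma T_equation:
  assumes p: "p \<in> I"
  shows "Tv k f g p = real k * IL (Tu k f g) p"
    and "Tu k f g p = b p * (ef k f g p + G * IL (Tu k f g) 0 - real k * IR (bmul c (Tv k f g) + eg k f g) p)"
proof -
  show "Tv k f g p = real k * IL (Tu k f g) p" by (simp add: Tv_def tw_eq_IL[OF p])
  have "D (tF k f g + real k *\<^sub>R IR (bmul c (Tv k f g) + eg k f g)) 0"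
    using D_add[OF D_tF D_scaleR[OF D_IR], of k f g "real k" "bmul c (Tv k f g) + eg k f g"]
    by (rule D_cong) (simp add: algebra_simps)
  from D_zero_const[OF this p, of 0]
  have "tF k f g p + real k * IR (bmul c (Tv k f g) + eg k f g) p = G * IL (Tu k f g) 0"
    by (simp add: robin tw_eq_IL)
  then show "Tu k f g p = b p * (ef k f g p + G * IL (Tu k f g) 0 - real k * IR (bmul c (Tv k f g) + eg k f g) p)"
    by (simp add: Tu_def)
qed

lemma phiF_mono: "p \<in> I \<Longrightarrow> \<phi>F k p \<le> \<phi>F k 0"
  by (rule mono_I[OF fs_d(2)[of _ k]]) (use fs_sign(1) cmin cm in \<open>auto intro!: mult_nonneg_nonneg intro: order_trans[OF less_imp_le]\<close>)

lemma mu_bound: "norm f \<le> m \<Longrightarrow> norm g \<le> m \<Longrightarrow> \<bar>\<mu> f g\<bar> \<le> Cn / \<bar>nw 1 d1 d2 0\<bar> * m"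
  unfolding \<mu>_def using nw_right_bound[of f m g 1] by (simp add: abs_divide divide_right_mono mult.commute)

lemma e_eb:
  obtains K where "0 \<le> K" "\<And>k f g a. eb \<alpha> k f a \<Longrightarrow> eb \<alpha> k g a \<Longrightarrow> eb \<alpha> k (ef k f g) (K * a) \<and> eb \<alpha> k (eg k f g) (K * a)"
    "\<And>k f g a. norm f \<le> a \<Longrightarrow> norm g \<le> a \<Longrightarrow> norm (ef k f g) \<le> K * a \<and> norm (eg k f g) \<le> K * a"
proof -
  obtain L1 L2 where L: "eb \<alpha> 0 d1 L1" "eb \<alpha> 0 d2 L2" using eb_fin by blast
  define L where "L = max L1 L2"
  have "L1 \<le> L" "L2 \<le> L" by (simp_all add: L_def)
  then have L: "eb \<alpha> k d1 L" "eb \<alpha> k d2 L" for k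
    using eb_mono[OF eb_weaken[OF L(1)], of L k] eb_mono[OF eb_weaken[OF L(2)], of L k] by simp_all
  define M where "M = Cn / \<bar>nw 1 d1 d2 0\<bar>"
  have M: "0 \<le> M" using Cn_nonneg by (simp add: M_def)
  have L0: "0 \<le> L" using eb_nonneg[OF L(1)] .
  have mu: "\<bar>if k = 1 then \<mu> f g else 0\<bar> \<le> M * a" if "norm f \<le> a" "norm g \<le> a" for f g a and k :: nat
    using mu_bound[OF that] M order_trans[OF norm_ge_zero that(1)] by (auto simp: M_def)
  have mu': "a + \<bar>if k = 1 then \<mu> f g else 0\<bar> * L \<le> (1 + M * L) * a" if "norm f \<le> a" "norm g \<le> a" for f g a and k :: nat
    using mult_right_mono[OF mu[OF that, of k] L0] by (simp add: algebra_simps)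
  show thesis
  proof
    show "0 \<le> 1 + M * L" using M L0 by simp
    show "eb \<alpha> k (ef k f g) ((1 + M * L) * a) \<and> eb \<alpha> k (eg k f g) ((1 + M * L) * a)"
      if "eb \<alpha> k f a" "eb \<alpha> k g a" for k f g a
      unfolding ef_def eg_def using mu'[OF eb_D(1)[OF that(1)] eb_D(1)[OF that(2)], of k]
      by (intro conjI eb_mono[OF eb_add[OF that(1) eb_scaleR[OF L(1)]]] eb_mono[OF eb_add[OF that(2) eb_scaleR[OF L(2)]]])
    show "norm (ef k f g) \<le> (1 + M * L) * a \<and> norm (eg k f g) \<le> (1 + M * L) * a"
      if "norm f \<le> a" "norm g \<le> a" for k f g a
    proof -
      have "norm (x + r *\<^sub>R l) \<le> a + \<bar>r\<bar> * L" if "norm x \<le> a" "norm l \<le> L" for x l :: cfun and r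
        using that by (intro norm_triangle_le add_mono) (auto intro: mult_left_mono)
      then show ?thesis unfolding ef_def eg_def using mu'[OF that, of k] that eb_D(1)[OF L(1)] eb_D(1)[OF L(2)]
        by (meson order_trans)
    qed
  qed
qed

lemma t_bounds:
  obtains K where "0 \<le> K" "\<And>k f g m. norm f \<le> m \<Longrightarrow> norm g \<le> m \<Longrightarrow> norm (tF k f g) \<le> K * m \<and> norm (Tv k f g) \<le> K * m"
proof -
  obtain \<delta> where \<delta>: "0 < \<delta>" "\<And>k. k \<noteq> 1 \<Longrightarrow> \<delta> * \<phi>F k 0 \<le> \<bar>\<Delta> k\<bar>" by (rule Delta_bound) (rule that)
  obtain E where E: "0 \<le> E" "\<And>k f g a. norm f \<le> a \<Longrightarrow> norm g \<le> a \<Longrightarrow> norm (ef k f g) \<le> E * a \<and> norm (eg k f g) \<le> E * a"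
    by (rule e_eb) (blast intro: that)
  define H where "H = G * Cn / \<delta>"
  have H: "0 \<le> H" using G_pos Cn_nonneg \<delta>(1) by (simp add: H_def)
  define K where "K = (CF + H + Cw + H / c0) * E"
  show thesis
  proof
    show "0 \<le> K" using E(1) H CF_nonneg Cw_nonneg c0 by (simp add: K_def)
    fix k :: nat and f g :: cfun and m :: real assume fg: "norm f \<le> m" "norm g \<le> m"
    note m = order_trans[OF norm_ge_zero fg(1)]
    define f' g' where "f' = ef k f g" and "g' = eg k f g"
    have e: "norm f' \<le> E * m" "norm g' \<le> E * m" using E(2)[OF fg] by (auto simp: f'_def g'_def)
    have Em: "0 \<le> E * m" using E(1) m by simp
    \<comment> \<open>\<open>\<theta>\<close> is measured against the surface value of
      \<open>\<phi>F\<close>, the largest value on the interval by \<open>phiF_mono\<close>; the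
      homogeneous part is then bounded at every depth, uniformly in k.\<close>
    have th: "\<bar>\<theta> k f' g'\<bar> * \<phi>F k 0 \<le> H * (E * m)"
    proof (cases "k = 1")
      case True
      then show ?thesis using nw_e_zero[of f g] H Em by (simp add: \<theta>_def f'_def g'_def)
    next
      case False
      have F: "0 < \<phi>F k 0" using W_pos[of k] by (simp add: W_def)
      have "\<bar>\<theta> k f' g'\<bar> * \<phi>F k 0 = G * \<bar>nw k f' g' 0\<bar> * (\<phi>F k 0 / \<bar>\<Delta> k\<bar>)"
        using G_pos by (simp add: \<theta>_def abs_mult abs_divide)
      also have "\<dots> \<le> G * (E * m * Cn) * (1 / \<delta>)"
      proof (intro mult_mono mult_left_mono nw_right_bound e)
        show "\<phi>F k 0 / \<bar>\<Delta> k\<bar> \<le> 1 / \<delta>"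
          using \<delta>(2)[OF False] \<delta>(1) Delta_nonzero[OF False] by (simp add: field_simps)
        show "0 \<le> G * (E * m * Cn)" "0 \<le> \<phi>F k 0 / \<bar>\<Delta> k\<bar>" "0 \<le> G"
          using G_pos mult_nonneg_nonneg[OF Em Cn_nonneg] F by simp_all
      qed simp_all
      finally show ?thesis by (simp add: H_def algebra_simps)
    qed
    have b1: "\<bar>tF k f g p\<bar> \<le> (CF + H) * E * m" if p: "p \<in> I" for p
    proof -
      have "\<bar>tF k f g p\<bar> \<le> \<bar>nF k f' g' p\<bar> + \<bar>\<theta> k f' g'\<bar> * \<phi>F k p"
        using fs_sign(2)[OF p, of k] abs_triangle_ineq[of "nF k f' g' p" "\<theta> k f' g' * \<phi>F k p"]
        by (simp add: tF_def f'_def g'_def abs_mult)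
      also have "\<dots> \<le> E * m * CF + \<bar>\<theta> k f' g'\<bar> * \<phi>F k 0"
        by (intro add_mono nF_bound e p mult_left_mono phiF_mono) auto
      finally show ?thesis using th by (simp add: algebra_simps)
    qed
    have b2: "\<bar>Tv k f g p\<bar> \<le> (Cw + H / c0) * E * m" if p: "p \<in> I" for p
    proof -
      have "\<bar>Tv k f g p\<bar> = real k * \<bar>nw k f' g' p + \<theta> k f' g' * \<phi> k p\<bar>"
        by (simp add: Tv_def tw_def f'_def g'_def abs_mult)
      also have "\<dots> \<le> real k * (\<bar>nw k f' g' p\<bar> + \<bar>\<theta> k f' g'\<bar> * \<phi> k p)"
        using fs_sign(1)[OF p, of k] abs_triangle_ineq[of "nw k f' g' p" "\<theta> k f' g' * \<phi> k p"]
        by (intro mult_left_mono) (auto simp: abs_mult)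
      also have "\<dots> = real k * \<bar>nw k f' g' p\<bar> + \<bar>\<theta> k f' g'\<bar> * (real k * \<phi> k p)" by (simp add: algebra_simps)
      also have "\<dots> \<le> E * m * Cw + \<bar>\<theta> k f' g'\<bar> * (\<phi>F k 0 / c0)"
        using phi_cone[OF p, of k] phiF_mono[OF p, of k] c0
        by (intro add_mono nw_bound e p mult_left_mono) (auto simp: field_simps)
      also have "\<dots> \<le> E * m * Cw + H * (E * m) / c0" using th c0 by (simp add: divide_right_mono)
      finally show ?thesis by (simp add: algebra_simps)
    qed
    have "(CF + H) * E * m \<le> K * m" "(Cw + H / c0) * E * m \<le> K * m"
      using H CF_nonneg Cw_nonneg c0 E(1) m by (auto simp: K_def intro!: mult_right_mono)
    then show "norm (tF k f g) \<le> K * m \<and> norm (Tv k f g) \<le> K * m"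
      using order_trans[OF b1] order_trans[OF b2] unfolding tF_def Tv_def tw_def
      by (intro conjI clinv_norm_le clinv_add clinv_scaleR clinv_n fs_clinv) blast+
  qed
qed

text \<open>By the equations, \<open>tF\<close> and \<open>Tv\<close> have derivatives of order k,
  so \<open>eb_Lip\<close> turns supremum bounds into Hoelder bounds. \<open>Tu\<close> also
  contains the datum itself, whose Hoelder regularity is passed on without gain.\<close>

lemma T_eb:
  obtains K where "0 \<le> K"
    "\<And>k f g a. eb \<alpha> k f a \<Longrightarrow> eb \<alpha> k g a \<Longrightarrow> eb \<alpha> k (Tu k f g) (K * a) \<and> eb \<alpha> k (Tv k f g) (K * a)"
    "\<And>k f g a. norm f \<le> a \<Longrightarrow> norm g \<le> a \<Longrightarrow> norm (Tu k f g) \<le> K * a \<and> norm (Tv k f g) \<le> K * a"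
proof -
  obtain E where E: "0 \<le> E" "\<And>k f g a. eb \<alpha> k f a \<Longrightarrow> eb \<alpha> k g a \<Longrightarrow> eb \<alpha> k (ef k f g) (E * a) \<and> eb \<alpha> k (eg k f g) (E * a)"
    "\<And>k f g a. norm f \<le> a \<Longrightarrow> norm g \<le> a \<Longrightarrow> norm (ef k f g) \<le> E * a \<and> norm (eg k f g) \<le> E * a"
    by (rule e_eb) (rule that)
  obtain T where T: "0 \<le> T" "\<And>k f g m. norm f \<le> m \<Longrightarrow> norm g \<le> m \<Longrightarrow> norm (tF k f g) \<le> T * m \<and> norm (Tv k f g) \<le> T * m"
    by (rule t_bounds) (rule that)
  obtain B where B: "eb \<alpha> 0 b B" using eb_fin by blast
  have B0: "0 \<le> B" "norm b \<le> B" using eb_nonneg[OF B] eb_D(1)[OF B] .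
  define L where "L = norm c * T + E"
  define K1 where "K1 = B * (T + L + E)"
  define K2 where "K2 = T + B * (T + E)"
  have nn: "0 \<le> L" "0 \<le> K1" "0 \<le> K2" using B0 T(1) E(1) by (simp_all add: L_def K1_def K2_def)
  have nu: "norm (Tu k f g) \<le> B * ((T + E) * a)" if "norm f \<le> a" "norm g \<le> a" for k f g a
  proof -
    have "norm (Tu k f g) \<le> norm b * norm (tF k f g + ef k f g)" unfolding Tu_def by (rule norm_bmul)
    also have "\<dots> \<le> B * (T * a + E * a)"
      using T(2)[OF that, of k] E(3)[OF that, of k] B0
      by (intro mult_mono norm_triangle_le add_mono) auto
    finally show ?thesis by (simp add: algebra_simps)
  qed
  show thesis
  proof
    show "0 \<le> K1 + K2" using nn by simp
    fix k :: nat and f g :: cfun and a :: real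
    show "norm (Tu k f g) \<le> (K1 + K2) * a \<and> norm (Tv k f g) \<le> (K1 + K2) * a" if "norm f \<le> a" "norm g \<le> a"
    proof -
      have a: "0 \<le> a" using order_trans[OF norm_ge_zero that(1)] .
      have "B * ((T + E) * a) \<le> (K1 + K2) * a" "T * a \<le> (K1 + K2) * a"
        using a B0 T(1) E(1) nn by (auto simp: K1_def K2_def intro!: mult_right_mono simp flip: mult.assoc)
      then show ?thesis using nu[OF that, of k] T(2)[OF that, of k] by (meson order_trans)
    qed
    assume eb: "eb \<alpha> k f a" "eb \<alpha> k g a"
    note n = eb_D(1)[OF eb(1)] eb_D(1)[OF eb(2)]
    have a: "0 \<le> a" using eb_nonneg[OF eb(1)] .
    have "eb \<alpha> k (tF k f g) ((T + L) * a)"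
    proof (rule eb_Lip[OF conjunct1[OF T(2)[OF n]] D_tF[unfolded D_def, rule_format]])
      show "\<bar>(real k *\<^sub>R (bmul c (Tv k f g) + eg k f g)) p\<bar> \<le> real k * (L * a)" for p
      proof -
        have "\<bar>(bmul c (Tv k f g) + eg k f g) p\<bar> \<le> norm (bmul c (Tv k f g) + eg k f g)" by (rule abs_apply_le)
        also have "\<dots> \<le> norm c * (T * a) + E * a"
          using T(2)[OF n, of k] E(3)[OF n, of k]
          by (intro norm_triangle_le add_mono order_trans[OF norm_bmul] mult_left_mono) auto
        finally have "\<bar>(bmul c (Tv k f g) + eg k f g) p\<bar> \<le> L * a" by (simp add: L_def algebra_simps)
        then have "real k * \<bar>(bmul c (Tv k f g) + eg k f g) p\<bar> \<le> real k * (L * a)" by (rule mult_left_mono) simp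
        then show ?thesis unfolding apply_bcontfun_scaleR real_scaleR_def abs_mult by simp
      qed
    qed (use a nn \<alpha> in \<open>auto simp: algebra_simps\<close>)
    then have "eb \<alpha> k (Tu k f g) (B * ((T + L) * a + E * a))"
      unfolding Tu_def by (intro eb_bmul[OF B] eb_add conjunct1[OF E(2)[OF eb]])
    then have 1: "eb \<alpha> k (Tu k f g) ((K1 + K2) * a)"
      by (rule eb_mono) (use a nn in \<open>auto simp: K1_def algebra_simps\<close>)
    have "eb \<alpha> k (Tv k f g) (K2 * a)"
    proof (rule eb_Lip[OF conjunct2[OF T(2)[OF n]], where B = "B * ((T + E) * a)"])
      show "(apply_bcontfun (Tv k f g) has_real_derivative (real k *\<^sub>R Tu k f g) p) (at p within I)" if "p \<in> I" for p
        using D_scaleR[OF D_tw, of "real k" k f g] that unfolding D_def Tv_def by blast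
      show "\<bar>(real k *\<^sub>R Tu k f g) p\<bar> \<le> real k * (B * ((T + E) * a))" for p
        using order_trans[OF abs_apply_le nu[OF n, of k], of p] by (auto simp: abs_mult intro: mult_left_mono)
    qed (use a B0 T(1) E(1) \<alpha> in \<open>auto simp: K2_def algebra_simps\<close>)
    then have 2: "eb \<alpha> k (Tv k f g) ((K1 + K2) * a)"
      by (rule eb_mono) (use a nn in \<open>auto intro: mult_right_mono\<close>)
    show "eb \<alpha> k (Tu k f g) ((K1 + K2) * a) \<and> eb \<alpha> k (Tv k f g) ((K1 + K2) * a)" using 1 2 by blast
  qed
qed

end

section \<open>The fixed point theorem\<close>

type_synonym unknowns = "wiener \<times> wiener \<times> wiener \<times> wiener \<times> wiener \<times> wiener"

definition hbX :: "real \<Rightarrow> unknowns \<Rightarrow> real \<Rightarrow> bool" where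
  "hbX \<alpha> x B \<longleftrightarrow> (case x of (x1, x2, x3, x4, x5, x6) \<Rightarrow>
     hb \<alpha> x1 B \<and> hb \<alpha> x2 B \<and> hb \<alpha> x3 B \<and> hb \<alpha> x4 B \<and> hb \<alpha> x5 B \<and> hb \<alpha> x6 B)"

text \<open>\<open>nc\<close> functions are a constant plus \<open>\<epsilon>\<close> times a tame function.  They are closed under the
  operations from which the fixed point problem is built, and a fixed point problem for an \<open>nc\<close> map
  is a contraction when \<open>\<epsilon>\<close> is small.\<close>

definition tame :: "real \<Rightarrow> (real \<Rightarrow> unknowns \<Rightarrow> wiener) \<Rightarrow> bool" where
  "tame \<alpha> f \<longleftrightarrow> (\<forall>B. \<exists>K\<ge>0. \<forall>\<epsilon> x y. \<epsilon> \<in> {0<..1} \<longrightarrow> hbX \<alpha> x B \<longrightarrow> hbX \<alpha> y B \<longrightarrow>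
     hb \<alpha> (f \<epsilon> x) K \<and> norm (f \<epsilon> x - f \<epsilon> y) \<le> K * norm (x - y))"

definition nc :: "real \<Rightarrow> (real \<Rightarrow> unknowns \<Rightarrow> wiener) \<Rightarrow> bool" where
  "nc \<alpha> f \<longleftrightarrow> (\<exists>c. (\<exists>K. hb \<alpha> c K) \<and> (\<forall>B. \<exists>K\<ge>0. \<forall>\<epsilon> x y. \<epsilon> \<in> {0<..1} \<longrightarrow> hbX \<alpha> x B \<longrightarrow> hbX \<alpha> y B \<longrightarrow>
     hb \<alpha> (f \<epsilon> x - c) (K * \<epsilon>) \<and> norm (f \<epsilon> x - f \<epsilon> y) \<le> K * \<epsilon> * norm (x - y)))"

lemma norm_fst_le': "norm (fst z) \<le> norm z" and norm_snd_le': "norm (snd z) \<le> norm z"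
  by (cases z; simp add: norm_fst_le norm_snd_le)+

lemma tame_proj:
  "tame \<alpha> (\<lambda>\<epsilon> x. fst x)" "tame \<alpha> (\<lambda>\<epsilon> x. fst (snd x))" "tame \<alpha> (\<lambda>\<epsilon> x. fst (snd (snd x)))"
  "tame \<alpha> (\<lambda>\<epsilon> x. fst (snd (snd (snd x))))" "tame \<alpha> (\<lambda>\<epsilon> x. fst (snd (snd (snd (snd x)))))"
  "tame \<alpha> (\<lambda>\<epsilon> x. snd (snd (snd (snd (snd x)))))"
proof -
  have *: "tame \<alpha> (\<lambda>\<epsilon> x. P x)"
    if hb: "\<And>x B. hbX \<alpha> x B \<Longrightarrow> hb \<alpha> (P x) B" and n: "\<And>z. norm (P z) \<le> norm z" and d: "\<And>x y. P x - P y = P (x - y)" for P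
    unfolding tame_def
  proof (intro allI exI[of _ "max 1 B" for B] conjI impI)
    fix B \<epsilon> :: real and x y :: unknowns assume x: "hbX \<alpha> x B"
    show "hb \<alpha> (P x) (max 1 B)" by (rule hb_mono[OF hb[OF x]]) simp
    have "1 * norm (x - y) \<le> max 1 B * norm (x - y)" by (intro mult_right_mono) auto
    then show "norm (P x - P y) \<le> max 1 B * norm (x - y)" using n[of "x - y"] by (simp add: d)
  qed simp
  show "tame \<alpha> (\<lambda>\<epsilon> x. fst x)" "tame \<alpha> (\<lambda>\<epsilon> x. fst (snd x))" "tame \<alpha> (\<lambda>\<epsilon> x. fst (snd (snd x)))"
  "tame \<alpha> (\<lambda>\<epsilon> x. fst (snd (snd (snd x))))" "tame \<alpha> (\<lambda>\<epsilon> x. fst (snd (snd (snd (snd x)))))"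
  "tame \<alpha> (\<lambda>\<epsilon> x. snd (snd (snd (snd (snd x)))))"
    by (rule *, simp add: hbX_def case_prod_unfold,
        (rule order_trans[OF norm_fst_le'] order_trans[OF norm_snd_le'] order_refl)+, simp)+
qed

lemma nc_const: "hb \<alpha> c K \<Longrightarrow> nc \<alpha> (\<lambda>_ _. c)"
  unfolding nc_def by (rule exI[of _ c], rule conjI, blast, rule allI, rule exI[of _ 0], simp)

lemma tameD:
  assumes "tame \<alpha> f"
  obtains K where "K \<ge> 0" "\<And>\<epsilon> x y. \<epsilon> \<in> {0<..1} \<Longrightarrow> hbX \<alpha> x B \<Longrightarrow> hbX \<alpha> y B \<Longrightarrow> hb \<alpha> (f \<epsilon> x) K"
    "\<And>\<epsilon> x y. \<epsilon> \<in> {0<..1} \<Longrightarrow> hbX \<alpha> x B \<Longrightarrow> hbX \<alpha> y B \<Longrightarrow> norm (f \<epsilon> x - f \<epsilon> y) \<le> K * norm (x - y)"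
  using assms unfolding tame_def by metis

lemma tameI:
  assumes "\<And>B. \<exists>K\<ge>0. \<forall>\<epsilon> x y. \<epsilon> \<in> {0<..1} \<longrightarrow> hbX \<alpha> x B \<longrightarrow> hbX \<alpha> y B \<longrightarrow>
     hb \<alpha> (f \<epsilon> x) K \<and> norm (f \<epsilon> x - f \<epsilon> y) \<le> K * norm (x - y)"
  shows "tame \<alpha> f"
  using assms unfolding tame_def by blast

lemma ncD:
  assumes "nc \<alpha> f"
  obtains c K0 where "hb \<alpha> c K0" "\<And>B. \<exists>K\<ge>0. \<forall>\<epsilon> x y. \<epsilon> \<in> {0<..1} \<longrightarrow> hbX \<alpha> x B \<longrightarrow> hbX \<alpha> y B \<longrightarrow>
    hb \<alpha> (f \<epsilon> x - c) (K * \<epsilon>) \<and> norm (f \<epsilon> x - f \<epsilon> y) \<le> K * \<epsilon> * norm (x - y)"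
  using assms unfolding nc_def by (elim exE conjE) (rule that, assumption, blast)

lemma ncI:
  assumes "hb \<alpha> c K0" "\<And>B. \<exists>K\<ge>0. \<forall>\<epsilon> x y. \<epsilon> \<in> {0<..1} \<longrightarrow> hbX \<alpha> x B \<longrightarrow> hbX \<alpha> y B \<longrightarrow>
    hb \<alpha> (f \<epsilon> x - c) (K * \<epsilon>) \<and> norm (f \<epsilon> x - f \<epsilon> y) \<le> K * \<epsilon> * norm (x - y)"
  shows "nc \<alpha> f"
  using assms unfolding nc_def by blast

lemma nc_tame:
  assumes "nc \<alpha> f"
  shows "tame \<alpha> f"
proof (rule tameI)
  fix B
  obtain c K0 where c: "hb \<alpha> c K0" and *: "\<And>B. \<exists>K\<ge>0. \<forall>\<epsilon> x y. \<epsilon> \<in> {0<..1} \<longrightarrow> hbX \<alpha> x B \<longrightarrow> hbX \<alpha> y B \<longrightarrow>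
     hb \<alpha> (f \<epsilon> x - c) (K * \<epsilon>) \<and> norm (f \<epsilon> x - f \<epsilon> y) \<le> K * \<epsilon> * norm (x - y)"
    by (rule ncD[OF assms]) (rule that)
  obtain K where K: "K \<ge> 0" and f: "\<And>\<epsilon> x y. \<epsilon> \<in> {0<..1} \<Longrightarrow> hbX \<alpha> x B \<Longrightarrow> hbX \<alpha> y B \<Longrightarrow>
     hb \<alpha> (f \<epsilon> x - c) (K * \<epsilon>) \<and> norm (f \<epsilon> x - f \<epsilon> y) \<le> K * \<epsilon> * norm (x - y)"
    using *[of B] by blast
  show "\<exists>K\<ge>0. \<forall>\<epsilon> x y. \<epsilon> \<in> {0<..1} \<longrightarrow> hbX \<alpha> x B \<longrightarrow> hbX \<alpha> y B \<longrightarrow>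
     hb \<alpha> (f \<epsilon> x) K \<and> norm (f \<epsilon> x - f \<epsilon> y) \<le> K * norm (x - y)"
  proof (intro exI[of _ "K + K0"] conjI allI impI)
    show "0 \<le> K + K0" using K hb_nonneg[OF c] by simp
    fix \<epsilon> :: real and x y assume e: "\<epsilon> \<in> {0<..1}" and xy: "hbX \<alpha> x B" "hbX \<alpha> y B"
    have Ke: "K * \<epsilon> \<le> K" using K e by (simp add: mult_left_le)
    have "hb \<alpha> ((f \<epsilon> x - c) + c) (K * \<epsilon> + K0)" by (intro hb_add c conjunct1[OF f[OF e xy]])
    then show "hb \<alpha> (f \<epsilon> x) (K + K0)" using Ke by (simp add: hb_mono)
    have "K * \<epsilon> * norm (x - y) \<le> (K + K0) * norm (x - y)"
      using Ke hb_nonneg[OF c] by (intro mult_right_mono) auto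
    then show "norm (f \<epsilon> x - f \<epsilon> y) \<le> (K + K0) * norm (x - y)" using f[OF e xy] by linarith
  qed
qed

lemma tame_add:
  assumes "tame \<alpha> f" "tame \<alpha> g"
  shows "tame \<alpha> (\<lambda>\<epsilon> x. f \<epsilon> x + g \<epsilon> x)"
proof (rule tameI)
  fix B
  obtain K where K: "K \<ge> 0" "\<And>\<epsilon> x y. \<epsilon> \<in> {0<..1} \<Longrightarrow> hbX \<alpha> x B \<Longrightarrow> hbX \<alpha> y B \<Longrightarrow> hb \<alpha> (f \<epsilon> x) K"
    "\<And>\<epsilon> x y. \<epsilon> \<in> {0<..1} \<Longrightarrow> hbX \<alpha> x B \<Longrightarrow> hbX \<alpha> y B \<Longrightarrow> norm (f \<epsilon> x - f \<epsilon> y) \<le> K * norm (x - y)"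
    by (rule tameD[OF assms(1)]) (rule that)
  obtain L where L: "L \<ge> 0" "\<And>\<epsilon> x y. \<epsilon> \<in> {0<..1} \<Longrightarrow> hbX \<alpha> x B \<Longrightarrow> hbX \<alpha> y B \<Longrightarrow> hb \<alpha> (g \<epsilon> x) L"
    "\<And>\<epsilon> x y. \<epsilon> \<in> {0<..1} \<Longrightarrow> hbX \<alpha> x B \<Longrightarrow> hbX \<alpha> y B \<Longrightarrow> norm (g \<epsilon> x - g \<epsilon> y) \<le> L * norm (x - y)"
    by (rule tameD[OF assms(2)]) (rule that)
  show "\<exists>K\<ge>0. \<forall>\<epsilon> x y. \<epsilon> \<in> {0<..1} \<longrightarrow> hbX \<alpha> x B \<longrightarrow> hbX \<alpha> y B \<longrightarrow>
     hb \<alpha> (f \<epsilon> x + g \<epsilon> x) K \<and> norm (f \<epsilon> x + g \<epsilon> x - (f \<epsilon> y + g \<epsilon> y)) \<le> K * norm (x - y)"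
  proof (intro exI[of _ "K + L"] conjI allI impI)
    fix \<epsilon> :: real and x y assume *: "\<epsilon> \<in> {0<..1}" "hbX \<alpha> x B" "hbX \<alpha> y B"
    show "hb \<alpha> (f \<epsilon> x + g \<epsilon> x) (K + L)" by (intro hb_add K(2)[OF *] L(2)[OF *])
    show "norm (f \<epsilon> x + g \<epsilon> x - (f \<epsilon> y + g \<epsilon> y)) \<le> (K + L) * norm (x - y)"
      using K(3)[OF *] L(3)[OF *] by (simp add: add_diff_add distrib_right norm_triangle_le)
  qed (use K L in simp)
qed

lemma nc_add:
  assumes "nc \<alpha> f" "nc \<alpha> g"
  shows "nc \<alpha> (\<lambda>\<epsilon> x. f \<epsilon> x + g \<epsilon> x)"
proof -
  obtain c K0 where c: "hb \<alpha> c K0" "\<And>B. \<exists>K\<ge>0. \<forall>\<epsilon> x y. \<epsilon> \<in> {0<..1} \<longrightarrow> hbX \<alpha> x B \<longrightarrow> hbX \<alpha> y B \<longrightarrow>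
    hb \<alpha> (f \<epsilon> x - c) (K * \<epsilon>) \<and> norm (f \<epsilon> x - f \<epsilon> y) \<le> K * \<epsilon> * norm (x - y)"
    by (rule ncD[OF assms(1)]) (rule that)
  obtain d L0 where d: "hb \<alpha> d L0" "\<And>B. \<exists>K\<ge>0. \<forall>\<epsilon> x y. \<epsilon> \<in> {0<..1} \<longrightarrow> hbX \<alpha> x B \<longrightarrow> hbX \<alpha> y B \<longrightarrow>
    hb \<alpha> (g \<epsilon> x - d) (K * \<epsilon>) \<and> norm (g \<epsilon> x - g \<epsilon> y) \<le> K * \<epsilon> * norm (x - y)"
    by (rule ncD[OF assms(2)]) (rule that)
  show ?thesis
  proof (rule ncI[OF hb_add[OF c(1) d(1)]])
    fix B
    obtain K where K: "K \<ge> 0" "\<And>\<epsilon> x y. \<epsilon> \<in> {0<..1} \<Longrightarrow> hbX \<alpha> x B \<Longrightarrow> hbX \<alpha> y B \<Longrightarrow> hb \<alpha> (f \<epsilon> x - c) (K * \<epsilon>)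
       \<and> norm (f \<epsilon> x - f \<epsilon> y) \<le> K * \<epsilon> * norm (x - y)" using c(2)[of B] by blast
    obtain L where L: "L \<ge> 0" "\<And>\<epsilon> x y. \<epsilon> \<in> {0<..1} \<Longrightarrow> hbX \<alpha> x B \<Longrightarrow> hbX \<alpha> y B \<Longrightarrow> hb \<alpha> (g \<epsilon> x - d) (L * \<epsilon>)
       \<and> norm (g \<epsilon> x - g \<epsilon> y) \<le> L * \<epsilon> * norm (x - y)" using d(2)[of B] by blast
    show "\<exists>K\<ge>0. \<forall>\<epsilon> x y. \<epsilon> \<in> {0<..1} \<longrightarrow> hbX \<alpha> x B \<longrightarrow> hbX \<alpha> y B \<longrightarrow>
      hb \<alpha> (f \<epsilon> x + g \<epsilon> x - (c + d)) (K * \<epsilon>) \<and> norm (f \<epsilon> x + g \<epsilon> x - (f \<epsilon> y + g \<epsilon> y)) \<le> K * \<epsilon> * norm (x - y)"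
    proof (intro exI[of _ "K + L"] conjI allI impI)
      fix \<epsilon> :: real and x y assume *: "\<epsilon> \<in> {0<..1}" "hbX \<alpha> x B" "hbX \<alpha> y B"
      show "hb \<alpha> (f \<epsilon> x + g \<epsilon> x - (c + d)) ((K + L) * \<epsilon>)"
        using hb_add[OF conjunct1[OF K(2)[OF *]] conjunct1[OF L(2)[OF *]]] by (simp add: add_diff_add distrib_right)
      show "norm (f \<epsilon> x + g \<epsilon> x - (f \<epsilon> y + g \<epsilon> y)) \<le> (K + L) * \<epsilon> * norm (x - y)"
        using K(2)[OF *] L(2)[OF *] by (simp add: add_diff_add distrib_right norm_triangle_le)
    qed (use K L in simp)
  qed
qed

lemma tame_hop:
  assumes "hop \<alpha> T" "tame \<alpha> f"
  shows "tame \<alpha> (\<lambda>\<epsilon> x. T (f \<epsilon> x))"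
proof (rule tameI)
  fix B
  obtain C where T: "bounded_linear T" "C \<ge> 0" "\<And>x K. hb \<alpha> x K \<Longrightarrow> hb \<alpha> (T x) (C * K)"
    using assms(1) unfolding hop_def by blast
  obtain N where N: "N \<ge> 0" "\<And>x. norm (T x) \<le> norm x * N" using bounded_linear.nonneg_bounded[OF T(1)] by blast
  obtain K where K: "K \<ge> 0" "\<And>\<epsilon> x y. \<epsilon> \<in> {0<..1} \<Longrightarrow> hbX \<alpha> x B \<Longrightarrow> hbX \<alpha> y B \<Longrightarrow> hb \<alpha> (f \<epsilon> x) K"
    "\<And>\<epsilon> x y. \<epsilon> \<in> {0<..1} \<Longrightarrow> hbX \<alpha> x B \<Longrightarrow> hbX \<alpha> y B \<Longrightarrow> norm (f \<epsilon> x - f \<epsilon> y) \<le> K * norm (x - y)"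
    by (rule tameD[OF assms(2)]) (rule that)
  show "\<exists>K\<ge>0. \<forall>\<epsilon> x y. \<epsilon> \<in> {0<..1} \<longrightarrow> hbX \<alpha> x B \<longrightarrow> hbX \<alpha> y B \<longrightarrow>
     hb \<alpha> (T (f \<epsilon> x)) K \<and> norm (T (f \<epsilon> x) - T (f \<epsilon> y)) \<le> K * norm (x - y)"
  proof (intro exI[of _ "C * K + N * K"] conjI allI impI)
    fix \<epsilon> :: real and x y assume *: "\<epsilon> \<in> {0<..1}" "hbX \<alpha> x B" "hbX \<alpha> y B"
    show "hb \<alpha> (T (f \<epsilon> x)) (C * K + N * K)" by (rule hb_mono[OF T(3)[OF K(2)[OF *]]]) (use N K in simp)
    have "norm (T (f \<epsilon> x) - T (f \<epsilon> y)) \<le> norm (f \<epsilon> x - f \<epsilon> y) * N"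
      using N(2)[of "f \<epsilon> x - f \<epsilon> y"] by (simp add: linear_diff[OF bounded_linear.linear[OF T(1)]])
    also have "\<dots> \<le> K * norm (x - y) * N" by (intro mult_right_mono K(3)[OF *] N)
    also have "\<dots> \<le> (C * K + N * K) * norm (x - y)" using T(2) K(1) by (simp add: algebra_simps)
    finally show "norm (T (f \<epsilon> x) - T (f \<epsilon> y)) \<le> (C * K + N * K) * norm (x - y)" .
  qed (use K N T in simp)
qed

lemma nc_hop:
  assumes "hop \<alpha> T" "nc \<alpha> f"
  shows "nc \<alpha> (\<lambda>\<epsilon> x. T (f \<epsilon> x))"
proof -
  obtain C where T: "bounded_linear T" "C \<ge> 0" "\<And>x K. hb \<alpha> x K \<Longrightarrow> hb \<alpha> (T x) (C * K)"
    using assms(1) unfolding hop_def by blast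
  note ld = linear_diff[OF bounded_linear.linear[OF T(1)]]
  obtain N where N: "N \<ge> 0" "\<And>x. norm (T x) \<le> norm x * N" using bounded_linear.nonneg_bounded[OF T(1)] by blast
  obtain c K0 where c: "hb \<alpha> c K0" "\<And>B. \<exists>K\<ge>0. \<forall>\<epsilon> x y. \<epsilon> \<in> {0<..1} \<longrightarrow> hbX \<alpha> x B \<longrightarrow> hbX \<alpha> y B \<longrightarrow>
    hb \<alpha> (f \<epsilon> x - c) (K * \<epsilon>) \<and> norm (f \<epsilon> x - f \<epsilon> y) \<le> K * \<epsilon> * norm (x - y)"
    by (rule ncD[OF assms(2)]) (rule that)
  show ?thesis
  proof (rule ncI[OF T(3)[OF c(1)]])
    fix B
    obtain K where K: "K \<ge> 0" "\<And>\<epsilon> x y. \<epsilon> \<in> {0<..1} \<Longrightarrow> hbX \<alpha> x B \<Longrightarrow> hbX \<alpha> y B \<Longrightarrow> hb \<alpha> (f \<epsilon> x - c) (K * \<epsilon>)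
       \<and> norm (f \<epsilon> x - f \<epsilon> y) \<le> K * \<epsilon> * norm (x - y)" using c(2)[of B] by blast
    show "\<exists>K\<ge>0. \<forall>\<epsilon> x y. \<epsilon> \<in> {0<..1} \<longrightarrow> hbX \<alpha> x B \<longrightarrow> hbX \<alpha> y B \<longrightarrow>
      hb \<alpha> (T (f \<epsilon> x) - T c) (K * \<epsilon>) \<and> norm (T (f \<epsilon> x) - T (f \<epsilon> y)) \<le> K * \<epsilon> * norm (x - y)"
    proof (intro exI[of _ "C * K + N * K"] conjI allI impI)
      fix \<epsilon> :: real and x y assume *: "\<epsilon> \<in> {0<..1}" "hbX \<alpha> x B" "hbX \<alpha> y B"
      have e: "0 \<le> \<epsilon>" using *(1) by simp
      have "hb \<alpha> (T (f \<epsilon> x - c)) (C * (K * \<epsilon>))" by (intro T(3) conjunct1[OF K(2)[OF *]])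
      then show "hb \<alpha> (T (f \<epsilon> x) - T c) ((C * K + N * K) * \<epsilon>)"
        unfolding ld by (rule hb_mono) (use N K e in \<open>simp add: algebra_simps\<close>)
      have "norm (T (f \<epsilon> x) - T (f \<epsilon> y)) \<le> norm (f \<epsilon> x - f \<epsilon> y) * N"
        using N(2)[of "f \<epsilon> x - f \<epsilon> y"] by (simp add: ld)
      also have "\<dots> \<le> K * \<epsilon> * norm (x - y) * N" using K(2)[OF *] N by (intro mult_right_mono) auto
      also have "\<dots> \<le> (C * K + N * K) * \<epsilon> * norm (x - y)" using T(2) K(1) e by (simp add: algebra_simps)
      finally show "norm (T (f \<epsilon> x) - T (f \<epsilon> y)) \<le> (C * K + N * K) * \<epsilon> * norm (x - y)" .
    qed (use K N T in simp)
  qed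
qed

lemma hop_scaleR: "hop \<alpha> (\<lambda>x. r *\<^sub>R x)"
  unfolding hop_def
  by (intro conjI bounded_linear_scaleR_right exI[of _ "\<bar>r\<bar>"]) (auto intro: hb_scaleR)

lemmas tame_scaleR = tame_hop[OF hop_scaleR] and nc_scaleR = nc_hop[OF hop_scaleR]

text \<open>The algebra property in \<open>hb\<close> gives boundedness. For the Lipschitz part the
  l1 norm is enough, because \<open>hb_norm\<close> bounds the factor that is not
  differenced.\<close>

lemma tame_prod:
  assumes "signs \<tau> \<sigma>" "tame \<alpha> f" "tame \<alpha> g"
  shows "tame \<alpha> (\<lambda>\<epsilon> x. sprod \<tau> \<sigma> (f \<epsilon> x) (g \<epsilon> x))"
proof (rule tameI)
  fix B
  interpret signs \<tau> \<sigma> by fact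
  note bb = bounded_bilinear.diff_left[OF bounded_bilinear_sprod] bounded_bilinear.diff_right[OF bounded_bilinear_sprod]
  obtain K where K: "K \<ge> 0" "\<And>\<epsilon> x y. \<epsilon> \<in> {0<..1} \<Longrightarrow> hbX \<alpha> x B \<Longrightarrow> hbX \<alpha> y B \<Longrightarrow> hb \<alpha> (f \<epsilon> x) K"
    "\<And>\<epsilon> x y. \<epsilon> \<in> {0<..1} \<Longrightarrow> hbX \<alpha> x B \<Longrightarrow> hbX \<alpha> y B \<Longrightarrow> norm (f \<epsilon> x - f \<epsilon> y) \<le> K * norm (x - y)"
    by (rule tameD[OF assms(2)]) (rule that)
  obtain L where L: "L \<ge> 0" "\<And>\<epsilon> x y. \<epsilon> \<in> {0<..1} \<Longrightarrow> hbX \<alpha> x B \<Longrightarrow> hbX \<alpha> y B \<Longrightarrow> hb \<alpha> (g \<epsilon> x) L"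
    "\<And>\<epsilon> x y. \<epsilon> \<in> {0<..1} \<Longrightarrow> hbX \<alpha> x B \<Longrightarrow> hbX \<alpha> y B \<Longrightarrow> norm (g \<epsilon> x - g \<epsilon> y) \<le> L * norm (x - y)"
    by (rule tameD[OF assms(3)]) (rule that)
  let ?p = "sprod \<tau> \<sigma>"
  show "\<exists>K\<ge>0. \<forall>\<epsilon> x y. \<epsilon> \<in> {0<..1} \<longrightarrow> hbX \<alpha> x B \<longrightarrow> hbX \<alpha> y B \<longrightarrow>
     hb \<alpha> (?p (f \<epsilon> x) (g \<epsilon> x)) K \<and> norm (?p (f \<epsilon> x) (g \<epsilon> x) - ?p (f \<epsilon> y) (g \<epsilon> y)) \<le> K * norm (x - y)"
  proof (intro exI[of _ "2 * (K * L)"] conjI allI impI)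
    fix \<epsilon> :: real and x y assume *: "\<epsilon> \<in> {0<..1}" "hbX \<alpha> x B" "hbX \<alpha> y B"
    note swap = *(1) *(3) *(2)
    show "hb \<alpha> (?p (f \<epsilon> x) (g \<epsilon> x)) (2 * (K * L))"
      by (rule hb_mono[OF hb_sprod[OF K(2)[OF *] L(2)[OF *]]]) (use K L in simp)
    have "?p (f \<epsilon> x) (g \<epsilon> x) - ?p (f \<epsilon> y) (g \<epsilon> y) = ?p (f \<epsilon> x - f \<epsilon> y) (g \<epsilon> x) + ?p (f \<epsilon> y) (g \<epsilon> x - g \<epsilon> y)"
      by (simp add: bb)
    also have "norm \<dots> \<le> norm (f \<epsilon> x - f \<epsilon> y) * norm (g \<epsilon> x) + norm (f \<epsilon> y) * norm (g \<epsilon> x - g \<epsilon> y)"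
      by (intro norm_triangle_le add_mono norm_sprod)
    also have "\<dots> \<le> (K * norm (x - y)) * L + K * (L * norm (x - y))"
      using K(1) L(1) by (intro add_mono mult_mono K(3)[OF *] L(3)[OF *] hb_norm[OF L(2)[OF *]] hb_norm[OF K(2)[OF swap]]) auto
    finally show "norm (?p (f \<epsilon> x) (g \<epsilon> x) - ?p (f \<epsilon> y) (g \<epsilon> y)) \<le> 2 * (K * L) * norm (x - y)"
      by (simp add: algebra_simps)
  qed (use K L in simp)
qed

lemma nc_prod:
  assumes "signs \<tau> \<sigma>" "nc \<alpha> f" "nc \<alpha> g"
  shows "nc \<alpha> (\<lambda>\<epsilon> x. sprod \<tau> \<sigma> (f \<epsilon> x) (g \<epsilon> x))"
proof -
  interpret signs \<tau> \<sigma> by fact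
  let ?p = "sprod \<tau> \<sigma>"
  note bb = bounded_bilinear.diff_left[OF bounded_bilinear_sprod] bounded_bilinear.diff_right[OF bounded_bilinear_sprod]
  obtain c K0 where c: "hb \<alpha> c K0" "\<And>B. \<exists>K\<ge>0. \<forall>\<epsilon> x y. \<epsilon> \<in> {0<..1} \<longrightarrow> hbX \<alpha> x B \<longrightarrow> hbX \<alpha> y B \<longrightarrow>
    hb \<alpha> (f \<epsilon> x - c) (K * \<epsilon>) \<and> norm (f \<epsilon> x - f \<epsilon> y) \<le> K * \<epsilon> * norm (x - y)"
    by (rule ncD[OF assms(2)]) (rule that)
  obtain d L0 where d: "hb \<alpha> d L0" "\<And>B. \<exists>K\<ge>0. \<forall>\<epsilon> x y. \<epsilon> \<in> {0<..1} \<longrightarrow> hbX \<alpha> x B \<longrightarrow> hbX \<alpha> y B \<longrightarrow>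
    hb \<alpha> (g \<epsilon> x - d) (K * \<epsilon>) \<and> norm (g \<epsilon> x - g \<epsilon> y) \<le> K * \<epsilon> * norm (x - y)"
    by (rule ncD[OF assms(3)]) (rule that)
  show ?thesis
  proof (rule ncI[OF hb_sprod[OF c(1) d(1)]])
    fix B
    obtain K where K: "K \<ge> 0" "\<And>\<epsilon> x y. \<epsilon> \<in> {0<..1} \<Longrightarrow> hbX \<alpha> x B \<Longrightarrow> hbX \<alpha> y B \<Longrightarrow> hb \<alpha> (f \<epsilon> x - c) (K * \<epsilon>)
       \<and> norm (f \<epsilon> x - f \<epsilon> y) \<le> K * \<epsilon> * norm (x - y)" using c(2)[of B] by blast
    obtain L where L: "L \<ge> 0" "\<And>\<epsilon> x y. \<epsilon> \<in> {0<..1} \<Longrightarrow> hbX \<alpha> x B \<Longrightarrow> hbX \<alpha> y B \<Longrightarrow> hb \<alpha> (g \<epsilon> x - d) (L * \<epsilon>)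
       \<and> norm (g \<epsilon> x - g \<epsilon> y) \<le> L * \<epsilon> * norm (x - y)" using d(2)[of B] by blast
    obtain Kt where Kt: "Kt \<ge> 0" "\<And>\<epsilon> x y. \<epsilon> \<in> {0<..1} \<Longrightarrow> hbX \<alpha> x B \<Longrightarrow> hbX \<alpha> y B \<Longrightarrow> hb \<alpha> (f \<epsilon> x) Kt"
      by (rule tameD[OF nc_tame[OF assms(2)]]) (rule that)
    obtain Lt where Lt: "Lt \<ge> 0" "\<And>\<epsilon> x y. \<epsilon> \<in> {0<..1} \<Longrightarrow> hbX \<alpha> x B \<Longrightarrow> hbX \<alpha> y B \<Longrightarrow> hb \<alpha> (g \<epsilon> x) Lt"
      by (rule tameD[OF nc_tame[OF assms(3)]]) (rule that)
    define M where "M = K * Lt + K0 * L + Kt * L"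
    show "\<exists>K\<ge>0. \<forall>\<epsilon> x y. \<epsilon> \<in> {0<..1} \<longrightarrow> hbX \<alpha> x B \<longrightarrow> hbX \<alpha> y B \<longrightarrow>
      hb \<alpha> (?p (f \<epsilon> x) (g \<epsilon> x) - ?p c d) (K * \<epsilon>) \<and> norm (?p (f \<epsilon> x) (g \<epsilon> x) - ?p (f \<epsilon> y) (g \<epsilon> y)) \<le> K * \<epsilon> * norm (x - y)"
    proof (intro exI[of _ M] conjI allI impI)
      note nn = K(1) L(1) Kt(1) Lt(1) hb_nonneg[OF c(1)]
      show "0 \<le> M" using nn by (simp add: M_def)
      fix \<epsilon> :: real and x y assume *: "\<epsilon> \<in> {0<..1}" "hbX \<alpha> x B" "hbX \<alpha> y B"
      note swap = *(1) *(3) *(2)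
      have e: "0 \<le> \<epsilon>" using *(1) by simp
      have "hb \<alpha> (?p (f \<epsilon> x - c) (g \<epsilon> x) + ?p c (g \<epsilon> x - d)) (K * \<epsilon> * Lt + K0 * (L * \<epsilon>))"
        by (intro hb_add hb_sprod c(1) conjunct1[OF K(2)[OF *]] conjunct1[OF L(2)[OF *]] Lt(2)[OF *])
      then have "hb \<alpha> (?p (f \<epsilon> x) (g \<epsilon> x) - ?p c d) (K * \<epsilon> * Lt + K0 * (L * \<epsilon>))" by (simp add: bb)
      then show "hb \<alpha> (?p (f \<epsilon> x) (g \<epsilon> x) - ?p c d) (M * \<epsilon>)"
        by (rule hb_mono) (use nn e in \<open>simp add: M_def algebra_simps\<close>)
      have "?p (f \<epsilon> x) (g \<epsilon> x) - ?p (f \<epsilon> y) (g \<epsilon> y) = ?p (f \<epsilon> x - f \<epsilon> y) (g \<epsilon> x) + ?p (f \<epsilon> y) (g \<epsilon> x - g \<epsilon> y)"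
        by (simp add: bb)
      also have "norm \<dots> \<le> norm (f \<epsilon> x - f \<epsilon> y) * norm (g \<epsilon> x) + norm (f \<epsilon> y) * norm (g \<epsilon> x - g \<epsilon> y)"
        by (intro norm_triangle_le add_mono norm_sprod)
      also have "\<dots> \<le> (K * \<epsilon> * norm (x - y)) * Lt + Kt * (L * \<epsilon> * norm (x - y))"
        using nn e by (intro add_mono mult_mono conjunct2[OF K(2)[OF *]] conjunct2[OF L(2)[OF *]]
            hb_norm[OF Lt(2)[OF *]] hb_norm[OF Kt(2)[OF swap]]) auto
      also have "\<dots> \<le> M * \<epsilon> * norm (x - y)" using nn e by (simp add: M_def algebra_simps)
      finally show "norm (?p (f \<epsilon> x) (g \<epsilon> x) - ?p (f \<epsilon> y) (g \<epsilon> y)) \<le> M * \<epsilon> * norm (x - y)" .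
    qed
  qed
qed

lemmas tame_products = tame_prod[OF signs_instances(1), folded cc_def] tame_prod[OF signs_instances(2), folded ss_def]
  tame_prod[OF signs_instances(3), folded cs_def]
lemmas nc_products = nc_prod[OF signs_instances(1), folded cc_def] nc_prod[OF signs_instances(2), folded ss_def]
  nc_prod[OF signs_instances(3), folded cs_def]

lemma nc_eps:
  assumes "tame \<alpha> f"
  shows "nc \<alpha> (\<lambda>\<epsilon> x. \<epsilon> *\<^sub>R f \<epsilon> x)"
proof (rule ncI[OF hb_zero])
  fix B
  obtain K where K: "K \<ge> 0" "\<And>\<epsilon> x y. \<epsilon> \<in> {0<..1} \<Longrightarrow> hbX \<alpha> x B \<Longrightarrow> hbX \<alpha> y B \<Longrightarrow> hb \<alpha> (f \<epsilon> x) K"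
    "\<And>\<epsilon> x y. \<epsilon> \<in> {0<..1} \<Longrightarrow> hbX \<alpha> x B \<Longrightarrow> hbX \<alpha> y B \<Longrightarrow> norm (f \<epsilon> x - f \<epsilon> y) \<le> K * norm (x - y)"
    by (rule tameD[OF assms]) (rule that)
  show "\<exists>K\<ge>0. \<forall>\<epsilon> x y. \<epsilon> \<in> {0<..1} \<longrightarrow> hbX \<alpha> x B \<longrightarrow> hbX \<alpha> y B \<longrightarrow>
    hb \<alpha> (\<epsilon> *\<^sub>R f \<epsilon> x - 0) (K * \<epsilon>) \<and> norm (\<epsilon> *\<^sub>R f \<epsilon> x - \<epsilon> *\<^sub>R f \<epsilon> y) \<le> K * \<epsilon> * norm (x - y)"
  proof (intro exI[of _ K] conjI allI impI)
    fix \<epsilon> :: real and x y assume *: "\<epsilon> \<in> {0<..1}" "hbX \<alpha> x B" "hbX \<alpha> y B"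
    show "hb \<alpha> (\<epsilon> *\<^sub>R f \<epsilon> x - 0) (K * \<epsilon>)"
      using hb_scaleR[OF K(2)[OF *], of \<epsilon>] *(1) by (simp add: mult.commute)
    have "norm (\<epsilon> *\<^sub>R f \<epsilon> x - \<epsilon> *\<^sub>R f \<epsilon> y) = \<epsilon> * norm (f \<epsilon> x - f \<epsilon> y)"
      using *(1) by (simp add: scaleR_diff_right[symmetric])
    also have "\<dots> \<le> \<epsilon> * (K * norm (x - y))" using *(1) by (intro mult_left_mono K(3)[OF *]) auto
    finally show "norm (\<epsilon> *\<^sub>R f \<epsilon> x - \<epsilon> *\<^sub>R f \<epsilon> y) \<le> K * \<epsilon> * norm (x - y)" by (simp add: algebra_simps)
  qed (rule K(1))
qed

lemma closed_hbX: "closed {x. hbX \<alpha> x B}"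
proof -
  have c: "closed {x. hb \<alpha> (P x) B}" if "continuous_on UNIV P" for P :: "unknowns \<Rightarrow> wiener"
    using closed_vimage[OF closed_hb that, of \<alpha> B] by (simp add: vimage_def)
  have "{x. hbX \<alpha> x B} = {x. hb \<alpha> (fst x) B} \<inter> {x. hb \<alpha> (fst (snd x)) B} \<inter> {x. hb \<alpha> (fst (snd (snd x))) B}
     \<inter> {x. hb \<alpha> (fst (snd (snd (snd x)))) B} \<inter> {x. hb \<alpha> (fst (snd (snd (snd (snd x))))) B}
     \<inter> {x. hb \<alpha> (snd (snd (snd (snd (snd x))))) B}"
    by (auto simp: hbX_def)
  also have "closed \<dots>" by (intro closed_Int c continuous_intros)
  finally show ?thesis .
qed

text \<open>Up to terms of order \<open>\<epsilon>\<close> the map is constant. A ball slightly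
  larger than the constants is invariant under it in the sense of \<open>hb\<close>, and on that
  ball its Lipschitz constant in the l1 norm is of order \<open>\<epsilon>\<close>.\<close>

lemma nc_fixed_point:
  assumes "nc \<alpha> f1" "nc \<alpha> f2" "nc \<alpha> f3" "nc \<alpha> f4" "nc \<alpha> f5" "nc \<alpha> f6"
  obtains B \<epsilon>0 where "0 < \<epsilon>0" "\<epsilon>0 \<le> 1"
    "\<And>\<epsilon>. 0 < \<epsilon> \<Longrightarrow> \<epsilon> \<le> \<epsilon>0 \<Longrightarrow> \<exists>x. hbX \<alpha> x B \<and> x = (f1 \<epsilon> x, f2 \<epsilon> x, f3 \<epsilon> x, f4 \<epsilon> x, f5 \<epsilon> x, f6 \<epsilon> x)"
proof -
  define fs where "fs = [f1, f2, f3, f4, f5, f6]"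
  have nc: "nc \<alpha> f" if "f \<in> set fs" for f using that assms by (auto simp: fs_def)
  have "\<forall>f\<in>set fs. \<exists>c K0. hb \<alpha> c K0 \<and> (\<forall>B. \<exists>K\<ge>0. \<forall>\<epsilon> x y. \<epsilon> \<in> {0<..1} \<longrightarrow> hbX \<alpha> x B \<longrightarrow> hbX \<alpha> y B \<longrightarrow>
    hb \<alpha> (f \<epsilon> x - c) (K * \<epsilon>) \<and> norm (f \<epsilon> x - f \<epsilon> y) \<le> K * \<epsilon> * norm (x - y))"
    by (rule ballI, rule ncD[OF nc], assumption) blast
  then obtain c K0 where c: "\<And>f. f \<in> set fs \<Longrightarrow> hb \<alpha> (c f) (K0 f)"
    and ex: "\<And>f B. f \<in> set fs \<Longrightarrow> \<exists>K\<ge>0. \<forall>\<epsilon> x y. \<epsilon> \<in> {0<..1} \<longrightarrow> hbX \<alpha> x B \<longrightarrow> hbX \<alpha> y B \<longrightarrow>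
    hb \<alpha> (f \<epsilon> x - c f) (K * \<epsilon>) \<and> norm (f \<epsilon> x - f \<epsilon> y) \<le> K * \<epsilon> * norm (x - y)" by metis
  \<comment> \<open>Exceeds the bound of each of the constants by at least 1, which leaves room for
    the perturbation. It must be fixed before the constants \<open>K\<close>, which depend on
    it.\<close>
  define B where "B = (\<Sum>f\<in>set fs. K0 f) + 1"
  have "\<forall>f\<in>set fs. \<exists>K. K\<ge>0 \<and> (\<forall>\<epsilon> x y. \<epsilon> \<in> {0<..1} \<longrightarrow> hbX \<alpha> x B \<longrightarrow> hbX \<alpha> y B \<longrightarrow>
    hb \<alpha> (f \<epsilon> x - c f) (K * \<epsilon>) \<and> norm (f \<epsilon> x - f \<epsilon> y) \<le> K * \<epsilon> * norm (x - y))" using ex by blast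
  then obtain K where K: "\<And>f. f \<in> set fs \<Longrightarrow> K f \<ge> 0"
    "\<And>f \<epsilon> x y. f \<in> set fs \<Longrightarrow> \<epsilon> \<in> {0<..1} \<Longrightarrow> hbX \<alpha> x B \<Longrightarrow> hbX \<alpha> y B \<Longrightarrow>
    hb \<alpha> (f \<epsilon> x - c f) (K f * \<epsilon>) \<and> norm (f \<epsilon> x - f \<epsilon> y) \<le> K f * \<epsilon> * norm (x - y)" by metis
  define S where "S = (\<Sum>f\<in>set fs. K f) + 1"
  have KS: "K f \<le> S" "K0 f + 1 \<le> B" if "f \<in> set fs" for f
    using member_le_sum[OF that, of K] member_le_sum[OF that, of K0] K(1) hb_nonneg[OF c]
    by (auto simp: S_def B_def)
  have S: "1 \<le> S" using sum_nonneg[of "set fs" K] K(1) by (simp add: S_def)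
  have B0: "0 \<le> B" using KS(2)[of f1] hb_nonneg[OF c, of f1] by (simp add: fs_def)
  show thesis
  proof
    \<comment> \<open>Each of the six components gets Lipschitz constant 1/12; together they
      contract by 1/2.\<close>
    show "0 < 1 / (12 * S)" "1 / (12 * S) \<le> 1" using S by auto
    fix \<epsilon> :: real assume \<epsilon>: "0 < \<epsilon>" "\<epsilon> \<le> 1 / (12 * S)"
    then have e1: "\<epsilon> \<in> {0<..1}" using \<open>1 / (12 * S) \<le> 1\<close> by simp
    have Se: "S * \<epsilon> \<le> 1 / 12" using \<epsilon> S by (simp add: field_simps)
    define F where "F x = (f1 \<epsilon> x, f2 \<epsilon> x, f3 \<epsilon> x, f4 \<epsilon> x, f5 \<epsilon> x, f6 \<epsilon> x)" for x
    have hbf: "hb \<alpha> (f \<epsilon> x) B" if f: "f \<in> set fs" and x: "hbX \<alpha> x B" for f x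
    proof -
      have "hb \<alpha> ((f \<epsilon> x - c f) + c f) (K f * \<epsilon> + K0 f)" by (intro hb_add c f conjunct1[OF K(2)[OF f e1 x x]])
      moreover have "K f * \<epsilon> \<le> S * \<epsilon>" using KS(1)[OF f] \<epsilon> by (intro mult_right_mono) auto
      ultimately show ?thesis using KS(2)[OF f] Se by (auto intro: hb_mono)
    qed
    have lip: "norm (f \<epsilon> x - f \<epsilon> y) \<le> 1/12 * norm (x - y)" if f: "f \<in> set fs" and x: "hbX \<alpha> x B" "hbX \<alpha> y B" for f x y
    proof -
      have "K f * \<epsilon> \<le> S * \<epsilon>" using KS(1)[OF f] \<epsilon> by (intro mult_right_mono) auto
      then have "K f * \<epsilon> * norm (x - y) \<le> 1/12 * norm (x - y)" using Se by (intro mult_right_mono) auto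
      then show ?thesis using K(2)[OF f e1 x] by linarith
    qed
    have "\<exists>!x\<in>{x. hbX \<alpha> x B}. F x = x"
    proof (rule Banach_fix[where c = "1/2"])
      show "complete {x. hbX \<alpha> x B}" by (simp add: complete_eq_closed closed_hbX)
      have "hbX \<alpha> (0, 0, 0, 0, 0, 0) B" using B0 by (auto simp: hbX_def intro: hb_mono[OF hb_zero])
      then show "{x. hbX \<alpha> x B} \<noteq> {}" by blast
      show "F ` {x. hbX \<alpha> x B} \<subseteq> {x. hbX \<alpha> x B}" using hbf by (auto simp: F_def hbX_def[of \<alpha> "(_, _)"] fs_def)
      fix x y assume "x \<in> {x. hbX \<alpha> x B}" "y \<in> {x. hbX \<alpha> x B}"
      then have xy: "hbX \<alpha> x B" "hbX \<alpha> y B" by auto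
      have "norm (F x - F y) \<le> norm (f1 \<epsilon> x - f1 \<epsilon> y) + (norm (f2 \<epsilon> x - f2 \<epsilon> y) + (norm (f3 \<epsilon> x - f3 \<epsilon> y)
         + (norm (f4 \<epsilon> x - f4 \<epsilon> y) + (norm (f5 \<epsilon> x - f5 \<epsilon> y) + norm (f6 \<epsilon> x - f6 \<epsilon> y)))))"
        unfolding F_def diff_Pair by (intro order_trans[OF norm_Pair_le] add_left_mono order_refl)
      also have "\<dots> \<le> 1/2 * norm (x - y)"
        using lip[OF _ xy, of f1] lip[OF _ xy, of f2] lip[OF _ xy, of f3] lip[OF _ xy, of f4] lip[OF _ xy, of f5] lip[OF _ xy, of f6]
        by (simp add: fs_def)
      finally show "dist (F x) (F y) \<le> 1/2 * dist x y" by (simp add: dist_norm)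
    qed auto
    then show "\<exists>x. hbX \<alpha> x B \<and> x = (f1 \<epsilon> x, f2 \<epsilon> x, f3 \<epsilon> x, f4 \<epsilon> x, f5 \<epsilon> x, f6 \<epsilon> x)"
      unfolding F_def by (metis mem_Collect_eq)
  qed
qed

section \<open>The linearised problem\<close>

definition lift :: "(nat \<Rightarrow> cfun \<Rightarrow> cfun) \<Rightarrow> wiener \<Rightarrow> wiener" where
  "lift L = modemap (\<lambda>i. i) (\<lambda>i. L (snd i))"

lemma hop_lift:
  assumes "\<And>k. linear (L k)" "0 \<le> C" "\<And>k e. norm (L k e) \<le> C * norm e" "\<And>k e c. eb \<alpha> k e c \<Longrightarrow> eb \<alpha> k (L k e) (C * c)"
  shows "hop \<alpha> (lift L)"
  unfolding lift_def by (rule hop_modemap) (use assms in auto)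

lemma coord_lift:
  assumes "\<And>k. linear (L k)" "\<And>k e. norm (L k e) \<le> C * norm e"
  shows "coord (lift L x) (n, k) = L k (coord x (n, k))"
proof -
  interpret modes "\<lambda>i. i" "\<lambda>i::nat \<times> nat. L (snd i)" C by (intro modes.intro assms)
  show ?thesis using coord_modemap[of x "(n, k)"] by (simp add: lift_def)
qed

lemma (in evaluation) ev_lift:
  assumes "\<And>k. linear (L k)" "\<And>k e. norm (L k e) \<le> C * norm e"
  shows "ev g t p (lift L x) = (\<Sum>\<^sub>\<infinity>(n, k). t ^ n * g k / 4 ^ k * L k (coord x (n, k)) p)"
  unfolding ev_def by (rule infsum_cong) (auto simp: coord_lift[OF assms])

lemma norm_const_bcontfun [simp]: "norm (const_bcontfun r :: cfun) = \<bar>r\<bar>"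
proof (rule antisym)
  show "norm (const_bcontfun r :: cfun) \<le> \<bar>r\<bar>" by (rule norm_bound) simp
  show "\<bar>r\<bar> \<le> norm (const_bcontfun r :: cfun)" using abs_apply_le[of "const_bcontfun r" 0] by simp
qed

lemma eb_const: "\<bar>r\<bar> \<le> c \<Longrightarrow> eb \<alpha> k (const_bcontfun r) c"
  by (rule eb_I[where B = 0]) auto

text \<open>The multiplier is read off the modes with k = 1 but must not depend on q or p. It is
  therefore stored as a constant at frequency 0, separately for every power of s.\<close>

definition moment :: "(cfun \<Rightarrow> real) \<Rightarrow> wiener \<Rightarrow> wiener" where
  "moment r = modemap (\<lambda>i. (fst i, 0)) (\<lambda>i e. const_bcontfun (if snd i = 1 then r e else 0))"

definition load :: "(cfun \<Rightarrow> real) \<Rightarrow> cfun \<Rightarrow> wiener \<Rightarrow> wiener" where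
  "load r d = lift (\<lambda>k e. (if k = 1 then r e else 0) *\<^sub>R d)"

locale bounded_functional =
  fixes r :: "cfun \<Rightarrow> real" and M :: real
  assumes lin: "linear r" and bd: "\<And>e. \<bar>r e\<bar> \<le> M * norm e" and M: "0 \<le> M"
begin

lemma modes_moment: "modes (\<lambda>(i :: nat \<times> nat) e. const_bcontfun (if snd i = 1 then r e else 0) :: cfun) M"
proof (rule modes.intro)
  show "linear (\<lambda>e. const_bcontfun (if snd i = 1 then r e else 0) :: cfun)" for i :: "nat \<times> nat"
    by (rule linearI; rule bcontfun_eqI) (auto simp: linear_add[OF lin] linear_scale[OF lin])
qed (use bd M in auto)

lemma hop_moment: "hop \<alpha> (moment r)"
  unfolding moment_def
proof (rule hop_modemap[where C = M])
  show "eb \<alpha> (snd (fst i, 0)) (const_bcontfun (if snd i = 1 then r e else 0)) (M * c)" if "eb \<alpha> (snd i) e c" for i e c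
  proof (rule eb_const)
    show "\<bar>if snd i = 1 then r e else 0\<bar> \<le> M * c"
      using order_trans[OF bd mult_left_mono[OF eb_D(1)[OF that] M]] eb_nonneg[OF that] M by auto
  qed
qed (use modes.lin[OF modes_moment] bd M in auto)

lemma load_lin: "linear (\<lambda>e. (if k = 1 then r e else 0) *\<^sub>R d)" for k :: nat and d :: cfun
  by (rule linearI) (auto simp: linear_add[OF lin] linear_scale[OF lin] algebra_simps)

lemma load_bd: "norm ((if k = 1 then r e else 0) *\<^sub>R d) \<le> M * norm d * norm e" for k :: nat and d :: cfun
  using mult_right_mono[OF bd[of e], of "norm d"] M by (auto simp: algebra_simps)

lemma hop_load:
  assumes d: "eb \<alpha> 0 d K"
  shows "hop \<alpha> (load r d)"
  unfolding load_def
proof (rule hop_lift[where C = "M * K"])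
  note K = eb_nonneg[OF d]
  show "0 \<le> M * K" using M K by simp
  show "norm ((if k = 1 then r e else 0) *\<^sub>R d) \<le> M * K * norm e" for k :: nat and e
    by (rule order_trans[OF load_bd]) (use eb_D(1)[OF d] M in \<open>auto intro!: mult_right_mono mult_left_mono\<close>)
  show "eb \<alpha> k ((if k = 1 then r e else 0) *\<^sub>R d) (M * K * c)" if "eb \<alpha> k e c" for k :: nat and e c
  proof (rule eb_mono[OF eb_scaleR[OF eb_weaken[OF d]]])
    have "\<bar>if k = 1 then r e else 0\<bar> \<le> M * c"
      using order_trans[OF bd mult_left_mono[OF eb_D(1)[OF that] M]] eb_nonneg[OF that] M by auto
    then show "\<bar>if k = 1 then r e else 0\<bar> * K \<le> M * K * c"
      using K by (metis mult.assoc mult.commute mult_right_mono)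
  qed
qed (rule load_lin)

lemma coord_load: "coord (load r d x) (n, k) = (if k = 1 then r (coord x (n, k)) else 0) *\<^sub>R d"
  unfolding load_def by (rule coord_lift[OF load_lin load_bd])

lemma ev_load:
  assumes "evaluation g t"
  shows "ev g t p (load r d x) = g 1 / 4 * d p * (\<Sum>\<^sub>\<infinity>(n, k). t ^ n * (if k = 1 then r (coord x (n, k)) else 0))"
  unfolding load_def evaluation.ev_lift[OF assms load_lin load_bd] infsum_cmult_right'[symmetric]
  by (rule infsum_cong) auto

lemma ec_moment:
  assumes "\<bar>t\<bar> \<le> 1"
  shows "ec t q p (moment r x) = (\<Sum>\<^sub>\<infinity>(n, k). t ^ n * (if k = 1 then r (coord x (n, k)) else 0))"
proof -
  interpret modes "\<lambda>i. (fst i, 0)" "\<lambda>(i :: nat \<times> nat) e. const_bcontfun (if snd i = 1 then r e else 0) :: cfun" M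
    by (rule modes_moment)
  interpret evaluation "\<lambda>k. cos (real k * q)" t by (rule evaluation_instances(1)[OF assms])
  show ?thesis
    unfolding moment_def ec_def eval_modemap[OF bounded_linear_ev]
    by (rule infsum_cong) (auto simp: ev_single)
qed

end

context modal_robin begin

definition TU where "TU x y = lift (\<lambda>k e. Tu k e 0) x + lift (\<lambda>k e. Tu k 0 e) y"
definition TV where "TV x y = lift (\<lambda>k e. Tv k e 0) x + lift (\<lambda>k e. Tv k 0 e) y"
definition TM where "TM x y = moment (\<lambda>e. \<mu> e 0) x + moment (\<lambda>e. \<mu> 0 e) y"
definition X1 where "X1 x y = load (\<lambda>e. \<mu> e 0) d1 x + load (\<lambda>e. \<mu> 0 e) d1 y"
definition X2 where "X2 x y = load (\<lambda>e. \<mu> e 0) d2 x + load (\<lambda>e. \<mu> 0 e) d2 y"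

lemma bounded_functional_mu:
  "bounded_functional (\<lambda>e. \<mu> e 0) (Cn / \<bar>nw 1 d1 d2 0\<bar>)" "bounded_functional (\<lambda>e. \<mu> 0 e) (Cn / \<bar>nw 1 d1 d2 0\<bar>)"
  using linear_mu(1)[of _ _ 0 0] linear_mu(2)[of _ _ 0] linear_mu(1)[of 0 0] linear_mu(2)[of _ 0]
    mu_bound[of _ _ 0] mu_bound[of 0] Cn_nonneg
  by (intro bounded_functional.intro linearI; force)+

lemma linear_T_args: "linear (\<lambda>e. Tu k e 0)" "linear (\<lambda>e. Tu k 0 e)" "linear (\<lambda>e. Tv k e 0)" "linear (\<lambda>e. Tv k 0 e)"
  using linear_T(1,3)[of k _ _ 0 0] linear_T(2,4)[of k _ _ 0] linear_T(1,3)[of k 0 0] linear_T(2,4)[of k _ 0]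
  by (auto intro!: linearI)

lemma T_args_bounds:
  obtains K where "0 \<le> K" "\<And>k e. norm (Tu k e 0) \<le> K * norm e" "\<And>k e. norm (Tu k 0 e) \<le> K * norm e"
    "\<And>k e. norm (Tv k e 0) \<le> K * norm e" "\<And>k e. norm (Tv k 0 e) \<le> K * norm e"
    "\<And>k e c. eb \<alpha> k e c \<Longrightarrow> eb \<alpha> k (Tu k e 0) (K * c)" "\<And>k e c. eb \<alpha> k e c \<Longrightarrow> eb \<alpha> k (Tu k 0 e) (K * c)"
    "\<And>k e c. eb \<alpha> k e c \<Longrightarrow> eb \<alpha> k (Tv k e 0) (K * c)" "\<And>k e c. eb \<alpha> k e c \<Longrightarrow> eb \<alpha> k (Tv k 0 e) (K * c)"
proof -
  obtain K where K: "0 \<le> K"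
    "\<And>k f g a. eb \<alpha> k f a \<Longrightarrow> eb \<alpha> k g a \<Longrightarrow> eb \<alpha> k (Tu k f g) (K * a) \<and> eb \<alpha> k (Tv k f g) (K * a)"
    "\<And>k f g a. norm f \<le> a \<Longrightarrow> norm g \<le> a \<Longrightarrow> norm (Tu k f g) \<le> K * a \<and> norm (Tv k f g) \<le> K * a"
    by (rule T_eb) (rule that)
  have e: "eb \<alpha> k (Tu k e 0) (K * c) \<and> eb \<alpha> k (Tv k e 0) (K * c)"
    "eb \<alpha> k (Tu k 0 e) (K * c) \<and> eb \<alpha> k (Tv k 0 e) (K * c)" if "eb \<alpha> k e c" for k e c
    using K(2)[OF that eb_zero] K(2)[OF eb_zero that] eb_nonneg[OF that] by blast+
  have n: "norm (Tu k e 0) \<le> K * norm e \<and> norm (Tv k e 0) \<le> K * norm e"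
    "norm (Tu k 0 e) \<le> K * norm e \<and> norm (Tv k 0 e) \<le> K * norm e" for k e
    using K(3)[of e "norm e" 0] K(3)[of 0 "norm e" e] by simp_all
  show thesis by (rule that[of K]) (use K(1) e n in blast)+
qed

lemma hop_T: "hop \<alpha> (lift (\<lambda>k e. Tu k e 0))" "hop \<alpha> (lift (\<lambda>k e. Tu k 0 e))"
  "hop \<alpha> (lift (\<lambda>k e. Tv k e 0))" "hop \<alpha> (lift (\<lambda>k e. Tv k 0 e))"
proof -
  obtain K where K: "0 \<le> K" "\<And>k e. norm (Tu k e 0) \<le> K * norm e" "\<And>k e. norm (Tu k 0 e) \<le> K * norm e"
    "\<And>k e. norm (Tv k e 0) \<le> K * norm e" "\<And>k e. norm (Tv k 0 e) \<le> K * norm e"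
    "\<And>k e c. eb \<alpha> k e c \<Longrightarrow> eb \<alpha> k (Tu k e 0) (K * c)" "\<And>k e c. eb \<alpha> k e c \<Longrightarrow> eb \<alpha> k (Tu k 0 e) (K * c)"
    "\<And>k e c. eb \<alpha> k e c \<Longrightarrow> eb \<alpha> k (Tv k e 0) (K * c)" "\<And>k e c. eb \<alpha> k e c \<Longrightarrow> eb \<alpha> k (Tv k 0 e) (K * c)"
    by (rule T_args_bounds) (rule that)
  show "hop \<alpha> (lift (\<lambda>k e. Tu k e 0))" by (rule hop_lift[OF linear_T_args(1) K(1,2,6)])
  show "hop \<alpha> (lift (\<lambda>k e. Tu k 0 e))" by (rule hop_lift[OF linear_T_args(2) K(1,3,7)])
  show "hop \<alpha> (lift (\<lambda>k e. Tv k e 0))" by (rule hop_lift[OF linear_T_args(3) K(1,4,8)])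
  show "hop \<alpha> (lift (\<lambda>k e. Tv k 0 e))" by (rule hop_lift[OF linear_T_args(4) K(1,5,9)])
qed

lemma nc_T:
  assumes "nc \<alpha> f" "nc \<alpha> g"
  shows "nc \<alpha> (\<lambda>\<epsilon> x. TU (f \<epsilon> x) (g \<epsilon> x))" "nc \<alpha> (\<lambda>\<epsilon> x. TV (f \<epsilon> x) (g \<epsilon> x))" "nc \<alpha> (\<lambda>\<epsilon> x. TM (f \<epsilon> x) (g \<epsilon> x))"
proof -
  note m = bounded_functional.hop_moment[OF bounded_functional_mu(1)] bounded_functional.hop_moment[OF bounded_functional_mu(2)]
  show "nc \<alpha> (\<lambda>\<epsilon> x. TU (f \<epsilon> x) (g \<epsilon> x))" unfolding TU_def
    by (rule nc_add[OF nc_hop[OF hop_T(1) assms(1)] nc_hop[OF hop_T(2) assms(2)]])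
  show "nc \<alpha> (\<lambda>\<epsilon> x. TV (f \<epsilon> x) (g \<epsilon> x))" unfolding TV_def
    by (rule nc_add[OF nc_hop[OF hop_T(3) assms(1)] nc_hop[OF hop_T(4) assms(2)]])
  show "nc \<alpha> (\<lambda>\<epsilon> x. TM (f \<epsilon> x) (g \<epsilon> x))" unfolding TM_def
    by (rule nc_add[OF nc_hop[OF m(1) assms(1)] nc_hop[OF m(2) assms(2)]])
qed

lemma coord_T: "coord (TU x y) (n, k) = Tu k (coord x (n, k)) (coord y (n, k))"
  "coord (TV x y) (n, k) = Tv k (coord x (n, k)) (coord y (n, k))"
proof -
  obtain K where K: "\<And>k e. norm (Tu k e 0) \<le> K * norm e" "\<And>k e. norm (Tu k 0 e) \<le> K * norm e"
    "\<And>k e. norm (Tv k e 0) \<le> K * norm e" "\<And>k e. norm (Tv k 0 e) \<le> K * norm e"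
    by (rule T_args_bounds) (blast intro: that)
  show "coord (TU x y) (n, k) = Tu k (coord x (n, k)) (coord y (n, k))"
    "coord (TV x y) (n, k) = Tv k (coord x (n, k)) (coord y (n, k))"
    unfolding TU_def TV_def coord_add
    unfolding coord_lift[OF linear_T_args(1) K(1)] coord_lift[OF linear_T_args(2) K(2)]
      coord_lift[OF linear_T_args(3) K(3)] coord_lift[OF linear_T_args(4) K(4)] linear_T[symmetric]
    by simp_all
qed

lemma coord_X: "ef k (coord x (n, k)) (coord y (n, k)) = coord (x + X1 x y) (n, k)"
  "eg k (coord x (n, k)) (coord y (n, k)) = coord (y + X2 x y) (n, k)"
  using linear_mu(1)[of "coord x (n, k)" 0 0 "coord y (n, k)"]
  by (auto simp: ef_def eg_def X1_def X2_def bounded_functional.coord_load[OF bounded_functional_mu(1)]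
      bounded_functional.coord_load[OF bounded_functional_mu(2)] scaleR_add_left)

text \<open>The same sum of multipliers occurs on both sides. In the loads it sits at frequency 1,
  whose weight is 4, and in \<open>TM\<close> at frequency 0 with weight 1; this is the origin of
  the quotient by 4.\<close>

lemma eval_X:
  assumes t: "\<bar>t\<bar> \<le> 1"
  shows "ec t q p (X1 x y) = cos q / 4 * d1 p * ec t 0 0 (TM x y)"
    "es t q p (X2 x y) = sin q / 4 * d2 p * ec t 0 0 (TM x y)"
    "ec t q p (TM x y) = ec t 0 0 (TM x y)"
proof -
  note ev_add = evaluation.ev_add[OF evaluation_instances(1)[OF t]] evaluation.ev_add[OF evaluation_instances(2)[OF t]]
  note l = bounded_functional.ev_load[OF bounded_functional_mu(1) evaluation_instances(1)[OF t]]
    bounded_functional.ev_load[OF bounded_functional_mu(2) evaluation_instances(1)[OF t]]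
    bounded_functional.ev_load[OF bounded_functional_mu(1) evaluation_instances(2)[OF t]]
    bounded_functional.ev_load[OF bounded_functional_mu(2) evaluation_instances(2)[OF t]]
  note m = bounded_functional.ec_moment[OF bounded_functional_mu(1) t] bounded_functional.ec_moment[OF bounded_functional_mu(2) t]
  have TM: "ec t q p (TM x y) = (\<Sum>\<^sub>\<infinity>(n, k). t ^ n * (if k = 1 then \<mu> (coord x (n, k)) 0 else 0))
     + (\<Sum>\<^sub>\<infinity>(n, k). t ^ n * (if k = 1 then \<mu> 0 (coord y (n, k)) else 0))" for q p
    unfolding TM_def using m by (simp add: ec_def ev_add)
  show "ec t q p (TM x y) = ec t 0 0 (TM x y)" by (simp add: TM)
  show "ec t q p (X1 x y) = cos q / 4 * d1 p * ec t 0 0 (TM x y)"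
    unfolding TM unfolding X1_def ec_def ev_add l by (simp add: distrib_left)
  show "es t q p (X2 x y) = sin q / 4 * d2 p * ec t 0 0 (TM x y)"
    unfolding TM unfolding X2_def es_def ev_add l by (simp add: distrib_left)
qed

lemma nc_X:
  assumes "nc \<alpha> f" "nc \<alpha> g"
  shows "nc \<alpha> (\<lambda>\<epsilon> x. X1 (f \<epsilon> x) (g \<epsilon> x))" "nc \<alpha> (\<lambda>\<epsilon> x. X2 (f \<epsilon> x) (g \<epsilon> x))"
proof -
  obtain K1 K2 where K: "eb \<alpha> 0 d1 K1" "eb \<alpha> 0 d2 K2" using eb_fin by blast
  note h = bounded_functional.hop_load[OF bounded_functional_mu(1)] bounded_functional.hop_load[OF bounded_functional_mu(2)]
  show "nc \<alpha> (\<lambda>\<epsilon> x. X1 (f \<epsilon> x) (g \<epsilon> x))" "nc \<alpha> (\<lambda>\<epsilon> x. X2 (f \<epsilon> x) (g \<epsilon> x))"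
    unfolding X1_def X2_def
    by (rule nc_add[OF nc_hop[OF h(1)[OF K(1)] assms(1)] nc_hop[OF h(2)[OF K(1)] assms(2)]],
        rule nc_add[OF nc_hop[OF h(1)[OF K(2)] assms(1)] nc_hop[OF h(2)[OF K(2)] assms(2)]])
qed

text \<open>The linearised problem, mode by mode and in integrated form.\<close>

definition Leq :: "wiener \<Rightarrow> wiener \<Rightarrow> wiener \<Rightarrow> wiener \<Rightarrow> bool" where
  "Leq x y U V \<longleftrightarrow> (\<forall>n k. \<forall>p\<in>I. coord V (n, k) p = real k * IL (coord U (n, k)) p \<and>
     coord U (n, k) p = b p * (coord x (n, k) p + G * IL (coord U (n, k)) 0
       - real k * IR (bmul c (coord V (n, k)) + coord y (n, k)) p))"

lemma Leq_T: "Leq (x + X1 x y) (y + X2 x y) (TU x y) (TV x y)"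
  unfolding Leq_def coord_T coord_X[symmetric] by (intro allI ballI conjI T_equation)

lemma LeqD:
  assumes "Leq x y U V" "p \<in> I"
  shows "coord V (n, k) p = real k * IL (coord U (n, k)) p"
    "coord U (n, k) p = b p * (coord x (n, k) p + G * IL (coord U (n, k)) 0
       - real k * IR (bmul c (coord V (n, k)) + coord y (n, k)) p)"
  using assms unfolding Leq_def by blast+

lemma Leq_add:
  assumes "Leq x y U V" "Leq x' y' U' V'"
  shows "Leq (x + x') (y + y') (U + U') (V + V')"
  unfolding Leq_def
proof (intro allI ballI)
  fix n k p assume p: "p \<in> I"
  show "coord (V + V') (n, k) p = real k * IL (coord (U + U') (n, k)) p \<and>
     coord (U + U') (n, k) p = b p * (coord (x + x') (n, k) p + G * IL (coord (U + U') (n, k)) 0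
       - real k * IR (bmul c (coord (V + V') (n, k)) + coord (y + y') (n, k)) p)"
    unfolding coord_add apply_bcontfun_add linear_add[OF linear_IL] linear_add[OF linear_IR]
      bounded_bilinear.add_right[OF bounded_bilinear_bmul]
    using LeqD[OF assms(1) p, of n k] LeqD[OF assms(2) p, of n k]
    unfolding linear_add[OF linear_IR] apply_bcontfun_add by (simp only:) (simp add: algebra_simps)
qed

lemma Leq_scaleR:
  assumes "Leq x y U V"
  shows "Leq (r *\<^sub>R x) (r *\<^sub>R y) (r *\<^sub>R U) (r *\<^sub>R V)"
  unfolding Leq_def
proof (intro allI ballI)
  fix n k p assume p: "p \<in> I"
  show "coord (r *\<^sub>R V) (n, k) p = real k * IL (coord (r *\<^sub>R U) (n, k)) p \<and>
     coord (r *\<^sub>R U) (n, k) p = b p * (coord (r *\<^sub>R x) (n, k) p + G * IL (coord (r *\<^sub>R U) (n, k)) 0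
       - real k * IR (bmul c (coord (r *\<^sub>R V) (n, k)) + coord (r *\<^sub>R y) (n, k)) p)"
    unfolding coord_scaleR apply_bcontfun_scaleR linear_scale[OF linear_IL]
      bounded_bilinear.scaleR_right[OF bounded_bilinear_bmul] scaleR_add_right[symmetric] linear_scale[OF linear_IR]
    using LeqD[OF assms p, of n k] by (simp only: real_scaleR_def) (simp add: algebra_simps)
qed

lemma Leq_shift:
  assumes "Leq x y U V"
  shows "Leq (shift x) (shift y) (shift U) (shift V)"
  unfolding Leq_def
proof (intro allI ballI)
  fix n k p assume "p \<in> I"
  have "IL 0 p = 0" "IL 0 0 = 0" "IR 0 p = 0" "bmul c 0 = 0"
    by (simp_all add: linear_0[OF linear_IL] linear_0[OF linear_IR] bounded_bilinear.zero_right[OF bounded_bilinear_bmul])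
  then show "coord (shift V) (n, k) p = real k * IL (coord (shift U) (n, k)) p \<and>
     coord (shift U) (n, k) p = b p * (coord (shift x) (n, k) p + G * IL (coord (shift U) (n, k)) 0
       - real k * IR (bmul c (coord (shift V) (n, k)) + coord (shift y) (n, k)) p)"
    using assms[unfolded Leq_def, rule_format, OF \<open>p \<in> I\<close>] by (cases n) auto
qed

text \<open>Resonance makes \<open>\<phi> 1\<close> a solution of the homogeneous Robin problem. At
  power 0 of s it provides the leading terms of the wave.\<close>

lemma Leq_kernel: "Leq 0 0 (single (0, 1) (r *\<^sub>R bmul b (\<phi>F 1))) (single (0, 1) (r *\<^sub>R \<phi> 1))"
proof -
  have z: "IL 0 p = 0" "IR 0 p = 0" "bmul c 0 = 0" for p
    by (simp_all add: linear_0[OF linear_IL] linear_0[OF linear_IR] bounded_bilinear.zero_right[OF bounded_bilinear_bmul])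
  have 1: "IL (bmul b (\<phi>F 1)) p = \<phi> 1 p" if "p \<in> I" for p
    by (rule D_unique[OF D_IL fs_D(1) _ that]) simp
  have 2: "\<phi>F 1 p = G * \<phi> 1 0 - IR (bmul c (\<phi> 1)) p" if "p \<in> I" for p
  proof -
    have "D (\<phi>F 1 + IR (bmul c (\<phi> 1))) 0"
      using D_add[OF fs_D(2)[of 1] D_IR[of "bmul c (\<phi> 1)"]] by (rule D_cong) simp
    from D_zero_const[OF this that, of 0] show ?thesis by (simp add: resonance[unfolded One_nat_def])
  qed
  show ?thesis
    unfolding Leq_def
  proof (intro allI ballI)
    fix n k :: nat and p :: real assume p: "p \<in> I"
    show "coord (single (0, 1) (r *\<^sub>R \<phi> 1)) (n, k) p = real k * IL (coord (single (0, 1) (r *\<^sub>R bmul b (\<phi>F 1))) (n, k)) p \<and>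
      coord (single (0, 1) (r *\<^sub>R bmul b (\<phi>F 1))) (n, k) p = b p * (apply_bcontfun (coord 0 (n, k)) p
        + G * IL (coord (single (0, 1) (r *\<^sub>R bmul b (\<phi>F 1))) (n, k)) 0
        - real k * IR (bmul c (coord (single (0, 1) (r *\<^sub>R \<phi> 1)) (n, k)) + coord 0 (n, k)) p)"
    proof (cases "(n, k) = (0, 1)")
      case True
      have "IL (bmul b (\<phi>F 1)) 0 = \<phi> 1 0" by (rule 1) simp
      then show ?thesis using True 1[OF p] 2[OF p]
        by (simp add: z linear_scale[OF linear_IL] linear_scale[OF linear_IR]
            bounded_bilinear.scaleR_right[OF bounded_bilinear_bmul] right_diff_distrib mult.left_commute)
    next
      case False
      then show ?thesis by (auto simp: coord_single z)
    qed
  qed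
qed

end

section \<open>Evaluation and regularity of the series\<close>

text \<open>A general sequence \<open>\<gamma>\<close> stands in place of the powers of s, and
  general functionals \<open>a k\<close> in place of point values. One estimate,
  \<open>S_bound\<close>, then covers values, derivatives and Taylor remainders, in s as well as in
  q and p.\<close>

definition S :: "(nat \<Rightarrow> real) \<Rightarrow> (nat \<Rightarrow> cfun \<Rightarrow> real) \<Rightarrow> wiener \<Rightarrow> real" where
  "S \<gamma> a X = (\<Sum>\<^sub>\<infinity>(n, k). \<gamma> n * a k (coord X (n, k)))"

definition controlled :: "real \<Rightarrow> real \<Rightarrow> (nat \<Rightarrow> cfun \<Rightarrow> real) \<Rightarrow> bool" where
  "controlled \<alpha> R a \<longleftrightarrow> 0 \<le> R \<and> (\<forall>k e c. eb \<alpha> k e c \<longrightarrow> \<bar>a k e\<bar> \<le> R * c)"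

lemma S_bound:
  assumes a: "controlled \<alpha> R a" and \<gamma>: "\<And>n. \<bar>\<gamma> n\<bar> \<le> N" and X: "hb \<alpha> X K"
  shows "(\<lambda>(n, k). \<gamma> n * a k (coord X (n, k))) summable_on UNIV" "\<bar>S \<gamma> a X\<bar> \<le> N * R * K"
proof -
  obtain c where c: "\<And>i. eb \<alpha> (snd i) (coord X i) (c i)" "c summable_on UNIV" "infsum c UNIV \<le> K"
    using hb_D[OF X] by metis
  have N: "0 \<le> N" using order_trans[OF abs_ge_zero \<gamma>[of 0]] .
  have R: "0 \<le> R" using a by (simp add: controlled_def)
  have le: "norm (case i of (n, k) \<Rightarrow> \<gamma> n * a k (coord X (n, k))) \<le> N * R * c i" for i
  proof (cases i)
    case (Pair n k)
    have "\<bar>\<gamma> n\<bar> * \<bar>a k (coord X (n, k))\<bar> \<le> N * (R * c (n, k))"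
      using a c(1)[of "(n, k)"] N by (intro mult_mono \<gamma>) (auto simp: controlled_def)
    then show ?thesis by (simp add: Pair abs_mult mult.assoc)
  qed
  have s: "(\<lambda>i. norm (case i of (n, k) \<Rightarrow> \<gamma> n * a k (coord X (n, k)))) summable_on UNIV"
    by (rule summable_on_comparison_test[OF summable_on_cmult_right[OF c(2), of "N * R"]]) (use le in auto)
  then show "(\<lambda>(n, k). \<gamma> n * a k (coord X (n, k))) summable_on UNIV" by (rule abs_summable_summable)
  have "\<bar>S \<gamma> a X\<bar> \<le> (\<Sum>\<^sub>\<infinity>i. norm (case i of (n, k) \<Rightarrow> \<gamma> n * a k (coord X (n, k))))"
    unfolding S_def real_norm_def[symmetric] by (rule norm_infsum_bound[OF s])
  also have "\<dots> \<le> (\<Sum>\<^sub>\<infinity>i. N * R * c i)"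
    by (rule infsum_mono[OF s summable_on_cmult_right[OF c(2)]]) (rule le)
  also have "\<dots> = N * R * infsum c UNIV" by (rule infsum_cmult_right')
  also have "\<dots> \<le> N * R * K" using N R by (intro mult_left_mono c(3)) auto
  finally show "\<bar>S \<gamma> a X\<bar> \<le> N * R * K" .
qed

lemma controlled_diff: "controlled \<alpha> R a \<Longrightarrow> controlled \<alpha> Q b \<Longrightarrow> controlled \<alpha> (R + Q) (\<lambda>k e. a k e - b k e)"
  unfolding controlled_def by (auto simp: distrib_right intro!: order_trans[OF abs_triangle_ineq4] add_mono)

lemma controlled_cmult: "controlled \<alpha> R a \<Longrightarrow> controlled \<alpha> (\<bar>r\<bar> * R) (\<lambda>k e. r * a k e)"
  unfolding controlled_def by (auto simp: abs_mult mult.assoc intro!: mult_left_mono)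

lemma S_diff:
  assumes "controlled \<alpha> R a" "controlled \<alpha> Q b" "\<And>n. \<bar>\<gamma> n\<bar> \<le> N" "hb \<alpha> X K"
  shows "S \<gamma> (\<lambda>k e. a k e - b k e) X = S \<gamma> a X - S \<gamma> b X"
proof -
  note s = S_bound(1)[OF assms(1,3,4)] and s' = summable_on_uminus[THEN iffD2, OF S_bound(1)[OF assms(2,3,4)]]
  show ?thesis
    unfolding S_def diff_conv_add_uminus infsum_uminus[symmetric] infsum_add[OF s s', symmetric]
    by (rule infsum_cong) (auto simp: algebra_simps)
qed

lemma S_cmult: "S \<gamma> (\<lambda>k e. r * a k e) X = r * S \<gamma> a X"
  unfolding S_def infsum_cmult_right'[symmetric] by (rule infsum_cong) (auto simp: algebra_simps)

lemma S_gamma_cmult: "S (\<lambda>n. r * \<gamma> n) a X = r * S \<gamma> a X"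
  unfolding S_def infsum_cmult_right'[symmetric] by (rule infsum_cong) (auto simp: algebra_simps)

lemma S_gamma_diff:
  assumes "controlled \<alpha> R a" "\<And>n. \<bar>\<gamma> n\<bar> \<le> N" "\<And>n. \<bar>\<gamma>' n\<bar> \<le> N'" "hb \<alpha> X K"
  shows "S (\<lambda>n. \<gamma> n - \<gamma>' n) a X = S \<gamma> a X - S \<gamma>' a X"
proof -
  note s = S_bound(1)[OF assms(1,2,4)] and s' = summable_on_uminus[THEN iffD2, OF S_bound(1)[OF assms(1,3,4)]]
  show ?thesis
    unfolding S_def diff_conv_add_uminus infsum_uminus[symmetric] infsum_add[OF s s', symmetric]
    by (rule infsum_cong) (auto simp: algebra_simps)
qed

text \<open>With X as the series of a p-derivative, \<open>A0\<close> gives the function vanishing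
  at the bottom and \<open>A1\<close>, \<open>A2\<close> its derivatives in q and p.
  \<open>A3\<close> gives a sine series, \<open>A4\<close> its q-derivative, and \<open>A5\<close>
  the integral of \<open>A4\<close> from p to the surface.\<close>

definition A0 where "A0 q p k e = cos (real k * q) / 4 ^ k * apply_bcontfun (IL e) p"
definition A1 where "A1 q p k e = - (real k * sin (real k * q) / 4 ^ k * apply_bcontfun (IL e) p)"
definition A2 where "A2 q p k e = cos (real k * q) / 4 ^ k * apply_bcontfun e p"
definition A3 where "A3 q p k e = sin (real k * q) / 4 ^ k * apply_bcontfun e p"
definition A4 where "A4 q p k e = real k * cos (real k * q) / 4 ^ k * apply_bcontfun e p"
definition A5 where "A5 q p k e = real k * cos (real k * q) / 4 ^ k * apply_bcontfun (IR e) p"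

lemma quadratic_Taylor:
  fixes f :: "real \<Rightarrow> real"
  assumes d: "\<And>x. (f has_real_derivative f' x) (at x)"
    and L: "\<And>x y. x \<in> C \<Longrightarrow> y \<in> C \<Longrightarrow> \<bar>f' x - f' y\<bar> \<le> L * \<bar>x - y\<bar>"
    and C: "is_interval C" "x \<in> C" "y \<in> C" and L0: "0 \<le> L"
  shows "\<bar>f y - f x - f' x * (y - x)\<bar> \<le> L * (y - x)\<^sup>2"
proof -
  have "\<exists>z\<in>C. \<bar>z - x\<bar> \<le> \<bar>y - x\<bar> \<and> f y - f x = f' z * (y - x)"
  proof (cases x y rule: linorder_cases)
    case less
    from MVT2[OF less d] obtain z where z: "x < z" "z < y" "f y - f x = (y - x) * f' z" by blast
    then have "z \<in> C" using mem_is_interval_1_I[OF C] by simp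
    then show ?thesis using z by (intro bexI[of _ z]) auto
  next
    case greater
    from MVT2[OF greater d] obtain z where z: "y < z" "z < x" "f x - f y = (x - y) * f' z" by blast
    then have "z \<in> C" using mem_is_interval_1_I[OF C(1,3,2)] by simp
    then show ?thesis using z by (intro bexI[of _ z]) (auto simp: algebra_simps)
  qed (use C in auto)
  then obtain z where z: "z \<in> C" "\<bar>z - x\<bar> \<le> \<bar>y - x\<bar>" "f y - f x = f' z * (y - x)" by blast
  have "\<bar>f y - f x - f' x * (y - x)\<bar> = \<bar>f' z - f' x\<bar> * \<bar>y - x\<bar>"
    unfolding z(3) abs_mult[symmetric] by (simp add: algebra_simps)
  also have "\<dots> \<le> L * \<bar>y - x\<bar> * \<bar>y - x\<bar>"
    by (intro mult_right_mono order_trans[OF L] mult_left_mono z L0 C) auto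
  finally show ?thesis by (simp add: power2_eq_square abs_mult[symmetric])
qed

lemma trig_Lip: "\<bar>cos (k * x) - cos (k * y)\<bar> \<le> \<bar>k\<bar> * \<bar>x - y\<bar>" "\<bar>sin (k * x) - sin (k * y)\<bar> \<le> \<bar>k\<bar> * \<bar>x - y\<bar>"
  for k x y :: real
proof -
  have *: "\<bar>f u - f v\<bar> \<le> \<bar>u - v\<bar>" if "\<And>x. (f has_real_derivative f' x) (at x)" "\<And>x. \<bar>f' x\<bar> \<le> 1" for f f' :: "real \<Rightarrow> real" and u v
    using field_differentiable_bound[of UNIV f f' 1 u v] that by simp
  have "\<bar>cos (k * x) - cos (k * y)\<bar> \<le> \<bar>k * x - k * y\<bar>" by (rule *[of cos "\<lambda>x. - sin x"]) (auto intro: DERIV_cos)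
  moreover have "\<bar>sin (k * x) - sin (k * y)\<bar> \<le> \<bar>k * x - k * y\<bar>" by (rule *[of sin cos]) (auto intro: DERIV_sin)
  ultimately show "\<bar>cos (k * x) - cos (k * y)\<bar> \<le> \<bar>k\<bar> * \<bar>x - y\<bar>" "\<bar>sin (k * x) - sin (k * y)\<bar> \<le> \<bar>k\<bar> * \<bar>x - y\<bar>"
    by (simp_all add: right_diff_distrib[symmetric] abs_mult)
qed

lemma trig_Taylor:
  "\<bar>cos (k * y) - cos (k * x) + k * sin (k * x) * (y - x)\<bar> \<le> k\<^sup>2 * (y - x)\<^sup>2"
  "\<bar>sin (k * y) - sin (k * x) - k * cos (k * x) * (y - x)\<bar> \<le> k\<^sup>2 * (y - x)\<^sup>2"
  for k x y :: real
proof -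
  have "\<bar>cos (k * y) - cos (k * x) - - k * sin (k * x) * (y - x)\<bar> \<le> k\<^sup>2 * (y - x)\<^sup>2"
  proof (rule quadratic_Taylor[where C = UNIV and f' = "\<lambda>x. - k * sin (k * x)"])
    show "((\<lambda>x. cos (k * x)) has_real_derivative - k * sin (k * x)) (at x)" for x
      by (auto intro!: derivative_eq_intros)
    show "\<bar>- k * sin (k * x) - - k * sin (k * y)\<bar> \<le> k\<^sup>2 * \<bar>x - y\<bar>" for x y
    proof -
      have "\<bar>- k * sin (k * x) - - k * sin (k * y)\<bar> = \<bar>k\<bar> * \<bar>sin (k * x) - sin (k * y)\<bar>"
        unfolding abs_mult[symmetric] by (simp add: algebra_simps abs_minus_commute)
      also have "\<dots> \<le> \<bar>k\<bar> * (\<bar>k\<bar> * \<bar>x - y\<bar>)" by (intro mult_left_mono trig_Lip) auto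
      finally show ?thesis by (simp add: power2_eq_square)
    qed
  qed auto
  then show "\<bar>cos (k * y) - cos (k * x) + k * sin (k * x) * (y - x)\<bar> \<le> k\<^sup>2 * (y - x)\<^sup>2" by simp
  show "\<bar>sin (k * y) - sin (k * x) - k * cos (k * x) * (y - x)\<bar> \<le> k\<^sup>2 * (y - x)\<^sup>2"
  proof (rule quadratic_Taylor[where C = UNIV and f' = "\<lambda>x. k * cos (k * x)"])
    show "((\<lambda>x. sin (k * x)) has_real_derivative k * cos (k * x)) (at x)" for x
      by (auto intro!: derivative_eq_intros)
    show "\<bar>k * cos (k * x) - k * cos (k * y)\<bar> \<le> k\<^sup>2 * \<bar>x - y\<bar>" for x y
    proof -
      have "\<bar>k * cos (k * x) - k * cos (k * y)\<bar> = \<bar>k\<bar> * \<bar>cos (k * x) - cos (k * y)\<bar>"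
        unfolding abs_mult[symmetric] by (simp add: algebra_simps)
      also have "\<dots> \<le> \<bar>k\<bar> * (\<bar>k\<bar> * \<bar>x - y\<bar>)" by (intro mult_left_mono trig_Lip) auto
      finally show ?thesis by (simp add: power2_eq_square)
    qed
  qed auto
qed

text \<open>These inequalities dictate the choice of weights: a second-order remainder in q costs
  \<open>k^2\<close>, a q-derivative of a Hoelder quotient costs \<open>k * 2 ^ k\<close>, and both
  have to stay below \<open>4 ^ k\<close>.\<close>

lemma weights:
  "real k \<le> 2 ^ k" "(real k)\<^sup>2 \<le> 4 ^ k" "real k * 2 ^ k \<le> 4 ^ k" "real k \<le> 4 ^ k" "(2::real) ^ k \<le> 4 ^ k"
proof -
  have "k \<le> 2 ^ k" by (simp add: less_imp_le)
  then show 1: "real k \<le> 2 ^ k" by (metis of_nat_le_iff of_nat_numeral of_nat_power)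
  have 4: "(4::real) ^ k = 2 ^ k * 2 ^ k" by (simp flip: power_mult_distrib)
  show "(real k)\<^sup>2 \<le> 4 ^ k" unfolding 4 power2_eq_square by (intro mult_mono 1) auto
  show "real k * 2 ^ k \<le> 4 ^ k" unfolding 4 by (intro mult_right_mono 1) auto
  show "(2::real) ^ k \<le> 4 ^ k" by (intro power_mono) auto
  with 1 show "real k \<le> 4 ^ k" by linarith
qed

context
  fixes \<alpha> :: real and e :: cfun and c :: real and k :: nat
  assumes eb: "eb \<alpha> k e c"
begin

lemma e_le: "\<bar>e p\<bar> \<le> c" using abs_apply_le[of e p] eb_D(1)[OF eb] by linarith

lemma c_nonneg: "0 \<le> c" by (rule eb_nonneg[OF eb])

lemma IL_Lip: "p \<in> I \<Longrightarrow> p' \<in> I \<Longrightarrow> \<bar>IL e p - IL e p'\<bar> \<le> c * \<bar>p - p'\<bar>"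
  by (rule Lip_I[OF D_IL[unfolded D_def, rule_format] e_le])

lemma IL_le: "p \<in> I \<Longrightarrow> \<bar>IL e p\<bar> \<le> c"
  using IL_Lip[of p "-1"] c_nonneg mult_left_mono[of "\<bar>p + 1\<bar>" 1 c] by auto

lemma IR_le: "p \<in> I \<Longrightarrow> \<bar>IR e p\<bar> \<le> c"
  using IL_Lip[of p 0] c_nonneg mult_left_mono[of "\<bar>p\<bar>" 1 c] by (auto simp: IR_def abs_minus_commute)

lemma e_holder: "p \<in> I \<Longrightarrow> p' \<in> I \<Longrightarrow> \<bar>e p - e p'\<bar> \<le> 2 ^ k * c * \<bar>p - p'\<bar> powr \<alpha>"
  by (rule eb_D(2)[OF eb])

lemma IL_Taylor: 
  assumes "p \<in> I" "p' \<in> I" "0 < \<alpha>"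
  shows "\<bar>IL e p' - IL e p - e p * (p' - p)\<bar> \<le> 2 ^ k * c * (\<bar>p' - p\<bar> powr \<alpha> * \<bar>p' - p\<bar>)"
proof -
  have "\<exists>z\<in>I. \<bar>z - p\<bar> \<le> \<bar>p' - p\<bar> \<and> IL e p' - IL e p = e z * (p' - p)"
  proof (cases p p' rule: linorder_cases)
    case less
    obtain r where "p < r" "r < p'" "IL e p' - IL e p = e r * (p' - p)"
      by (rule mvt_I[OF D_IL[unfolded D_def, rule_format, of _ e], of p p']) (use less assms in auto)
    then show ?thesis using assms by (intro bexI[of _ r]) auto
  next
    case greater
    obtain r where "p' < r" "r < p" "IL e p - IL e p' = e r * (p - p')"
      by (rule mvt_I[OF D_IL[unfolded D_def, rule_format, of _ e], of p' p]) (use greater assms in auto)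
    then show ?thesis using assms by (intro bexI[of _ r]) (auto simp: algebra_simps)
  qed (use assms in auto)
  then obtain z where z: "z \<in> I" "\<bar>z - p\<bar> \<le> \<bar>p' - p\<bar>" "IL e p' - IL e p = e z * (p' - p)" by blast
  have "\<bar>IL e p' - IL e p - e p * (p' - p)\<bar> = \<bar>e z - e p\<bar> * \<bar>p' - p\<bar>"
    unfolding z(3) abs_mult[symmetric] by (simp add: algebra_simps)
  also have "\<dots> \<le> 2 ^ k * c * \<bar>p' - p\<bar> powr \<alpha> * \<bar>p' - p\<bar>"
    using z assms c_nonneg
    by (intro mult_right_mono order_trans[OF e_holder] mult_left_mono powr_mono2) auto
  finally show ?thesis by (simp add: mult.assoc)
qed

end

lemma scaled_le:
  fixes x w c R :: real
  assumes "\<bar>x\<bar> \<le> w * (R * c)" "0 \<le> R * c" "w \<le> 4 ^ k"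
  shows "\<bar>x / 4 ^ k\<bar> \<le> R * c"
proof -
  have "w * (R * c) \<le> 4 ^ k * (R * c)" using assms by (intro mult_right_mono)
  then show ?thesis using assms(1) by (simp add: divide_le_eq mult.commute)
qed

lemma controlledI:
  assumes "0 \<le> R" "\<And>k e c. eb \<alpha> k e c \<Longrightarrow> \<exists>x w. a k e = x / 4 ^ k \<and> \<bar>x\<bar> \<le> w * (R * c) \<and> w \<le> 4 ^ k"
  shows "controlled \<alpha> R a"
  unfolding controlled_def
proof (intro conjI allI impI assms(1))
  fix k e c assume eb: "eb \<alpha> k e c"
  then obtain x w where "a k e = x / 4 ^ k" "\<bar>x\<bar> \<le> w * (R * c)" "w \<le> 4 ^ k" using assms(2) by blast
  then show "\<bar>a k e\<bar> \<le> R * c" using scaled_le[of x w R c k] eb_nonneg[OF eb] assms(1) by simp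
qed

lemma abs_cos_mult: "\<bar>cos x * y\<bar> \<le> \<bar>y\<bar>" and abs_sin_mult: "\<bar>sin x * y\<bar> \<le> \<bar>y\<bar>" for x y :: real
  by (simp_all add: abs_mult mult_left_le_one_le)

lemma controlled_A:
  assumes p: "p \<in> I"
  shows "controlled \<alpha> 1 (A0 q p)" "controlled \<alpha> 1 (A1 q p)" "controlled \<alpha> 1 (A2 q p)"
    "controlled \<alpha> 1 (A3 q p)" "controlled \<alpha> 1 (A4 q p)" "controlled \<alpha> 1 (A5 q p)"
proof -
  note c = order_trans[OF abs_cos_mult] order_trans[OF abs_sin_mult]
  show "controlled \<alpha> 1 (A0 q p)"
  proof (rule controlledI)
    fix k e c assume eb: "eb \<alpha> k e c"
    show "\<exists>x w. A0 q p k e = x / 4 ^ k \<and> \<bar>x\<bar> \<le> w * (1 * c) \<and> w \<le> 4 ^ k"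
      by (rule exI[of _ "cos (real k * q) * IL e p"], rule exI[of _ 1], intro conjI) (auto simp: A0_def intro!: c IL_le[OF eb p])
  qed simp
  show "controlled \<alpha> 1 (A2 q p)"
  proof (rule controlledI)
    fix k e c assume eb: "eb \<alpha> k e c"
    show "\<exists>x w. A2 q p k e = x / 4 ^ k \<and> \<bar>x\<bar> \<le> w * (1 * c) \<and> w \<le> 4 ^ k"
      by (rule exI[of _ "cos (real k * q) * apply_bcontfun e p"], rule exI[of _ 1], intro conjI) (auto simp: A2_def intro!: c e_le[OF eb])
  qed simp
  show "controlled \<alpha> 1 (A3 q p)"
  proof (rule controlledI)
    fix k e c assume eb: "eb \<alpha> k e c"
    show "\<exists>x w. A3 q p k e = x / 4 ^ k \<and> \<bar>x\<bar> \<le> w * (1 * c) \<and> w \<le> 4 ^ k"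
      by (rule exI[of _ "sin (real k * q) * apply_bcontfun e p"], rule exI[of _ 1], intro conjI) (auto simp: A3_def intro!: c e_le[OF eb])
  qed simp
  have m: "\<bar>real k * y\<bar> \<le> real k * (1 * c)" if "\<bar>y\<bar> \<le> c" for k y and c :: real
    using that by (simp add: abs_mult mult_left_mono)
  show "controlled \<alpha> 1 (A1 q p)"
  proof (rule controlledI)
    fix k e c assume eb: "eb \<alpha> k e c"
    show "\<exists>x w. A1 q p k e = x / 4 ^ k \<and> \<bar>x\<bar> \<le> w * (1 * c) \<and> w \<le> 4 ^ k"
      by (rule exI[of _ "real k * (sin (real k * q) * - IL e p)"], rule exI[of _ "real k"], intro conjI m c weights)
         (auto simp: A1_def IL_le[OF eb p])
  qed simp
  show "controlled \<alpha> 1 (A4 q p)"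
  proof (rule controlledI)
    fix k e c assume eb: "eb \<alpha> k e c"
    show "\<exists>x w. A4 q p k e = x / 4 ^ k \<and> \<bar>x\<bar> \<le> w * (1 * c) \<and> w \<le> 4 ^ k"
      by (rule exI[of _ "real k * (cos (real k * q) * apply_bcontfun e p)"], rule exI[of _ "real k"], intro conjI m c weights)
         (auto simp: A4_def e_le[OF eb])
  qed simp
  show "controlled \<alpha> 1 (A5 q p)"
  proof (rule controlledI)
    fix k e c assume eb: "eb \<alpha> k e c"
    show "\<exists>x w. A5 q p k e = x / 4 ^ k \<and> \<bar>x\<bar> \<le> w * (1 * c) \<and> w \<le> 4 ^ k"
      by (rule exI[of _ "real k * (cos (real k * q) * IR e p)"], rule exI[of _ "real k"], intro conjI m c weights)
         (auto simp: A5_def IR_le[OF eb p])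
  qed simp
qed

lemma abs_prod_diff: "\<bar>u * x - v * y\<bar> \<le> \<bar>u - v\<bar> * \<bar>x\<bar> + \<bar>v\<bar> * \<bar>x - y\<bar>" for u v x y :: real
proof -
  have "u * x - v * y = (u - v) * x + v * (x - y)" by (simp add: algebra_simps)
  then show ?thesis using abs_triangle_ineq[of "(u - v) * x" "v * (x - y)"] by (simp add: abs_mult)
qed

lemma controlled_A_diff:
  fixes p p' q q' \<alpha> :: real
  assumes p: "p \<in> I" "p' \<in> I" and \<alpha>: "0 < \<alpha>" "\<alpha> \<le> 1"
  defines "R \<equiv> \<bar>p - p'\<bar> powr \<alpha> + \<bar>q - q'\<bar>"
  shows "controlled \<alpha> R (\<lambda>k e. A1 q p k e - A1 q' p' k e)" "controlled \<alpha> R (\<lambda>k e. A2 q p k e - A2 q' p' k e)"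
    "controlled \<alpha> R (\<lambda>k e. A3 q p k e - A3 q' p' k e)" "controlled \<alpha> R (\<lambda>k e. A4 q p k e - A4 q' p' k e)"
proof -
  have R: "0 \<le> R" by (simp add: R_def)
  have trig: "\<bar>T (real k * q) * y - T (real k * q') * y'\<bar> \<le> real k * \<bar>q - q'\<bar> * c + L"
    if "T = cos \<or> T = sin" "\<bar>y\<bar> \<le> c" "\<bar>y - y'\<bar> \<le> L" for T y y' c L and k :: nat
  proof -
    have T: "\<bar>T (real k * q) - T (real k * q')\<bar> \<le> real k * \<bar>q - q'\<bar>" "\<bar>T (real k * q')\<bar> \<le> 1"
      using that(1) trig_Lip[of "real k" q q'] by auto
    have "\<bar>T (real k * q) - T (real k * q')\<bar> * \<bar>y\<bar> + \<bar>T (real k * q')\<bar> * \<bar>y - y'\<bar> \<le> real k * \<bar>q - q'\<bar> * c + 1 * L"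
      using that by (intro add_mono mult_mono T) auto
    then show ?thesis using abs_prod_diff[of "T (real k * q)" y "T (real k * q')" y'] by linarith
  qed
  have comb: "real k * \<bar>q - q'\<bar> * c + 2 ^ k * c * \<bar>p - p'\<bar> powr \<alpha> \<le> 2 ^ k * (R * c)" if "0 \<le> c" for k c
    using mult_right_mono[OF weights(1)[of k], of "\<bar>q - q'\<bar> * c"] that by (simp add: R_def algebra_simps)
  have eT: "\<bar>T (real k * q) * apply_bcontfun e p - T (real k * q') * apply_bcontfun e p'\<bar> \<le> 2 ^ k * (R * c)"
    if "T = cos \<or> T = sin" "eb \<alpha> k e c" for T k e c
    using trig[OF that(1) e_le[OF that(2)] e_holder[OF that(2) p], of k] comb[OF c_nonneg[OF that(2)], of k] by linarith
  show "controlled \<alpha> R (\<lambda>k e. A2 q p k e - A2 q' p' k e)"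
    by (rule controlledI[OF R], intro exI conjI, simp only: A2_def times_divide_eq_left diff_divide_distrib[symmetric],
        rule eT) (auto simp: weights)
  show "controlled \<alpha> R (\<lambda>k e. A3 q p k e - A3 q' p' k e)"
    by (rule controlledI[OF R], intro exI conjI, simp only: A3_def times_divide_eq_left diff_divide_distrib[symmetric],
        rule eT) (auto simp: weights)
  show "controlled \<alpha> R (\<lambda>k e. A4 q p k e - A4 q' p' k e)"
  proof (rule controlledI[OF R])
    fix k e c assume eb: "eb \<alpha> k e c"
    show "\<exists>x w. A4 q p k e - A4 q' p' k e = x / 4 ^ k \<and> \<bar>x\<bar> \<le> w * (R * c) \<and> w \<le> 4 ^ k"
    proof (intro exI conjI)
      show "A4 q p k e - A4 q' p' k e = real k * (cos (real k * q) * apply_bcontfun e p - cos (real k * q') * apply_bcontfun e p') / 4 ^ k"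
        by (simp add: A4_def diff_divide_distrib algebra_simps)
      have "real k * \<bar>cos (real k * q) * apply_bcontfun e p - cos (real k * q') * apply_bcontfun e p'\<bar> \<le> real k * (2 ^ k * (R * c))"
        using eT[OF _ eb, of cos] by (intro mult_left_mono) auto
      then show "\<bar>real k * (cos (real k * q) * apply_bcontfun e p - cos (real k * q') * apply_bcontfun e p')\<bar> \<le> real k * 2 ^ k * (R * c)"
        by (simp add: abs_mult mult.assoc)
    qed (rule weights)
  qed
  show "controlled \<alpha> R (\<lambda>k e. A1 q p k e - A1 q' p' k e)"
  proof (rule controlledI[OF R])
    fix k e c assume eb: "eb \<alpha> k e c"
    have c: "0 \<le> c" by (rule c_nonneg[OF eb])
    show "\<exists>x w. A1 q p k e - A1 q' p' k e = x / 4 ^ k \<and> \<bar>x\<bar> \<le> w * (R * c) \<and> w \<le> 4 ^ k"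
    proof (intro exI conjI)
      show "A1 q p k e - A1 q' p' k e = - (real k * (sin (real k * q) * IL e p - sin (real k * q') * IL e p')) / 4 ^ k"
        by (simp add: A1_def diff_divide_distrib algebra_simps)
      have "c * \<bar>p - p'\<bar> \<le> c * \<bar>p - p'\<bar> powr \<alpha>"
        using p \<alpha> c by (intro mult_left_mono powr_le_Lip) auto
      also have "\<dots> \<le> 2 ^ k * (c * \<bar>p - p'\<bar> powr \<alpha>)"
        using mult_right_mono[of 1 "2 ^ k" "c * \<bar>p - p'\<bar> powr \<alpha>"] c by simp
      finally have "real k * \<bar>q - q'\<bar> * c + c * \<bar>p - p'\<bar> \<le> 2 ^ k * (R * c)"
        using comb[OF c, of k] by (simp add: algebra_simps)
      then have "\<bar>sin (real k * q) * IL e p - sin (real k * q') * IL e p'\<bar> \<le> 2 ^ k * (R * c)"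
        using trig[OF _ IL_le[OF eb p(1)] IL_Lip[OF eb p], of sin k] by simp
      then have "real k * \<bar>sin (real k * q) * IL e p - sin (real k * q') * IL e p'\<bar> \<le> real k * (2 ^ k * (R * c))"
        by (intro mult_left_mono) auto
      then show "\<bar>- (real k * (sin (real k * q) * IL e p - sin (real k * q') * IL e p'))\<bar> \<le> real k * 2 ^ k * (R * c)"
        by (simp add: abs_mult mult.assoc)
    qed (rule weights)
  qed
qed

lemma controlled_Taylor_A0:
  assumes p: "p \<in> I" "p' \<in> I" and \<alpha>: "0 < \<alpha>" "\<alpha> \<le> 1"
  shows "controlled \<alpha> (\<bar>p' - p\<bar> powr \<alpha> * \<bar>p' - p\<bar> + \<bar>q' - q\<bar> * \<bar>p' - p\<bar> + (q' - q)\<^sup>2)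
     (\<lambda>k e. A0 q' p' k e - A0 q p k e - (q' - q) * A1 q p k e - (p' - p) * A2 q p k e)" (is "controlled _ ?R _")
proof (rule controlledI)
  fix k e c assume eb: "eb \<alpha> k e c"
  have c: "0 \<le> c" by (rule c_nonneg[OF eb])
  \<comment> \<open>The remainder is split exactly into three parts: the Taylor remainder of the
    integral in p, the mixed increment, and the second-order remainder of the cosine.\<close>
  define x1 where "x1 = cos (real k * q') * (IL e p' - IL e p - e p * (p' - p))"
  define x2 where "x2 = (cos (real k * q') - cos (real k * q)) * (e p * (p' - p))"
  define x3 where "x3 = (cos (real k * q') - cos (real k * q) + real k * sin (real k * q) * (q' - q)) * IL e p"
  have b1: "\<bar>x1\<bar> \<le> 4 ^ k * (c * (\<bar>p' - p\<bar> powr \<alpha> * \<bar>p' - p\<bar>))"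
  proof -
    have "\<bar>x1\<bar> \<le> 2 ^ k * c * (\<bar>p' - p\<bar> powr \<alpha> * \<bar>p' - p\<bar>)"
      unfolding x1_def by (rule order_trans[OF abs_cos_mult IL_Taylor[OF eb p \<alpha>(1)]])
    also have "\<dots> \<le> 4 ^ k * c * (\<bar>p' - p\<bar> powr \<alpha> * \<bar>p' - p\<bar>)" using c by (intro mult_right_mono weights) auto
    finally show ?thesis by (simp add: mult.assoc)
  qed
  have b2: "\<bar>x2\<bar> \<le> 4 ^ k * (c * (\<bar>q' - q\<bar> * \<bar>p' - p\<bar>))"
  proof -
    have "\<bar>x2\<bar> \<le> (real k * \<bar>q' - q\<bar>) * (c * \<bar>p' - p\<bar>)"
      unfolding x2_def abs_mult using trig_Lip(1)[of "real k" q' q] c by (intro mult_mono e_le[OF eb]) auto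
    also have "\<dots> = real k * (c * (\<bar>q' - q\<bar> * \<bar>p' - p\<bar>))" by (simp add: algebra_simps)
    also have "\<dots> \<le> 4 ^ k * (c * (\<bar>q' - q\<bar> * \<bar>p' - p\<bar>))" using c by (intro mult_right_mono weights) auto
    finally show ?thesis .
  qed
  have b3: "\<bar>x3\<bar> \<le> 4 ^ k * (c * (q' - q)\<^sup>2)"
  proof -
    have "\<bar>x3\<bar> \<le> ((real k)\<^sup>2 * (q' - q)\<^sup>2) * c"
      unfolding x3_def abs_mult by (intro mult_mono trig_Taylor IL_le[OF eb p(1)]) auto
    also have "\<dots> = (real k)\<^sup>2 * (c * (q' - q)\<^sup>2)" by (simp add: algebra_simps)
    also have "\<dots> \<le> 4 ^ k * (c * (q' - q)\<^sup>2)" using c by (intro mult_right_mono weights) auto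
    finally show ?thesis .
  qed
  show "\<exists>x w. A0 q' p' k e - A0 q p k e - (q' - q) * A1 q p k e - (p' - p) * A2 q p k e = x / 4 ^ k \<and> \<bar>x\<bar> \<le> w * (?R * c) \<and> w \<le> 4 ^ k"
  proof (intro exI conjI)
    show "A0 q' p' k e - A0 q p k e - (q' - q) * A1 q p k e - (p' - p) * A2 q p k e = (x1 + x2 + x3) / 4 ^ k"
      unfolding A0_def A1_def A2_def x1_def x2_def x3_def
      by (simp add: diff_divide_distrib add_divide_distrib algebra_simps)
    have "\<bar>x1 + x2 + x3\<bar> \<le> \<bar>x1\<bar> + \<bar>x2\<bar> + \<bar>x3\<bar>" by linarith
    also have "\<dots> \<le> 4 ^ k * (?R * c)" using b1 b2 b3 by (simp add: algebra_simps)
    finally show "\<bar>x1 + x2 + x3\<bar> \<le> 4 ^ k * (?R * c)" .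
  qed simp
qed simp

lemma controlled_Taylor_A3:
  "controlled \<alpha> ((q' - q)\<^sup>2) (\<lambda>k e. A3 q' p k e - A3 q p k e - (q' - q) * A4 q p k e)"
proof (rule controlledI)
  fix k e c assume eb: "eb \<alpha> k e c"
  show "\<exists>x w. A3 q' p k e - A3 q p k e - (q' - q) * A4 q p k e = x / 4 ^ k \<and> \<bar>x\<bar> \<le> w * ((q' - q)\<^sup>2 * c) \<and> w \<le> 4 ^ k"
  proof (intro exI conjI)
    show "A3 q' p k e - A3 q p k e - (q' - q) * A4 q p k e
      = (sin (real k * q') - sin (real k * q) - real k * cos (real k * q) * (q' - q)) * e p / 4 ^ k"
      unfolding A3_def A4_def by (simp add: field_simps)
    have "\<bar>(sin (real k * q') - sin (real k * q) - real k * cos (real k * q) * (q' - q)) * e p\<bar> \<le> ((real k)\<^sup>2 * (q' - q)\<^sup>2) * c"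
      unfolding abs_mult by (intro mult_mono trig_Taylor e_le[OF eb]) auto
    then show "\<bar>(sin (real k * q') - sin (real k * q) - real k * cos (real k * q) * (q' - q)) * e p\<bar> \<le> (real k)\<^sup>2 * ((q' - q)\<^sup>2 * c)"
      by (simp add: mult.assoc)
  qed (rule weights)
qed simp

lemma controlled_Taylor_A5:
  assumes p: "p \<in> I" "p' \<in> I" and \<alpha>: "0 < \<alpha>"
  shows "controlled \<alpha> (\<bar>p' - p\<bar> powr \<alpha> * \<bar>p' - p\<bar>) (\<lambda>k e. A5 q p' k e - A5 q p k e - (- (p' - p)) * A4 q p k e)"
proof (rule controlledI)
  fix k e c assume eb: "eb \<alpha> k e c"
  show "\<exists>x w. A5 q p' k e - A5 q p k e - (- (p' - p)) * A4 q p k e = x / 4 ^ k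
     \<and> \<bar>x\<bar> \<le> w * (\<bar>p' - p\<bar> powr \<alpha> * \<bar>p' - p\<bar> * c) \<and> w \<le> 4 ^ k"
  proof (intro exI conjI)
    show "A5 q p' k e - A5 q p k e - (- (p' - p)) * A4 q p k e
      = real k * (cos (real k * q) * - (IL e p' - IL e p - e p * (p' - p))) / 4 ^ k"
      unfolding A5_def A4_def IR_def by (simp add: diff_divide_distrib add_divide_distrib algebra_simps)
    have "\<bar>cos (real k * q) * - (IL e p' - IL e p - e p * (p' - p))\<bar> \<le> 2 ^ k * c * (\<bar>p' - p\<bar> powr \<alpha> * \<bar>p' - p\<bar>)"
      using IL_Taylor[OF eb p \<alpha>] by (intro order_trans[OF abs_cos_mult]) simp
    then have "real k * \<bar>cos (real k * q) * - (IL e p' - IL e p - e p * (p' - p))\<bar> \<le> real k * (2 ^ k * c * (\<bar>p' - p\<bar> powr \<alpha> * \<bar>p' - p\<bar>))"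
      by (rule mult_left_mono) simp
    then show "\<bar>real k * (cos (real k * q) * - (IL e p' - IL e p - e p * (p' - p)))\<bar>
        \<le> real k * 2 ^ k * (\<bar>p' - p\<bar> powr \<alpha> * \<bar>p' - p\<bar> * c)"
      by (simp only: abs_mult[of "real k"] abs_of_nat mult_ac)
  qed (rule weights)
qed simp

section \<open>From Taylor bounds to \<open>C^{1,\<alpha>}\<close> regularity\<close>

text \<open>A function with candidate partial derivatives and a quantitative first-order expansion.
  The modulus, Lipschitz in q and Hoelder in p, is uniform over all real q, so that one statement
  serves the strip and the period cell.\<close>

definition T3 :: "real \<Rightarrow> (real \<times> real \<Rightarrow> real) \<Rightarrow> (real \<times> real \<Rightarrow> real) \<Rightarrow> (real \<times> real \<Rightarrow> real) \<Rightarrow> real \<Rightarrow> bool" where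
  "T3 \<alpha> f f1 f2 K \<longleftrightarrow> (\<forall>q q'. \<forall>p\<in>I. \<forall>p'\<in>I.
     \<bar>f (q, p)\<bar> \<le> K \<and> \<bar>f1 (q, p)\<bar> \<le> K \<and> \<bar>f2 (q, p)\<bar> \<le> K \<and>
     \<bar>f1 (q, p) - f1 (q', p')\<bar> \<le> K * (\<bar>p - p'\<bar> powr \<alpha> + \<bar>q - q'\<bar>) \<and>
     \<bar>f2 (q, p) - f2 (q', p')\<bar> \<le> K * (\<bar>p - p'\<bar> powr \<alpha> + \<bar>q - q'\<bar>) \<and>
     \<bar>f (q', p') - f (q, p) - (q' - q) * f1 (q, p) - (p' - p) * f2 (q, p)\<bar>
       \<le> K * (\<bar>p' - p\<bar> powr \<alpha> * \<bar>p' - p\<bar> + \<bar>q' - q\<bar> * \<bar>p' - p\<bar> + (q' - q)\<^sup>2))"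

lemma T3_cong:
  assumes "T3 \<alpha> f f1 f2 K" "\<And>q p. p \<in> I \<Longrightarrow> f (q, p) = g (q, p)" "\<And>q p. p \<in> I \<Longrightarrow> f1 (q, p) = g1 (q, p)"
    "\<And>q p. p \<in> I \<Longrightarrow> f2 (q, p) = g2 (q, p)"
  shows "T3 \<alpha> g g1 g2 K"
  using assms(1) unfolding T3_def by (simp add: assms(2-4)[symmetric])

lemma S_T3:
  assumes \<gamma>: "\<And>n. \<bar>\<gamma> n\<bar> \<le> N" and X: "hb \<alpha> X K" and \<alpha>: "0 < \<alpha>" "\<alpha> \<le> 1"
  shows "T3 \<alpha> (\<lambda>(q, p). S \<gamma> (A0 q p) X) (\<lambda>(q, p). S \<gamma> (A1 q p) X) (\<lambda>(q, p). S \<gamma> (A2 q p) X) (N * K)"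
  unfolding T3_def prod.case
proof (intro allI ballI conjI)
  fix q q' p p' :: real assume p: "p \<in> I" "p' \<in> I"
  note cA = controlled_A[OF p(1)] and cA' = controlled_A[OF p(2)]
  have b: "\<bar>S \<gamma> a X\<bar> \<le> N * R * K" if "controlled \<alpha> R a" for R a
    by (rule S_bound(2)[OF that \<gamma> X])
  have d: "S \<gamma> (\<lambda>k e. a k e - b k e) X = S \<gamma> a X - S \<gamma> b X" if "controlled \<alpha> R a" "controlled \<alpha> R' b" for R R' a b
    by (rule S_diff[OF that \<gamma> X])
  show "\<bar>S \<gamma> (A0 q p) X\<bar> \<le> N * K" using b[OF cA(1)[of \<alpha> q]] by simp
  show "\<bar>S \<gamma> (A1 q p) X\<bar> \<le> N * K" using b[OF cA(2)[of \<alpha> q]] by simp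
  show "\<bar>S \<gamma> (A2 q p) X\<bar> \<le> N * K" using b[OF cA(3)[of \<alpha> q]] by simp
  show "\<bar>S \<gamma> (A1 q p) X - S \<gamma> (A1 q' p') X\<bar> \<le> N * K * (\<bar>p - p'\<bar> powr \<alpha> + \<bar>q - q'\<bar>)"
    using b[OF controlled_A_diff(1)[OF p \<alpha>, of q q']] d[OF cA(2)[of \<alpha> q] cA'(2)[of \<alpha> q']] by (simp add: mult.assoc mult.left_commute mult.commute)
  show "\<bar>S \<gamma> (A2 q p) X - S \<gamma> (A2 q' p') X\<bar> \<le> N * K * (\<bar>p - p'\<bar> powr \<alpha> + \<bar>q - q'\<bar>)"
    using b[OF controlled_A_diff(2)[OF p \<alpha>, of q q']] d[OF cA(3)[of \<alpha> q] cA'(3)[of \<alpha> q']] by (simp add: mult.assoc mult.left_commute mult.commute)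
  note c1 = controlled_cmult[OF cA(2)[of \<alpha> q], of "q' - q"] and c2 = controlled_cmult[OF cA(3)[of \<alpha> q], of "p' - p"]
  note c0 = controlled_diff[OF cA'(1)[of \<alpha> q'] cA(1)[of \<alpha> q]]
  have "S \<gamma> (\<lambda>k e. A0 q' p' k e - A0 q p k e - (q' - q) * A1 q p k e - (p' - p) * A2 q p k e) X
     = S \<gamma> (A0 q' p') X - S \<gamma> (A0 q p) X - (q' - q) * S \<gamma> (A1 q p) X - (p' - p) * S \<gamma> (A2 q p) X"
    unfolding d[OF controlled_diff[OF c0 c1] c2] d[OF c0 c1] d[OF cA'(1)[of \<alpha> q'] cA(1)[of \<alpha> q]] S_cmult ..
  then show "\<bar>S \<gamma> (A0 q' p') X - S \<gamma> (A0 q p) X - (q' - q) * S \<gamma> (A1 q p) X - (p' - p) * S \<gamma> (A2 q p) X\<bar>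
     \<le> N * K * (\<bar>p' - p\<bar> powr \<alpha> * \<bar>p' - p\<bar> + \<bar>q' - q\<bar> * \<bar>p' - p\<bar> + (q' - q)\<^sup>2)"
    using b[OF controlled_Taylor_A0[OF p \<alpha>, where q = q and q' = q']] by (simp only: mult.assoc mult.left_commute mult.commute)
qed

text \<open>For points at distance at most 1 the Lipschitz part is dominated by the Hoelder power of
  the distance; for distant points the bound by \<open>2 * K\<close> is already enough.\<close>

lemma holder_error_bound:
  fixes x y :: "real \<times> real"
  assumes "0 < \<alpha>" "0 \<le> K" "\<bar>a\<bar> \<le> K * (\<bar>snd x - snd y\<bar> powr \<alpha> + \<bar>fst x - fst y\<bar>)" "\<bar>a\<bar> \<le> 2 * K" "\<alpha> \<le> 1"
  shows "\<bar>a\<bar> \<le> 2 * K * dist x y powr \<alpha>"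
proof -
  have d: "\<bar>snd x - snd y\<bar> \<le> dist x y" "\<bar>fst x - fst y\<bar> \<le> dist x y"
    using dist_snd_le[of x y] dist_fst_le[of x y] by (simp_all add: dist_real_def)
  show ?thesis
  proof (cases "dist x y \<le> 1")
    case True
    have "\<bar>snd x - snd y\<bar> powr \<alpha> + \<bar>fst x - fst y\<bar> \<le> dist x y powr \<alpha> + dist x y powr \<alpha>"
      using d powr_le_Lip[OF _ True assms(1,5)] assms(1) by (intro add_mono powr_mono2) auto
    then have "K * (\<bar>snd x - snd y\<bar> powr \<alpha> + \<bar>fst x - fst y\<bar>) \<le> K * (2 * dist x y powr \<alpha>)"
      using assms(2) by (intro mult_left_mono) auto
    then show ?thesis using assms(3) by simp
  next
    case False
    then have "1 \<le> dist x y powr \<alpha>" using assms(1) by (simp add: ge_one_powr_ge_zero)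
    then have "2 * K * 1 \<le> 2 * K * dist x y powr \<alpha>" using assms(2) by (intro mult_left_mono) auto
    then show ?thesis using assms(4) by simp
  qed
qed

context
  fixes \<alpha> K :: real and f f1 f2 :: "real \<times> real \<Rightarrow> real" and Q :: "real set" and T :: "(real \<times> real) set"
  assumes T3: "T3 \<alpha> f f1 f2 K" and \<alpha>: "0 < \<alpha>" "\<alpha> \<le> 1"
    and T: "T = Q \<times> I" and Q: "\<And>z e. z \<in> Q \<Longrightarrow> 0 < e \<Longrightarrow> \<exists>d. 0 < \<bar>d\<bar> \<and> \<bar>d\<bar> < e \<and> z + d \<in> Q"
begin

lemma T3_bounds: "x \<in> T \<Longrightarrow> \<bar>f x\<bar> \<le> K" "x \<in> T \<Longrightarrow> \<bar>f1 x\<bar> \<le> K" "x \<in> T \<Longrightarrow> \<bar>f2 x\<bar> \<le> K"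
  using T3 unfolding T3_def T by (cases x; blast)+

lemma T3_nonneg: "0 \<le> K"
  using T3[unfolded T3_def, rule_format, of 0 0 undefined undefined] order_trans[OF abs_ge_zero] by force

lemma T3_holder: "x \<in> T \<Longrightarrow> y \<in> T \<Longrightarrow> \<bar>f1 x - f1 y\<bar> \<le> 2 * K * dist x y powr \<alpha>"
  "x \<in> T \<Longrightarrow> y \<in> T \<Longrightarrow> \<bar>f2 x - f2 y\<bar> \<le> 2 * K * dist x y powr \<alpha>"
proof -
  assume xy: "x \<in> T" "y \<in> T"
  then have I: "snd x \<in> I" "snd y \<in> I" by (auto simp: T)
  from T3[unfolded T3_def, rule_format, OF I, of "fst x" "fst y"]
  have "\<bar>f1 x - f1 y\<bar> \<le> K * (\<bar>snd x - snd y\<bar> powr \<alpha> + \<bar>fst x - fst y\<bar>)"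
    "\<bar>f2 x - f2 y\<bar> \<le> K * (\<bar>snd x - snd y\<bar> powr \<alpha> + \<bar>fst x - fst y\<bar>)" by simp_all
  moreover have "\<bar>f1 x - f1 y\<bar> \<le> 2 * K" "\<bar>f2 x - f2 y\<bar> \<le> 2 * K"
    using T3_bounds(2)[OF xy(1)] T3_bounds(2)[OF xy(2)] T3_bounds(3)[OF xy(1)] T3_bounds(3)[OF xy(2)] by linarith+
  ultimately show "\<bar>f1 x - f1 y\<bar> \<le> 2 * K * dist x y powr \<alpha>" "\<bar>f2 x - f2 y\<bar> \<le> 2 * K * dist x y powr \<alpha>"
    using holder_error_bound[OF \<alpha>(1) T3_nonneg _ _ \<alpha>(2)] by blast+
qed

lemma T3_has_derivative:
  assumes x: "x \<in> T"
  shows "(f has_derivative (\<lambda>h. fst h * f1 x + snd h * f2 x)) (at x within T)"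
proof (rule has_derivativeI_sandwich[where e = 1 and H = "\<lambda>y. K * (dist y x powr \<alpha> + 2 * dist y x)"])
  show "bounded_linear (\<lambda>h. fst h * f1 x + snd h * f2 x)"
    by (intro bounded_linear_add bounded_linear_mult_const bounded_linear_fst bounded_linear_snd)
  have "((\<lambda>y. K * (dist y x powr \<alpha> + 2 * dist y x)) \<longlongrightarrow> K * (0 powr \<alpha> + 2 * 0)) (at x within T)"
  proof -
    have 0: "((\<lambda>y. dist y x) \<longlongrightarrow> 0) (at x within T)"
      using tendsto_dist[OF tendsto_ident_at[of x T] tendsto_const[of x]] by simp
    show ?thesis
      by (intro tendsto_mult tendsto_add tendsto_const 0 tendsto_powr') (use \<alpha> in auto)
  qed
  then show "((\<lambda>y. K * (dist y x powr \<alpha> + 2 * dist y x)) \<longlongrightarrow> 0) (at x within T)" using \<alpha> by simp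
  fix y assume y: "y \<in> T" "y \<noteq> x"
  define \<delta> where "\<delta> = dist y x"
  have \<delta>: "0 < \<delta>" using y by (simp add: \<delta>_def)
  have d: "\<bar>snd y - snd x\<bar> \<le> \<delta>" "\<bar>fst y - fst x\<bar> \<le> \<delta>"
    using dist_snd_le[of y x] dist_fst_le[of y x] by (simp_all add: dist_real_def \<delta>_def)
  have I: "snd x \<in> I" "snd y \<in> I" using x y by (auto simp: T)
  have "\<bar>f y - f x - (fst y - fst x) * f1 x - (snd y - snd x) * f2 x\<bar>
     \<le> K * (\<bar>snd y - snd x\<bar> powr \<alpha> * \<bar>snd y - snd x\<bar> + \<bar>fst y - fst x\<bar> * \<bar>snd y - snd x\<bar> + (fst y - fst x)\<^sup>2)"
    using T3[unfolded T3_def, rule_format, OF I, of "fst x" "fst y"] by simp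
  also have "\<dots> \<le> K * (\<delta> powr \<alpha> * \<delta> + \<delta> * \<delta> + \<delta> * \<delta>)"
  proof (intro mult_left_mono add_mono T3_nonneg)
    show "\<bar>snd y - snd x\<bar> powr \<alpha> * \<bar>snd y - snd x\<bar> \<le> \<delta> powr \<alpha> * \<delta>"
      using d \<alpha> by (intro mult_mono powr_mono2) auto
    show "\<bar>fst y - fst x\<bar> * \<bar>snd y - snd x\<bar> \<le> \<delta> * \<delta>" using d by (intro mult_mono) auto
    show "(fst y - fst x)\<^sup>2 \<le> \<delta> * \<delta>" using power_mono[OF d(2), of 2] by (simp add: power2_eq_square)
  qed
  finally have "\<bar>f y - f x - (fst y - fst x) * f1 x - (snd y - snd x) * f2 x\<bar> / \<delta> \<le> K * (\<delta> powr \<alpha> + 2 * \<delta>)"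
    using \<delta> by (simp add: divide_le_eq algebra_simps)
  then show "norm (f y - f x - (fst (y - x) * f1 x + snd (y - x) * f2 x)) / norm (y - x) \<le> K * (dist y x powr \<alpha> + 2 * dist y x)"
    by (simp add: \<delta>_def dist_norm algebra_simps)
qed (rule zero_less_one)

text \<open>A derivative within a set is unique only if the set accumulates at the point along every
  coordinate axis. \<open>Q\<close> provides this for the first coordinate, the interval for the
  second.\<close>

lemma T3_pd_on:
  assumes x: "x \<in> T"
  shows "pd_on T (1, 0) f x = f1 x" "pd_on T (0, 1) f x = f2 x"
proof -
  have "(f has_derivative frechet_derivative f (at x within T)) (at x within T)"
    using T3_has_derivative[OF x] frechet_derivative_works unfolding differentiable_def by blast
  then have "frechet_derivative f (at x within T) = (\<lambda>h. fst h * f1 x + snd h * f2 x)"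
  proof (rule frechet_derivative_unique_within[OF _ T3_has_derivative[OF x]])
    fix i :: "real \<times> real" and e :: real assume i: "i \<in> Basis" and e: "e > 0"
    show "\<exists>d. 0 < \<bar>d\<bar> \<and> \<bar>d\<bar> < e \<and> x + d *\<^sub>R i \<in> T"
    proof (cases "i = (1, 0)")
      case True
      have "fst x \<in> Q" using x by (auto simp: T)
      from Q[OF this e] show ?thesis using x True by (force simp: T)
    next
      case False
      then have i: "i = (0, 1)" using i by (auto simp: Basis_prod_def)
      have p: "snd x \<in> I" using x by (auto simp: T)
      \<comment> \<open>The step in p has to point into the interval: upwards from its lower part,
        downwards otherwise.\<close>
      show ?thesis
      proof (cases "snd x < - 1/2")
        case True
        then show ?thesis using x p e by (intro exI[of _ "min (1/2) (e/2)"]) (auto simp: T i)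
      next
        case False
        then show ?thesis using x p e by (intro exI[of _ "- min (1/2) (e/2)"]) (auto simp: T i)
      qed
    qed
  qed
  then show "pd_on T (1, 0) f x = f1 x" "pd_on T (0, 1) f x = f2 x"
    by (simp_all add: pd_on_def)
qed

lemma Basis_R2: "b \<in> Basis \<Longrightarrow> b = (1, 0) \<or> b = (0, 1 :: real)" for b :: "real \<times> real"
  by (auto simp: Basis_prod_def)

lemma T3_pd_bounds:
  assumes "b \<in> Basis"
  shows "x \<in> T \<Longrightarrow> \<bar>pd_on T b f x\<bar> \<le> K" "x \<in> T \<Longrightarrow> y \<in> T \<Longrightarrow> \<bar>pd_on T b f x - pd_on T b f y\<bar> \<le> 2 * K * dist x y powr \<alpha>"
proof -
  have *: "(\<forall>x\<in>T. pd_on T b f x = f1 x) \<or> (\<forall>x\<in>T. pd_on T b f x = f2 x)"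
    using Basis_R2[OF assms] T3_pd_on by blast
  show "x \<in> T \<Longrightarrow> \<bar>pd_on T b f x\<bar> \<le> K" using * T3_bounds(2,3)[of x] by fastforce
  show "x \<in> T \<Longrightarrow> y \<in> T \<Longrightarrow> \<bar>pd_on T b f x - pd_on T b f y\<bar> \<le> 2 * K * dist x y powr \<alpha>"
    using * T3_holder[of x y] by fastforce
qed

lemma T3_C1_holder: "f \<in> C1_holder \<alpha> T"
  unfolding C1_holder_def holder_def mem_Collect_eq
proof (intro conjI ballI)
  show "f differentiable_on T"
    using T3_has_derivative by (auto simp: differentiable_on_def differentiable_def)
  show "bounded (f ` T)" by (rule boundedI[where B = K]) (use T3_bounds(1) in force)
  fix b :: "real \<times> real" assume b: "b \<in> Basis"
  show "bounded (pd_on T b f ` T)" by (rule boundedI[where B = K]) (use T3_pd_bounds(1)[OF b] in force)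
  show "\<exists>C. \<forall>x\<in>T. \<forall>y\<in>T. \<bar>pd_on T b f x - pd_on T b f y\<bar> \<le> C * dist x y powr \<alpha>"
    using T3_pd_bounds(2)[OF b] by blast
qed

text \<open>The factor 7 counts one supremum of \<open>f\<close>, and for each of two directions a
  supremum bounded by \<open>K\<close> and a seminorm bounded by \<open>2 * K\<close>.\<close>

lemma T3_norm:
  assumes ne: "T \<noteq> {}"
  shows "\<bar>C1_holder_norm \<alpha> T f\<bar> \<le> 7 * K"
proof -
  have sup: "\<bar>sup_norm_on T g\<bar> \<le> K" if "\<And>x. x \<in> T \<Longrightarrow> \<bar>g x\<bar> \<le> K" for g
  proof -
    have "sup_norm_on T g \<le> K" unfolding sup_norm_on_def by (rule cSUP_least[OF ne that])
    moreover obtain x where x: "x \<in> T" using ne by blast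
    have "\<bar>g x\<bar> \<le> sup_norm_on T g"
      unfolding sup_norm_on_def by (rule cSUP_upper[OF x]) (auto intro!: bdd_aboveI2[where M = K] that)
    ultimately show ?thesis by linarith
  qed
  have hol: "\<bar>holder_seminorm \<alpha> T g\<bar> \<le> 2 * K" if g: "\<And>x y. x \<in> T \<Longrightarrow> y \<in> T \<Longrightarrow> \<bar>g x - g y\<bar> \<le> 2 * K * dist x y powr \<alpha>" for g
  proof -
    have le: "(case z of (x, y) \<Rightarrow> \<bar>g x - g y\<bar> / dist x y powr \<alpha>) \<le> 2 * K" if "z \<in> T \<times> T" for z
    proof -
      obtain x y where z: "z = (x, y)" by (cases z)
      show ?thesis
      proof (cases "x = y")
        case True
        then show ?thesis using T3_nonneg by (simp add: z)
      next
        case False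
        then show ?thesis using g[of x y] that by (simp add: z divide_le_eq)
      qed
    qed
    have "holder_seminorm \<alpha> T g \<le> 2 * K" unfolding holder_seminorm_def by (rule cSUP_least) (use ne le in auto)
    moreover obtain x where x: "x \<in> T" using ne by blast
    have "(case (x, x) of (x, y) \<Rightarrow> \<bar>g x - g y\<bar> / dist x y powr \<alpha>) \<le> holder_seminorm \<alpha> T g"
      unfolding holder_seminorm_def
      by (rule cSUP_upper) (use x in simp, rule bdd_aboveI2[where M = "2 * K"], rule le)
    then have "0 \<le> holder_seminorm \<alpha> T g" by simp
    ultimately show ?thesis by linarith
  qed
  have "\<bar>\<Sum>b\<in>Basis. sup_norm_on T (pd_on T b f) + holder_seminorm \<alpha> T (pd_on T b f)\<bar>
     \<le> (\<Sum>b\<in>(Basis :: (real \<times> real) set). 3 * K)"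
  proof (rule order_trans[OF sum_abs sum_mono])
    fix b :: "real \<times> real" assume b: "b \<in> Basis"
    show "\<bar>sup_norm_on T (pd_on T b f) + holder_seminorm \<alpha> T (pd_on T b f)\<bar> \<le> 3 * K"
    proof -
      have "\<bar>sup_norm_on T (pd_on T b f)\<bar> \<le> K" by (rule sup) (rule T3_pd_bounds(1)[OF b])
      moreover have "\<bar>holder_seminorm \<alpha> T (pd_on T b f)\<bar> \<le> 2 * K" by (rule hol) (rule T3_pd_bounds(2)[OF b])
      ultimately show ?thesis by linarith
    qed
  qed
  also have "\<dots> = 6 * K" by simp
  finally have "\<bar>\<Sum>b\<in>Basis. sup_norm_on T (pd_on T b f) + holder_seminorm \<alpha> T (pd_on T b f)\<bar> \<le> 6 * K" .
  moreover have "\<bar>sup_norm_on T f\<bar> \<le> K" by (rule sup) (rule T3_bounds(1))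
  ultimately show ?thesis unfolding C1_holder_norm_def by linarith
qed

end

lemma strip_side: "z \<in> (UNIV :: real set) \<Longrightarrow> 0 < e \<Longrightarrow> \<exists>d. 0 < \<bar>d\<bar> \<and> \<bar>d\<bar> < e \<and> z + d \<in> (UNIV :: real set)"
  by (intro exI[of _ "e/2"]) auto

lemma cell_side: "z \<in> {-pi..pi} \<Longrightarrow> 0 < e \<Longrightarrow> \<exists>d. 0 < \<bar>d\<bar> \<and> \<bar>d\<bar> < e \<and> z + d \<in> {-pi..pi}"
proof (cases "z < 0")
  case True
  then show "z \<in> {-pi..pi} \<Longrightarrow> 0 < e \<Longrightarrow> ?thesis" using pi_gt_zero by (intro exI[of _ "min pi (e/2)"]) auto
next
  case False
  then show "z \<in> {-pi..pi} \<Longrightarrow> 0 < e \<Longrightarrow> ?thesis" using pi_gt_zero by (intro exI[of _ "- min pi (e/2)"]) auto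
qed

lemmas T3_strip_pd = T3_pd_on[OF _ _ _ strip_def strip_side]
lemmas T3_strip_C1 = T3_C1_holder[OF _ _ _ strip_def strip_side]

lemma T3_cell_norm: "T3 \<alpha> f f1 f2 K \<Longrightarrow> 0 < \<alpha> \<Longrightarrow> \<alpha> \<le> 1 \<Longrightarrow> \<bar>C1_holder_norm \<alpha> cell f\<bar> \<le> 7 * K"
  by (rule T3_norm[OF _ _ _ cell_def cell_side]) (auto simp: cell_def)

lemma S_even_periodic:
  "S \<gamma> (A0 (- q) p) X = S \<gamma> (A0 q p) X" "S \<gamma> (A0 (q + 2 * pi) p) X = S \<gamma> (A0 q p) X"
proof -
  have "cos (real k * (q + 2 * pi)) = cos (real k * q)" for k
  proof -
    have "real k * (q + 2 * pi) = real k * q + 2 * real k * pi" by (simp add: algebra_simps)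
    then show ?thesis by (simp only: cos_add cos_2npi sin_2npi)
  qed
  then have "A0 (q + 2 * pi) p = A0 q p" by (intro ext) (simp add: A0_def)
  moreover have "A0 (- q) p = A0 q p" by (intro ext) (simp add: A0_def)
  ultimately show "S \<gamma> (A0 (- q) p) X = S \<gamma> (A0 q p) X" "S \<gamma> (A0 (q + 2 * pi) p) X = S \<gamma> (A0 q p) X" by simp_all
qed

lemma S_C1_holder_per:
  assumes "\<And>n. \<bar>\<gamma> n\<bar> \<le> N" "hb \<alpha> X K" "0 < \<alpha>" "\<alpha> \<le> 1"
  shows "(\<lambda>(q, p). S \<gamma> (A0 q p) X) \<in> C1_holder_per \<alpha>"
  unfolding C1_holder_per_def using T3_strip_C1[OF S_T3[OF assms] assms(3,4)] by (auto simp: S_even_periodic)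

section \<open>Dependence of the series on the parameter s\<close>

text \<open>Differentiation of the n-th power costs factors n, and a Lipschitz bound for the
  derivative costs \<open>n^2\<close>; at radius 1/4 both are absorbed by \<open>4 ^ n\<close>. This
  is why the curve uses only \<open>\<bar>s\<bar> \<le> \<epsilon> / 4\<close>, while the series
  converge up to \<open>\<epsilon>\<close>.\<close>

lemma power_quarter:
  fixes x y :: real
  assumes xy: "\<bar>x\<bar> \<le> 1/4" "\<bar>y\<bar> \<le> 1/4"
  shows "\<bar>x ^ n\<bar> \<le> 1" "\<bar>real n * x ^ (n - 1)\<bar> \<le> 4" "\<bar>real n * x ^ (n - 1) - real n * y ^ (n - 1)\<bar> \<le> 64 * \<bar>x - y\<bar>"
    "\<bar>x ^ n - y ^ n - real n * y ^ (n - 1) * (x - y)\<bar> \<le> 64 * (x - y)\<^sup>2"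
proof -
  show "\<bar>x ^ n\<bar> \<le> 1" using assms(1) by (simp add: power_abs power_le_one)
  show "\<bar>real n * x ^ (n - 1)\<bar> \<le> 4"
  proof (cases n)
    case (Suc m)
    have "\<bar>x\<bar> ^ m \<le> (1/4) ^ m" using xy by (intro power_mono) auto
    then have "real n * \<bar>x\<bar> ^ m \<le> 4 ^ n * (1/4) ^ m" using weights(4)[of n] by (intro mult_mono) auto
    also have "\<dots> = 4" by (simp add: Suc power_one_over)
    finally show ?thesis by (simp add: Suc abs_mult power_abs)
  qed simp
  have lip: "\<bar>real n * x ^ (n - 1) - real n * y ^ (n - 1)\<bar> \<le> 64 * \<bar>x - y\<bar>"
    if xy: "x \<in> {-1/4..1/4}" "y \<in> {-1/4..1/4}" for x y
  proof (cases n)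
    case (Suc m)
    define X r where "X = \<bar>x ^ m - y ^ m\<bar>" and "r = \<bar>x - y\<bar>"
    \<comment> \<open>After scaling by 4 the points have absolute value at most 1, where the m-th
      power is Lipschitz with constant m; undoing the scaling gains the factor
      \<open>4 ^ m\<close>.\<close>
    have "norm ((4 * x) ^ m - (4 * y) ^ m) \<le> real m * norm (4 * x - 4 * y)"
      by (rule norm_power_diff) (use xy in auto)
    moreover have "(4 * x) ^ m - (4 * y) ^ m = 4 ^ m * (x ^ m - y ^ m)"
      by (simp only: power_mult_distrib right_diff_distrib)
    moreover have "4 * x - 4 * y = 4 * (x - y)" by (simp only: right_diff_distrib)
    ultimately have "4 ^ m * X \<le> real m * (4 * r)"
      by (simp only: real_norm_def abs_mult X_def r_def abs_numeral power_abs)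
    also have "\<dots> \<le> real n * (4 * r)" using Suc by (intro mult_right_mono) (auto simp: r_def)
    finally have 1: "4 ^ m * X \<le> real n * (4 * r)" .
    have r: "0 \<le> r" by (simp add: r_def)
    have "4 ^ m * (real n * X) = real n * (4 ^ m * X)" by simp
    also have "\<dots> \<le> real n * (real n * (4 * r))" by (intro mult_left_mono 1) auto
    also have "\<dots> = (real n)\<^sup>2 * (4 * r)" by (simp add: power2_eq_square)
    also have "\<dots> \<le> 4 ^ n * (4 * r)" using r by (intro mult_right_mono weights) auto
    also have "\<dots> = 4 ^ m * (16 * r)" by (simp add: Suc)
    finally have "real n * X \<le> 16 * r" by simp
    then have "\<bar>real n * (x ^ m - y ^ m)\<bar> \<le> 64 * \<bar>x - y\<bar>"
      using r \<open>real n * X \<le> 16 * r\<close> unfolding abs_mult abs_of_nat X_def[symmetric] r_def[symmetric] by linarith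
    then show ?thesis by (simp add: Suc right_diff_distrib)
  qed simp
  show "\<bar>real n * x ^ (n - 1) - real n * y ^ (n - 1)\<bar> \<le> 64 * \<bar>x - y\<bar>" by (rule lip) (use xy in auto)
  show "\<bar>x ^ n - y ^ n - real n * y ^ (n - 1) * (x - y)\<bar> \<le> 64 * (x - y)\<^sup>2"
  proof (rule quadratic_Taylor[where f = "\<lambda>x. x ^ n" and f' = "\<lambda>x. real n * x ^ (n - 1)" and C = "{-1/4..1/4}"])
    show "((\<lambda>x. x ^ n) has_real_derivative real n * x ^ (n - 1)) (at x)" for x :: real
      by (auto intro!: derivative_eq_intros)
  qed (use xy lip in \<open>auto simp: is_interval_cc\<close>)
qed

definition pw :: "real \<Rightarrow> real \<Rightarrow> nat \<Rightarrow> real" where "pw \<epsilon> s n = (s / \<epsilon>) ^ n"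
text \<open>The s-derivative of \<open>pw\<close>. For n = 0 the truncated exponent is harmless,
  because the factor \<open>real n\<close> is 0.\<close>

definition pw' :: "real \<Rightarrow> real \<Rightarrow> nat \<Rightarrow> real" where "pw' \<epsilon> s n = (real n * (s / \<epsilon>) ^ (n - 1)) / \<epsilon>"

lemma pw_bounds:
  assumes e: "0 < \<epsilon>" and s: "\<bar>s\<bar> \<le> \<epsilon> / 4" "\<bar>t\<bar> \<le> \<epsilon> / 4"
  shows "\<bar>pw \<epsilon> s n\<bar> \<le> 1" "\<bar>pw' \<epsilon> s n\<bar> \<le> 4 / \<epsilon>" "\<bar>pw' \<epsilon> t n - pw' \<epsilon> s n\<bar> \<le> 64 / \<epsilon>\<^sup>2 * \<bar>t - s\<bar>"
    "\<bar>pw \<epsilon> t n - pw \<epsilon> s n - pw' \<epsilon> s n * (t - s)\<bar> \<le> 64 / \<epsilon>\<^sup>2 * (t - s)\<^sup>2"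
proof -
  have x: "\<bar>t / \<epsilon>\<bar> \<le> 1/4" "\<bar>s / \<epsilon>\<bar> \<le> 1/4" using assms by (simp_all add: abs_divide divide_le_eq)
  show "\<bar>pw \<epsilon> s n\<bar> \<le> 1" using power_quarter(1)[OF x(2) x(2), of n] by (simp add: pw_def)
  show "\<bar>pw' \<epsilon> s n\<bar> \<le> 4 / \<epsilon>" using power_quarter(2)[OF x(2) x(2), of n] e
    unfolding pw'_def abs_divide by (simp add: divide_right_mono)
  have "\<bar>real n * (t / \<epsilon>) ^ (n - 1) - real n * (s / \<epsilon>) ^ (n - 1)\<bar> / \<epsilon> \<le> 64 * \<bar>t / \<epsilon> - s / \<epsilon>\<bar> / \<epsilon>"
    using power_quarter(3)[OF x, of n] e by (intro divide_right_mono) auto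
  then show "\<bar>pw' \<epsilon> t n - pw' \<epsilon> s n\<bar> \<le> 64 / \<epsilon>\<^sup>2 * \<bar>t - s\<bar>"
    using e unfolding pw'_def diff_divide_distrib[symmetric] abs_divide by (simp add: power2_eq_square)
  show "\<bar>pw \<epsilon> t n - pw \<epsilon> s n - pw' \<epsilon> s n * (t - s)\<bar> \<le> 64 / \<epsilon>\<^sup>2 * (t - s)\<^sup>2"
    using power_quarter(4)[OF x, of n] by (simp add: pw_def pw'_def diff_divide_distrib[symmetric] power_divide)
qed

text \<open>Differentiating in s changes the sequence \<open>\<gamma>\<close> only. The error of a
  difference quotient is again a series, with scalar Taylor remainders as \<open>\<gamma>\<close>,
  so that \<open>S_T3\<close> converts a scalar bound into a bound of the full norm.\<close>

lemma S_curve: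
  assumes e: "0 < \<epsilon>" and X: "hb \<alpha> X K" and \<alpha>: "0 < \<alpha>" "\<alpha> \<le> 1" and J: "J \<subseteq> {- \<epsilon> / 4..\<epsilon> / 4}"
  shows "C1_curve_per \<alpha> J (\<lambda>s (q, p). S (pw \<epsilon> s) (A0 q p) X)"
  unfolding C1_curve_per_def
proof (intro conjI ballI exI[of _ "\<lambda>s (q, p). S (pw' \<epsilon> s) (A0 q p) X"])
  have J': "\<bar>s\<bar> \<le> \<epsilon> / 4" if "s \<in> J" for s
  proof -
    have "s \<in> {- \<epsilon> / 4..\<epsilon> / 4}" using J that by blast
    then show ?thesis by auto
  qed
  note b = pw_bounds[OF e]
  fix s assume s: "s \<in> J"
  show "(\<lambda>(q, p). S (pw \<epsilon> s) (A0 q p) X) \<in> C1_holder_per \<alpha>"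
    by (rule S_C1_holder_per[OF b(1)[OF J'[OF s] J'[OF s]] X \<alpha>])
  show "(\<lambda>(q, p). S (pw' \<epsilon> s) (A0 q p) X) \<in> C1_holder_per \<alpha>"
    by (rule S_C1_holder_per[OF b(2)[OF J'[OF s] J'[OF s]] X \<alpha>])
  have lim: "((\<lambda>t. 7 * (64 / \<epsilon>\<^sup>2 * \<bar>t - s\<bar> * K)) \<longlongrightarrow> 0) (at s within J)"
    by (rule tendsto_eq_intros refl | simp)+
  show "((\<lambda>t. C1_holder_norm \<alpha> cell (\<lambda>x. (case x of (q, p) \<Rightarrow> S (pw' \<epsilon> t) (A0 q p) X) - (case x of (q, p) \<Rightarrow> S (pw' \<epsilon> s) (A0 q p) X))) \<longlongrightarrow> 0) (at s within J)"
  proof (rule Lim_null_comparison[OF _ lim])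
    show "\<forall>\<^sub>F t in at s within J. norm (C1_holder_norm \<alpha> cell (\<lambda>x. (case x of (q, p) \<Rightarrow> S (pw' \<epsilon> t) (A0 q p) X) - (case x of (q, p) \<Rightarrow> S (pw' \<epsilon> s) (A0 q p) X)))
       \<le> 7 * (64 / \<epsilon>\<^sup>2 * \<bar>t - s\<bar> * K)"
      unfolding eventually_at_filter
    proof (rule always_eventually, intro allI impI)
      fix t assume t: "t \<in> J"
      note st = J'[OF s] J'[OF t]
      have "T3 \<alpha> (\<lambda>x. (case x of (q, p) \<Rightarrow> S (pw' \<epsilon> t) (A0 q p) X) - (case x of (q, p) \<Rightarrow> S (pw' \<epsilon> s) (A0 q p) X))
         (\<lambda>(q, p). S (\<lambda>n. pw' \<epsilon> t n - pw' \<epsilon> s n) (A1 q p) X) (\<lambda>(q, p). S (\<lambda>n. pw' \<epsilon> t n - pw' \<epsilon> s n) (A2 q p) X) (64 / \<epsilon>\<^sup>2 * \<bar>t - s\<bar> * K)"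
        by (rule T3_cong[OF S_T3[OF b(3)[OF st] X \<alpha>]])
           (simp_all add: S_gamma_diff[OF controlled_A(1) b(2)[OF st(2) st(2)] b(2)[OF st(1) st(1)] X])
      from T3_cell_norm[OF this \<alpha>]
      show "norm (C1_holder_norm \<alpha> cell (\<lambda>x. (case x of (q, p) \<Rightarrow> S (pw' \<epsilon> t) (A0 q p) X) - (case x of (q, p) \<Rightarrow> S (pw' \<epsilon> s) (A0 q p) X)))
       \<le> 7 * (64 / \<epsilon>\<^sup>2 * \<bar>t - s\<bar> * K)" by simp
    qed
  qed
  show "((\<lambda>t. C1_holder_norm \<alpha> cell (\<lambda>x. ((case x of (q, p) \<Rightarrow> S (pw \<epsilon> t) (A0 q p) X) - (case x of (q, p) \<Rightarrow> S (pw \<epsilon> s) (A0 q p) X)) / (t - s)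
      - (case x of (q, p) \<Rightarrow> S (pw' \<epsilon> s) (A0 q p) X))) \<longlongrightarrow> 0) (at s within J)"
  proof (rule Lim_null_comparison[OF _ lim])
    show "\<forall>\<^sub>F t in at s within J. norm (C1_holder_norm \<alpha> cell (\<lambda>x. ((case x of (q, p) \<Rightarrow> S (pw \<epsilon> t) (A0 q p) X) - (case x of (q, p) \<Rightarrow> S (pw \<epsilon> s) (A0 q p) X)) / (t - s)
      - (case x of (q, p) \<Rightarrow> S (pw' \<epsilon> s) (A0 q p) X)))
       \<le> 7 * (64 / \<epsilon>\<^sup>2 * \<bar>t - s\<bar> * K)"
      unfolding eventually_at_filter
    proof (rule always_eventually, intro allI impI)
      fix t assume t: "t \<noteq> s" "t \<in> J"
      note st = J'[OF s] J'[OF t(2)]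
      define \<gamma> where "\<gamma> n = 1 / (t - s) * (pw \<epsilon> t n - pw \<epsilon> s n) - pw' \<epsilon> s n" for n
      have g: "\<bar>\<gamma> n\<bar> \<le> 64 / \<epsilon>\<^sup>2 * \<bar>t - s\<bar>" for n
      proof -
        have "\<gamma> n = (pw \<epsilon> t n - pw \<epsilon> s n - pw' \<epsilon> s n * (t - s)) / (t - s)"
          using t by (simp add: \<gamma>_def field_simps)
        then have "\<bar>\<gamma> n\<bar> = \<bar>pw \<epsilon> t n - pw \<epsilon> s n - pw' \<epsilon> s n * (t - s)\<bar> / \<bar>t - s\<bar>" by (simp add: abs_divide)
        also have "\<dots> \<le> 64 / \<epsilon>\<^sup>2 * (t - s)\<^sup>2 / \<bar>t - s\<bar>" by (intro divide_right_mono b(4)[OF st]) auto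
        also have "(t - s)\<^sup>2 = \<bar>t - s\<bar> * \<bar>t - s\<bar>" by (simp add: power2_eq_square)
        also have "64 / \<epsilon>\<^sup>2 * (\<bar>t - s\<bar> * \<bar>t - s\<bar>) / \<bar>t - s\<bar> = 64 / \<epsilon>\<^sup>2 * \<bar>t - s\<bar>"
        proof -
          have "c * (r * r) / r = c * r" if "r \<noteq> 0" for c r :: real using that by simp
          from this[of "\<bar>t - s\<bar>"] show ?thesis using t by (simp only: abs_eq_0 right_minus_eq not_False_eq_True)
        qed
        finally show ?thesis .
      qed
      have b1: "\<bar>1 / (t - s) * (pw \<epsilon> t n - pw \<epsilon> s n)\<bar> \<le> \<bar>1 / (t - s)\<bar> * 2" for n
        using b(1)[OF st(1) st(1), of n] b(1)[OF st(2) st(2), of n] unfolding abs_mult by (intro mult_left_mono) auto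
      have b2: "\<bar>pw \<epsilon> t n\<bar> \<le> 1" "\<bar>pw \<epsilon> s n\<bar> \<le> 1" for n using b(1)[OF st(1) st(1), of n] b(1)[OF st(2) st(2), of n] by auto
      have eq: "S \<gamma> (A0 q p) X = (S (pw \<epsilon> t) (A0 q p) X - S (pw \<epsilon> s) (A0 q p) X) / (t - s) - S (pw' \<epsilon> s) (A0 q p) X" if "p \<in> I" for q p
        unfolding \<gamma>_def S_gamma_diff[OF controlled_A(1)[OF that] b1 b(2)[OF st(1) st(1)] X] S_gamma_cmult
          S_gamma_diff[OF controlled_A(1)[OF that] b2 X] by simp
      have "T3 \<alpha> (\<lambda>x. ((case x of (q, p) \<Rightarrow> S (pw \<epsilon> t) (A0 q p) X) - (case x of (q, p) \<Rightarrow> S (pw \<epsilon> s) (A0 q p) X)) / (t - s)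
      - (case x of (q, p) \<Rightarrow> S (pw' \<epsilon> s) (A0 q p) X))
         (\<lambda>(q, p). S \<gamma> (A1 q p) X) (\<lambda>(q, p). S \<gamma> (A2 q p) X) (64 / \<epsilon>\<^sup>2 * \<bar>t - s\<bar> * K)"
        by (rule T3_cong[OF S_T3[OF g X \<alpha>]]) (simp_all add: eq)
      from T3_cell_norm[OF this \<alpha>]
      show "norm (C1_holder_norm \<alpha> cell (\<lambda>x. ((case x of (q, p) \<Rightarrow> S (pw \<epsilon> t) (A0 q p) X) - (case x of (q, p) \<Rightarrow> S (pw \<epsilon> s) (A0 q p) X)) / (t - s)
      - (case x of (q, p) \<Rightarrow> S (pw' \<epsilon> s) (A0 q p) X)))
       \<le> 7 * (64 / \<epsilon>\<^sup>2 * \<bar>t - s\<bar> * K)" by simp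
    qed
  qed
qed

lemma S_C1_differentiable:
  assumes e: "0 < \<epsilon>" and X: "hb \<alpha> X K" and a: "controlled \<alpha> R a" and J: "J \<subseteq> {- \<epsilon> / 4<..<\<epsilon> / 4}"
  shows "(\<lambda>s. S (pw \<epsilon> s) a X) C1_differentiable_on J"
  unfolding C1_differentiable_on_def
proof (intro exI[of _ "\<lambda>s. S (pw' \<epsilon> s) a X"] conjI ballI)
  have J': "\<bar>s\<bar> \<le> \<epsilon> / 4" if "s \<in> {- \<epsilon> / 4<..<\<epsilon> / 4}" for s using that by (auto simp: abs_le_iff)
  note b = pw_bounds[OF e]
  define C where "C = 64 / \<epsilon>\<^sup>2 * R * K"
  have lip: "\<bar>S (pw' \<epsilon> t) a X - S (pw' \<epsilon> s) a X\<bar> \<le> C * \<bar>t - s\<bar>" if "s \<in> {- \<epsilon> / 4<..<\<epsilon> / 4}" "t \<in> {- \<epsilon> / 4<..<\<epsilon> / 4}" for s t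
    using S_bound(2)[OF a b(3)[OF J'[OF that(1)] J'[OF that(2)]] X]
    unfolding S_gamma_diff[OF a b(2)[OF J'[OF that(2)] J'[OF that(2)]] b(2)[OF J'[OF that(1)] J'[OF that(1)]] X]
    by (simp add: C_def mult.commute mult.left_commute)
  have "continuous_on {- \<epsilon> / 4<..<\<epsilon> / 4} (\<lambda>s. S (pw' \<epsilon> s) a X)"
    unfolding continuous_on_def
  proof
    fix s assume s: "s \<in> {- \<epsilon> / 4<..<\<epsilon> / 4}"
    have "((\<lambda>t. S (pw' \<epsilon> t) a X - S (pw' \<epsilon> s) a X) \<longlongrightarrow> 0) (at s within {- \<epsilon> / 4<..<\<epsilon> / 4})"
    proof (rule Lim_null_comparison)
      show "\<forall>\<^sub>F t in at s within {- \<epsilon> / 4<..<\<epsilon> / 4}. norm (S (pw' \<epsilon> t) a X - S (pw' \<epsilon> s) a X) \<le> C * \<bar>t - s\<bar>"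
        unfolding eventually_at_filter using lip[OF s] by (intro always_eventually) auto
      show "((\<lambda>t. C * \<bar>t - s\<bar>) \<longlongrightarrow> 0) (at s within {- \<epsilon> / 4<..<\<epsilon> / 4})"
        by (rule tendsto_eq_intros refl | simp)+
    qed
    then show "((\<lambda>s. S (pw' \<epsilon> s) a X) \<longlongrightarrow> S (pw' \<epsilon> s) a X) (at s within {- \<epsilon> / 4<..<\<epsilon> / 4})"
      by (simp add: LIM_zero_iff)
  qed
  then show "continuous_on J (\<lambda>s. S (pw' \<epsilon> s) a X)" by (rule continuous_on_subset[OF _ J])
  fix s assume "s \<in> J"
  then have s: "s \<in> {- \<epsilon> / 4<..<\<epsilon> / 4}" using J by blast
  have "((\<lambda>s. S (pw \<epsilon> s) a X) has_derivative (\<lambda>h. h * S (pw' \<epsilon> s) a X)) (at s within {- \<epsilon> / 4<..<\<epsilon> / 4})"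
  proof (rule has_derivativeI_sandwich[where e = 1 and H = "\<lambda>t. C * \<bar>t - s\<bar>"])
    show "bounded_linear (\<lambda>h. h * S (pw' \<epsilon> s) a X)" by (rule bounded_linear_mult_left)
    show "((\<lambda>t. C * \<bar>t - s\<bar>) \<longlongrightarrow> 0) (at s within {- \<epsilon> / 4<..<\<epsilon> / 4})"
      by (rule tendsto_eq_intros refl | simp)+
    fix t assume t: "t \<in> {- \<epsilon> / 4<..<\<epsilon> / 4}" "t \<noteq> s"
    note st = J'[OF s] J'[OF t(1)]
    have b1: "\<bar>pw \<epsilon> t n - pw \<epsilon> s n\<bar> \<le> 2" for n
      using b(1)[OF st(1) st(1), of n] b(1)[OF st(2) st(2), of n] by linarith
    have b2: "\<bar>(t - s) * pw' \<epsilon> s n\<bar> \<le> \<bar>t - s\<bar> * (4 / \<epsilon>)" for n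
      unfolding abs_mult by (intro mult_left_mono b(2)[OF st(1) st(1)]) auto
    have b3: "\<bar>pw \<epsilon> t n\<bar> \<le> 1" "\<bar>pw \<epsilon> s n\<bar> \<le> 1" for n using b(1)[OF st(1) st(1), of n] b(1)[OF st(2) st(2), of n] by auto
    have b4: "\<bar>pw \<epsilon> t n - pw \<epsilon> s n - (t - s) * pw' \<epsilon> s n\<bar> \<le> 64 / \<epsilon>\<^sup>2 * (t - s)\<^sup>2" for n
      using b(4)[OF st, of n] by (simp add: mult.commute)
    have "\<bar>S (pw \<epsilon> t) a X - S (pw \<epsilon> s) a X - (t - s) * S (pw' \<epsilon> s) a X\<bar> \<le> 64 / \<epsilon>\<^sup>2 * (t - s)\<^sup>2 * R * K"
      using S_bound(2)[OF a b4 X]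
      unfolding S_gamma_diff[OF a b1 b2 X] S_gamma_cmult S_gamma_diff[OF a b3 X] .
    also have "\<dots> = C * \<bar>t - s\<bar> * \<bar>t - s\<bar>" by (simp add: C_def power2_eq_square)
    finally show "norm (S (pw \<epsilon> t) a X - S (pw \<epsilon> s) a X - (t - s) * S (pw' \<epsilon> s) a X) / norm (t - s) \<le> C * \<bar>t - s\<bar>"
      using t by (simp add: divide_le_eq)
  qed simp
  then show "((\<lambda>s. S (pw \<epsilon> s) a X) has_vector_derivative S (pw' \<epsilon> s) a X) (at s)"
    using s by (simp add: has_vector_derivative_def at_within_open[OF _ open_greaterThanLessThan])
qed

section \<open>Weak equations\<close>

lemma smoothD:
  assumes "smooth f"
  shows "f differentiable (at x)" "b \<in> Basis \<Longrightarrow> smooth (\<lambda>x. frechet_derivative f (at x) b)"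
  using assms by (auto elim: smooth.cases)

lemma smooth_continuous: "smooth f \<Longrightarrow> continuous_on T f"
  using smoothD(1) differentiable_imp_continuous_within by (blast intro: continuous_at_imp_continuous_on)

lemma smooth_partial_derivatives:
  fixes \<phi> :: "real \<times> real \<Rightarrow> real"
  assumes "smooth \<phi>"
  shows "((\<lambda>q. \<phi> (q, p)) has_real_derivative frechet_derivative \<phi> (at (q, p)) (1, 0)) (at q)"
    and "((\<lambda>p. \<phi> (q, p)) has_real_derivative frechet_derivative \<phi> (at (q, p)) (0, 1)) (at p)"
proof -
  have d: "(\<phi> has_derivative frechet_derivative \<phi> (at x)) (at x)" for x
    using smoothD(1)[OF assms] by (simp add: frechet_derivative_works)
  have l: "frechet_derivative \<phi> (at (q, p)) (h *\<^sub>R x) = h *\<^sub>R frechet_derivative \<phi> (at (q, p)) x" for h x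
    by (rule linear_scale[OF has_derivative_linear[OF d[of "(q, p)"]]])
  have "((\<lambda>q. (q, p)) has_derivative (\<lambda>h. (h, 0))) (at q)"
    by (rule has_derivative_Pair[OF has_derivative_ident has_derivative_const])
  from diff_chain_at[OF this d[of "(q, p)"]]
  have 1: "((\<lambda>q. \<phi> (q, p)) has_derivative (\<lambda>h. frechet_derivative \<phi> (at (q, p)) (h, 0))) (at q)"
    by (simp only: o_def)
  have e1: "frechet_derivative \<phi> (at (q, p)) (h, 0) = frechet_derivative \<phi> (at (q, p)) (1, 0) * h" for h
  proof -
    have e: "(h, 0) = h *\<^sub>R (1 :: real, 0 :: real)" by simp
    show ?thesis unfolding e l real_scaleR_def by (rule mult.commute)
  qed
  show "((\<lambda>q. \<phi> (q, p)) has_real_derivative frechet_derivative \<phi> (at (q, p)) (1, 0)) (at q)"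
    unfolding has_field_derivative_def by (rule has_derivative_eq_rhs[OF 1]) (rule ext, rule e1)
  have "((\<lambda>p. (q, p)) has_derivative (\<lambda>h. (0, h))) (at p)"
    by (rule has_derivative_Pair[OF has_derivative_const has_derivative_ident])
  from diff_chain_at[OF this d[of "(q, p)"]]
  have 2: "((\<lambda>p. \<phi> (q, p)) has_derivative (\<lambda>h. frechet_derivative \<phi> (at (q, p)) (0, h))) (at p)"
    by (simp only: o_def)
  have e2: "frechet_derivative \<phi> (at (q, p)) (0, h) = frechet_derivative \<phi> (at (q, p)) (0, 1) * h" for h
  proof -
    have e: "(0, h) = h *\<^sub>R (0 :: real, 1 :: real)" by simp
    show ?thesis unfolding e l real_scaleR_def by (rule mult.commute)
  qed
  show "((\<lambda>p. \<phi> (q, p)) has_real_derivative frechet_derivative \<phi> (at (q, p)) (0, 1)) (at p)"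
    unfolding has_field_derivative_def by (rule has_derivative_eq_rhs[OF 2]) (rule ext, rule e2)
qed

lemma frechet_derivative_zero_outside:
  assumes "\<And>x. x \<notin> K \<Longrightarrow> \<phi> x = 0" "closed K" "x \<notin> K"
  shows "frechet_derivative \<phi> (at x) = (\<lambda>_. 0)"
proof -
  have "(\<phi> has_derivative (\<lambda>_. 0)) (at x)"
    by (rule has_derivative_transform_within_open[where f = "\<lambda>_. 0" and s = "- K"]) (use assms in auto)
  then show ?thesis by (rule frechet_derivative_at[symmetric])
qed

lemma integral_derivative_zero:
  fixes u u' :: "real \<Rightarrow> real"
  assumes "a \<le> b" "\<And>x. x \<in> {a..b} \<Longrightarrow> (u has_real_derivative u' x) (at x)" "\<And>x. x \<in> {a..b} \<Longrightarrow> isCont u' x"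
    "u a = 0" "u b = 0" "\<And>x. x \<notin> {a..b} \<Longrightarrow> v x = 0" "\<And>x. x \<in> {a..b} \<Longrightarrow> v x = u' x"
  shows "(LINT x|lborel. v x) = 0"
proof -
  have "(LINT x|lborel. v x) = (LINT x|lborel. u' x * indicator {a..b} x)"
  proof (rule Bochner_Integration.integral_cong[OF refl])
    show "v x = u' x * indicator {a..b} x" for x
      using assms(6,7)[of x] by (cases "x \<in> {a..b}") simp_all
  qed
  also have "\<dots> = u b - u a"
    by (rule integral_FTC_Icc_real[OF assms(1)]) (simp_all add: assms(2,3))
  finally show ?thesis by (simp add: assms(4,5))
qed

text \<open>Each component has to be differentiable in its own variable only. By Fubini,
  \<open>F1 * \<phi>1 + E * \<phi>\<close> is integrated first in q and
  \<open>F2 * \<phi>2 - E * \<phi>\<close> first in p, where each is the derivative of a compactly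
  supported product; the terms with \<open>E\<close> cancel in the sum.\<close>

lemma distrib_div_eq_classical:
  fixes F1 F2 E :: "real \<times> real \<Rightarrow> real"
  assumes cF1: "continuous_on open_strip F1" and cF2: "continuous_on open_strip F2" and cE: "continuous_on open_strip E"
    and d1: "\<And>q p. p \<in> {-1<..<0} \<Longrightarrow> ((\<lambda>q. F1 (q, p)) has_real_derivative E (q, p)) (at q)"
    and d2: "\<And>q p. p \<in> {-1<..<0} \<Longrightarrow> ((\<lambda>p. F2 (q, p)) has_real_derivative - E (q, p)) (at p)"
  shows "distrib_div_eq open_strip (\<lambda>x. (F1 x, F2 x)) (\<lambda>x. 0)"
  unfolding distrib_div_eq_def
proof (intro allI impI)
  fix \<phi> :: "real \<times> real \<Rightarrow> real" assume "test_function open_strip \<phi>"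
  then obtain K where sm: "smooth \<phi>" and K: "compact K" "K \<subseteq> open_strip" "\<And>x. x \<notin> K \<Longrightarrow> \<phi> x = 0"
    unfolding test_function_def by blast
  define \<phi>1 \<phi>2 where "\<phi>1 x = frechet_derivative \<phi> (at x) (1, 0)" and "\<phi>2 x = frechet_derivative \<phi> (at x) (0, 1)" for x
  have B: "(1, 0) \<in> (Basis :: (real \<times> real) set)" "(0, 1) \<in> (Basis :: (real \<times> real) set)" by (auto simp: Basis_prod_def)
  have c: "continuous_on T \<phi>" "continuous_on T \<phi>1" "continuous_on T \<phi>2" for T
    unfolding \<phi>1_def \<phi>2_def using smooth_continuous[OF sm] smooth_continuous[OF smoothD(2)[OF sm B(1)]]
      smooth_continuous[OF smoothD(2)[OF sm B(2)]] by auto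
  have z: "\<phi> x = 0" "\<phi>1 x = 0" "\<phi>2 x = 0" if "x \<notin> K" for x
    using K(3)[OF that] frechet_derivative_zero_outside[OF K(3) compact_imp_closed[OF K(1)] that] by (auto simp: \<phi>1_def \<phi>2_def)
  have dphi: "((\<lambda>q. \<phi> (q, p)) has_real_derivative \<phi>1 (q, p)) (at q)" "((\<lambda>p. \<phi> (q, p)) has_real_derivative \<phi>2 (q, p)) (at p)" for q p
    using smooth_partial_derivatives[OF sm] by (auto simp: \<phi>1_def \<phi>2_def)
  have cK: "continuous_on K F1" "continuous_on K F2" "continuous_on K E"
    using K(2) cF1 cF2 cE by (auto intro: continuous_on_subset)
  define H1 H2 where "H1 x = indicator K x *\<^sub>R (F1 x * \<phi>1 x + E x * \<phi> x)" and "H2 x = indicator K x *\<^sub>R (F2 x * \<phi>2 x - E x * \<phi> x)" for x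
  have i1: "integrable lborel H1" and i2: "integrable lborel H2"
    unfolding H1_def H2_def by (intro borel_integrable_compact K(1) continuous_intros cK c)+
  have lin: "frechet_derivative \<phi> (at x) (F1 x, F2 x) = F1 x * \<phi>1 x + F2 x * \<phi>2 x" for x
  proof -
    have l: "linear (frechet_derivative \<phi> (at x))"
      using smoothD(1)[OF sm, of x] unfolding frechet_derivative_works by (rule has_derivative_linear)
    have "(F1 x, F2 x) = F1 x *\<^sub>R (1, 0) + F2 x *\<^sub>R (0, 1 :: real)" by simp
    then show ?thesis unfolding \<phi>1_def \<phi>2_def by (simp only: linear_add[OF l] linear_scale[OF l] real_scaleR_def)
  qed
  have "(LINT x:open_strip|lborel. frechet_derivative \<phi> (at x) (F1 x, F2 x)) = (LINT x|lborel. H1 x + H2 x)"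
    unfolding set_lebesgue_integral_def
  proof (rule Bochner_Integration.integral_cong[OF refl])
    show "indicator open_strip x *\<^sub>R frechet_derivative \<phi> (at x) (F1 x, F2 x) = H1 x + H2 x" for x
      using K(2) z[of x] by (cases "x \<in> K") (auto simp: lin H1_def H2_def)
  qed
  also have "\<dots> = (LINT x|lborel. H1 x) + (LINT x|lborel. H2 x)" by (rule Bochner_Integration.integral_add[OF i1 i2])
  also have "(LINT x|lborel. H1 x) = 0"
  proof -
    obtain R where R: "\<And>x. x \<in> K \<Longrightarrow> norm x \<le> R" using compact_imp_bounded[OF K(1)] by (auto simp: bounded_iff)
    have R': "(q, p) \<notin> K" if "\<bar>q\<bar> > R" for q p
      using R[of "(q, p)"] norm_fst_le[of q p] that by force
    have "(LINT p|lborel. (LINT q|lborel. H1 (q, p))) = (LINT x|lborel. H1 x)"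
      using lborel_pair.integral_snd[of "\<lambda>q p. H1 (q, p)"] i1 by (simp add: lborel_prod)
    moreover have "(LINT q|lborel. H1 (q, p)) = 0" for p
    proof (cases "p \<in> {-1<..<0}")
      case True
      have op: "open open_strip" by (auto simp: open_strip_def intro: open_Times)
      have ic: "isCont (\<lambda>q. G (q, p)) q" if "continuous_on open_strip G" for G :: "real \<times> real \<Rightarrow> real" and q
      proof -
        have "isCont G (q, p)" 
          by (rule continuous_on_eq_continuous_at[OF op, THEN iffD1, rule_format, OF that])
             (use True in \<open>simp add: open_strip_def\<close>)
        then show ?thesis by (intro isCont_o2[where g = G and f = "\<lambda>q. (q, p)"]) (auto intro!: continuous_intros)
      qed
      show ?thesis
      proof (rule integral_derivative_zero[where a = "- \<bar>R\<bar> - 1" and b = "\<bar>R\<bar> + 1" and u = "\<lambda>q. F1 (q, p) * \<phi> (q, p)"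
            and u' = "\<lambda>q. F1 (q, p) * \<phi>1 (q, p) + E (q, p) * \<phi> (q, p)"])
        show "((\<lambda>q. F1 (q, p) * \<phi> (q, p)) has_real_derivative F1 (q, p) * \<phi>1 (q, p) + E (q, p) * \<phi> (q, p)) (at q)" for q
          by (rule derivative_eq_intros d1[OF True] dphi refl)+ simp
        show "isCont (\<lambda>q. F1 (q, p) * \<phi>1 (q, p) + E (q, p) * \<phi> (q, p)) q" for q
          by (intro continuous_intros ic cF1 cE c)
        show "F1 (- \<bar>R\<bar> - 1, p) * \<phi> (- \<bar>R\<bar> - 1, p) = 0" "F1 (\<bar>R\<bar> + 1, p) * \<phi> (\<bar>R\<bar> + 1, p) = 0"
          using z(1)[OF R'] by auto
        show "H1 (q, p) = 0" if "q \<notin> {- \<bar>R\<bar> - 1..\<bar>R\<bar> + 1}" for q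
        proof -
          have "\<bar>q\<bar> > R" using that by auto
          then show ?thesis using R' by (simp add: H1_def)
        qed
        show "H1 (q, p) = F1 (q, p) * \<phi>1 (q, p) + E (q, p) * \<phi> (q, p)" for q
          using z[of "(q, p)"] by (auto simp: H1_def indicator_def)
      qed simp
    next
      case False
      then have "H1 (q, p) = 0" for q using K(2) by (auto simp: H1_def indicator_def open_strip_def)
      then show ?thesis by simp
    qed
    ultimately show ?thesis by simp
  qed
  also have "(LINT x|lborel. H2 x) = 0"
  proof -
    have "compact (snd ` K)" by (intro compact_continuous_image K(1) continuous_on_snd continuous_on_id)
    \<comment> \<open>The derivative of \<open>F2\<close> in p is available in the open interval
      only, so the integration is confined to a compact interval that still contains the
      support.\<close>
    have "\<exists>a b. -1 < a \<and> a < b \<and> b < 0 \<and> snd ` K \<subseteq> {a<..<b}"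
    proof (cases "K = {}")
      case True
      then show ?thesis by (intro exI[of _ "-2/3"] exI[of _ "-1/3"]) auto
    next
      case False
      obtain x where x: "x \<in> snd ` K" "\<And>y. y \<in> snd ` K \<Longrightarrow> x \<le> y"
        using compact_attains_inf[OF \<open>compact (snd ` K)\<close>] False by auto
      obtain y where y: "y \<in> snd ` K" "\<And>x. x \<in> snd ` K \<Longrightarrow> x \<le> y"
        using compact_attains_sup[OF \<open>compact (snd ` K)\<close>] False by auto
      have "-1 < x" "x < 0" "-1 < y" "y < 0" "x \<le> y" using x y K(2) by (auto simp: open_strip_def)
      then show ?thesis using x(2) y(2)
        by (intro exI[of _ "(x - 1) / 2"] exI[of _ "y / 2"]) (force simp: field_simps)
    qed
    then obtain a b where ab: "-1 < a" "a < b" "b < 0" "snd ` K \<subseteq> {a<..<b}" by blast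
    have R': "(q, p) \<notin> K" if "p \<notin> {a<..<b}" for q p using ab(4) that by force
    have "(LINT q|lborel. (LINT p|lborel. H2 (q, p))) = (LINT x|lborel. H2 x)"
      using lborel_pair.integral_fst[of "\<lambda>q p. H2 (q, p)"] i2 by (simp add: lborel_prod)
    moreover have "(LINT p|lborel. H2 (q, p)) = 0" for q
    proof -
      have op: "open open_strip" by (auto simp: open_strip_def intro: open_Times)
      have ic: "isCont (\<lambda>p. G (q, p)) p" if "continuous_on open_strip G" "p \<in> {a..b}" for G :: "real \<times> real \<Rightarrow> real" and p
      proof -
        have "isCont G (q, p)" 
          by (rule continuous_on_eq_continuous_at[OF op, THEN iffD1, rule_format, OF that(1)])
             (use that ab in \<open>simp add: open_strip_def\<close>)
        then show ?thesis by (intro isCont_o2[where g = G and f = "\<lambda>p. (q, p)"]) (auto intro!: continuous_intros)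
      qed
      show ?thesis
      proof (rule integral_derivative_zero[where a = a and b = b and u = "\<lambda>p. F2 (q, p) * \<phi> (q, p)"
            and u' = "\<lambda>p. F2 (q, p) * \<phi>2 (q, p) - E (q, p) * \<phi> (q, p)"])
        show "((\<lambda>p. F2 (q, p) * \<phi> (q, p)) has_real_derivative F2 (q, p) * \<phi>2 (q, p) - E (q, p) * \<phi> (q, p)) (at p)" if "p \<in> {a..b}" for p
        proof -
          have "p \<in> {-1<..<0}" using that ab by auto
          then show ?thesis by (auto intro!: derivative_eq_intros d2 dphi)
        qed
        show "isCont (\<lambda>p. F2 (q, p) * \<phi>2 (q, p) - E (q, p) * \<phi> (q, p)) p" if "p \<in> {a..b}" for p
          by (intro continuous_intros ic cF2 cE c that)
        show "F2 (q, a) * \<phi> (q, a) = 0" "F2 (q, b) * \<phi> (q, b) = 0"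
          using z(1)[OF R'] by auto
        show "H2 (q, p) = 0" if "p \<notin> {a..b}" for p
          using R'[of p q] that by (auto simp: H2_def indicator_def)
        show "H2 (q, p) = F2 (q, p) * \<phi>2 (q, p) - E (q, p) * \<phi> (q, p)" for p
          using z[of "(q, p)"] by (auto simp: H2_def indicator_def)
      qed (use ab in simp)
    qed
    ultimately show ?thesis by simp
  qed
  finally show "(LINT x:open_strip|lborel. frechet_derivative \<phi> (at x) (F1 x, F2 x)) = - (LINT x:open_strip|lborel. 0 * \<phi> x)"
    by simp
qed

section \<open>The Sturm--Liouville problem\<close>

text \<open>The functions \<open>exp (- 1 / x) / x^k\<close> on the positive half line, continued by
  0. Derivatives are combinations of members of the same family, so smoothness at 0 reduces to a
  single limit.\<close>

definition bexp :: "nat \<Rightarrow> real \<Rightarrow> real" where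
  "bexp k x = (if 0 < x then exp (- (1 / x)) * (1 / x) ^ k else 0)"

lemma bexp_tendsto_0: "(bexp k \<longlongrightarrow> 0) (at 0)"
proof (rule filterlim_split_at)
  have "((\<lambda>x. inverse x ^ k / exp (inverse x)) \<longlongrightarrow> 0) (at_right (0 :: real))"
    by (rule filterlim_compose[OF tendsto_power_div_exp_0 filterlim_inverse_at_top_right])
  then show "(bexp k \<longlongrightarrow> 0) (at_right 0)"
  proof (rule Lim_transform_eventually)
    show "\<forall>\<^sub>F x in at_right 0. inverse x ^ k / exp (inverse x) = bexp k x"
      unfolding eventually_at_right_field
      by (intro exI[of _ 1]) (simp add: bexp_def exp_minus inverse_eq_divide)
  qed
  show "(bexp k \<longlongrightarrow> 0) (at_left 0)"
    by (rule Lim_transform_eventually[OF tendsto_const])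
       (auto simp: eventually_at_left_field bexp_def intro!: exI[of _ "-1"])
qed

lemma DERIV_bexp: "(bexp k has_real_derivative bexp (Suc (Suc k)) x - real k * bexp (Suc k) x) (at x)"
proof -
  consider "x < 0" | "x = 0" | "0 < x" by linarith
  then show ?thesis
  proof cases
    case 1
    have "((\<lambda>_. 0) has_real_derivative 0) (at x)" by simp
    then show ?thesis
      by (rule has_field_derivative_transform_within_open[where S = "{..<0}", THEN DERIV_cong])
         (use 1 in \<open>auto simp: bexp_def\<close>)
  next
    case 2
    have "(bexp k 0 :: real) = 0" by (simp add: bexp_def)
    moreover have "(bexp k h) / h = bexp (Suc k) h" for h by (simp add: bexp_def)
    ultimately show ?thesis using bexp_tendsto_0[of "Suc k"] 2
      by (simp add: DERIV_def bexp_def[of _ 0])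
  next
    case 3
    have "((\<lambda>x. exp (- (1 / x)) * (1 / x) ^ k) has_real_derivative
        exp (- (1 / x)) * (1 / x) ^ (Suc (Suc k)) - real k * (exp (- (1 / x)) * (1 / x) ^ (Suc k))) (at x)"
    proof -
      have y: "((\<lambda>x. 1 / x) has_real_derivative - (1 / x)\<^sup>2) (at x)"
        using 3 by (auto intro!: derivative_eq_intros simp: power2_eq_square)
      have e: "((\<lambda>x. exp (- (1 / x))) has_real_derivative exp (- (1 / x)) * (1 / x)\<^sup>2) (at x)"
        by (rule DERIV_cong[OF DERIV_fun_exp[OF DERIV_minus[OF y]]]) simp
      show ?thesis
        by (rule DERIV_cong[OF DERIV_mult[OF e DERIV_power[OF y, of k]]])
           (cases k; simp add: power2_eq_square algebra_simps del: of_nat_Suc)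
    qed
    then show ?thesis
      by (rule has_field_derivative_transform_within_open[where S = "{0<..}", THEN DERIV_cong])
         (use 3 in \<open>auto simp: bexp_def\<close>)
  qed
qed

text \<open>A class of functions closed under differentiation. As \<open>smooth\<close> is
  coinductive, this closure is all that smoothness requires.\<close>

inductive bump_fun :: "(real \<Rightarrow> real) \<Rightarrow> bool" where
  "bump_fun (\<lambda>_. r)"
| "bump_fun (\<lambda>x. bexp k (s * x + t))"
| "bump_fun f \<Longrightarrow> bump_fun g \<Longrightarrow> bump_fun (\<lambda>x. f x + g x)"
| "bump_fun f \<Longrightarrow> bump_fun g \<Longrightarrow> bump_fun (\<lambda>x. f x * g x)"

lemma bump_fun_deriv:
  assumes "bump_fun f"
  shows "\<exists>f'. bump_fun f' \<and> (\<forall>x. (f has_real_derivative f' x) (at x))"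
  using assms
proof induction
  case (1 r)
  show ?case by (intro exI[of _ "\<lambda>_. 0"]) (auto intro: bump_fun.intros)
next
  case (2 k s t)
  have "bump_fun (\<lambda>x. (bexp (Suc (Suc k)) (s * x + t) + (- real k) * bexp (Suc k) (s * x + t)) * s)"
    by (intro bump_fun.intros)
  moreover have "((\<lambda>x. bexp k (s * x + t)) has_real_derivative
     (bexp (Suc (Suc k)) (s * x + t) + (- real k) * bexp (Suc k) (s * x + t)) * s) (at x)" for x
    by (rule DERIV_chain2[OF DERIV_cong[OF DERIV_bexp]]) (auto intro!: derivative_eq_intros)
  ultimately show ?case by blast
next
  case (3 f g)
  then obtain f' g' where fg: "bump_fun f'" "bump_fun g'" "\<And>x. (f has_real_derivative f' x) (at x)"
    "\<And>x. (g has_real_derivative g' x) (at x)" by blast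
  show ?case
    by (intro exI[of _ "\<lambda>x. f' x + g' x"] conjI allI bump_fun.intros fg DERIV_add)
next
  case (4 f g)
  then obtain f' g' where fg: "bump_fun f'" "bump_fun g'" "\<And>x. (f has_real_derivative f' x) (at x)"
    "\<And>x. (g has_real_derivative g' x) (at x)" by blast
  show ?case
    by (intro exI[of _ "\<lambda>x. f x * g' x + f' x * g x"] conjI allI bump_fun.intros fg 4 DERIV_mult')
qed

lemma frechet_derivative_real:
  "(f has_real_derivative d) (at x) \<Longrightarrow> frechet_derivative f (at x) h = d * h"
  unfolding has_field_derivative_def by (drule frechet_derivative_at) (simp add: fun_eq_iff)

lemma smooth_antiderivative:
  assumes "\<And>x. (F has_real_derivative f x) (at x)" "smooth f"
  shows "smooth F"
proof
  show "F differentiable at x" for x using assms(1) real_differentiable_def by blast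
  show "smooth (\<lambda>x. frechet_derivative F (at x) b)" if "b \<in> Basis" for b
    using assms(2) that by (simp add: frechet_derivative_real[OF assms(1)])
qed

lemma smooth_bump_fun: "bump_fun f \<Longrightarrow> smooth f"
proof (coinduction arbitrary: f rule: smooth.coinduct)
  case (smooth f)
  then obtain f' where f': "bump_fun f'" "\<And>x. (f has_real_derivative f' x) (at x)"
    using bump_fun_deriv by blast
  have "(\<lambda>x. frechet_derivative f (at x) 1) = f'"
    by (simp add: frechet_derivative_real[OF f'(2)])
  then show ?case using f' real_differentiable_def by (auto intro!: exI[of _ f])
qed

text \<open>The primitive is constant on either side of the bump, hence the difference of two of its
  translates has compact support: a test function whose derivative consists of two opposite
  bumps.\<close>

lemma bump_primitive:
  fixes r :: real
  assumes "0 < r"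
  obtains B \<Psi> where "bump_fun B" "\<And>x. (\<Psi> has_real_derivative B x) (at x)" "\<And>x. 0 \<le> B x" "0 < B 0"
    "\<And>x. r \<le> \<bar>x\<bar> \<Longrightarrow> B x = 0" "\<And>x. x \<le> - r \<Longrightarrow> \<Psi> x = 0" "\<And>x. r \<le> x \<Longrightarrow> \<Psi> x = \<Psi> r"
proof -
  define B where "B x = bexp 0 (1 * x + r) * bexp 0 ((-1) * x + r)" for x
  define \<Psi> where "\<Psi> x = integral {- r - 1..x} B" for x
  have B: "bump_fun B" unfolding B_def by (intro bump_fun.intros)
  have B0: "B x = 0" if "r \<le> \<bar>x\<bar>" for x using that by (auto simp: B_def bexp_def)
  have cB: "continuous_on T B" for T
  proof (rule continuous_at_imp_continuous_on, rule ballI)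
    fix x show "isCont B x" using bump_fun_deriv[OF B] DERIV_isCont by blast
  qed
  have left: "\<Psi> x = 0" if "x \<le> - r" for x
  proof -
    have "integral {- r - 1..x} B = integral {- r - 1..x} (\<lambda>_. 0)"
      by (rule integral_cong) (use that B0 assms in auto)
    then show ?thesis by (simp add: \<Psi>_def)
  qed
  have right: "\<Psi> x = \<Psi> r" if "r \<le> x" for x
  proof -
    have "integral {- r - 1..r} B + integral {r..x} B = integral {- r - 1..x} B"
      by (rule Henstock_Kurzweil_Integration.integral_combine)
         (use that assms in \<open>auto intro: integrable_continuous_interval cB\<close>)
    moreover have "integral {r..x} B = integral {r..x} (\<lambda>_. 0)"
      by (rule integral_cong) (use that B0 assms in auto)
    ultimately show ?thesis by (simp add: \<Psi>_def)
  qed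
  have der: "(\<Psi> has_real_derivative B x) (at x)" for x
  proof (cases "x < - r")
    case True
    have "((\<lambda>_. 0) has_real_derivative 0) (at x)" by simp
    then have "(\<Psi> has_real_derivative 0) (at x)"
      by (rule has_field_derivative_transform_within_open[where S = "{..<- r}"]) (use True left in auto)
    then show ?thesis using B0[of x] True assms by simp
  next
    case False
    have "(\<Psi> has_real_derivative B x) (at x within {- r - 1..x + 1})"
      unfolding \<Psi>_def by (rule integral_has_real_derivative[OF cB]) (use False in auto)
    then show ?thesis using at_within_Icc_at[of "- r - 1" x "x + 1"] False by simp
  qed
  have nn: "0 \<le> B x" for x by (simp add: B_def bexp_def)
  have pos: "0 < B 0" using assms by (simp add: B_def bexp_def)
  show thesis
    by (rule that[OF B der nn pos B0 left right])
qed

lemma set_integral_open_unit: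
  fixes f :: "real \<Rightarrow> real"
  assumes "continuous_on I f"
  shows "(LINT x:{-1<..<0}|lborel. f x) = integral I f"
proof -
  have "set_integrable lborel {-1<..<0} f"
    by (rule set_integrable_subset[OF borel_integrable_atLeastAtMost'[OF assms]]) auto
  from set_borel_integral_eq_integral(2)[OF this] show ?thesis
    by (simp add: integral_open_interval_real)
qed

lemma integral_by_FTC:
  fixes F f :: "real \<Rightarrow> real"
  assumes "\<And>x. x \<in> I \<Longrightarrow> (F has_real_derivative f x) (at x within I)"
  shows "integral I f = F 0 - F (-1)"
  by (intro integral_unique fundamental_theorem_of_calculus)
     (use assms in \<open>auto simp: has_real_derivative_iff_has_vector_derivative\<close>)

section \<open>The lemma of du Bois-Reymond\<close>

text \<open>The test function has derivative a bump at \<open>a\<close> minus a bump at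
  \<open>b\<close>. If \<open>G a < G b\<close>, with m the mean of the two values, then
  \<open>\<phi>' * (m - G)\<close> is nonnegative with integral 0, yet positive at
  \<open>a\<close>.\<close>

lemma weak_constant_le:
  fixes G :: "real \<Rightarrow> real"
  assumes cG: "continuous_on I G"
    and weak: "\<And>\<phi> \<phi>'. test_function {-1<..<0} \<phi> \<Longrightarrow> (\<And>x. (\<phi> has_real_derivative \<phi>' x) (at x)) \<Longrightarrow>
       continuous_on UNIV \<phi>' \<Longrightarrow> integral I (\<lambda>x. \<phi>' x * G x) = 0"
    and ab: "a \<in> {-1<..<0}" "b \<in> {-1<..<0}"
  shows "G b \<le> G a"
proof (rule ccontr)
  assume "\<not> G b \<le> G a"
  then have lt: "G a < G b" by simp
  define m where "m = (G a + G b) / 2"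
  have close: "\<exists>r>0. \<forall>x\<in>I. \<bar>x - y\<bar> < r \<longrightarrow> \<bar>G x - G y\<bar> < (G b - G a) / 2" if "y \<in> {-1<..<0}" for y
    using cG[unfolded continuous_on_iff dist_real_def, rule_format, of y "(G b - G a) / 2"] that lt by auto
  obtain ra rb where r: "0 < ra" "0 < rb" "\<And>x. x \<in> I \<Longrightarrow> \<bar>x - a\<bar> < ra \<Longrightarrow> \<bar>G x - G a\<bar> < (G b - G a) / 2"
    "\<And>x. x \<in> I \<Longrightarrow> \<bar>x - b\<bar> < rb \<Longrightarrow> \<bar>G x - G b\<bar> < (G b - G a) / 2"
    using close[OF ab(1)] close[OF ab(2)] by blast
  define lo hi where "lo = min a b" and "hi = max a b"
  have lh: "-1 < lo" "hi < 0" "lo \<le> a" "a \<le> hi" "lo \<le> b" "b \<le> hi" using ab by (auto simp: lo_def hi_def)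
  \<comment> \<open>Narrow enough for the continuity estimates at both points and for the support to
    keep away from the ends of the interval.\<close>
  define r where "r = min (min ra rb) (min ((lo + 1) / 2) (- hi / 2))"
  have r0: "0 < r" and rr: "r \<le> ra" "r \<le> rb" "r \<le> (lo + 1) / 2" "r \<le> - hi / 2" using r(1,2) lh by (simp_all only: r_def min_less_iff_conj) (simp_all add: min_def)
  obtain B \<Psi> where B: "bump_fun B" "\<And>x. (\<Psi> has_real_derivative B x) (at x)" "\<And>x. 0 \<le> B x" "0 < B 0"
    "\<And>x. r \<le> \<bar>x\<bar> \<Longrightarrow> B x = 0" "\<And>x. x \<le> - r \<Longrightarrow> \<Psi> x = 0" "\<And>x. r \<le> x \<Longrightarrow> \<Psi> x = \<Psi> r"
    by (rule bump_primitive[OF r0]) (rule that)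
  define \<phi> where "\<phi> x = \<Psi> (x - a) - \<Psi> (x - b)" for x
  define \<phi>' where "\<phi>' x = B (x - a) - B (x - b)" for x
  have d: "(\<phi> has_real_derivative \<phi>' x) (at x)" for x
    unfolding \<phi>_def \<phi>'_def
    by (intro DERIV_diff DERIV_cong[OF DERIV_chain2[OF B(2)]]) (auto intro!: derivative_eq_intros)
  have sB: "smooth B" by (rule smooth_bump_fun[OF B(1)])
  have cB: "continuous_on UNIV (\<lambda>x. B (x - y))" for y
    by (rule continuous_on_compose2[OF smooth_continuous[OF sB, of UNIV]]) (auto intro!: continuous_intros)
  have c': "continuous_on T \<phi>'" for T
    unfolding \<phi>'_def by (intro continuous_intros continuous_on_subset[OF cB]) auto
  have shift: "bump_fun (\<lambda>x. f (x - y))" if "bump_fun f" for f y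
    using that
  proof induction
    case (2 k s t)
    have "(\<lambda>x. bexp k (s * (x - y) + t)) = (\<lambda>x. bexp k (s * x + (t - s * y)))" by (simp add: algebra_simps)
    then show ?case by (simp only: bump_fun.intros)
  qed (auto intro: bump_fun.intros)
  have "bump_fun (\<lambda>x. B (x - a) + (-1) * B (x - b))"
    by (intro bump_fun.intros shift B)
  then have sm: "smooth \<phi>'" using smooth_bump_fun by (simp add: \<phi>'_def[abs_def])
  have out: "\<phi> x = 0" if "x \<notin> {lo - r..hi + r}" for x
  proof (cases "x < lo - r")
    case True
    then show ?thesis using lh B(6) by (simp add: \<phi>_def)
  next
    case False
    then have "r \<le> x - a" "r \<le> x - b" using that lh by auto
    from B(7)[OF this(1)] B(7)[OF this(2)] show ?thesis by (simp only: \<phi>_def diff_self)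
  qed
  have l0: "lo - r > -1" using rr(3) lh(1) by (simp add: field_simps)
  have h0: "hi + r < 0" using rr(4) lh(2) by (simp add: field_simps)
  have sub: "{lo - r..hi + r} \<subseteq> {-1<..<0}" using l0 h0 by auto
  have test: "test_function {-1<..<0} \<phi>"
    unfolding test_function_def
    by (intro conjI smooth_antiderivative[OF d sm] exI[of _ "{lo - r..hi + r}"] allI impI compact_Icc sub out)
  have z: "\<phi> 0 = 0" "\<phi> (-1) = 0" using out[of 0] out[of "-1"] l0 h0 by auto
  have int0: "integral I \<phi>' = 0"
    using integral_by_FTC[of \<phi> \<phi>', OF has_field_derivative_at_within[OF d]] unfolding z by simp
  have ci: "continuous_on I (\<lambda>x. \<phi>' x * G x)" by (intro continuous_intros c' cG)
  \<comment> \<open>The term with m contributes nothing to the integral, since \<open>\<phi>\<close>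
    vanishes at both ends, but it gives the integrand a sign.\<close>
  define h where "h x = m * \<phi>' x - \<phi>' x * G x" for x
  have ch: "continuous_on I h" unfolding h_def by (intro continuous_intros c' cG)
  have "integral I h = m * integral I \<phi>' - integral I (\<lambda>x. \<phi>' x * G x)"
    unfolding h_def
    by (subst integral_diff) (auto intro!: integrable_continuous_interval continuous_intros c' cG)
  then have ih: "integral I h = 0" using int0 weak[OF test d c'] by simp
  have hB: "h x = B (x - a) * (m - G x) + B (x - b) * (G x - m)" for x by (simp add: h_def \<phi>'_def algebra_simps)
  have h1: "0 \<le> B (x - a) * (m - G x)" if "x \<in> I" for x
  proof (cases "\<bar>x - a\<bar> < r")
    case True
    then have "\<bar>G x - G a\<bar> < (G b - G a) / 2" using r(3)[OF that] rr by simp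
    then have "0 \<le> m - G x" using abs_ge_self[of "G x - G a"] by (simp add: m_def field_simps)
    then show ?thesis using B(3) by simp
  qed (simp add: B(5))
  have h2: "0 \<le> B (x - b) * (G x - m)" if "x \<in> I" for x
  proof (cases "\<bar>x - b\<bar> < r")
    case True
    then have "\<bar>G x - G b\<bar> < (G b - G a) / 2" using r(4)[OF that] rr by simp
    then have "0 \<le> G x - m" using abs_ge_minus_self[of "G x - G b"] by (simp add: m_def field_simps)
    then show ?thesis using B(3) by simp
  qed (simp add: B(5))
  have "h x = 0" if "x \<in> I" for x
    using integral_eq_0_iff[OF ch] ih that h1 h2 by (auto simp: hB)
  then have "h a = 0" using ab by auto
  moreover have "0 < B (a - a) * (m - G a)" using B(4) lt by (simp add: m_def field_simps)
  moreover have "0 \<le> B (a - b) * (G a - m)" using h2[of a] ab by auto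
  ultimately show False unfolding hB by linarith
qed

text \<open>Subtracting a primitive of \<open>f\<close> leaves a continuous function with weak
  derivative zero. It is constant inside by \<open>weak_constant_le\<close> applied in both
  directions, and up to the ends by continuity.\<close>

lemma du_Bois_Reymond:
  fixes F f :: "real \<Rightarrow> real"
  assumes cF: "continuous_on I F" and cf: "continuous_on I f" and w: "distrib_div_eq {-1<..<0} F f"
    and p: "p \<in> I"
  shows "F p = F (-1) + integral {-1..p} f"
proof -
  define K where "K p = integral {-1..p} f" for p
  have dK: "(K has_real_derivative f x) (at x within I)" if "x \<in> I" for x
    unfolding K_def by (rule integral_has_real_derivative[OF cf that])
  have cK: "continuous_on I K"
    unfolding K_def by (rule continuous_on_integral_Icc[OF cf])
  define G where "G x = F x - K x" for x
  have cG: "continuous_on I G" unfolding G_def by (intro continuous_intros cF cK)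
  have weak: "integral I (\<lambda>x. \<phi>' x * G x) = 0"
    if t: "test_function {-1<..<0} \<phi>" and d: "\<And>x. (\<phi> has_real_derivative \<phi>' x) (at x)" and c': "continuous_on UNIV \<phi>'"
    for \<phi> \<phi>'
  proof -
    obtain C where C: "C \<subseteq> {-1<..<0}" "\<And>x. x \<notin> C \<Longrightarrow> \<phi> x = 0" "smooth \<phi>" using t unfolding test_function_def by blast
    have z: "\<phi> 0 = 0" "\<phi> (-1) = 0" using C by force+
    have cI: "continuous_on I \<phi>'" "continuous_on I \<phi>" using c' smooth_continuous[OF C(3)] by (auto intro: continuous_on_subset)
    have "(LINT x:{-1<..<0}|lborel. frechet_derivative \<phi> (at x) (F x)) = - (LINT x:{-1<..<0}|lborel. f x * \<phi> x)"
      using w t unfolding distrib_div_eq_def by blast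
    then have 1: "integral I (\<lambda>x. \<phi>' x * F x) = - integral I (\<lambda>x. f x * \<phi> x)"
      unfolding frechet_derivative_real[OF d]
      by (simp add: set_integral_open_unit continuous_on_mult cI cF cf)
    have "integral I (\<lambda>x. \<phi>' x * K x + f x * \<phi> x) = \<phi> 0 * K 0 - \<phi> (-1) * K (-1)"
    proof (rule integral_by_FTC)
      fix x :: real assume x: "x \<in> I"
      show "((\<lambda>x. \<phi> x * K x) has_real_derivative \<phi>' x * K x + f x * \<phi> x) (at x within I)"
        by (rule DERIV_cong[OF DERIV_mult[OF has_field_derivative_at_within[OF d] dK[OF x]]]) simp
    qed
    then have 2: "integral I (\<lambda>x. \<phi>' x * K x) + integral I (\<lambda>x. f x * \<phi> x) = 0"
      using z by (subst integral_add[symmetric]) (auto intro!: integrable_continuous_interval continuous_intros cI cK cf)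
    have "integral I (\<lambda>x. \<phi>' x * G x) = integral I (\<lambda>x. \<phi>' x * F x) - integral I (\<lambda>x. \<phi>' x * K x)"
      unfolding G_def right_diff_distrib
      by (rule integral_diff) (auto intro!: integrable_continuous_interval continuous_intros cI cK cF)
    then show ?thesis using 1 2 by simp
  qed
  have cst: "G x = G (-1/2)" if "x \<in> {-1<..<0}" for x
  proof -
    have le: "G b \<le> G a" if "a \<in> {-1<..<0}" "b \<in> {-1<..<0}" for a b
      by (rule weak_constant_le[OF cG _ that]) (rule weak; assumption)
    show ?thesis by (rule antisym; rule le) (use that in auto)
  qed
  have clo: "closure {-1<..<0} = I" by simp
  have "G x = G (-1/2)" if "x \<in> I" for x
    by (rule continuous_constant_on_closure[of "{-1<..<0}" G, unfolded clo, OF cG _ that]) (rule cst)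
  from trans[OF this[OF p] this[of "-1", symmetric]] have "G p = G (-1)" by simp
  then show ?thesis by (simp add: G_def K_def)
qed

section \<open>Rules for Hoelder functions\<close>

lemma holder_continuous_on:
  assumes "f \<in> holder \<alpha> T" "0 < \<alpha>"
  shows "continuous_on T f"
proof -
  obtain C where C: "\<And>x y. x \<in> T \<Longrightarrow> y \<in> T \<Longrightarrow> \<bar>f x - f y\<bar> \<le> C * dist x y powr \<alpha>"
    using assms(1) unfolding holder_def by blast
  show ?thesis unfolding continuous_on_iff
  proof (intro ballI allI impI)
    fix x :: 'a and e :: real assume x: "x \<in> T" and e: "0 < e"
    define \<delta> where "\<delta> = (e / (\<bar>C\<bar> + 1)) powr (1 / \<alpha>)"
    have "0 < \<delta>" using e by (simp add: \<delta>_def)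
    moreover have "dist (f y) (f x) < e" if y: "y \<in> T" "dist y x < \<delta>" for y
    proof -
      have "dist y x powr \<alpha> < \<delta> powr \<alpha>" using y assms(2) by (intro powr_less_mono2) auto
      also have "\<dots> = e / (\<bar>C\<bar> + 1)" using e assms(2) by (simp add: \<delta>_def powr_powr)
      finally have lt: "dist y x powr \<alpha> * (\<bar>C\<bar> + 1) < e" by (simp add: pos_less_divide_eq)
      have "\<bar>f y - f x\<bar> \<le> C * dist y x powr \<alpha>" by (rule C[OF y(1) x])
      also have "\<dots> \<le> dist y x powr \<alpha> * (\<bar>C\<bar> + 1)"
        by (subst mult.commute) (intro mult_left_mono, auto)
      finally show ?thesis using lt by (simp add: dist_real_def)
    qed
    ultimately show "\<exists>d>0. \<forall>y\<in>T. dist y x < d \<longrightarrow> dist (f y) (f x) < e" by blast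
  qed
qed

lemma holder_const: "(\<lambda>_. r) \<in> holder \<alpha> T"
  unfolding holder_def by (auto simp: image_constant_conv intro: exI[of _ 0])

lemma holder_bounded:
  assumes "f \<in> holder \<alpha> T"
  obtains A where "\<And>x. x \<in> T \<Longrightarrow> \<bar>f x\<bar> \<le> A"
  using assms unfolding holder_def bounded_iff by (auto intro: that)

lemma holder_mult:
  assumes "f \<in> holder \<alpha> T" "g \<in> holder \<alpha> T"
  shows "(\<lambda>x. f x * g x) \<in> holder \<alpha> T"
proof -
  obtain A where A: "\<And>x. x \<in> T \<Longrightarrow> \<bar>f x\<bar> \<le> A" by (rule holder_bounded[OF assms(1)]) (rule that)
  obtain B where B: "\<And>x. x \<in> T \<Longrightarrow> \<bar>g x\<bar> \<le> B" by (rule holder_bounded[OF assms(2)]) (rule that)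
  note AB = A B
  obtain K L where KL: "\<And>x y. x \<in> T \<Longrightarrow> y \<in> T \<Longrightarrow> \<bar>f x - f y\<bar> \<le> K * dist x y powr \<alpha>"
    "\<And>x y. x \<in> T \<Longrightarrow> y \<in> T \<Longrightarrow> \<bar>g x - g y\<bar> \<le> L * dist x y powr \<alpha>"
    using assms unfolding holder_def by blast
  have "\<bar>f x * g x\<bar> \<le> A * B" if "x \<in> T" for x
    unfolding abs_mult using AB[OF that] by (intro mult_mono) auto
  then have "bounded ((\<lambda>x. f x * g x) ` T)" unfolding bounded_iff by auto
  moreover have "\<bar>f x * g x - f y * g y\<bar> \<le> (A * L + B * K) * dist x y powr \<alpha>" if xy: "x \<in> T" "y \<in> T" for x y
  proof -
    have "f x * g x - f y * g y = f x * (g x - g y) + g y * (f x - f y)" by (simp add: algebra_simps)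
    then have "\<bar>f x * g x - f y * g y\<bar> \<le> \<bar>f x\<bar> * \<bar>g x - g y\<bar> + \<bar>g y\<bar> * \<bar>f x - f y\<bar>"
      using abs_triangle_ineq[of "f x * (g x - g y)" "g y * (f x - f y)"] by (simp add: abs_mult)
    also have "\<dots> \<le> A * (L * dist x y powr \<alpha>) + B * (K * dist x y powr \<alpha>)"
      using AB(1)[OF xy(1)] AB(2)[OF xy(2)] KL(1)[OF xy] KL(2)[OF xy] by (intro add_mono mult_mono) auto
    finally show ?thesis by (simp add: algebra_simps)
  qed
  ultimately show ?thesis unfolding holder_def by blast
qed

lemma holder_Lipschitz_image:
  assumes "f \<in> holder \<alpha> T" "\<And>x. x \<in> T \<Longrightarrow> \<bar>h x\<bar> \<le> A" "0 \<le> L"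
    "\<And>x y. x \<in> T \<Longrightarrow> y \<in> T \<Longrightarrow> \<bar>h x - h y\<bar> \<le> L * \<bar>f x - f y\<bar>"
  shows "h \<in> holder \<alpha> T"
proof -
  obtain K where K: "\<And>x y. x \<in> T \<Longrightarrow> y \<in> T \<Longrightarrow> \<bar>f x - f y\<bar> \<le> K * dist x y powr \<alpha>"
    using assms(1) unfolding holder_def by blast
  have "bounded (h ` T)" using assms(2) unfolding bounded_iff by auto
  moreover have "\<bar>h x - h y\<bar> \<le> L * K * dist x y powr \<alpha>" if "x \<in> T" "y \<in> T" for x y
    using assms(4)[OF that] mult_left_mono[OF K[OF that] assms(3)] by (simp add: mult.assoc)
  ultimately show ?thesis unfolding holder_def by blast
qed

lemma holder_eb:
  assumes "f \<in> holder \<alpha> I" "0 < \<alpha>"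
  shows "\<exists>K. eb \<alpha> 0 (mkc f) K"
proof -
  have c: "continuous_on I f" by (rule holder_continuous_on[OF assms])
  obtain L where L: "\<And>x y. x \<in> I \<Longrightarrow> y \<in> I \<Longrightarrow> \<bar>f x - f y\<bar> \<le> L * dist x y powr \<alpha>"
    using assms(1) unfolding holder_def by blast
  have "eb \<alpha> 0 (mkc f) (norm (mkc f) + \<bar>L\<bar>)"
  proof (rule eb_I[OF order_refl abs_ge_zero _ order_refl])
    fix p q :: real assume pq: "p \<in> I" "q \<in> I"
    have "\<bar>f p - f q\<bar> \<le> L * dist p q powr \<alpha>" by (rule L[OF pq])
    also have "\<dots> \<le> \<bar>L\<bar> * dist p q powr \<alpha>" by (intro mult_right_mono) auto
    finally show "\<bar>mkc f p - mkc f q\<bar> \<le> 2 ^ 0 * \<bar>L\<bar> * \<bar>p - q\<bar> powr \<alpha>"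
      using pq by (simp add: mkc_apply[OF c] dist_real_def)
  qed
  then show ?thesis by blast
qed

lemma at_I_nontrivial: "p \<in> I \<Longrightarrow> at p within I \<noteq> bot"
  unfolding trivial_limit_within by (simp add: connected_imp_perfect)

lemma pd_on_I_unique:
  assumes "(f has_real_derivative d) (at p within I)" "p \<in> I"
  shows "pd_on I 1 f p = d"
proof -
  have "(f has_derivative (*) d) (at p within I)" using assms(1) by (simp add: has_field_derivative_def)
  then have "f differentiable (at p within I)" by (rule differentiableI)
  then have fd: "(f has_derivative frechet_derivative f (at p within I)) (at p within I)"
    by (simp only: frechet_derivative_works)
  have "frechet_derivative f (at p within I) h = pd_on I 1 f p * h" for h
    using linear_scale[OF has_derivative_linear[OF fd], of h 1] by (simp add: pd_on_def)
  then have "frechet_derivative f (at p within I) = (*) (pd_on I 1 f p)" by auto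
  with fd have "(f has_real_derivative pd_on I 1 f p) (at p within I)" by (simp add: has_field_derivative_def)
  moreover have "at p within I \<noteq> bot" by (rule at_I_nontrivial[OF assms(2)])
  ultimately show ?thesis using has_field_derivative_unique assms(1) by blast
qed

lemma C1_holder_I:
  assumes "N \<in> C1_holder \<alpha> I"
  shows "p \<in> I \<Longrightarrow> (N has_real_derivative pd_on I 1 N p) (at p within I)" "pd_on I 1 N \<in> holder \<alpha> I"
proof -
  show "pd_on I 1 N \<in> holder \<alpha> I" using assms unfolding C1_holder_def by auto
  assume p: "p \<in> I"
  have "N differentiable (at p within I)" using assms p unfolding C1_holder_def differentiable_on_def by blast
  then obtain d where "(N has_real_derivative d) (at p within I)" unfolding real_differentiable_def by blast
  with pd_on_I_unique[OF this p] show "(N has_real_derivative pd_on I 1 N p) (at p within I)" by simp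
qed

section \<open>Weak solutions of the Sturm--Liouville problem and the resonant mode\<close>

lemma SL_solution_scale:
  assumes "SL_solution \<alpha> g d p0 \<Gamma> l N"
  shows "SL_solution \<alpha> g d p0 \<Gamma> l (\<lambda>p. k * N p)"
proof -
  define F where "F p = SL_coeff \<Gamma> l p ^ 3 * pd_on I 1 N p" for p
  define f where "f p = d\<^sup>2 * SL_coeff \<Gamma> l p * N p" for p
  have sl: "N \<in> C1_holder \<alpha> I" "distrib_div_eq {-1<..<0} F f" "F 0 = g * d ^ 3 / p0\<^sup>2 * N 0" "N (-1) = 0"
    using assms unfolding SL_solution_def Let_def F_def f_def by auto
  have d: "((\<lambda>p. k * N p) has_real_derivative k * pd_on I 1 N p) (at p within I)" if "p \<in> I" for p
    by (rule DERIV_cmult[OF C1_holder_I(1)[OF sl(1) that]])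
  have pd: "pd_on I 1 (\<lambda>p. k * N p) p = k * pd_on I 1 N p" if "p \<in> I" for p
    by (rule pd_on_I_unique[OF d[OF that] that])
  obtain A where "\<And>x. x \<in> I \<Longrightarrow> \<bar>pd_on I 1 N x\<bar> \<le> A"
    by (rule holder_bounded[OF C1_holder_I(2)[OF sl(1)]]) (rule that)
  then have "pd_on I 1 (\<lambda>p. k * N p) \<in> holder \<alpha> I"
    by (intro holder_Lipschitz_image[OF C1_holder_I(2)[OF sl(1)], where A = "\<bar>k\<bar> * A" and L = "\<bar>k\<bar>"])
       (auto simp: pd abs_mult mult_left_mono simp flip: right_diff_distrib)
  moreover have "bounded ((\<lambda>p. k * N p) ` I)"
  proof -
    have "bounded (N ` I)" using sl(1) by (simp add: C1_holder_def)
    from bounded_scaling[OF this, of k] show ?thesis by (simp add: image_image)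
  qed
  moreover have "(\<lambda>p. k * N p) differentiable_on I"
    unfolding differentiable_on_def using d real_differentiable_def by blast
  ultimately have "(\<lambda>p. k * N p) \<in> C1_holder \<alpha> I" by (simp add: C1_holder_def)
  moreover have "distrib_div_eq {-1<..<0} (\<lambda>p. SL_coeff \<Gamma> l p ^ 3 * pd_on I 1 (\<lambda>p. k * N p) p) (\<lambda>p. d\<^sup>2 * SL_coeff \<Gamma> l p * (k * N p))"
    unfolding distrib_div_eq_def
  proof (intro allI impI)
    fix \<phi> :: "real \<Rightarrow> real" assume t: "test_function {-1<..<0} \<phi>"
    have sc: "frechet_derivative \<phi> (at x) (k * y) = k * frechet_derivative \<phi> (at x) y" for x y
    proof -
      have "\<phi> differentiable at x" using t smoothD(1) unfolding test_function_def by blast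
      then have "linear (frechet_derivative \<phi> (at x))" by (rule linear_frechet_derivative)
      from linear_scale[OF this, of k y] show ?thesis by simp
    qed
    have "(LINT x:{-1<..<0}|lborel. frechet_derivative \<phi> (at x) (SL_coeff \<Gamma> l x ^ 3 * pd_on I 1 (\<lambda>p. k * N p) x))
        = (LINT x:{-1<..<0}|lborel. k * frechet_derivative \<phi> (at x) (F x))"
      by (rule set_lebesgue_integral_cong) (auto simp: pd F_def sc[symmetric] ac_simps)
    also have "\<dots> = - (k * (LINT x:{-1<..<0}|lborel. f x * \<phi> x))"
      using sl(2) t unfolding distrib_div_eq_def by simp
    also have "\<dots> = - (LINT x:{-1<..<0}|lborel. d\<^sup>2 * SL_coeff \<Gamma> l x * (k * N x) * \<phi> x)"
      by (simp add: f_def ac_simps flip: set_integral_mult_right)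
    finally show "(LINT x:{-1<..<0}|lborel. frechet_derivative \<phi> (at x) (SL_coeff \<Gamma> l x ^ 3 * pd_on I 1 (\<lambda>p. k * N p) x))
        = - (LINT x:{-1<..<0}|lborel. d\<^sup>2 * SL_coeff \<Gamma> l x * (k * N x) * \<phi> x)" .
  qed
  moreover have "SL_coeff \<Gamma> l 0 ^ 3 * (k * pd_on I 1 N 0) = g * d ^ 3 / p0\<^sup>2 * (k * N 0)"
    using arg_cong[OF sl(3), of "(*) k"] by (simp add: F_def ac_simps)
  ultimately show ?thesis unfolding SL_solution_def Let_def using sl(4) by (simp add: pd)
qed

text \<open>The Wronskians of \<open>(N, F)\<close> with both fundamental solutions are constant.
  Their values at the bottom give two linear equations for \<open>(N, F)\<close>, with determinant
  \<open>W 1\<close>.\<close>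

lemma (in modal) ivp_unique:
  assumes dN: "\<And>p. p \<in> I \<Longrightarrow> (N has_real_derivative b p * F p) (at p within I)"
    and dF: "\<And>p. p \<in> I \<Longrightarrow> (F has_real_derivative c p * N p) (at p within I)"
    and N: "N (-1) = 0" and p: "p \<in> I"
  shows "N p = F (-1) * \<phi> 1 p" "F p = F (-1) * \<phi>F 1 p"
proof -
  note fs = fs_d[where k = 1]
  have "((\<lambda>p. F p * \<phi> 1 p - N p * \<phi>F 1 p) has_real_derivative 0) (at p within I)" if "p \<in> I" for p
    by (rule derivative_eq_intros dN dF fs that refl)+ (simp add: algebra_simps)
  from Lip_I[OF this, where K = 0, of p "-1"] p have 1: "F p * \<phi> 1 p = N p * \<phi>F 1 p"
    using N fs_init(1)[of 1] by (simp del: One_nat_def)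
  have "((\<lambda>p. F p * \<psi> 1 p - N p * \<psi>F 1 p) has_real_derivative 0) (at p within I)" if "p \<in> I" for p
    by (rule derivative_eq_intros dN dF fs that refl)+ (simp add: algebra_simps)
  from Lip_I[OF this, where K = 0, of p "-1"] p have 2: "F p * \<psi> 1 p - N p * \<psi>F 1 p = F (-1) * \<psi> 1 (-1)"
    using N by simp
  have w: "\<phi>F 1 p * \<psi> 1 p - \<phi> 1 p * \<psi>F 1 p = W 1" "\<psi> 1 (-1) = W 1"
    using wronskian[OF p, of 1] wronskian[of "-1" 1] fs_init(1)[of 1] fs_init(2)[of 1] by (simp_all del: One_nat_def)
  have "F p * W 1 = \<phi>F 1 p * (F p * \<psi> 1 p) - (F p * \<phi> 1 p) * \<psi>F 1 p"
    unfolding w(1)[symmetric] by (simp only: algebra_simps)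
  also have "\<dots> = \<phi>F 1 p * (F p * \<psi> 1 p - N p * \<psi>F 1 p)" unfolding 1 by (simp add: algebra_simps)
  also have "\<dots> = F (-1) * \<phi>F 1 p * W 1" unfolding 2 w(2) by simp
  finally show F: "F p = F (-1) * \<phi>F 1 p" using W_pos[of 1] by simp
  have "\<phi>F 1 p \<noteq> 0" using fs_sign(2)[OF p, of 1] by simp
  then show "N p = F (-1) * \<phi> 1 p" using 1 unfolding F by (simp add: ac_simps)
qed

text \<open>By du Bois-Reymond the weak flux \<open>a^3 N'\<close> is classically differentiable, so
  a weak solution satisfies the first-order system of mode 1 and is a multiple of
  \<open>\<phi> 1\<close>. For a nonzero multiple the surface condition becomes the resonance of
  \<open>modal_robin\<close>.\<close>

lemma (in modal) SL_structure:
  assumes sl: "SL_solution \<alpha> g d p0 \<Gamma> l N" and \<alpha>: "0 < \<alpha>"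
    and a: "continuous_on I (SL_coeff \<Gamma> l)" "\<And>p. p \<in> I \<Longrightarrow> 0 < SL_coeff \<Gamma> l p"
    and b: "\<And>p. p \<in> I \<Longrightarrow> b p = 1 / SL_coeff \<Gamma> l p ^ 3" and c: "\<And>p. p \<in> I \<Longrightarrow> c p = d\<^sup>2 * SL_coeff \<Gamma> l p"
  obtains \<kappa> where "\<And>p. p \<in> I \<Longrightarrow> N p = \<kappa> * \<phi> 1 p" "\<And>p. p \<in> I \<Longrightarrow> pd_on I 1 N p = \<kappa> * (b p * \<phi>F 1 p)"
    "\<kappa> * \<phi>F 1 0 = g * d ^ 3 / p0\<^sup>2 * (\<kappa> * \<phi> 1 0)"
proof -
  define F where "F p = SL_coeff \<Gamma> l p ^ 3 * pd_on I 1 N p" for p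
  define f where "f p = d\<^sup>2 * SL_coeff \<Gamma> l p * N p" for p
  have s: "N \<in> C1_holder \<alpha> I" "distrib_div_eq {-1<..<0} F f" "F 0 = g * d ^ 3 / p0\<^sup>2 * N 0" "N (-1) = 0"
    using sl unfolding SL_solution_def Let_def F_def f_def by auto
  note dN = C1_holder_I(1)[OF s(1)]
  have cN: "continuous_on I N"
    by (rule differentiable_imp_continuous_on) (use s(1) in \<open>simp add: C1_holder_def\<close>)
  have cF: "continuous_on I F" unfolding F_def
    by (intro continuous_intros a holder_continuous_on[OF C1_holder_I(2)[OF s(1)] \<alpha>])
  have cf: "continuous_on I f" unfolding f_def by (intro continuous_intros a cN)
  have dF: "(F has_real_derivative c p * N p) (at p within I)" if p: "p \<in> I" for p
  proof -
    have "((\<lambda>p. F (-1) + integral {-1..p} f) has_real_derivative f p) (at p within I)"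
      by (rule DERIV_cong[OF DERIV_add[OF DERIV_const integral_has_real_derivative[OF cf p]]]) simp
    then have "(F has_real_derivative f p) (at p within I)"
      by (rule has_field_derivative_transform_within[OF _ zero_less_one p du_Bois_Reymond[OF cF cf s(2), symmetric]])
    then show ?thesis by (simp add: f_def c[OF p])
  qed
  have bF: "pd_on I 1 N p = b p * F p" if "p \<in> I" for p using a(2)[OF that] by (simp add: F_def b[OF that])
  have dN': "(N has_real_derivative b p * F p) (at p within I)" if "p \<in> I" for p
    using dN[OF that] unfolding bF[OF that] .
  have u: "N p = F (-1) * \<phi> 1 p" "F p = F (-1) * \<phi>F 1 p" if "p \<in> I" for p
    by (rule ivp_unique[OF dN' dF s(4) that]; assumption)+
  show thesis
  proof
    show "N p = F (-1) * \<phi> 1 p" if "p \<in> I" for p by (rule u(1)[OF that])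
    show "pd_on I 1 N p = F (-1) * (b p * \<phi>F 1 p)" if "p \<in> I" for p
    proof -
      have "b p * F p = F (-1) * (b p * \<phi>F 1 p)" by (subst u(2)[OF that]) (simp only: ac_simps)
      then show ?thesis by (simp only: bF[OF that])
    qed
    show "F (-1) * \<phi>F 1 0 = g * d ^ 3 / p0\<^sup>2 * (F (-1) * \<phi> 1 0)" 
    proof -
      have "(0 :: real) \<in> I" by simp
      from s(3)[unfolded u[OF this]] show ?thesis .
    qed
  qed
qed

section \<open>The nonlinear problem\<close>

text \<open>The surface value is the integral of
  \<open>(b * \<phi>F * d1 - \<phi> * d2) / W\<close>, and the sign conditions exclude cancellation.
  For the loads of \<open>stream_problem\<close> this is the transversality condition.\<close>

lemma (in modal) load_nonzero:
  fixes d1 d2 :: cfun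
  assumes "\<And>p. p \<in> I \<Longrightarrow> d1 p < 0" "\<And>p. p \<in> I \<Longrightarrow> 0 \<le> d2 p"
  shows "nw 1 d1 d2 0 \<noteq> 0"
proof -
  define e where "e = (1 / W 1) *\<^sub>R bmul (bmul b (\<phi>F 1)) d1 - (real 1 / W 1) *\<^sub>R bmul (\<phi> 1) d2"
  have e: "e p < 0" if p: "p \<in> I" for p
  proof -
    have "b p * \<phi>F 1 p * d1 p < 0"
      using bpos[OF p] fs_sign(2)[OF p, of 1] assms(1)[OF p] by (intro mult_pos_neg mult_pos_pos) auto
    moreover have "0 \<le> \<phi> 1 p * d2 p" using fs_sign(1)[OF p, of 1] assms(2)[OF p] by simp
    moreover have "e p = (b p * \<phi>F 1 p * d1 p - \<phi> 1 p * d2 p) / W 1"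
      by (simp add: e_def diff_divide_distrib)
    ultimately show ?thesis using W_pos[of 1] by (simp add: divide_neg_pos)
  qed
  obtain r where r: "-1 < r" "r < 0" "IL e 0 - IL e (-1) = e r * (0 - (-1))"
    by (rule mvt_I[OF D_IL[unfolded D_def, rule_format], of "-1" 0 e]) auto
  then have "IL e 0 = e r" by simp
  with e[of r] r have "IL e 0 < 0" by simp
  then show ?thesis unfolding n_init beta_def e_def by simp
qed

text \<open>Multiplication by s: evaluated at \<open>s / \<epsilon>\<close> the shift yields the
  factor \<open>s / \<epsilon>\<close>, and the scalar turns it into s. The scalar is also what
  makes the result small in the fixed point problem.\<close>

definition sh :: "real \<Rightarrow> wiener \<Rightarrow> wiener" where "sh \<epsilon> w = \<epsilon> *\<^sub>R shift w"

lemma nc_sh: "tame \<alpha> f \<Longrightarrow> nc \<alpha> (\<lambda>\<epsilon> x. sh \<epsilon> (f \<epsilon> x))"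
  unfolding sh_def by (rule nc_eps[OF tame_hop[OF hop_shift]])

lemmas tame_sh = nc_tame[OF nc_sh]

lemma holder_hop: "w \<in> holder \<alpha> I \<Longrightarrow> 0 < \<alpha> \<Longrightarrow> hop \<alpha> (mulE (mkc w))"
  using holder_eb[of w \<alpha>] hop_mulE by blast

lemma nc_mul: "w \<in> holder \<alpha> I \<Longrightarrow> 0 < \<alpha> \<Longrightarrow> nc \<alpha> f \<Longrightarrow> nc \<alpha> (\<lambda>\<epsilon> x. mulE (mkc w) (f \<epsilon> x))"
  by (rule nc_hop[OF holder_hop])

lemma tame_mul: "w \<in> holder \<alpha> I \<Longrightarrow> 0 < \<alpha> \<Longrightarrow> tame \<alpha> f \<Longrightarrow> tame \<alpha> (\<lambda>\<epsilon> x. mulE (mkc w) (f \<epsilon> x))"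
  by (rule tame_hop[OF holder_hop])

lemma ec_simps:
  assumes "\<bar>t\<bar> \<le> 1"
  shows "ec t q p (x + y) = ec t q p x + ec t q p y" "es t q p (x + y) = es t q p x + es t q p y"
    "ec t q p (r *\<^sub>R x) = r * ec t q p x" "es t q p (r *\<^sub>R x) = r * es t q p x"
    "ec t q p (sh \<epsilon> x) = \<epsilon> * t * ec t q p x" "es t q p (sh \<epsilon> x) = \<epsilon> * t * es t q p x"
    "ec t q p (mulE f x) = f p * ec t q p x" "es t q p (mulE f x) = f p * es t q p x"
    "ec t q p (x \<odot> y) = ec t q p x * ec t q p y" "ec t q p (ss x y) = es t q p x * es t q p y"
    "es t q p (cs x y) = ec t q p x * es t q p y"
    "ec t q p (single (n, k) e) = t ^ n * cos (real k * q) / 4 ^ k * e p"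
    "es t q p (single (n, k) e) = t ^ n * sin (real k * q) / 4 ^ k * e p"
    "\<bar>ec t q p x\<bar> \<le> norm x"
  unfolding ec_cc[OF assms] ec_ss[OF assms] es_cs[OF assms] sh_def
  unfolding ec_def es_def
  by (simp_all only: evaluation.ev_add[OF evaluation_instances(1)[OF assms]] evaluation.ev_add[OF evaluation_instances(2)[OF assms]]
    evaluation.ev_scaleR[OF evaluation_instances(1)[OF assms]] evaluation.ev_scaleR[OF evaluation_instances(2)[OF assms]]
    evaluation.ev_mulE[OF evaluation_instances(1)[OF assms]] evaluation.ev_mulE[OF evaluation_instances(2)[OF assms]]
    evaluation.ev_shift[OF evaluation_instances(1)[OF assms]] evaluation.ev_shift[OF evaluation_instances(2)[OF assms]]
    evaluation.ev_single[OF evaluation_instances(1)[OF assms]] evaluation.ev_single[OF evaluation_instances(2)[OF assms]]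
    evaluation.abs_ev_le[OF evaluation_instances(1)[OF assms]] mult.assoc)

text \<open>With \<open>a\<^sup>2 = \<Gamma> + \<lambda>\<close> the coefficients \<open>a^3\<close>
  and \<open>d^2 a\<close> have \<open>\<lambda>\<close>-derivatives \<open>3 a / 2\<close> and
  \<open>d^2 / (2 a)\<close>. Applied to M' and M, multiplied by 4 as the weight of mode 1, and with
  the first one moved across the equation, they give \<open>d1\<close> and \<open>d2\<close>; here
  \<open>\<kappa> * \<phi> 1\<close> is M.\<close>

locale stream_problem = modal_robin +
  fixes a :: "real \<Rightarrow> real" and d \<kappa> :: real
  assumes ah: "a \<in> holder \<alpha> I" and ai: "(\<lambda>p. 1 / a p) \<in> holder \<alpha> I" and apos: "\<And>p. p \<in> I \<Longrightarrow> 0 < a p"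
    and d: "0 < d" and kap: "\<kappa> * \<phi> 1 0 = 1"
    and bval: "\<And>p. p \<in> I \<Longrightarrow> b p = 1 / a p ^ 3" and cval: "\<And>p. p \<in> I \<Longrightarrow> c p = d\<^sup>2 * a p"
    and d1val: "\<And>p. p \<in> I \<Longrightarrow> d1 p = - 6 * a p * (\<kappa> * (b p * \<phi>F 1 p))"
    and d2val: "\<And>p. p \<in> I \<Longrightarrow> d2 p = 2 * d\<^sup>2 * (\<kappa> * \<phi> 1 p) / a p"
begin

lemma ac: "continuous_on I a" by (rule holder_continuous_on[OF ah \<alpha>(1)])
definition a1 where "a1 = (\<lambda>p. -3/2 * a p)"
definition a2 where "a2 = (\<lambda>p. 1/2 * a p)"
definition a3 where "a3 = (\<lambda>p. 1/2 * (1 / a p))"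
definition a4 where "a4 = (\<lambda>p. 1 / a p * (1 / a p))"
definition a5 where "a5 = (\<lambda>p. 1 / a p)"
definition a6 where "a6 = (\<lambda>p. a p * a p)"

lemmas a_defs = a1_def a2_def a3_def a4_def a5_def a6_def

lemma a_holder: "a1 \<in> holder \<alpha> I" "a2 \<in> holder \<alpha> I" "a3 \<in> holder \<alpha> I" "a4 \<in> holder \<alpha> I" "a5 \<in> holder \<alpha> I" "a6 \<in> holder \<alpha> I"
  unfolding a_defs by (intro holder_mult holder_const ah ai)+

lemma mkc_a: "p \<in> I \<Longrightarrow> mkc a1 p = a1 p" "p \<in> I \<Longrightarrow> mkc a2 p = a2 p" "p \<in> I \<Longrightarrow> mkc a3 p = a3 p"
  "p \<in> I \<Longrightarrow> mkc a4 p = a4 p" "p \<in> I \<Longrightarrow> mkc a5 p = a5 p" "p \<in> I \<Longrightarrow> mkc a6 p = a6 p" "p \<in> I \<Longrightarrow> mkc a p = a p"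
  using mkc_apply[OF holder_continuous_on[OF a_holder(1) \<alpha>(1)]] mkc_apply[OF holder_continuous_on[OF a_holder(2) \<alpha>(1)]]
    mkc_apply[OF holder_continuous_on[OF a_holder(3) \<alpha>(1)]] mkc_apply[OF holder_continuous_on[OF a_holder(4) \<alpha>(1)]]
    mkc_apply[OF holder_continuous_on[OF a_holder(5) \<alpha>(1)]] mkc_apply[OF holder_continuous_on[OF a_holder(6) \<alpha>(1)]]
    mkc_apply[OF ac] by simp_all

lemma hb_mkc: "w \<in> holder \<alpha> I \<Longrightarrow> \<exists>K. hb \<alpha> (single (0, 0) (mkc w)) K"
  using holder_eb[OF _ \<alpha>(1)] hb_single[of \<alpha> "(0, 0)" "mkc w"] by auto

definition u0 where "u0 = single (0, 1) ((4 * \<kappa>) *\<^sub>R bmul b (\<phi>F 1))"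
definition v0 where "v0 = single (0, 1) ((4 * \<kappa>) *\<^sub>R \<phi> 1)"

lemma hb_base: "\<exists>K. hb \<alpha> u0 K" "\<exists>K. hb \<alpha> v0 K"
proof -
  have lip: "\<exists>K. eb \<alpha> 0 e K" if "D e f" "\<And>p. p \<in> I \<Longrightarrow> \<bar>f p\<bar> \<le> A" for e f :: cfun and A
  proof -
    have A: "0 \<le> A" using that(2)[of 0] by (meson abs_ge_zero order_trans atLeastAtMost_iff le_minus_one_simps(1) order_refl)
    have "eb \<alpha> 0 e (norm e + A)"
    proof (rule eb_I[OF order_refl A _ order_refl])
      fix p q :: real assume pq: "p \<in> I" "q \<in> I"
      have "\<bar>e p - e q\<bar> \<le> A * \<bar>p - q\<bar>"
        by (rule Lip_I[OF _ that(2) pq]) (use that(1) in \<open>simp_all add: D_def\<close>)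
      also have "\<dots> \<le> A * \<bar>p - q\<bar> powr \<alpha>" using pq \<alpha> A by (intro mult_left_mono powr_le_Lip) auto
      finally show "\<bar>e p - e q\<bar> \<le> 2 ^ 0 * A * \<bar>p - q\<bar> powr \<alpha>" by simp
    qed
    then show ?thesis by blast
  qed
  obtain K1 where K1: "eb \<alpha> 0 (\<phi> 1) K1" using lip[OF fs_D(1), of 1 "norm (bmul b (\<phi>F 1))"] abs_apply_le by blast
  obtain K2 where K2: "eb \<alpha> 0 (\<phi>F 1) K2"
    using lip[OF fs_D(2), of 1 "norm ((real 1)\<^sup>2 *\<^sub>R bmul c (\<phi> 1))"] abs_apply_le by blast
  obtain K3 where K3: "eb \<alpha> 0 b K3" using eb_fin(1) by blast
  have "hb \<alpha> v0 (\<bar>4 * \<kappa>\<bar> * K1)"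
    unfolding v0_def by (rule hb_single, rule eb_scaleR, simp only: snd_conv) (rule eb_weaken[OF K1])
  then show "\<exists>K. hb \<alpha> v0 K" by blast
  have "hop \<alpha> (mulE b)" by (rule hop_mulE[OF K3])
  then obtain K where K: "hb \<alpha> (mulE b (single (0, 1) (\<phi>F 1))) K"
    using hb_single[of \<alpha> "(0, 1)" "\<phi>F 1" K2] eb_weaken[OF K2] unfolding hop_def snd_conv by blast
  have "mulE b (single (0, 1) (\<phi>F 1)) = single (0, 1) (bmul b (\<phi>F 1))"
    by (rule l1_eqI) (simp add: coord_single bounded_bilinear.zero_right[OF bounded_bilinear_bmul])
  then have "u0 = (4 * \<kappa>) *\<^sub>R mulE b (single (0, 1) (\<phi>F 1))"
    unfolding u0_def by (simp only: linear_scale[OF bounded_linear.linear[OF bounded_linear_single]])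
  then show "\<exists>K. hb \<alpha> u0 K" using hb_scaleR[OF K] by metis
qed

text \<open>
  The unknowns are the corrections of order \<open>s\<close> to \<open>u\<close> and \<open>v\<close>, the multiplier \<open>m\<close>, and \<open>\<eta>\<close>, \<open>r\<close>, \<open>y\<close> with
  \<open>e = a + s \<eta>\<close>, \<open>1 / e = 1 / a + s r\<close> and \<open>Y = a\<^sup>2 u\<^sub>0 + s y\<close>.  The auxiliary series \<open>Y\<close> is defined by
  \<open>Y = e\<^sup>2 u - s e u Y\<close>, so that \<open>1 / (h\<^sub>p + 1) = e - s Y\<close> and no division occurs.  The factor \<open>4\<close> in the leading
  terms compensates for the weight of the mode \<open>k = 1\<close>.
\<close>

definition Um where "Um \<epsilon> x = u0 + sh \<epsilon> (fst x)" for x :: unknowns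
definition Vm where "Vm \<epsilon> x = v0 + sh \<epsilon> (fst (snd x))" for x :: unknowns
abbreviation Mm :: "unknowns \<Rightarrow> wiener" where "Mm x \<equiv> fst (snd (snd x))"
abbreviation Nm :: "unknowns \<Rightarrow> wiener" where "Nm x \<equiv> fst (snd (snd (snd x)))"
abbreviation Rm :: "unknowns \<Rightarrow> wiener" where "Rm x \<equiv> fst (snd (snd (snd (snd x))))"
definition Em where "Em \<epsilon> x = single (0, 0) (mkc a) + sh \<epsilon> (Nm x)" for x :: unknowns
definition Ym where "Ym \<epsilon> x = mulE (mkc a6) u0 + sh \<epsilon> (snd (snd (snd (snd (snd x)))))" for x :: unknowns
definition Tm where "Tm \<epsilon> x = Em \<epsilon> x + sh \<epsilon> ((-1) *\<^sub>R Ym \<epsilon> x)" for x :: unknowns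

text \<open>Let w be half the right-hand side of \<open>vertical_flux\<close>. For nonzero s,
  \<open>G1 + X1\<close> evaluates to \<open>(a^3 u - w) / s\<close> and \<open>G2 + X2\<close> to
  \<open>(d^2 \<tau> v - d^2 a v) / s\<close>. The terms in \<open>m u0\<close> and
  \<open>m v0\<close> are left out here, since the solution operator adds them itself as
  loads.\<close>

definition G1 where "G1 \<epsilon> x = mulE (mkc a1) (sh \<epsilon> (Mm x \<odot> fst x)) + mulE (mkc a2) (sh \<epsilon> ((Nm x \<odot> Nm x) \<odot> Um \<epsilon> x))
  + (-1) *\<^sub>R sh \<epsilon> ((Nm x \<odot> Mm x) \<odot> Um \<epsilon> x) + (Em \<epsilon> x \<odot> Em \<epsilon> x) \<odot> (Um \<epsilon> x \<odot> Ym \<epsilon> x)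
  + (1/2) *\<^sub>R (Ym \<epsilon> x \<odot> Ym \<epsilon> x) + (d\<^sup>2 / 2) *\<^sub>R (ss (Vm \<epsilon> x) (Vm \<epsilon> x) \<odot> (Tm \<epsilon> x \<odot> Tm \<epsilon> x))" for x :: unknowns
definition G2 where "G2 \<epsilon> x = d\<^sup>2 *\<^sub>R (mulE (mkc a3) (sh \<epsilon> (cs (Mm x) (fst (snd x))))
  + (-1) *\<^sub>R sh \<epsilon> (cs (mulE (mkc a3) (Nm x \<odot> Nm x)) (Vm \<epsilon> x)) + (-1) *\<^sub>R cs (Ym \<epsilon> x) (Vm \<epsilon> x))" for x :: unknowns
text \<open>\<open>Nn\<close>, \<open>Rn\<close> and \<open>Yn\<close> are the polynomial forms of
  \<open>e\<^sup>2 = a\<^sup>2 + s m\<close>, of \<open>e * (1 / a + s r) = 1\<close> and of the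
  equation for Y, divided by s. The new values \<open>TM\<close>, \<open>TU\<close> and
  \<open>Nn\<close> are used wherever a bare unknown would occur: an unknown without a factor
  \<open>\<epsilon>\<close> is only tame, its image is \<open>nc\<close>. At the fixed point both
  coincide.\<close>

definition Nn where "Nn \<epsilon> x = mulE (mkc a3) (TM (G1 \<epsilon> x) (G2 \<epsilon> x) + (-1) *\<^sub>R sh \<epsilon> (Nm x \<odot> Nm x))" for x :: unknowns
definition Rn where "Rn \<epsilon> x = (-1) *\<^sub>R mulE (mkc a4) (Nn \<epsilon> x) + (-1) *\<^sub>R mulE (mkc a5) (sh \<epsilon> (Nm x \<odot> Rm x))" for x :: unknowns
definition Yn where "Yn \<epsilon> x = mulE (mkc a6) (TU (G1 \<epsilon> x) (G2 \<epsilon> x)) + TM (G1 \<epsilon> x) (G2 \<epsilon> x) \<odot> u0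
  + sh \<epsilon> (Mm x \<odot> fst x) + (-1) *\<^sub>R (Em \<epsilon> x \<odot> (Um \<epsilon> x \<odot> Ym \<epsilon> x))" for x :: unknowns

lemma nc_base: "nc \<alpha> (\<lambda>_ _. u0)" "nc \<alpha> (\<lambda>_ _. v0)" "nc \<alpha> (\<lambda>_ _. single (0, 0) (mkc a))"
  using hb_base hb_mkc[OF ah] by (blast intro: nc_const)+

lemma nc_UVEY: "nc \<alpha> Um" "nc \<alpha> Vm" "nc \<alpha> Em" "nc \<alpha> Ym"
  unfolding Um_def[abs_def] Vm_def[abs_def] Em_def[abs_def] Ym_def[abs_def]
  by (intro nc_add nc_base nc_mul a_holder \<alpha> nc_sh tame_proj)+

lemmas tame_UVEY = nc_UVEY[THEN nc_tame]

lemma nc_Tm: "nc \<alpha> Tm"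
  unfolding Tm_def[abs_def] by (intro nc_add nc_UVEY nc_sh tame_scaleR tame_UVEY)

lemma nc_G: "nc \<alpha> G1" "nc \<alpha> G2"
  unfolding G1_def[abs_def] G2_def[abs_def]
  by (intro nc_add nc_mul a_holder \<alpha> nc_sh nc_scaleR nc_products nc_UVEY nc_Tm tame_products tame_mul tame_proj tame_UVEY)+

lemma nc_Nn: "nc \<alpha> Nn"
  unfolding Nn_def[abs_def]
  by (intro nc_mul a_holder \<alpha> nc_add nc_T nc_G nc_scaleR nc_sh tame_products tame_proj)

lemma nc_RY: "nc \<alpha> Rn" "nc \<alpha> Yn"
  unfolding Rn_def[abs_def] Yn_def[abs_def]
  by (intro nc_add nc_mul a_holder \<alpha> nc_sh nc_scaleR nc_products nc_UVEY nc_Nn nc_T nc_G nc_base tame_products tame_proj)+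

lemma fixed_point:
  obtains \<epsilon> x B where "0 < \<epsilon>" "\<epsilon> \<le> 1" "hbX \<alpha> x B"
    "x = (TU (G1 \<epsilon> x) (G2 \<epsilon> x), TV (G1 \<epsilon> x) (G2 \<epsilon> x), TM (G1 \<epsilon> x) (G2 \<epsilon> x), Nn \<epsilon> x, Rn \<epsilon> x, Yn \<epsilon> x)"
proof -
  obtain B \<epsilon>0 where e: "0 < \<epsilon>0" "\<epsilon>0 \<le> 1"
    "\<And>\<epsilon>. 0 < \<epsilon> \<Longrightarrow> \<epsilon> \<le> \<epsilon>0 \<Longrightarrow> \<exists>x. hbX \<alpha> x B \<and> x = (TU (G1 \<epsilon> x) (G2 \<epsilon> x), TV (G1 \<epsilon> x) (G2 \<epsilon> x),
       TM (G1 \<epsilon> x) (G2 \<epsilon> x), Nn \<epsilon> x, Rn \<epsilon> x, Yn \<epsilon> x)"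
    by (rule nc_fixed_point[OF nc_T[OF nc_G] nc_Nn nc_RY]) (rule that)
  from e(3)[OF e(1) order_refl] obtain x where "hbX \<alpha> x B" "x = (TU (G1 \<epsilon>0 x) (G2 \<epsilon>0 x), TV (G1 \<epsilon>0 x) (G2 \<epsilon>0 x),
       TM (G1 \<epsilon>0 x) (G2 \<epsilon>0 x), Nn \<epsilon>0 x, Rn \<epsilon>0 x, Yn \<epsilon>0 x)" by blast
  then show thesis by (rule that[OF e(1,2)])
qed

end

lemma has_real_derivative_powr_bound:
  fixes f :: "real \<Rightarrow> real"
  assumes bd: "\<And>y. y \<in> T \<Longrightarrow> \<bar>f y - f x - (y - x) * L\<bar> \<le> K * (\<bar>y - x\<bar> powr \<alpha> * \<bar>y - x\<bar>)" and \<alpha>: "0 < \<alpha>"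
  shows "(f has_real_derivative L) (at x within T)"
  unfolding has_field_derivative_iff
proof (rule LIM_zero_cancel)
  have "((\<lambda>y. \<bar>y - x\<bar> powr \<alpha>) \<longlongrightarrow> 0) (at x within T)"
    by (rule tendsto_zero_powrI[OF _ tendsto_const]) (auto intro!: tendsto_eq_intros simp: \<alpha>)
  then have lim: "((\<lambda>y. K * \<bar>y - x\<bar> powr \<alpha>) \<longlongrightarrow> 0) (at x within T)" by (rule tendsto_mult_right_zero)
  show "((\<lambda>y. (f y - f x) / (y - x) - L) \<longlongrightarrow> 0) (at x within T)"
  proof (rule Lim_null_comparison[OF _ lim])
    have "norm ((f y - f x) / (y - x) - L) \<le> K * \<bar>y - x\<bar> powr \<alpha>" if "y \<in> T" "y \<noteq> x" for y
    proof -
      have "(f y - f x) / (y - x) - L = (f y - f x - (y - x) * L) / (y - x)" using that by (simp add: field_simps)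
      then have "norm ((f y - f x) / (y - x) - L) = \<bar>f y - f x - (y - x) * L\<bar> / \<bar>y - x\<bar>" by (simp add: abs_divide)
      also have "\<dots> \<le> K * (\<bar>y - x\<bar> powr \<alpha> * \<bar>y - x\<bar>) / \<bar>y - x\<bar>" by (intro divide_right_mono bd that) simp
      finally show ?thesis using that by simp
    qed
    then show "\<forall>\<^sub>F y in at x within T. norm ((f y - f x) / (y - x) - L) \<le> K * \<bar>y - x\<bar> powr \<alpha>"
      by (auto simp: eventually_at_filter)
  qed
qed

lemma T3_derivatives:
  assumes T: "T3 \<alpha> f f1 f2 K" and \<alpha>: "0 < \<alpha>" and p: "p \<in> I"
  shows "((\<lambda>q. f (q, p)) has_real_derivative f1 (q, p)) (at q)"
    "((\<lambda>p. f (q, p)) has_real_derivative f2 (q, p)) (at p within I)"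
proof -
  have bd: "\<bar>f (q', p') - f (q, p) - (q' - q) * f1 (q, p) - (p' - p) * f2 (q, p)\<bar>
       \<le> K * (\<bar>p' - p\<bar> powr \<alpha> * \<bar>p' - p\<bar> + \<bar>q' - q\<bar> * \<bar>p' - p\<bar> + (q' - q)\<^sup>2)" if "p' \<in> I" for q' p'
    using T p that unfolding T3_def by blast
  show "((\<lambda>q. f (q, p)) has_real_derivative f1 (q, p)) (at q)"
    by (rule has_real_derivative_powr_bound[where \<alpha> = 1 and K = K])
       (use bd[OF p] in \<open>simp_all add: power2_eq_square\<close>)
  show "((\<lambda>p. f (q, p)) has_real_derivative f2 (q, p)) (at p within I)"
    by (rule has_real_derivative_powr_bound[where \<alpha> = \<alpha> and K = K, OF _ \<alpha>])
       (use bd[of _ q] in simp)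
qed

lemma S_deriv_A3:
  assumes "\<And>n. \<bar>\<gamma> n\<bar> \<le> N" "hb \<alpha> X K" "p \<in> I"
  shows "((\<lambda>q. S \<gamma> (A3 q p) X) has_real_derivative S \<gamma> (A4 q p) X) (at q)"
proof (rule has_real_derivative_powr_bound[where \<alpha> = 1 and K = "N * K"])
  fix q' :: real
  note c = controlled_A[OF assms(3)]
  note d = S_diff[OF _ _ assms(1,2)]
  have "S \<gamma> (\<lambda>k e. A3 q' p k e - A3 q p k e - (q' - q) * A4 q p k e) X
      = S \<gamma> (A3 q' p) X - S \<gamma> (A3 q p) X - (q' - q) * S \<gamma> (A4 q p) X"
    by (simp only: d[OF controlled_diff[OF c(4) c(4)] controlled_cmult[OF c(5)]] d[OF c(4) c(4)] S_cmult)
  with S_bound(2)[where \<gamma> = \<gamma>, OF controlled_Taylor_A3[of \<alpha> q' q p] assms(1,2)]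
  show "\<bar>S \<gamma> (A3 q' p) X - S \<gamma> (A3 q p) X - (q' - q) * S \<gamma> (A4 q p) X\<bar> \<le> N * K * (\<bar>q' - q\<bar> powr 1 * \<bar>q' - q\<bar>)"
    by (simp add: power2_eq_square ac_simps)
qed simp

lemma S_deriv_A5:
  assumes "\<And>n. \<bar>\<gamma> n\<bar> \<le> N" "hb \<alpha> X K" "p \<in> I" "0 < \<alpha>"
  shows "((\<lambda>p. S \<gamma> (A5 q p) X) has_real_derivative - S \<gamma> (A4 q p) X) (at p within I)"
proof (rule has_real_derivative_powr_bound[where \<alpha> = \<alpha> and K = "N * K", OF _ assms(4)])
  fix p' :: real assume p': "p' \<in> I"
  note c = controlled_A[OF assms(3)] and c' = controlled_A[OF p']
  note d = S_diff[OF _ _ assms(1,2)]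
  have "S \<gamma> (\<lambda>k e. A5 q p' k e - A5 q p k e - (- (p' - p)) * A4 q p k e) X
      = S \<gamma> (A5 q p') X - S \<gamma> (A5 q p) X - (- (p' - p)) * S \<gamma> (A4 q p) X"
    by (simp only: d[OF controlled_diff[OF c'(6) c(6)] controlled_cmult[OF c(5)]] d[OF c'(6) c(6)] S_cmult)
  with S_bound(2)[where \<gamma> = \<gamma>, OF controlled_Taylor_A5[where q = q, OF assms(3) p' assms(4)] assms(1,2)]
  show "\<bar>S \<gamma> (A5 q p') X - S \<gamma> (A5 q p) X - (p' - p) * - S \<gamma> (A4 q p) X\<bar> \<le> N * K * (\<bar>p' - p\<bar> powr \<alpha> * \<bar>p' - p\<bar>)"
    by (simp only: minus_mult_minus mult_minus_left mult_minus_right) (simp add: ac_simps)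
qed

lemma continuous_on_powr_bound:
  fixes f :: "real \<times> real \<Rightarrow> real"
  assumes bd: "\<And>q p q' p'. p \<in> I \<Longrightarrow> p' \<in> I \<Longrightarrow> \<bar>f (q, p) - f (q', p')\<bar> \<le> C * (\<bar>p - p'\<bar> powr \<alpha> + \<bar>q - q'\<bar>)"
    and \<alpha>: "0 < \<alpha>"
  shows "continuous_on open_strip f"
  unfolding continuous_on_def
proof
  fix z :: "real \<times> real" assume z: "z \<in> open_strip"
  have "((\<lambda>y. \<bar>snd y - snd z\<bar> powr \<alpha>) \<longlongrightarrow> 0) (at z within open_strip)"
    by (rule tendsto_zero_powrI[OF _ tendsto_const]) (auto intro!: tendsto_eq_intros simp: \<alpha>)
  moreover have "((\<lambda>y. \<bar>fst y - fst z\<bar>) \<longlongrightarrow> 0) (at z within open_strip)" by (auto intro!: tendsto_eq_intros)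
  ultimately have "((\<lambda>y. \<bar>snd y - snd z\<bar> powr \<alpha> + \<bar>fst y - fst z\<bar>) \<longlongrightarrow> 0) (at z within open_strip)"
    by (rule tendsto_add_zero)
  then have lim: "((\<lambda>y. C * (\<bar>snd y - snd z\<bar> powr \<alpha> + \<bar>fst y - fst z\<bar>)) \<longlongrightarrow> 0) (at z within open_strip)"
    by (rule tendsto_mult_right_zero)
  show "(f \<longlongrightarrow> f z) (at z within open_strip)"
  proof (rule LIM_zero_cancel, rule Lim_null_comparison[OF _ lim])
    have "norm (f y - f z) \<le> C * (\<bar>snd y - snd z\<bar> powr \<alpha> + \<bar>fst y - fst z\<bar>)" if "y \<in> open_strip" for y
      using bd[of "snd y" "snd z" "fst y" "fst z"] z that by (auto simp: open_strip_def)
    then show "\<forall>\<^sub>F y in at z within open_strip. norm (f y - f z) \<le> C * (\<bar>snd y - snd z\<bar> powr \<alpha> + \<bar>fst y - fst z\<bar>)"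
      by (auto simp: eventually_at_filter)
  qed
qed

lemma S_continuous:
  assumes "\<And>n. \<bar>\<gamma> n\<bar> \<le> N" "hb \<alpha> X K" "0 < \<alpha>" "\<alpha> \<le> 1"
  shows "continuous_on open_strip (\<lambda>(q, p). S \<gamma> (A2 q p) X)" "continuous_on open_strip (\<lambda>(q, p). S \<gamma> (A3 q p) X)"
    "continuous_on open_strip (\<lambda>(q, p). S \<gamma> (A4 q p) X)"
proof -
  have *: "continuous_on open_strip (\<lambda>(q, p). S \<gamma> (A q p) X)"
    if c: "\<And>q p. p \<in> I \<Longrightarrow> controlled \<alpha> 1 (A q p)"
      and d: "\<And>q p q' p'. p \<in> I \<Longrightarrow> p' \<in> I \<Longrightarrow> controlled \<alpha> (\<bar>p - p'\<bar> powr \<alpha> + \<bar>q - q'\<bar>) (\<lambda>k e. A q p k e - A q' p' k e)" for A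
  proof (rule continuous_on_powr_bound[OF _ assms(3), where C = "N * K"])
    fix q p q' p' :: real assume p: "p \<in> I" "p' \<in> I"
    show "\<bar>(case (q, p) of (q, p) \<Rightarrow> S \<gamma> (A q p) X) - (case (q', p') of (q, p) \<Rightarrow> S \<gamma> (A q p) X)\<bar>
        \<le> N * K * (\<bar>p - p'\<bar> powr \<alpha> + \<bar>q - q'\<bar>)"
      using S_bound(2)[where \<gamma> = \<gamma>, OF d[OF p, of q q'] assms(1,2)] unfolding S_diff[OF c[OF p(1)] c[OF p(2)] assms(1,2)]
      by (simp add: ac_simps)
  qed
  show "continuous_on open_strip (\<lambda>(q, p). S \<gamma> (A2 q p) X)" "continuous_on open_strip (\<lambda>(q, p). S \<gamma> (A3 q p) X)"
    "continuous_on open_strip (\<lambda>(q, p). S \<gamma> (A4 q p) X)"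
    by (rule *; rule controlled_A controlled_A_diff; (rule assms)?; assumption)+
qed

lemma ec_S: "ec (s / \<epsilon>) q p X = S (pw \<epsilon> s) (A2 q p) X" and es_S: "es (s / \<epsilon>) q p X = S (pw \<epsilon> s) (A3 q p) X"
  unfolding ec_def es_def ev_def S_def by (rule infsum_cong; simp add: pw_def A2_def A3_def split: prod.split)+

lemma S_A0_left: "S \<gamma> (A0 q (-1)) X = 0"
  unfolding S_def by (rule infsum_0) (auto simp: A0_def)

lemma derivative_unique_I:
  fixes f g :: "real \<Rightarrow> real"
  assumes "\<And>p. p \<in> I \<Longrightarrow> (f has_real_derivative f' p) (at p within I)" "\<And>p. p \<in> I \<Longrightarrow> (g has_real_derivative f' p) (at p within I)"
    "f (-1) = g (-1)" "p \<in> I"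
  shows "f p = g p"
proof -
  have "((\<lambda>p. f p - g p) has_real_derivative 0) (at p within I)" if "p \<in> I" for p
    using DERIV_diff[OF assms(1,2)[OF that]] by simp
  from Lip_I[OF this, where K = 0, of p "-1"] show ?thesis using assms(3,4) by simp
qed

section \<open>Polynomial identities between speed, height and fluxes\<close>

lemma squared_speed: "e = a + s * n \<Longrightarrow> 2 * a * n = m - s * (n * n) \<Longrightarrow> e * e = a * a + s * m" for e a s n m :: real
  by algebra

lemma reciprocal_speed: "e = a + s * n \<Longrightarrow> a * i = 1 \<Longrightarrow> r = - (i * i * n) - i * (s * (n * r)) \<Longrightarrow> e * (i + s * r) = 1"
  for e a s n i r :: real
  by algebra

lemma Y_identity: "Y = a * a * u0 + s * y \<Longrightarrow> y = a * a * z + m * u0 + s * (m * z) - e * (u * Y) \<Longrightarrow> u = u0 + s * z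
    \<Longrightarrow> e * e = a * a + s * m \<Longrightarrow> Y = e * e * u - s * (e * (u * Y))" for Y a u0 s y z m e u :: real
  by algebra

lemma reciprocal_height: "e * \<rho> = 1 \<Longrightarrow> Y = e * e * u - s * (e * (u * Y)) \<Longrightarrow> (e - s * Y) * (\<rho> + s * u) = 1"
  for e \<rho> Y u s :: real
  by algebra

text \<open>From \<open>e^3 = (a + s n) (a^2 + s m)\<close> and the equation for n follows
  \<open>e^3 = a^3 + 3/2 a s m - s^2 (a n^2 / 2 - n m)\<close>. In the term linear in m,
  \<open>u\<close> is split into \<open>u0 + s z\<close>, so that \<open>m u0\<close> alone is left
  for the load.\<close>

lemma vertical_flux_identity:
  fixes e a s n m u u0 z Y f w \<delta> :: real
  assumes "e = a + s * n" "2 * a * n = m - s * (n * n)" "u = u0 + s * z" "Y = e * e * u - s * (e * (u * Y))"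
    "2 * f = s * (- 3 * a * (s * (m * z)) + a * (s * (n * n * u)) - 2 * (s * (n * m * u)) + 2 * (e * e * (u * Y))
      + Y * Y + \<delta> * w - 3 * a * (u0 * m))"
  shows "2 * (a ^ 3 * u - f) = 2 * (e * Y) - s * (Y * Y) - s * (\<delta> * w)"
  using assms by algebra

lemma horizontal_flux_identity:
  fixes e a s n m v v0 z Y f \<delta> i :: real
  assumes "e = a + s * n" "2 * a * n = m - s * (n * n)" "v = v0 + s * z" "a * i = 1"
    "2 * f = s * (\<delta> * (i * (s * (m * z)) - s * (i * (n * n) * v) - 2 * (Y * v) + i * (m * v0)))"
  shows "\<delta> * a * v + f = \<delta> * (e - s * Y) * v"
proof -
  have "2 * f = s * (\<delta> * (2 * (n * v) - 2 * (Y * v)))" using assms by algebra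
  then show ?thesis using assms(1) by algebra
qed

section \<open>Evaluation of the fixed point\<close>

locale fixed_flow = stream_problem +
  fixes \<epsilon> :: real and x :: unknowns and B :: real
  assumes eps: "0 < \<epsilon>" "\<epsilon> \<le> 1" and hbx: "hbX \<alpha> x B"
    and fp: "x = (TU (G1 \<epsilon> x) (G2 \<epsilon> x), TV (G1 \<epsilon> x) (G2 \<epsilon> x), TM (G1 \<epsilon> x) (G2 \<epsilon> x), Nn \<epsilon> x, Rn \<epsilon> x, Yn \<epsilon> x)"
begin

lemma fp_components: "fst x = TU (G1 \<epsilon> x) (G2 \<epsilon> x)" "fst (snd x) = TV (G1 \<epsilon> x) (G2 \<epsilon> x)" "Mm x = TM (G1 \<epsilon> x) (G2 \<epsilon> x)"
  "Nm x = Nn \<epsilon> x" "Rm x = Rn \<epsilon> x" "snd (snd (snd (snd (snd x)))) = Yn \<epsilon> x"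
  using arg_cong[OF fp, of fst] arg_cong[OF fp, of "\<lambda>x. fst (snd x)"] arg_cong[OF fp, of Mm] arg_cong[OF fp, of Nm]
    arg_cong[OF fp, of Rm] arg_cong[OF fp, of "\<lambda>x. snd (snd (snd (snd (snd x))))"]
  by (simp_all only: fst_conv snd_conv)

definition F1 where "F1 = sh \<epsilon> (G1 \<epsilon> x + X1 (G1 \<epsilon> x) (G2 \<epsilon> x))"
definition F2 where "F2 = sh \<epsilon> (G2 \<epsilon> x + X2 (G1 \<epsilon> x) (G2 \<epsilon> x))"
definition \<Omega> where "\<Omega> = mulE c (Vm \<epsilon> x) + F2"
text \<open>Series of the p-derivative of the height, \<open>1 / a + s r + s u - 1\<close>. The
  height itself is its integral from the bottom, which builds in the bottom condition.\<close>

definition H where "H = single (0, 0) (mkc a5) + sh \<epsilon> (Rm x) + sh \<epsilon> (Um \<epsilon> x) + (-1) *\<^sub>R single (0, 0) (mkc (\<lambda>_. 1))"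

text \<open>A kernel element plus \<open>\<epsilon>\<close> times the shifted solution: shift and
  scaling respect \<open>Leq\<close>, because the mode equations do not involve the power of
  s.\<close>

lemma Leq_UV: "Leq F1 F2 (Um \<epsilon> x) (Vm \<epsilon> x)"
  using Leq_add[OF Leq_kernel[of "4 * \<kappa>"] Leq_scaleR[OF Leq_shift[OF Leq_T[of "G1 \<epsilon> x" "G2 \<epsilon> x"]], of \<epsilon>]]
  by (simp only: F1_def F2_def Um_def Vm_def u0_def v0_def sh_def fp_components(1,2) add_0_left)

lemma tame_hb: "tame \<alpha> f \<Longrightarrow> \<exists>K. hb \<alpha> (f \<epsilon> x) K"
proof -
  assume f: "tame \<alpha> f"
  obtain K where "K \<ge> 0" "\<And>\<epsilon> x y. \<epsilon> \<in> {0<..1} \<Longrightarrow> hbX \<alpha> x B \<Longrightarrow> hbX \<alpha> y B \<Longrightarrow> hb \<alpha> (f \<epsilon> x) K"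
    by (rule tameD[OF f, of B]) (rule that)
  then have "hb \<alpha> (f \<epsilon> x) K" using eps hbx by auto
  then show ?thesis by blast
qed

lemma hb_elements: "\<exists>K. hb \<alpha> (Um \<epsilon> x) K" "\<exists>K. hb \<alpha> (Ym \<epsilon> x) K" "\<exists>K. hb \<alpha> F1 K" "\<exists>K. hb \<alpha> \<Omega> K" "\<exists>K. hb \<alpha> H K"
  "\<exists>K. hb \<alpha> (fst x) K" "\<exists>K. hb \<alpha> (Mm x) K" "\<exists>K. hb \<alpha> (Nm x) K"
proof -
  note tG = nc_G[THEN nc_tame] and tX = nc_X[OF nc_G, THEN nc_tame]
  have "c = mkc (\<lambda>p. d\<^sup>2 * a p)"
  proof (rule bcontfun_eqI)
    fix p
    have "continuous_on I (\<lambda>p. d\<^sup>2 * a p)" by (intro continuous_intros ac)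
    then have "mkc (\<lambda>p. d\<^sup>2 * a p) p = c (cl p)" by (simp add: mkc_apply cval)
    also have "\<dots> = c p" using clc unfolding clinv_def by simp
    finally show "c p = mkc (\<lambda>p. d\<^sup>2 * a p) p" by simp
  qed
  then have hc: "hop \<alpha> (mulE c)" using holder_hop[OF holder_mult[OF holder_const ah] \<alpha>(1)] by simp
  show "\<exists>K. hb \<alpha> (Um \<epsilon> x) K" "\<exists>K. hb \<alpha> (Ym \<epsilon> x) K"
    by (rule tame_hb[OF tame_UVEY(1)], rule tame_hb[OF tame_UVEY(4)])
  show "\<exists>K. hb \<alpha> F1 K" unfolding F1_def by (rule tame_hb[OF tame_sh[OF tame_add[OF tG(1) tX(1)]]])
  show "\<exists>K. hb \<alpha> \<Omega> K" unfolding \<Omega>_def F2_def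
    by (rule tame_hb[OF tame_add[OF tame_hop[OF hc tame_UVEY(2)] tame_sh[OF tame_add[OF tG(2) tX(2)]]]])
  show "\<exists>K. hb \<alpha> (fst x) K" "\<exists>K. hb \<alpha> (Mm x) K" "\<exists>K. hb \<alpha> (Nm x) K"
    by (rule tame_hb[OF tame_proj(1)], rule tame_hb[OF tame_proj(3)], rule tame_hb[OF tame_proj(4)])
  obtain K1 where K1: "hb \<alpha> (single (0, 0) (mkc a5)) K1" using hb_mkc[OF a_holder(5)] by blast
  obtain K2 where K2: "hb \<alpha> (sh \<epsilon> (Rm x)) K2" using tame_hb[OF tame_sh[OF tame_proj(5)]] by blast
  obtain K3 where K3: "hb \<alpha> (sh \<epsilon> (Um \<epsilon> x)) K3" using tame_hb[OF tame_sh[OF tame_UVEY(1)]] by blast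
  obtain K4 where K4: "hb \<alpha> (single (0, 0) (mkc (\<lambda>_. 1))) K4" using hb_mkc[OF holder_const] by blast
  show "\<exists>K. hb \<alpha> H K" unfolding H_def using hb_add[OF hb_add[OF hb_add[OF K1 K2] K3] hb_scaleR[OF K4, of "-1"]] by blast
qed

definition \<nu> where "\<nu> s = ec (s / \<epsilon>) 0 0 (Mm x)"
definition ee where "ee s q p = ec (s / \<epsilon>) q p (Em \<epsilon> x)"
definition uu where "uu s q p = ec (s / \<epsilon>) q p (Um \<epsilon> x)"
definition vv where "vv s q p = es (s / \<epsilon>) q p (Vm \<epsilon> x)"
definition yy where "yy s q p = ec (s / \<epsilon>) q p (Ym \<epsilon> x)"
definition \<rho> where "\<rho> s q p = 1 / a p + s * ec (s / \<epsilon>) q p (Rm x)"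
definition \<tau> where "\<tau> s q p = ee s q p - s * yy s q p"

context
  fixes s q p :: real
  assumes s: "\<bar>s\<bar> \<le> \<epsilon> / 4" and p: "p \<in> I"
begin

lemma t_le: "\<bar>s / \<epsilon>\<bar> \<le> 1"
proof -
  have "\<bar>s\<bar> \<le> 1 * \<epsilon>" using s eps by linarith
  then show ?thesis using eps by (simp add: abs_divide divide_le_eq)
qed

lemma sh_eval: "ec (s / \<epsilon>) q p (sh \<epsilon> X) = s * ec (s / \<epsilon>) q p X" "es (s / \<epsilon>) q p (sh \<epsilon> X) = s * es (s / \<epsilon>) q p X"
  using ec_simps(5,6)[OF t_le, of q p \<epsilon> X] eps by simp_all

lemmas evs = ec_simps(1-4,7-11)[OF t_le] sh_eval

lemma base_eval: "ec (s / \<epsilon>) q p u0 = cos q * (\<kappa> * (b p * \<phi>F 1 p))" "es (s / \<epsilon>) q p v0 = sin q * (\<kappa> * \<phi> 1 p)"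
  "ec (s / \<epsilon>) q p (single (0, 0) e) = e p" for e
  unfolding u0_def v0_def ec_simps(12,13)[OF t_le] by (simp_all add: mult.assoc)

lemma mkc_val: "mkc a1 p = -3/2 * a p" "mkc a2 p = 1/2 * a p" "mkc a3 p = 1/2 * (1 / a p)" "mkc a4 p = 1 / a p * (1 / a p)"
  "mkc a5 p = 1 / a p" "mkc a6 p = a p * a p" "mkc a p = a p"
  by (simp_all only: mkc_a[OF p]) (simp_all only: a_defs)

lemma mu_eval: "ec (s / \<epsilon>) q p (Mm x) = \<nu> s"
  unfolding \<nu>_def fp_components(3) by (rule eval_X(3)[OF t_le])

lemma ee_eq: "ee s q p = a p + s * ec (s / \<epsilon>) q p (Nm x)"
  unfolding ee_def Em_def evs base_eval mkc_val(7) ..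

lemma uu_eq: "uu s q p = cos q * (\<kappa> * (b p * \<phi>F 1 p)) + s * ec (s / \<epsilon>) q p (fst x)"
  unfolding uu_def Um_def evs base_eval ..

lemma vv_eq: "vv s q p = sin q * (\<kappa> * \<phi> 1 p) + s * es (s / \<epsilon>) q p (fst (snd x))"
  unfolding vv_def Vm_def evs base_eval ..

lemma tau_eval: "ec (s / \<epsilon>) q p (Tm \<epsilon> x) = \<tau> s q p"
  unfolding Tm_def \<tau>_def ee_def yy_def evs by simp

lemma n_eq: "2 * a p * ec (s / \<epsilon>) q p (Nm x) = \<nu> s - s * (ec (s / \<epsilon>) q p (Nm x) * ec (s / \<epsilon>) q p (Nm x))"
proof -
  have "ec (s / \<epsilon>) q p (Nm x) = mkc a3 p * (\<nu> s + (-1) * (s * (ec (s / \<epsilon>) q p (Nm x) * ec (s / \<epsilon>) q p (Nm x))))"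
    using arg_cong[OF fp_components(4), of "ec (s / \<epsilon>) q p"]
    unfolding Nn_def evs fp_components(3)[symmetric] mu_eval .
  then have "2 * a p * ec (s / \<epsilon>) q p (Nm x) = 2 * a p * (mkc a3 p * (\<nu> s + (-1) * (s * (ec (s / \<epsilon>) q p (Nm x) * ec (s / \<epsilon>) q p (Nm x)))))"
    by (rule arg_cong)
  also have "\<dots> = \<nu> s - s * (ec (s / \<epsilon>) q p (Nm x) * ec (s / \<epsilon>) q p (Nm x))"
    using apos[OF p] by (simp add: mkc_val)
  finally show ?thesis .
qed

lemma ee_square: "ee s q p * ee s q p = a p * a p + s * \<nu> s"
  by (rule squared_speed[OF ee_eq n_eq])

lemma ai_eq: "a p * (1 / a p) = 1" using apos[OF p] by simp

lemma ee_rho: "ee s q p * \<rho> s q p = 1"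
  unfolding \<rho>_def
proof (rule reciprocal_speed[OF ee_eq ai_eq])
  have "ec (s / \<epsilon>) q p (Rm x) = (-1) * (mkc a4 p * ec (s / \<epsilon>) q p (Nm x)) + (-1) * (mkc a5 p * (s * (ec (s / \<epsilon>) q p (Nm x) * ec (s / \<epsilon>) q p (Rm x))))"
    using arg_cong[OF fp_components(5), of "ec (s / \<epsilon>) q p"] unfolding Rn_def evs fp_components(4)[symmetric] .
  then show "ec (s / \<epsilon>) q p (Rm x) = - (1 / a p * (1 / a p) * ec (s / \<epsilon>) q p (Nm x)) - 1 / a p * (s * (ec (s / \<epsilon>) q p (Nm x) * ec (s / \<epsilon>) q p (Rm x)))"
    unfolding mkc_val by linarith
qed

lemma yy_eq: "yy s q p = ee s q p * ee s q p * uu s q p - s * (ee s q p * (uu s q p * yy s q p))"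
proof (rule Y_identity[OF _ _ uu_eq ee_square])
  show "yy s q p = a p * a p * (cos q * (\<kappa> * (b p * \<phi>F 1 p))) + s * ec (s / \<epsilon>) q p (Yn \<epsilon> x)"
    unfolding yy_def Ym_def evs base_eval mkc_val fp_components(6) ..
  show "ec (s / \<epsilon>) q p (Yn \<epsilon> x) = a p * a p * ec (s / \<epsilon>) q p (fst x) + \<nu> s * (cos q * (\<kappa> * (b p * \<phi>F 1 p)))
    + s * (\<nu> s * ec (s / \<epsilon>) q p (fst x)) - ee s q p * (uu s q p * yy s q p)"
    unfolding Yn_def evs fp_components(1,3)[symmetric] mu_eval base_eval mkc_val ee_def[symmetric] uu_def[symmetric] yy_def[symmetric]
    by simp
qed

lemma tau_rho: "\<tau> s q p * (\<rho> s q p + s * uu s q p) = 1"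
  unfolding \<tau>_def by (rule reciprocal_height[OF ee_rho yy_eq])

lemma vertical_flux: "2 * (a p ^ 3 * uu s q p - ec (s / \<epsilon>) q p F1) = 2 * (ee s q p * yy s q p) - s * (yy s q p * yy s q p)
    - s * (d\<^sup>2 * (vv s q p * vv s q p * (\<tau> s q p * \<tau> s q p)))"
proof (rule vertical_flux_identity[OF ee_eq n_eq uu_eq yy_eq])
  let ?z = "ec (s / \<epsilon>) q p (fst x)" and ?n = "ec (s / \<epsilon>) q p (Nm x)" and ?u0 = "cos q * (\<kappa> * (b p * \<phi>F 1 p))"
  have "ec (s / \<epsilon>) q p (X1 (G1 \<epsilon> x) (G2 \<epsilon> x)) = cos q / 4 * (- 6 * a p * (\<kappa> * (b p * \<phi>F 1 p))) * \<nu> s"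
    unfolding eval_X(1)[OF t_le] fp_components(3)[symmetric] \<nu>_def[symmetric] d1val[OF p] ..
  also have "\<dots> = - 3 / 2 * (a p * (?u0 * \<nu> s))" by simp
  finally have x1: "ec (s / \<epsilon>) q p (X1 (G1 \<epsilon> x) (G2 \<epsilon> x)) = - 3 / 2 * (a p * (?u0 * \<nu> s))" .
  have "ec (s / \<epsilon>) q p F1 = s * (-3/2 * a p * (s * (\<nu> s * ?z)) + 1/2 * a p * (s * (?n * ?n * uu s q p)) + -1 * (s * (?n * \<nu> s * uu s q p))
      + ee s q p * ee s q p * (uu s q p * yy s q p) + 1/2 * (yy s q p * yy s q p)
      + d\<^sup>2 / 2 * (vv s q p * vv s q p * (\<tau> s q p * \<tau> s q p)) + - 3 / 2 * (a p * (?u0 * \<nu> s)))"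
    unfolding F1_def sh_eval ec_simps(1)[OF t_le] x1 unfolding G1_def evs mu_eval tau_eval mkc_val
      ee_def[symmetric] uu_def[symmetric] yy_def[symmetric] vv_def[symmetric] ..
  then show "2 * ec (s / \<epsilon>) q p F1 = s * (- 3 * a p * (s * (\<nu> s * ?z)) + a p * (s * (?n * ?n * uu s q p))
      - 2 * (s * (?n * \<nu> s * uu s q p)) + 2 * (ee s q p * ee s q p * (uu s q p * yy s q p)) + yy s q p * yy s q p
      + d\<^sup>2 * (vv s q p * vv s q p * (\<tau> s q p * \<tau> s q p)) - 3 * a p * (?u0 * \<nu> s))"
    by (simp only:) (simp add: algebra_simps)
qed

lemma horizontal_flux: "es (s / \<epsilon>) q p \<Omega> = d\<^sup>2 * \<tau> s q p * vv s q p"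
proof -
  let ?z = "es (s / \<epsilon>) q p (fst (snd x))" and ?n = "ec (s / \<epsilon>) q p (Nm x)" and ?v0 = "sin q * (\<kappa> * \<phi> 1 p)"
  have "es (s / \<epsilon>) q p (X2 (G1 \<epsilon> x) (G2 \<epsilon> x)) = sin q / 4 * (2 * d\<^sup>2 * (\<kappa> * \<phi> 1 p) / a p) * \<nu> s"
    unfolding eval_X(2)[OF t_le] fp_components(3)[symmetric] \<nu>_def[symmetric] d2val[OF p] ..
  also have "\<dots> = d\<^sup>2 / 2 * (1 / a p * (\<nu> s * ?v0))" by simp
  finally have x2: "es (s / \<epsilon>) q p (X2 (G1 \<epsilon> x) (G2 \<epsilon> x)) = d\<^sup>2 / 2 * (1 / a p * (\<nu> s * ?v0))" .
  have "es (s / \<epsilon>) q p F2 = s * (d\<^sup>2 * (1/2 * (1 / a p) * (s * (\<nu> s * ?z)) + -1 * (s * (1/2 * (1 / a p) * (?n * ?n) * vv s q p))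
      + -1 * (yy s q p * vv s q p)) + d\<^sup>2 / 2 * (1 / a p * (\<nu> s * ?v0)))"
    unfolding F2_def sh_eval ec_simps(2)[OF t_le] x2 unfolding G2_def evs mu_eval mkc_val yy_def[symmetric] vv_def[symmetric] ..
  then have "2 * es (s / \<epsilon>) q p F2 = s * (d\<^sup>2 * (1 / a p * (s * (\<nu> s * ?z)) - s * (1 / a p * (?n * ?n) * vv s q p)
      - 2 * (yy s q p * vv s q p) + 1 / a p * (\<nu> s * ?v0)))"
    by (simp only:) (simp add: algebra_simps)
  from horizontal_flux_identity[OF ee_eq n_eq vv_eq ai_eq this]
  show ?thesis unfolding \<Omega>_def evs vv_def[symmetric] cval[OF p] \<tau>_def .
qed

lemma pw_le: "\<bar>pw \<epsilon> s n\<bar> \<le> 1" by (rule pw_bounds(1)[OF eps(1) s s])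

lemma vv_S: "vv s q p = - S (pw \<epsilon> s) (A1 q p) (Um \<epsilon> x)"
  unfolding vv_def es_S S_def infsum_uminus[symmetric]
  by (rule infsum_cong) (auto simp: A1_def A3_def LeqD(1)[OF Leq_UV p])

text \<open>The second equation of \<open>Leq\<close>, summed over all modes; the three series
  converge separately. The factor k in front of \<open>IR\<close> is the one built into
  \<open>A5\<close>.\<close>

lemma uu_S: "uu s q p = b p * (ec (s / \<epsilon>) q p F1 + G * S (pw \<epsilon> s) (A0 q 0) (Um \<epsilon> x) - S (pw \<epsilon> s) (A5 q p) \<Omega>)"
proof -
  obtain K1 K2 K3 where K: "hb \<alpha> F1 K1" "hb \<alpha> (Um \<epsilon> x) K2" "hb \<alpha> \<Omega> K3" using hb_elements by blast
  note A = controlled_A[OF p] and A' = controlled_A[of 0]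
  have z: "(0 :: real) \<in> I" by simp
  note s1 = S_bound(1)[OF A(3)[of \<alpha> q] pw_le K(1)]
  note s2 = summable_on_cmult_right[OF S_bound(1)[OF A'(1)[OF z, of \<alpha> q] pw_le K(2)], of G]
  note s3 = S_bound(1)[OF A(6)[of \<alpha> q] pw_le K(3)]
  have "uu s q p = (\<Sum>\<^sub>\<infinity>i. b p * ((case i of (n, k) \<Rightarrow> pw \<epsilon> s n * A2 q p k (coord F1 (n, k)))
     + G * (case i of (n, k) \<Rightarrow> pw \<epsilon> s n * A0 q 0 k (coord (Um \<epsilon> x) (n, k)))
     + - (case i of (n, k) \<Rightarrow> pw \<epsilon> s n * A5 q p k (coord \<Omega> (n, k)))))"
    unfolding uu_def ec_S S_def
  proof (rule infsum_cong)
    fix i :: "nat \<times> nat"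
    obtain n k where i: "i = (n, k)" by (cases i)
    have co: "coord \<Omega> (n, k) = bmul c (coord (Vm \<epsilon> x) (n, k)) + coord F2 (n, k)" by (simp add: \<Omega>_def)
    show "(case i of (n, k) \<Rightarrow> pw \<epsilon> s n * A2 q p k (coord (Um \<epsilon> x) (n, k))) =
      b p * ((case i of (n, k) \<Rightarrow> pw \<epsilon> s n * A2 q p k (coord F1 (n, k)))
     + G * (case i of (n, k) \<Rightarrow> pw \<epsilon> s n * A0 q 0 k (coord (Um \<epsilon> x) (n, k)))
     + - (case i of (n, k) \<Rightarrow> pw \<epsilon> s n * A5 q p k (coord \<Omega> (n, k))))"
      unfolding i prod.case A2_def A0_def A5_def LeqD(2)[OF Leq_UV p, of n k] co by (simp add: algebra_simps)
  qed
  also have "\<dots> = b p * ((S (pw \<epsilon> s) (A2 q p) F1 + G * S (pw \<epsilon> s) (A0 q 0) (Um \<epsilon> x)) + - S (pw \<epsilon> s) (A5 q p) \<Omega>)"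
    unfolding S_def infsum_cmult_right' infsum_uminus[symmetric]
    unfolding infsum_cmult_right'[symmetric, of G]
    by (subst infsum_add[OF summable_on_add[OF s1 s2] summable_on_uminus[THEN iffD2, OF s3]], subst infsum_add[OF s1 s2]) (rule refl)
  finally show ?thesis by (simp add: ec_S)
qed

text \<open>On the left, \<open>a\<close> and the series are only Hoelder continuous in p. On the
  right p enters through the integral \<open>A5\<close> alone, so the flux as a whole is
  differentiable. At the surface \<open>A5\<close> vanishes and the Robin condition remains.\<close>

lemma flux_balance: "a p ^ 3 * uu s q p - ec (s / \<epsilon>) q p F1 = G * S (pw \<epsilon> s) (A0 q 0) (Um \<epsilon> x) - S (pw \<epsilon> s) (A5 q p) \<Omega>"
proof -
  have "a p ^ 3 * b p = 1" using apos[OF p] by (simp add: bval[OF p])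
  then have "a p ^ 3 * uu s q p = ec (s / \<epsilon>) q p F1 + G * S (pw \<epsilon> s) (A0 q 0) (Um \<epsilon> x) - S (pw \<epsilon> s) (A5 q p) \<Omega>"
    by (subst uu_S) (simp only: mult.assoc[symmetric] mult_1_left)
  then show ?thesis by simp
qed

lemma H_eval: "ec (s / \<epsilon>) q p H = \<rho> s q p + s * uu s q p - 1"
proof -
  have "mkc (\<lambda>_. 1) p = 1" by (simp add: mkc_apply)
  then show ?thesis unfolding H_def evs base_eval mkc_val \<rho>_def uu_def by simp
qed

end

end

lemma distrib_div_eq_cong:
  assumes "distrib_div_eq T F f" "\<And>x. x \<in> T \<Longrightarrow> F x = F' x"
  shows "distrib_div_eq T F' f"
  unfolding distrib_div_eq_def
proof (intro allI impI)
  fix \<phi> assume t: "test_function T \<phi>"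
  have "(LINT x:T|lborel. frechet_derivative \<phi> (at x) (F' x)) = (LINT x:T|lborel. frechet_derivative \<phi> (at x) (F x))"
    unfolding set_lebesgue_integral_def
    by (rule Bochner_Integration.integral_cong) (auto simp: indicator_def assms(2))
  then show "(LINT x:T|lborel. frechet_derivative \<phi> (at x) (F' x)) = - (LINT x:T|lborel. f x * \<phi> x)"
    using assms(1) t unfolding distrib_div_eq_def by simp
qed

lemma energy_identity:
  fixes d s v \<tau> \<Gamma> lam e y w :: real
  assumes "0 < d" "0 < \<tau>" "e * e = lam + \<Gamma>" "\<tau> = e - s * y"
    "2 * w = 2 * (e * y) - s * (y * y) - s * (d\<^sup>2 * (v * v * (\<tau> * \<tau>)))"
  shows "- (1 + d\<^sup>2 * (- (s * v))\<^sup>2) / (2 * d\<^sup>2 * (1 / \<tau>)\<^sup>2) + \<Gamma> / (2 * d\<^sup>2) = - lam / (2 * d\<^sup>2) + s / d\<^sup>2 * w"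
proof -
  have "- (1 + d\<^sup>2 * (s * v * (s * v))) * (\<tau> * \<tau>) + \<Gamma> = - lam + s * (2 * w)"
    unfolding assms(5) using assms(3,4) by algebra
  then have "(- (1 + d\<^sup>2 * (s * v * (s * v))) * (\<tau> * \<tau>) + \<Gamma>) / (2 * d\<^sup>2) = (- lam + s * (2 * w)) / (2 * d\<^sup>2)" by simp
  moreover have "- (1 + d\<^sup>2 * (- (s * v))\<^sup>2) / (2 * d\<^sup>2 * (1 / \<tau>)\<^sup>2) = - (1 + d\<^sup>2 * (s * v * (s * v))) * (\<tau> * \<tau>) / (2 * d\<^sup>2)"
    using assms(1,2) by (simp add: power_divide power2_eq_square)
  moreover have "(- lam + s * (2 * w)) / (2 * d\<^sup>2) = - lam / (2 * d\<^sup>2) + s / d\<^sup>2 * w"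
    using assms(1) by (simp add: field_simps)
  ultimately show ?thesis by (simp only: add_divide_distrib)
qed

text \<open>The laminar contributions cancel by the choice of Q as a function of
  \<open>\<lambda>\<close>. What is left at order s is the Robin condition, which fixes
  \<open>G\<close>.\<close>

lemma surface_identity:
  fixes g d p0 lam s h1 J G :: real
  assumes "0 < d" "p0 \<noteq> 0" "G = g * d ^ 3 / p0\<^sup>2"
  shows "- lam / (2 * d\<^sup>2) + s / d\<^sup>2 * (G * h1) - g * d * (J - 1 + s * h1 + 1) / p0\<^sup>2
    + (2 * g * d * J + p0\<^sup>2 / d\<^sup>2 * lam) / (2 * p0\<^sup>2) = 0"
  unfolding assms(3) using assms(1,2) by (simp add: field_simps power2_eq_square power3_eq_cube)

section \<open>The height function as a solution of the water wave problem\<close>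

locale wave_flow = fixed_flow +
  fixes \<Gamma> :: "real \<Rightarrow> real" and l g p0 :: real and M :: "real \<Rightarrow> real"
  assumes asq: "\<And>p. p \<in> I \<Longrightarrow> a p * a p = \<Gamma> p + l" and Gval: "G = g * d ^ 3 / p0\<^sup>2" and p0: "p0 \<noteq> 0"
    and \<Gamma>0: "\<Gamma> 0 = 0" and c\<Gamma>: "continuous_on I \<Gamma>" and Mval: "\<And>p. p \<in> I \<Longrightarrow> M p = \<kappa> * \<phi> 1 p"
begin

definition lam where "lam s = l + s * \<nu> s"
definition hh where "hh s = (\<lambda>(q, p). S (pw \<epsilon> s) (A0 q p) H)"

lemma lam_ee: "\<bar>s\<bar> \<le> \<epsilon> / 4 \<Longrightarrow> p \<in> I \<Longrightarrow> ee s q p * ee s q p = lam s + \<Gamma> p"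
  using ee_square[of s p q] asq[of p] by (simp add: lam_def)

lemma A0_Um:
  assumes s: "\<bar>s\<bar> \<le> \<epsilon> / 4" and p: "p \<in> I"
  shows "S (pw \<epsilon> s) (A0 q p) (Um \<epsilon> x) = M p * cos q + s * S (pw \<epsilon> s) (A0 q p) (fst x)"
proof -
  obtain KU KZ where K: "hb \<alpha> (Um \<epsilon> x) KU" "hb \<alpha> (fst x) KZ" using hb_elements by blast
  note pw = pw_bounds(1)[OF eps(1) s s]
  note dU = T3_derivatives(2)[OF S_T3[where \<gamma> = "pw \<epsilon> s", OF pw K(1) \<alpha>] \<alpha>(1), unfolded prod.case]
  note dZ = T3_derivatives(2)[OF S_T3[where \<gamma> = "pw \<epsilon> s", OF pw K(2) \<alpha>] \<alpha>(1), unfolded prod.case]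
  have "S (pw \<epsilon> s) (A0 q p) (Um \<epsilon> x) = \<kappa> * \<phi> 1 p * cos q + s * S (pw \<epsilon> s) (A0 q p) (fst x)"
  proof (rule derivative_unique_I[OF dU _ _ p])
    fix p :: real assume p: "p \<in> I"
    have "((\<lambda>p. \<kappa> * \<phi> 1 p * cos q + s * S (pw \<epsilon> s) (A0 q p) (fst x)) has_real_derivative
        \<kappa> * (b p * \<phi>F 1 p) * cos q + s * S (pw \<epsilon> s) (A2 q p) (fst x)) (at p within I)"
      by (intro DERIV_add DERIV_cmult DERIV_cmult_right fs_d(1) dZ p)
    then show "((\<lambda>p. \<kappa> * \<phi> 1 p * cos q + s * S (pw \<epsilon> s) (A0 q p) (fst x)) has_real_derivative
        S (pw \<epsilon> s) (A2 q p) (Um \<epsilon> x)) (at p within I)"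
      by (rule DERIV_cong) (use uu_eq[OF s p, of q] in \<open>simp add: uu_def ec_S mult.commute\<close>)
  qed (simp_all add: S_A0_left)
  then show ?thesis by (simp add: Mval[OF p])
qed

context
  fixes s :: real
  assumes s: "\<bar>s\<bar> \<le> \<epsilon> / 4" and pos: "\<And>q p. p \<in> I \<Longrightarrow> 0 < ee s q p" "\<And>q p. p \<in> I \<Longrightarrow> 0 < \<tau> s q p"
begin

text \<open>The square of \<open>ee\<close> is known, but the series determines the root only
  together with a sign; positivity selects the laminar speed.\<close>

lemma rho_eq: "p \<in> I \<Longrightarrow> \<rho> s q p = 1 / sqrt (lam s + \<Gamma> p)"
proof -
  assume p: "p \<in> I"
  have "sqrt (lam s + \<Gamma> p) = ee s q p"
    using lam_ee[OF s p, of q] pos(1)[OF p, of q] by (intro real_sqrt_unique) (auto simp: power2_eq_square)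
  then show ?thesis using ee_rho[OF s p, of q] pos(1)[OF p, of q] by (simp add: field_simps)
qed

lemma lam_Gamma_pos: "p \<in> I \<Longrightarrow> 0 < lam s + \<Gamma> p"
  using lam_ee[OF s, of p 0] pos(1)[of p 0] by (metis mult_pos_pos)

lemma height_slope: "p \<in> I \<Longrightarrow> \<rho> s q p + s * uu s q p = 1 / \<tau> s q p"
  using tau_rho[OF s, of p q] pos(2)[of p q] by (simp add: field_simps)

lemma hh_T3: obtains K where "T3 \<alpha> (hh s) (\<lambda>(q, p). S (pw \<epsilon> s) (A1 q p) H) (\<lambda>(q, p). S (pw \<epsilon> s) (A2 q p) H) K"
proof -
  obtain K where "hb \<alpha> H K" using hb_elements by blast
  from S_T3[where \<gamma> = "pw \<epsilon> s", OF pw_bounds(1)[OF eps(1) s s] this \<alpha>] show thesis by (rule that[unfolded hh_def])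
qed

text \<open>Both sides vanish at the bottom and have the same p-derivative: by \<open>H_eval\<close>
  it is the laminar slope plus \<open>s * uu\<close>.\<close>

lemma hh_eq: "p \<in> I \<Longrightarrow> hh s (q, p) = laminar \<Gamma> (lam s) p + s * S (pw \<epsilon> s) (A0 q p) (Um \<epsilon> x)"
proof -
  assume p: "p \<in> I"
  obtain K where T: "T3 \<alpha> (hh s) (\<lambda>(q, p). S (pw \<epsilon> s) (A1 q p) H) (\<lambda>(q, p). S (pw \<epsilon> s) (A2 q p) H) K"
    by (rule hh_T3) (rule that)
  obtain KU where K: "hb \<alpha> (Um \<epsilon> x) KU" using hb_elements by blast
  note dU = T3_derivatives(2)[OF S_T3[where \<gamma> = "pw \<epsilon> s", OF pw_bounds(1)[OF eps(1) s s] K \<alpha>] \<alpha>(1), unfolded prod.case]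
  have cont: "continuous_on I (\<lambda>s'. 1 / sqrt (lam s + \<Gamma> s'))"
  proof (intro continuous_intros c\<Gamma> ballI)
    show "sqrt (lam s + \<Gamma> p) \<noteq> 0" if "p \<in> I" for p using lam_Gamma_pos[OF that] by simp
  qed
  show ?thesis
  proof (rule derivative_unique_I[OF T3_derivatives(2)[OF T \<alpha>(1), unfolded prod.case] _ _ p])
    fix p :: real assume p: "p \<in> I"
    have "((\<lambda>p. laminar \<Gamma> (lam s) p + s * S (pw \<epsilon> s) (A0 q p) (Um \<epsilon> x)) has_real_derivative
        (1 / sqrt (lam s + \<Gamma> p) - (1 + 0)) + s * S (pw \<epsilon> s) (A2 q p) (Um \<epsilon> x)) (at p within I)"
      unfolding laminar_def
      by (intro DERIV_add DERIV_diff DERIV_cmult dU p integral_has_real_derivative[OF cont p] DERIV_ident DERIV_const)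
    then show "((\<lambda>p. laminar \<Gamma> (lam s) p + s * S (pw \<epsilon> s) (A0 q p) (Um \<epsilon> x)) has_real_derivative
        S (pw \<epsilon> s) (A2 q p) H) (at p within I)"
      by (rule DERIV_cong) (use H_eval[OF s p, of q] in \<open>simp add: rho_eq[OF p] uu_def ec_S\<close>)
  qed (simp_all add: hh_def S_A0_left laminar_def)
qed

text \<open>The q-derivative is computed twice, from the series \<open>H\<close> and from
  \<open>hh_eq\<close>, whose laminar part does not depend on q.\<close>

lemma slope_q: "p \<in> I \<Longrightarrow> S (pw \<epsilon> s) (A1 q p) H = - (s * vv s q p)"
proof -
  assume p: "p \<in> I"
  obtain K where T: "T3 \<alpha> (hh s) (\<lambda>(q, p). S (pw \<epsilon> s) (A1 q p) H) (\<lambda>(q, p). S (pw \<epsilon> s) (A2 q p) H) K"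
    by (rule hh_T3) (rule that)
  obtain KU where K: "hb \<alpha> (Um \<epsilon> x) KU" using hb_elements by blast
  note dU = T3_derivatives(1)[OF S_T3[where \<gamma> = "pw \<epsilon> s", OF pw_bounds(1)[OF eps(1) s s] K \<alpha>] \<alpha>(1) p, unfolded prod.case]
  have "((\<lambda>q. laminar \<Gamma> (lam s) p + s * S (pw \<epsilon> s) (A0 q p) (Um \<epsilon> x)) has_real_derivative
      0 + s * S (pw \<epsilon> s) (A1 q p) (Um \<epsilon> x)) (at q)"
    by (intro DERIV_add DERIV_cmult dU DERIV_const)
  then have "((\<lambda>q. hh s (q, p)) has_real_derivative 0 + s * S (pw \<epsilon> s) (A1 q p) (Um \<epsilon> x)) (at q)"
    by (simp only: hh_eq[OF p])
  from DERIV_unique[OF this T3_derivatives(1)[OF T \<alpha>(1) p, unfolded prod.case]]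
  show ?thesis using vv_S[OF s p, of q] by simp
qed

lemma hh_pd:
  assumes "p \<in> I"
  shows "pd_on strip (1, 0) (hh s) (q, p) = - (s * vv s q p)" "1 + pd_on strip (0, 1) (hh s) (q, p) = 1 / \<tau> s q p"
proof -
  obtain K where T: "T3 \<alpha> (hh s) (\<lambda>(q, p). S (pw \<epsilon> s) (A1 q p) H) (\<lambda>(q, p). S (pw \<epsilon> s) (A2 q p) H) K"
    by (rule hh_T3) (rule that)
  have "(q, p) \<in> strip" using assms by (simp add: strip_def)
  then have pd: "pd_on strip (1, 0) (hh s) (q, p) = S (pw \<epsilon> s) (A1 q p) H" "pd_on strip (0, 1) (hh s) (q, p) = S (pw \<epsilon> s) (A2 q p) H"
    using T3_strip_pd[OF T \<alpha>, of "(q, p)"] by simp_all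
  show "pd_on strip (1, 0) (hh s) (q, p) = - (s * vv s q p)" unfolding pd slope_q[OF assms] ..
  show "1 + pd_on strip (0, 1) (hh s) (q, p) = 1 / \<tau> s q p"
    unfolding pd using H_eval[OF s assms, of q] height_slope[OF assms, of q] by (simp add: ec_S)
qed

definition energy where
  "energy z = - (1 + d\<^sup>2 * (pd_on strip (1, 0) (hh s) z)\<^sup>2) / (2 * d\<^sup>2 * (1 + pd_on strip (0, 1) (hh s) z)\<^sup>2)"

lemma energy_eq:
  assumes p: "p \<in> I"
  shows "energy (q, p) + \<Gamma> p / (2 * d\<^sup>2) = - lam s / (2 * d\<^sup>2) + s / d\<^sup>2 * (a p ^ 3 * uu s q p - ec (s / \<epsilon>) q p F1)"
  unfolding energy_def hh_pd[OF p]
  by (rule energy_identity[OF d pos(2)[OF p] lam_ee[OF s p] \<tau>_def vertical_flux[OF s p]])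

text \<open>Both components are replaced by series: the horizontal one by the sine series of
  \<open>\<Omega>\<close>, the vertical one, through \<open>flux_balance\<close>, by an integral of
  the q-derivative of that series. The two derivatives then cancel, as
  \<open>distrib_div_eq_classical\<close> demands.\<close>

lemma hh_distrib:
  "distrib_div_eq open_strip (\<lambda>z. (pd_on strip (1, 0) (hh s) z / (1 + pd_on strip (0, 1) (hh s) z), energy z + \<Gamma> (snd z) / (2 * d\<^sup>2))) (\<lambda>z. 0)"
proof -
  obtain KU KF KO where K: "hb \<alpha> (Um \<epsilon> x) KU" "hb \<alpha> F1 KF" "hb \<alpha> \<Omega> KO" using hb_elements by blast
  note pw = pw_bounds(1)[OF eps(1) s s]
  define P1 P2 P3 where "P1 = (\<lambda>(q, p). S (pw \<epsilon> s) (A2 q p) (Um \<epsilon> x))" and "P2 = (\<lambda>(q, p). S (pw \<epsilon> s) (A2 q p) F1)"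
    and "P3 = (\<lambda>(q, p). S (pw \<epsilon> s) (A3 q p) \<Omega>)"
  define P4 where "P4 = (\<lambda>(q, p). S (pw \<epsilon> s) (A4 q p) \<Omega>)"
  have cP: "continuous_on open_strip P1" "continuous_on open_strip P2" "continuous_on open_strip P3" "continuous_on open_strip P4"
    unfolding P1_def P2_def P3_def P4_def
    by (rule S_continuous(1)[where \<gamma> = "pw \<epsilon> s", OF pw K(1) \<alpha>] S_continuous(1)[where \<gamma> = "pw \<epsilon> s", OF pw K(2) \<alpha>] S_continuous(2)[where \<gamma> = "pw \<epsilon> s", OF pw K(3) \<alpha>] S_continuous(3)[where \<gamma> = "pw \<epsilon> s", OF pw K(3) \<alpha>])+
  have ca: "continuous_on open_strip (\<lambda>z. a (snd z))"
    by (rule continuous_on_compose2[OF ac continuous_on_snd[OF continuous_on_id]]) (auto simp: open_strip_def)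
  show ?thesis
  proof (rule distrib_div_eq_cong[OF distrib_div_eq_classical[where ?F1.0 = "\<lambda>z. - (s / d\<^sup>2) * P3 z"
        and ?F2.0 = "\<lambda>z. - lam s / (2 * d\<^sup>2) + s / d\<^sup>2 * (a (snd z) ^ 3 * P1 z - P2 z)" and E = "\<lambda>z. - (s / d\<^sup>2) * P4 z"]])
    show "continuous_on open_strip (\<lambda>z. - (s / d\<^sup>2) * P3 z)" "continuous_on open_strip (\<lambda>z. - (s / d\<^sup>2) * P4 z)"
      "continuous_on open_strip (\<lambda>z. - lam s / (2 * d\<^sup>2) + s / d\<^sup>2 * (a (snd z) ^ 3 * P1 z - P2 z))"
      by (intro continuous_on_add continuous_on_mult continuous_on_diff continuous_on_power continuous_on_const cP ca)+
  next
    fix q p :: real assume p: "p \<in> {-1<..<0}"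
    then have pI: "p \<in> I" by auto
    show "((\<lambda>q. - (s / d\<^sup>2) * P3 (q, p)) has_real_derivative - (s / d\<^sup>2) * P4 (q, p)) (at q)"
      unfolding P3_def P4_def prod.case by (rule DERIV_cmult[OF S_deriv_A3[where \<gamma> = "pw \<epsilon> s", OF pw K(3) pI]])
    have eq: "- lam s / (2 * d\<^sup>2) + s / d\<^sup>2 * (a (snd (q, p)) ^ 3 * P1 (q, p) - P2 (q, p))
        = - lam s / (2 * d\<^sup>2) + s / d\<^sup>2 * (G * S (pw \<epsilon> s) (A0 q 0) (Um \<epsilon> x) - S (pw \<epsilon> s) (A5 q p) \<Omega>)" if "p \<in> I" for p
      using flux_balance[OF s that, of q] by (simp add: P1_def P2_def uu_def ec_S)
    have "((\<lambda>p. - lam s / (2 * d\<^sup>2) + s / d\<^sup>2 * (G * S (pw \<epsilon> s) (A0 q 0) (Um \<epsilon> x) - S (pw \<epsilon> s) (A5 q p) \<Omega>))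
        has_real_derivative 0 + s / d\<^sup>2 * (0 - - S (pw \<epsilon> s) (A4 q p) \<Omega>)) (at p within I)"
      by (intro DERIV_add DERIV_cmult DERIV_diff DERIV_const S_deriv_A5[where \<gamma> = "pw \<epsilon> s", OF pw K(3) pI \<alpha>(1)])
    then have "((\<lambda>p. - lam s / (2 * d\<^sup>2) + s / d\<^sup>2 * (a (snd (q, p)) ^ 3 * P1 (q, p) - P2 (q, p)))
        has_real_derivative 0 + s / d\<^sup>2 * (0 - - S (pw \<epsilon> s) (A4 q p) \<Omega>)) (at p within I)"
      by (rule has_field_derivative_transform_within[OF _ zero_less_one pI]) (simp only: eq)
    then show "((\<lambda>p. - lam s / (2 * d\<^sup>2) + s / d\<^sup>2 * (a (snd (q, p)) ^ 3 * P1 (q, p) - P2 (q, p)))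
        has_real_derivative - (- (s / d\<^sup>2) * P4 (q, p))) (at p)"
      using at_within_Icc_at[of "-1" p 0] p by (simp add: P4_def)
  next
    fix z :: "real \<times> real" assume "z \<in> open_strip"
    then obtain q p where z: "z = (q, p)" and pI: "p \<in> I" by (cases z) (auto simp: open_strip_def)
    have 1: "- (s / d\<^sup>2) * P3 (q, p) = - (s * vv s q p) / (1 / \<tau> s q p)"
      using horizontal_flux[OF s pI, of q] d by (simp add: P3_def es_S)
    have 2: "- lam s / (2 * d\<^sup>2) + s / d\<^sup>2 * (a p ^ 3 * P1 (q, p) - P2 (q, p)) = energy (q, p) + \<Gamma> p / (2 * d\<^sup>2)"
      unfolding energy_eq[OF pI] by (simp add: P1_def P2_def uu_def ec_S)
    show "(- (s / d\<^sup>2) * P3 z, - lam s / (2 * d\<^sup>2) + s / d\<^sup>2 * (a (snd z) ^ 3 * P1 z - P2 z))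
      = (pd_on strip (1, 0) (hh s) z / (1 + pd_on strip (0, 1) (hh s) z), energy z + \<Gamma> (snd z) / (2 * d\<^sup>2))"
      unfolding z snd_conv hh_pd[OF pI] 1 2 ..
  qed
qed

lemma hh_surface: "energy (q, 0) - g * d * (hh s (q, 0) + 1) / p0\<^sup>2 + Q_of g d p0 \<Gamma> (lam s) / (2 * p0\<^sup>2) = 0"
proof -
  have z: "(0 :: real) \<in> I" by simp
  have "S (pw \<epsilon> s) (A5 q 0) \<Omega> = 0" unfolding S_def by (rule infsum_0) (auto simp: A5_def)
  then have "energy (q, 0) = - lam s / (2 * d\<^sup>2) + s / d\<^sup>2 * (G * S (pw \<epsilon> s) (A0 q 0) (Um \<epsilon> x))"
    using energy_eq[OF z, of q] flux_balance[OF s z, of q] \<Gamma>0 by simp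
  then show ?thesis
    using surface_identity[OF d p0 Gval, of "lam s" s "S (pw \<epsilon> s) (A0 q 0) (Um \<epsilon> x)" "integral I (\<lambda>s'. 1 / sqrt (lam s + \<Gamma> s'))"]
    by (simp only: hh_eq[OF z] laminar_def Q_of_def add_0_left)
qed

lemma hh_solution: "water_wave_solution \<alpha> g d p0 \<Gamma> (Q_of g d p0 \<Gamma> (lam s)) (hh s)"
  unfolding water_wave_solution_def Let_def
proof (intro conjI ballI allI)
  obtain K where K: "hb \<alpha> H K" using hb_elements by blast
  show "hh s \<in> C1_holder_per \<alpha>"
    unfolding hh_def by (rule S_C1_holder_per[where \<gamma> = "pw \<epsilon> s", OF pw_bounds(1)[OF eps(1) s s] K \<alpha>])
  show "0 < pd_on strip (0, 1) (hh s) z + 1" if "z \<in> strip" for z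
  proof -
    obtain q p where z: "z = (q, p)" "p \<in> I" using \<open>z \<in> strip\<close> by (cases z) (auto simp: strip_def)
    show ?thesis using hh_pd(2)[OF z(2), of q] pos(2)[OF z(2), of q] by (simp add: z add.commute)
  qed
  show "hh s (q, -1) = 0" for q by (simp add: hh_def S_A0_left)
qed (use hh_distrib hh_surface in \<open>simp_all only: energy_def\<close>)

lemma hh_expansion:
  "p \<in> I \<Longrightarrow> hh s (q, p) - (laminar \<Gamma> (lam s) p + s * M p * cos q) = s\<^sup>2 * S (pw \<epsilon> s) (A0 q p) (fst x)"
  by (simp add: hh_eq A0_Um[OF s] algebra_simps power2_eq_square)

text \<open>The remainder is again one of the series treated by \<open>S_T3\<close>, with
  \<open>s\<^sup>2\<close> put into the sequence \<open>\<gamma>\<close>; it is quadratic in s in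
  the full norm.\<close>

lemma hh_remainder:
  assumes K: "hb \<alpha> (fst x) K"
  shows "\<bar>C1_holder_norm \<alpha> cell (\<lambda>(q, p). hh s (q, p) - (laminar \<Gamma> (lam s) p + s * M p * cos q))\<bar> \<le> 7 * (s\<^sup>2 * K)"
proof -
  have "\<bar>s\<^sup>2 * pw \<epsilon> s n\<bar> \<le> s\<^sup>2" for n
    using pw_bounds(1)[OF eps(1) s s, of n] by (simp add: abs_mult mult_left_le)
  from S_T3[where \<gamma> = "\<lambda>n. s\<^sup>2 * pw \<epsilon> s n", OF this K \<alpha>]
  have "T3 \<alpha> (\<lambda>(q, p). hh s (q, p) - (laminar \<Gamma> (lam s) p + s * M p * cos q))
    (\<lambda>(q, p). S (\<lambda>n. s\<^sup>2 * pw \<epsilon> s n) (A1 q p) (fst x)) (\<lambda>(q, p). S (\<lambda>n. s\<^sup>2 * pw \<epsilon> s n) (A2 q p) (fst x)) (s\<^sup>2 * K)"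
    by (rule T3_cong) (simp_all add: hh_expansion S_gamma_cmult)
  then show ?thesis by (rule T3_cell_norm[OF _ \<alpha>])
qed

lemma hh_q_independent:
  assumes K: "hb \<alpha> (fst x) K" and small: "\<bar>s\<bar> * K < 1"
  shows "q_independent (hh s) \<longleftrightarrow> s = 0"
proof
  assume "s = 0"
  have "hh s (q, p) = hh s (q', p)" if "p \<in> I" for q q' p
    unfolding hh_eq[OF that] using \<open>s = 0\<close> by simp
  then show "q_independent (hh s)" unfolding q_independent_def by blast
next
  assume qi: "q_independent (hh s)"
  have z: "(0 :: real) \<in> I" by simp
  have w: "\<bar>S (pw \<epsilon> s) (A0 q 0) (fst x)\<bar> \<le> K" for q
    using S_bound(2)[where \<gamma> = "pw \<epsilon> s", OF controlled_A(1)[OF z, of \<alpha> q] pw_bounds(1)[OF eps(1) s s] K] by simp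
  have M0: "M 0 = 1" using Mval[OF z] kap by simp
  \<comment> \<open>The crest and the trough of the cosine at the surface, where M is 1: the heights
    differ by 2 s plus terms of order \<open>s\<^sup>2\<close>.\<close>
  have "hh s (0, 0) = hh s (pi, 0)" using qi z unfolding q_independent_def by blast
  then have "s * (2 + s * (S (pw \<epsilon> s) (A0 0 0) (fst x) - S (pw \<epsilon> s) (A0 pi 0) (fst x))) = 0"
    using hh_expansion[OF z, of 0] hh_expansion[OF z, of pi] M0 by (simp add: algebra_simps power2_eq_square)
  moreover have "\<bar>s * (S (pw \<epsilon> s) (A0 0 0) (fst x) - S (pw \<epsilon> s) (A0 pi 0) (fst x))\<bar> < 2"
  proof -
    have "\<bar>s\<bar> * \<bar>S (pw \<epsilon> s) (A0 0 0) (fst x) - S (pw \<epsilon> s) (A0 pi 0) (fst x)\<bar> \<le> \<bar>s\<bar> * (2 * K)"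
      using w[of 0] w[of pi] by (intro mult_left_mono) linarith+
    also have "\<dots> < 2" using small by simp
    finally show ?thesis by (simp add: abs_mult)
  qed
  ultimately show "s = 0" by auto
qed

end

end

section \<open>The bifurcating curve\<close>

lemma (in wave_flow) local_curve:
  obtains r where "0 < r" "\<And>\<delta>. 0 < \<delta> \<Longrightarrow> \<delta> \<le> r \<Longrightarrow> lam C1_differentiable_on {-\<delta><..<\<delta>}"
    "\<And>\<delta>. 0 < \<delta> \<Longrightarrow> \<delta> \<le> r \<Longrightarrow> C1_curve_per \<alpha> {-\<delta><..<\<delta>} hh"
    "\<And>s. \<bar>s\<bar> < r \<Longrightarrow> lam s > - Gamma_min \<Gamma>"
    "\<And>s. \<bar>s\<bar> < r \<Longrightarrow> water_wave_solution \<alpha> g d p0 \<Gamma> (Q_of g d p0 \<Gamma> (lam s)) (hh s)"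
    "\<And>s. \<bar>s\<bar> < r \<Longrightarrow> q_independent (hh s) \<longleftrightarrow> s = 0"
    "lam 0 = l" "\<And>q p. p \<in> I \<Longrightarrow> hh 0 (q, p) = laminar \<Gamma> l p"
    "(\<lambda>s. C1_holder_norm \<alpha> cell (\<lambda>(q, p). hh s (q, p) - (laminar \<Gamma> (lam s) p + s * M p * cos q))) \<in> o[at 0](\<lambda>s. s)"
proof -
  obtain p1 where p1: "p1 \<in> I" "\<And>p. p \<in> I \<Longrightarrow> a p1 \<le> a p"
    using continuous_attains_inf[OF compact_Icc _ ac] by auto
  define a0 where "a0 = a p1"
  have a0: "0 < a0" "\<And>p. p \<in> I \<Longrightarrow> a0 \<le> a p" using p1 apos by (auto simp: a0_def)
  obtain KZ KM KH where K: "hb \<alpha> (fst x) KZ" "hb \<alpha> (Mm x) KM" "hb \<alpha> H KH" using hb_elements by blast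
  have KZ: "0 \<le> KZ" by (rule hb_nonneg[OF K(1)])
  define E where "E = norm (Nm x) + norm (Ym \<epsilon> x) + 1"
  have E: "0 < E" by (simp add: E_def add_nonneg_pos)
  \<comment> \<open>The first bound keeps s within the radius of differentiability
    \<open>\<epsilon> / 4\<close>, the second keeps \<open>ee\<close> and \<open>\<tau>\<close>
    above \<open>a0 / 2\<close>, and the third lets the leading cosine dominate the
    remainder.\<close>
  define r where "r = min (\<epsilon> / 8) (min (a0 / (2 * E)) (1 / (KZ + 1)))"
  have r: "0 < r" "r \<le> \<epsilon> / 8" "r \<le> a0 / (2 * E)" "r \<le> 1 / (KZ + 1)"
    using eps a0 E KZ by (auto simp: r_def)
  have s4: "\<bar>s\<bar> \<le> \<epsilon> / 4" if "\<bar>s\<bar> < r" for s using that r(2) eps by linarith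
  have sE: "\<bar>s\<bar> * E \<le> a0 / 2" if "\<bar>s\<bar> < r" for s
  proof -
    have "\<bar>s\<bar> * E \<le> a0 / (2 * E) * E" using that r(3) E by (intro mult_right_mono) linarith+
    then show ?thesis using E by simp
  qed
  have sK: "\<bar>s\<bar> * KZ < 1" if "\<bar>s\<bar> < r" for s
  proof -
    have "\<bar>s\<bar> * (KZ + 1) \<le> 1 / (KZ + 1) * (KZ + 1)" using that r(4) KZ by (intro mult_right_mono) linarith+
    also have "\<dots> = 1" using KZ by simp
    finally have "\<bar>s\<bar> * KZ + \<bar>s\<bar> \<le> 1" by (simp add: distrib_left)
    then show ?thesis by (cases "s = 0") auto
  qed
  have low: "a0 / 2 \<le> ee s q p" "a0 / 2 \<le> \<tau> s q p" if s: "\<bar>s\<bar> < r" and p: "p \<in> I" for s q p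
  proof -
    note bd = ec_simps(14)[OF t_le[OF s4[OF s] p], of q p]
    define X Y where "X = \<bar>s\<bar> * norm (Nm x)" and "Y = \<bar>s\<bar> * norm (Ym \<epsilon> x)"
    have 1: "\<bar>s * ec (s / \<epsilon>) q p (Nm x)\<bar> \<le> X" unfolding abs_mult X_def by (intro mult_left_mono bd) simp
    have 2: "\<bar>s * yy s q p\<bar> \<le> Y" unfolding abs_mult Y_def yy_def by (intro mult_left_mono bd) simp
    have "X + Y + \<bar>s\<bar> \<le> a0 / 2" using sE[OF s] by (simp add: E_def X_def Y_def algebra_simps)
    moreover have "0 \<le> X" "0 \<le> Y" by (simp_all add: X_def Y_def)
    ultimately show "a0 / 2 \<le> ee s q p" "a0 / 2 \<le> \<tau> s q p"
      unfolding \<tau>_def ee_eq[OF s4[OF s] p] using 1 2 a0(2)[OF p] by linarith+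
  qed
  have pos: "0 < ee s q p" "0 < \<tau> s q p" if "\<bar>s\<bar> < r" "p \<in> I" for s q p
    using low[OF that, of q] a0(1) by linarith+
  show thesis
  proof (rule that[OF r(1)])
    fix \<delta> :: real assume \<delta>: "0 < \<delta>" "\<delta> \<le> r"
    have J: "{-\<delta><..<\<delta>} \<subseteq> {- \<epsilon> / 4<..<\<epsilon> / 4}" "{-\<delta><..<\<delta>} \<subseteq> {- \<epsilon> / 4..\<epsilon> / 4}" using \<delta> r(2) eps by auto
    have z: "(0 :: real) \<in> I" by simp
    have "(\<lambda>s. S (pw \<epsilon> s) (A2 0 0) (Mm x)) C1_differentiable_on {-\<delta><..<\<delta>}"
      by (rule S_C1_differentiable[OF eps(1) K(2) controlled_A(3)[OF z] J(1)])
    then have "\<nu> C1_differentiable_on {-\<delta><..<\<delta>}" by (simp only: \<nu>_def[abs_def] ec_S)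
    then show "lam C1_differentiable_on {-\<delta><..<\<delta>}"
      unfolding lam_def[abs_def] by (intro C1_differentiable_on_add C1_differentiable_on_mult) simp_all
    show "C1_curve_per \<alpha> {-\<delta><..<\<delta>} hh"
      unfolding hh_def[abs_def] by (rule S_curve[OF eps(1) K(3) \<alpha> J(2)])
  next
    fix s :: real assume s: "\<bar>s\<bar> < r"
    show "water_wave_solution \<alpha> g d p0 \<Gamma> (Q_of g d p0 \<Gamma> (lam s)) (hh s)"
      by (rule hh_solution[OF s4[OF s] pos(1)[OF s] pos(2)[OF s]])
    show "q_independent (hh s) \<longleftrightarrow> s = 0"
      by (rule hh_q_independent[OF s4[OF s] pos(1)[OF s] pos(2)[OF s] K(1) sK[OF s]])
    \<comment> \<open>The square of \<open>ee\<close> is \<open>\<lambda> + \<Gamma>\<close>, so its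
      uniform lower bound gives the strict inequality for the infimum of
      \<open>\<Gamma>\<close>.\<close>
    have "(a0 / 2) * (a0 / 2) - lam s \<le> \<Gamma> p" if p: "p \<in> I" for p
    proof -
      have "(a0 / 2) * (a0 / 2) \<le> ee s 0 p * ee s 0 p" using low(1)[OF s p, of 0] a0(1) by (intro mult_mono) auto
      then show ?thesis using lam_ee[OF s4[OF s] p, of 0] by linarith
    qed
    then have "(a0 / 2) * (a0 / 2) - lam s \<le> Gamma_min \<Gamma>" unfolding Gamma_min_def by (intro cINF_greatest) auto
    moreover have "0 < (a0 / 2) * (a0 / 2)" using a0(1) by simp
    ultimately show "lam s > - Gamma_min \<Gamma>" by linarith
  next
    show l0: "lam 0 = l" by (simp add: lam_def)
    have z: "\<bar>0 :: real\<bar> < r" using r(1) by simp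
    show "hh 0 (q, p) = laminar \<Gamma> l p" if "p \<in> I" for q p
      using hh_eq[OF s4[OF z] pos(1)[OF z] pos(2)[OF z] that, of q] by (simp add: l0)
    show "(\<lambda>s. C1_holder_norm \<alpha> cell (\<lambda>(q, p). hh s (q, p) - (laminar \<Gamma> (lam s) p + s * M p * cos q))) \<in> o[at 0](\<lambda>s. s)"
    proof (rule landau_o.smallI)
      fix k :: real assume k: "0 < k"
      define w where "w = min r (k / (7 * KZ + 1))"
      have w: "0 < w" "w \<le> r" "w \<le> k / (7 * KZ + 1)" using r(1) k KZ by (auto simp: w_def)
      show "\<forall>\<^sub>F s in at 0. norm (C1_holder_norm \<alpha> cell (\<lambda>(q, p). hh s (q, p) - (laminar \<Gamma> (lam s) p + s * M p * cos q))) \<le> k * norm s"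
        unfolding eventually_at
      proof (intro exI[of _ w] conjI ballI impI w(1))
        fix s :: real assume "s \<noteq> 0 \<and> dist s 0 < w"
        then have sw: "\<bar>s\<bar> < w" by simp
        then have s: "\<bar>s\<bar> < r" using w(2) by linarith
        have "\<bar>s\<bar> * (7 * KZ + 1) \<le> k / (7 * KZ + 1) * (7 * KZ + 1)" using sw w(3) KZ by (intro mult_right_mono) linarith+
        then have "\<bar>s\<bar> * (7 * KZ + 1) \<le> k" using KZ by simp
        then have "\<bar>s\<bar> * (7 * KZ) \<le> k" using KZ by (simp add: distrib_left)
        then have "\<bar>s\<bar> * (7 * KZ) * \<bar>s\<bar> \<le> k * \<bar>s\<bar>" by (intro mult_right_mono) auto
        moreover have "\<bar>s\<bar> * (7 * KZ) * \<bar>s\<bar> = 7 * (s\<^sup>2 * KZ)" by (simp add: power2_eq_square algebra_simps)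
        ultimately show "norm (C1_holder_norm \<alpha> cell (\<lambda>(q, p). hh s (q, p) - (laminar \<Gamma> (lam s) p + s * M p * cos q))) \<le> k * norm s"
          using hh_remainder[OF s4[OF s] pos(1)[OF s] pos(2)[OF s] K(1)] by simp
      qed
    qed
  qed
qed

lemma C1_holder_imp_holder:
  assumes "N \<in> C1_holder \<alpha> I" "0 < \<alpha>" "\<alpha> \<le> 1"
  shows "N \<in> holder \<alpha> I"
proof -
  obtain A where A: "\<And>p. p \<in> I \<Longrightarrow> \<bar>pd_on I 1 N p\<bar> \<le> A" by (rule holder_bounded[OF C1_holder_I(2)[OF assms(1)]]) (rule that)
  have A0: "0 \<le> A" using A[of 0] by auto
  have "\<bar>N p - N q\<bar> \<le> A * dist p q powr \<alpha>" if "p \<in> I" "q \<in> I" for p q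
  proof -
    have "\<bar>N p - N q\<bar> \<le> A * \<bar>p - q\<bar>" by (rule Lip_I[OF C1_holder_I(1)[OF assms(1)] A that])
    also have "\<dots> \<le> A * \<bar>p - q\<bar> powr \<alpha>" using that assms A0 by (intro mult_left_mono powr_le_Lip) auto
    finally show ?thesis by (simp add: dist_real_def)
  qed
  moreover have "bounded (N ` I)" using assms(1) by (simp add: C1_holder_def)
  ultimately show ?thesis unfolding holder_def by blast
qed

text \<open>The strict inequality for l bounds \<open>\<Gamma> + l\<close> below by a positive
  constant; above it, square root and reciprocal are Lipschitz and preserve Hoelder
  continuity.\<close>

lemma SL_coeff_properties:
  assumes \<Gamma>: "\<Gamma> \<in> holder \<alpha> I" and l: "l > - Gamma_min \<Gamma>"
  obtains r0 M1 where "0 < r0" "\<And>p. p \<in> I \<Longrightarrow> r0 \<le> SL_coeff \<Gamma> l p" "0 \<le> M1"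
    "\<And>p. p \<in> I \<Longrightarrow> SL_coeff \<Gamma> l p * SL_coeff \<Gamma> l p = \<Gamma> p + l" "\<And>p. p \<in> I \<Longrightarrow> SL_coeff \<Gamma> l p * SL_coeff \<Gamma> l p \<le> M1"
    "SL_coeff \<Gamma> l \<in> holder \<alpha> I" "(\<lambda>p. 1 / SL_coeff \<Gamma> l p) \<in> holder \<alpha> I"
proof -
  let ?a = "SL_coeff \<Gamma> l"
  obtain GA where GA: "\<And>p. p \<in> I \<Longrightarrow> \<bar>\<Gamma> p\<bar> \<le> GA" by (rule holder_bounded[OF \<Gamma>]) (rule that)
  have "bdd_below (\<Gamma> ` I)" by (rule bdd_belowI2[of _ "- GA"]) (use GA in \<open>force simp: abs_le_iff\<close>)
  then have "Gamma_min \<Gamma> \<le> \<Gamma> p" if "p \<in> I" for p unfolding Gamma_min_def by (rule cINF_lower) (rule that)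
  then have ge: "Gamma_min \<Gamma> + l \<le> \<Gamma> p + l" if "p \<in> I" for p using that by simp
  define r0 where "r0 = sqrt (Gamma_min \<Gamma> + l)"
  have r0: "0 < r0" using l by (simp add: r0_def)
  have low: "r0 \<le> ?a p" if "p \<in> I" for p unfolding r0_def SL_coeff_def by (rule real_sqrt_le_mono[OF ge[OF that]])
  have sq: "?a p * ?a p = \<Gamma> p + l" if "p \<in> I" for p using ge[OF that] l by (simp add: SL_coeff_def)
  have up: "?a p * ?a p \<le> GA + \<bar>l\<bar>" if "p \<in> I" for p using GA[OF that] by (simp add: sq[OF that])
  have GA0: "0 \<le> GA + \<bar>l\<bar>" using GA[of 0] by auto
  have ah: "?a \<in> holder \<alpha> I"
  proof (rule holder_Lipschitz_image[OF \<Gamma>, where A = "GA + \<bar>l\<bar> + 1" and L = "1 / r0"])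
    fix p :: real assume p: "p \<in> I"
    \<comment> \<open>Yields that \<open>a\<close> is at most \<open>a\<^sup>2 + 1/4\<close>, which
      bounds \<open>a\<close> by the known bound of its square.\<close>
    have "0 \<le> (?a p - 1/2) * (?a p - 1/2)" by simp
    then show "\<bar>?a p\<bar> \<le> GA + \<bar>l\<bar> + 1" using low[OF p] r0 up[OF p] by (simp add: algebra_simps)
  next
    fix p q :: real assume pq: "p \<in> I" "q \<in> I"
    have "(?a p - ?a q) * (?a p + ?a q) = \<Gamma> p - \<Gamma> q" using sq[OF pq(1)] sq[OF pq(2)] by (simp add: algebra_simps)
    then have "\<bar>?a p - ?a q\<bar> * \<bar>?a p + ?a q\<bar> = \<bar>\<Gamma> p - \<Gamma> q\<bar>" by (simp only: abs_mult[symmetric])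
    moreover have "\<bar>?a p - ?a q\<bar> * r0 \<le> \<bar>?a p - ?a q\<bar> * \<bar>?a p + ?a q\<bar>"
      using low[OF pq(1)] low[OF pq(2)] r0 by (intro mult_left_mono) auto
    ultimately show "\<bar>?a p - ?a q\<bar> \<le> 1 / r0 * \<bar>\<Gamma> p - \<Gamma> q\<bar>" using r0 by (simp add: pos_le_divide_eq)
  qed (use r0 in simp)
  have ai: "(\<lambda>p. 1 / ?a p) \<in> holder \<alpha> I"
  proof (rule holder_Lipschitz_image[OF ah, where A = "1 / r0" and L = "1 / (r0 * r0)"])
    show "\<bar>1 / ?a p\<bar> \<le> 1 / r0" if "p \<in> I" for p
      using low[OF that] r0 by (simp add: abs_divide frac_le)
  next
    fix p q :: real assume pq: "p \<in> I" "q \<in> I"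
    have a: "0 < ?a p" "0 < ?a q" using low[OF pq(1)] low[OF pq(2)] r0 by linarith+
    have "\<bar>1 / ?a p - 1 / ?a q\<bar> = \<bar>?a p - ?a q\<bar> / (?a p * ?a q)"
      using a by (simp add: diff_frac_eq abs_divide abs_mult abs_minus_commute)
    also have "\<dots> \<le> \<bar>?a p - ?a q\<bar> / (r0 * r0)"
      using low[OF pq(1)] low[OF pq(2)] r0 a by (intro divide_left_mono mult_mono) auto
    finally show "\<bar>1 / ?a p - 1 / ?a q\<bar> \<le> 1 / (r0 * r0) * \<bar>?a p - ?a q\<bar>" by simp
  qed (use r0 in simp)
  show thesis by (rule that[OF r0 low GA0 sq up ah ai])
qed

theorem theorem2p3:
  fixes g d p0 c \<alpha> l :: real and \<Gamma> M0 :: "real \<Rightarrow> real"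
  assumes "g > 0" and "d > 0" and "p0 < 0" and "c > 0"
    and "0 < \<alpha>" and "\<alpha> < 1"
    and "\<Gamma> \<in> holder \<alpha> {-1..0}" and "\<Gamma> 0 = 0"
    and "l > - Gamma_min \<Gamma>"
    and "SL_solution \<alpha> g d p0 \<Gamma> l M0" and "\<exists>p\<in>{-1..0}. M0 p \<noteq> 0"
  shows "\<exists>M. SL_solution \<alpha> g d p0 \<Gamma> l M \<and> M 0 = 1 \<and>
    (\<forall>N. SL_solution \<alpha> g d p0 \<Gamma> l N \<and> N 0 = 1 \<longrightarrow> (\<forall>p\<in>{-1..0}. N p = M p)) \<and>
    (\<forall>\<^sub>F \<epsilon> in at_right 0.
      \<exists>(lam :: real \<Rightarrow> real) (h :: real \<Rightarrow> real \<times> real \<Rightarrow> real).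
        lam C1_differentiable_on {-\<epsilon><..<\<epsilon>} \<and>
        C1_curve_per \<alpha> {-\<epsilon><..<\<epsilon>} h \<and>
        (\<forall>s\<in>{-\<epsilon><..<\<epsilon>}.
          lam s > - Gamma_min \<Gamma> \<and>
          water_wave_solution \<alpha> g d p0 \<Gamma> (Q_of g d p0 \<Gamma> (lam s)) (h s)) \<and>
        (\<forall>s\<in>{-\<epsilon><..<\<epsilon>}. q_independent (h s) \<longleftrightarrow> s = 0) \<and>
        lam 0 = l \<and> (\<forall>q. \<forall>p\<in>{-1..0}. h 0 (q, p) = laminar \<Gamma> l p) \<and>
        (\<lambda>s. C1_holder_norm \<alpha> cell
               (\<lambda>(q, p). h s (q, p) - (laminar \<Gamma> (lam s) p + s * M p * cos q)))
          \<in> o[at 0](\<lambda>s. s))"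
proof -
  define a where "a = SL_coeff \<Gamma> l"
  obtain r0 M1 where a: "0 < r0" "\<And>p. p \<in> I \<Longrightarrow> r0 \<le> a p" "0 \<le> M1"
    "\<And>p. p \<in> I \<Longrightarrow> a p * a p = \<Gamma> p + l" "\<And>p. p \<in> I \<Longrightarrow> a p * a p \<le> M1"
    and ah: "a \<in> holder \<alpha> I" and ai: "(\<lambda>p. 1 / a p) \<in> holder \<alpha> I"
    by (rule SL_coeff_properties[OF assms(7,9), folded a_def]) (rule that)
  have apos: "0 < a p" if "p \<in> I" for p using a(1) a(2)[OF that] by linarith
  have ac: "continuous_on I a" by (rule holder_continuous_on[OF ah assms(5)])
  define bf where "bf = (\<lambda>p. 1 / a p * (1 / a p) * (1 / a p))"
  define cf where "cf = (\<lambda>p. d\<^sup>2 * a p)"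
  have bh: "bf \<in> holder \<alpha> I" and ch: "cf \<in> holder \<alpha> I" unfolding bf_def cf_def by (intro holder_mult holder_const ah ai)+
  define b e where "b = mkc bf" and "e = mkc cf"
  have bc: "continuous_on I bf" and cc: "continuous_on I cf" using holder_continuous_on[OF _ assms(5)] bh ch by blast+
  have bval: "b p = 1 / a p ^ 3" and eval: "e p = d\<^sup>2 * a p" if "p \<in> I" for p
    unfolding b_def e_def mkc_apply[OF bc] mkc_apply[OF cc] cl_id[OF that] by (simp_all add: bf_def cf_def power3_eq_cube)
  have b0: "0 < b p" "0 < e p" if "p \<in> I" for p using apos[OF that] assms(2) by (simp_all add: bval[OF that] eval[OF that])
  have "\<exists>t. fundamental_system b e (real k) (fst t) (fst (snd t)) (fst (snd (snd t))) (snd (snd (snd t)))" for k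
  proof -
    obtain \<phi> \<phi>F \<psi> \<psi>F where "fundamental_system b e (real k) \<phi> \<phi>F \<psi> \<psi>F"
      by (rule fundamental_system_exists[of b e "real k"]) (use b0 in \<open>auto intro: less_imp_le\<close>)
    then show ?thesis by (intro exI[of _ "(\<phi>, \<phi>F, \<psi>, \<psi>F)"]) simp
  qed
  then obtain t where t: "\<And>k. fundamental_system b e (real k) (fst (t k)) (fst (snd (t k))) (fst (snd (snd (t k)))) (snd (snd (snd (t k))))"
    by metis
  define \<phi> \<phi>F \<psi> \<psi>F where "\<phi> k = fst (t k)" and "\<phi>F k = fst (snd (t k))" and "\<psi> k = fst (snd (snd (t k)))"
    and "\<psi>F k = snd (snd (snd (t k)))" for k
  \<comment> \<open>The quotient of the two coefficients is \<open>d^2 a^4\<close>. The lower bound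
    \<open>r0\<close> of \<open>a\<close> and the upper bound \<open>M1\<close> of its square
    therefore give the brackets \<open>d * (r0 * r0)\<close> and \<open>d * M1\<close>.\<close>
  have cone: "(d * k)\<^sup>2 * b p \<le> e p" if "p \<in> I" "0 \<le> k" "k \<le> a p * a p" for p k
  proof -
    have "(d * k)\<^sup>2 \<le> (d * (a p * a p))\<^sup>2" using that assms(2) by (intro power_mono mult_left_mono) auto
    also have "\<dots> = d\<^sup>2 * a p * a p ^ 3" by (simp add: power2_eq_square power3_eq_cube)
    finally show ?thesis using apos[OF that(1)] by (simp add: bval[OF that(1)] eval[OF that(1)] pos_divide_le_eq)
  qed
  have cone': "e p \<le> (d * k)\<^sup>2 * b p" if "p \<in> I" "a p * a p \<le> k" for p k
  proof -
    have "d\<^sup>2 * a p * a p ^ 3 = (d * (a p * a p))\<^sup>2" by (simp add: power2_eq_square power3_eq_cube)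
    also have "\<dots> \<le> (d * k)\<^sup>2" using that assms(2) by (intro power_mono mult_left_mono) auto
    finally show ?thesis using apos[OF that(1)] by (simp add: bval[OF that(1)] eval[OF that(1)] pos_le_divide_eq)
  qed
  have modal: "modal b e \<phi> \<phi>F \<psi> \<psi>F (d * (r0 * r0)) (d * M1) (d\<^sup>2 * r0)"
  proof (rule modal.intro)
    show "clinv b" "clinv e" unfolding b_def e_def by (rule clinv_mkc[OF bc], rule clinv_mkc[OF cc])
    show "0 < d * (r0 * r0)" "0 < d\<^sup>2 * r0" "0 \<le> d * M1" using a(1,3) assms(2) by simp_all
    show "(d * (r0 * r0))\<^sup>2 * b p \<le> e p" if "p \<in> I" for p
      by (rule cone[OF that]) (use a(1) a(2)[OF that] in \<open>auto intro: mult_mono\<close>)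
    show "e p \<le> (d * M1)\<^sup>2 * b p" if "p \<in> I" for p by (rule cone'[OF that a(5)[OF that]])
    show "0 < b p" if "p \<in> I" for p by (rule b0(1)[OF that])
    show "d\<^sup>2 * r0 \<le> e p" if "p \<in> I" for p using a(2)[OF that] by (simp add: eval[OF that] mult_left_mono)
    show "fundamental_system b e (real k) (\<phi> k) (\<phi>F k) (\<psi> k) (\<psi>F k)" for k
      using t[of k] by (simp add: \<phi>_def \<phi>F_def \<psi>_def \<psi>F_def)
  qed
  then interpret md: modal b e \<phi> \<phi>F \<psi> \<psi>F "d * (r0 * r0)" "d * M1" "d\<^sup>2 * r0" .
  have sl_form: "\<exists>\<kappa>. (\<forall>p\<in>I. N p = \<kappa> * \<phi> 1 p) \<and> (\<forall>p\<in>I. pd_on I 1 N p = \<kappa> * (b p * \<phi>F 1 p)) \<and>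
      \<kappa> * \<phi>F 1 0 = g * d ^ 3 / p0\<^sup>2 * (\<kappa> * \<phi> 1 0)" if sol: "SL_solution \<alpha> g d p0 \<Gamma> l N" for N
  proof -
    obtain \<kappa> where "\<And>p. p \<in> I \<Longrightarrow> N p = \<kappa> * \<phi> 1 p" "\<And>p. p \<in> I \<Longrightarrow> pd_on I 1 N p = \<kappa> * (b p * \<phi>F 1 p)"
      "\<kappa> * \<phi>F 1 0 = g * d ^ 3 / p0\<^sup>2 * (\<kappa> * \<phi> 1 0)"
      by (rule md.SL_structure[OF sol assms(5) ac[unfolded a_def] apos[unfolded a_def] bval[unfolded a_def] eval[unfolded a_def]])
         (assumption | rule that)+
    then show ?thesis by blast
  qed
  have ph: "0 < \<phi> 1 0" by (rule md.phi_pos) auto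
  obtain \<kappa>0 where k0: "\<And>p. p \<in> I \<Longrightarrow> M0 p = \<kappa>0 * \<phi> 1 p" using sl_form[OF assms(10)] by blast
  \<comment> \<open>A solution is a multiple of \<open>\<phi> 1\<close>, which is positive at the
    surface; a nontrivial one can thus be normalised to 1 there.\<close>
  have "M0 0 \<noteq> 0"
  proof
    assume "M0 0 = 0"
    then have "\<kappa>0 = 0" using k0[of 0] ph by simp
    then show False using assms(11) k0 by auto
  qed
  define M where "M = (\<lambda>p. 1 / M0 0 * M0 p)"
  have slM: "SL_solution \<alpha> g d p0 \<Gamma> l M" unfolding M_def by (rule SL_solution_scale[OF assms(10)])
  have M0: "M 0 = 1" using \<open>M0 0 \<noteq> 0\<close> by (simp add: M_def)
  obtain \<kappa> where kM: "\<And>p. p \<in> I \<Longrightarrow> M p = \<kappa> * \<phi> 1 p" "\<And>p. p \<in> I \<Longrightarrow> pd_on I 1 M p = \<kappa> * (b p * \<phi>F 1 p)"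
    "\<kappa> * \<phi>F 1 0 = g * d ^ 3 / p0\<^sup>2 * (\<kappa> * \<phi> 1 0)" using sl_form[OF slM] by blast
  have kap: "\<kappa> * \<phi> 1 0 = 1" using kM(1)[of 0] M0 by simp
  then have kpos: "0 < \<kappa>" using ph by (metis zero_less_mult_pos2 zero_less_one)
  have unique: "N p = M p" if sol: "SL_solution \<alpha> g d p0 \<Gamma> l N" and N0: "N 0 = 1" and p: "p \<in> I" for N p
  proof -
    obtain \<kappa>' where k': "\<And>p. p \<in> I \<Longrightarrow> N p = \<kappa>' * \<phi> 1 p" using sl_form[OF sol] by blast
    have "\<kappa>' * \<phi> 1 0 = \<kappa> * \<phi> 1 0" using k'[of 0] N0 kap by simp
    then have "\<kappa>' = \<kappa>" using ph by simp
    then show ?thesis using k'[OF p] kM(1)[OF p] by simp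
  qed
  have MC: "M \<in> C1_holder \<alpha> I" using slM by (simp add: SL_solution_def Let_def)
  \<comment> \<open>The loads, four times the contributions of the
    \<open>\<lambda>\<close>-derivatives of the two coefficients acting on M.\<close>
  define f1 f2 where "f1 = (\<lambda>p. - 6 * a p * pd_on I 1 M p)" and "f2 = (\<lambda>p. 2 * d\<^sup>2 * M p * (1 / a p))"
  have fh: "f1 \<in> holder \<alpha> I" "f2 \<in> holder \<alpha> I" unfolding f1_def f2_def
    using assms(5,6) by (intro holder_mult holder_const ah ai C1_holder_I(2)[OF MC] C1_holder_imp_holder[OF MC]; simp)+
  have fc: "continuous_on I f1" "continuous_on I f2" using holder_continuous_on[OF _ assms(5)] fh by blast+
  have d1: "mkc f1 p = - 6 * a p * (\<kappa> * (b p * \<phi>F 1 p))" and d2: "mkc f2 p = 2 * d\<^sup>2 * (\<kappa> * \<phi> 1 p) / a p" if "p \<in> I" for p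
    unfolding mkc_apply[OF fc(1)] mkc_apply[OF fc(2)] cl_id[OF that]
    unfolding f1_def f2_def kM(1)[OF that] kM(2)[OF that] by simp_all
  have load: "md.nw 1 (mkc f1) (mkc f2) 0 \<noteq> 0"
  proof (rule md.load_nonzero)
    fix p :: real assume p: "p \<in> I"
    have "0 < a p * (\<kappa> * (b p * \<phi>F 1 p))" using apos[OF p] kpos b0(1)[OF p] md.fs_sign(2)[OF p, of 1] by (intro mult_pos_pos) auto
    then show "mkc f1 p < 0" unfolding d1[OF p] mult.assoc[of "-6"] by linarith
    show "0 \<le> mkc f2 p" unfolding d2[OF p] using apos[OF p] kpos md.fs_sign(1)[OF p, of 1] by simp
  qed
  have stream: "stream_problem b e \<phi> \<phi>F \<psi> \<psi>F (d * (r0 * r0)) (d * M1) (d\<^sup>2 * r0) (g * d ^ 3 / p0\<^sup>2) (mkc f1) (mkc f2) \<alpha> a d \<kappa>"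
  proof (intro stream_problem.intro modal_robin.intro modal modal_robin_axioms.intro stream_problem_axioms.intro)
    show "\<phi>F 1 0 = g * d ^ 3 / p0\<^sup>2 * \<phi> 1 0"
    proof -
      have "\<kappa> * \<phi>F 1 0 = \<kappa> * (g * d ^ 3 / p0\<^sup>2 * \<phi> 1 0)" unfolding kM(3) by (rule mult.left_commute)
      then show ?thesis using kpos by (simp only: mult_cancel_left) auto
    qed
    show "md.nw 1 (mkc f1) (mkc f2) 0 \<noteq> 0" by (rule load)
    show "\<exists>K. eb \<alpha> 0 b K" "\<exists>K. eb \<alpha> 0 (mkc f1) K" "\<exists>K. eb \<alpha> 0 (mkc f2) K"
      unfolding b_def by (rule holder_eb[OF _ assms(5)], rule bh fh)+
    show "a \<in> holder \<alpha> I" "(\<lambda>p. 1 / a p) \<in> holder \<alpha> I" by (rule ah, rule ai)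
    show "0 < d" "\<kappa> * \<phi> 1 0 = 1" by (rule assms(2), rule kap)
    fix p :: real assume p: "p \<in> I"
    show "0 < a p" "b p = 1 / a p ^ 3" "e p = d\<^sup>2 * a p" by (rule apos[OF p], rule bval[OF p], rule eval[OF p])
    show "mkc f1 p = - 6 * a p * (\<kappa> * (b p * \<phi>F 1 p))" "mkc f2 p = 2 * d\<^sup>2 * (\<kappa> * \<phi> 1 p) / a p"
      by (rule d1[OF p], rule d2[OF p])
  qed (use assms(5,6) in simp_all)
  then interpret sp: stream_problem b e \<phi> \<phi>F \<psi> \<psi>F "d * (r0 * r0)" "d * M1" "d\<^sup>2 * r0" "g * d ^ 3 / p0\<^sup>2" "mkc f1" "mkc f2" \<alpha> a d \<kappa> .
  \<comment> \<open>One value of \<open>\<epsilon>\<close> is fixed for good. The curve parameter s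
    enters only afterwards, through the powers of \<open>s / \<epsilon>\<close> in the evaluation of
    this single fixed point.\<close>
  obtain \<epsilon> x B where fp: "0 < \<epsilon>" "\<epsilon> \<le> 1" "hbX \<alpha> x B"
    "x = (sp.TU (sp.G1 \<epsilon> x) (sp.G2 \<epsilon> x), sp.TV (sp.G1 \<epsilon> x) (sp.G2 \<epsilon> x), sp.TM (sp.G1 \<epsilon> x) (sp.G2 \<epsilon> x),
      sp.Nn \<epsilon> x, sp.Rn \<epsilon> x, sp.Yn \<epsilon> x)"
    by (rule sp.fixed_point) (rule that)
  interpret wf: wave_flow b e \<phi> \<phi>F \<psi> \<psi>F "d * (r0 * r0)" "d * M1" "d\<^sup>2 * r0" "g * d ^ 3 / p0\<^sup>2" "mkc f1" "mkc f2" \<alpha> a d \<kappa> \<epsilon> x B \<Gamma> l g p0 M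
  proof (intro wave_flow.intro fixed_flow.intro stream fixed_flow_axioms.intro fp(1-3) wave_flow_axioms.intro refl)
    show "continuous_on I \<Gamma>" by (rule holder_continuous_on[OF assms(7,5)])
    show "x = (sp.TU (sp.G1 \<epsilon> x) (sp.G2 \<epsilon> x), sp.TV (sp.G1 \<epsilon> x) (sp.G2 \<epsilon> x), sp.TM (sp.G1 \<epsilon> x) (sp.G2 \<epsilon> x),
      sp.Nn \<epsilon> x, sp.Rn \<epsilon> x, sp.Yn \<epsilon> x)" by (rule fp(4))
    show "p0 \<noteq> 0" using assms(3) by simp
    show "\<Gamma> 0 = 0" by (rule assms(8))
    show "a p * a p = \<Gamma> p + l" "M p = \<kappa> * \<phi> 1 p" if "p \<in> I" for p by (rule a(4)[OF that], rule kM(1)[OF that])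
  qed
  obtain r where r: "0 < r" "\<And>\<delta>. 0 < \<delta> \<Longrightarrow> \<delta> \<le> r \<Longrightarrow> wf.lam C1_differentiable_on {-\<delta><..<\<delta>}"
    "\<And>\<delta>. 0 < \<delta> \<Longrightarrow> \<delta> \<le> r \<Longrightarrow> C1_curve_per \<alpha> {-\<delta><..<\<delta>} wf.hh"
    "\<And>s. \<bar>s\<bar> < r \<Longrightarrow> wf.lam s > - Gamma_min \<Gamma>"
    "\<And>s. \<bar>s\<bar> < r \<Longrightarrow> water_wave_solution \<alpha> g d p0 \<Gamma> (Q_of g d p0 \<Gamma> (wf.lam s)) (wf.hh s)"
    "\<And>s. \<bar>s\<bar> < r \<Longrightarrow> q_independent (wf.hh s) \<longleftrightarrow> s = 0"
    "wf.lam 0 = l" "\<And>q p. p \<in> I \<Longrightarrow> wf.hh 0 (q, p) = laminar \<Gamma> l p"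
    "(\<lambda>s. C1_holder_norm \<alpha> cell (\<lambda>(q, p). wf.hh s (q, p) - (laminar \<Gamma> (wf.lam s) p + s * M p * cos q))) \<in> o[at 0](\<lambda>s. s)"
    by (rule wf.local_curve) (rule that)
  show ?thesis
  proof (intro exI[of _ M] conjI allI impI ballI)
    show "SL_solution \<alpha> g d p0 \<Gamma> l M" "M 0 = 1" by (rule slM, rule M0)
    show "N p = M p" if "SL_solution \<alpha> g d p0 \<Gamma> l N \<and> N 0 = 1" "p \<in> I" for N p using unique that by blast
  next
    show "\<forall>\<^sub>F \<epsilon> in at_right 0.
      \<exists>(lam :: real \<Rightarrow> real) (h :: real \<Rightarrow> real \<times> real \<Rightarrow> real).
        lam C1_differentiable_on {-\<epsilon><..<\<epsilon>} \<and>
        C1_curve_per \<alpha> {-\<epsilon><..<\<epsilon>} h \<and>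
        (\<forall>s\<in>{-\<epsilon><..<\<epsilon>}.
          lam s > - Gamma_min \<Gamma> \<and>
          water_wave_solution \<alpha> g d p0 \<Gamma> (Q_of g d p0 \<Gamma> (lam s)) (h s)) \<and>
        (\<forall>s\<in>{-\<epsilon><..<\<epsilon>}. q_independent (h s) \<longleftrightarrow> s = 0) \<and>
        lam 0 = l \<and> (\<forall>q. \<forall>p\<in>{-1..0}. h 0 (q, p) = laminar \<Gamma> l p) \<and>
        (\<lambda>s. C1_holder_norm \<alpha> cell
               (\<lambda>(q, p). h s (q, p) - (laminar \<Gamma> (lam s) p + s * M p * cos q)))
          \<in> o[at 0](\<lambda>s. s)"
    \<comment> \<open>The same pair of functions serves every small half-length; only the interval
      of s shrinks.\<close>
    proof (rule eventually_at_rightI[OF _ r(1)], intro exI[of _ wf.lam] exI[of _ wf.hh] conjI ballI allI)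
      fix \<delta> :: real assume "\<delta> \<in> {0<..<r}"
      then have \<delta>: "0 < \<delta>" "\<delta> \<le> r" by auto
      show "wf.lam C1_differentiable_on {-\<delta><..<\<delta>}" "C1_curve_per \<alpha> {-\<delta><..<\<delta>} wf.hh" by (rule r(2,3)[OF \<delta>])+
      have s: "\<bar>s\<bar> < r" if "s \<in> {-\<delta><..<\<delta>}" for s using that \<delta>(2) by auto
      show "wf.lam s > - Gamma_min \<Gamma>" "water_wave_solution \<alpha> g d p0 \<Gamma> (Q_of g d p0 \<Gamma> (wf.lam s)) (wf.hh s)"
        "q_independent (wf.hh s) \<longleftrightarrow> s = 0" if "s \<in> {-\<delta><..<\<delta>}" for s by (rule r(4-6)[OF s[OF that]])+
    qed (rule r(7,9) r(8); assumption?)+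
  qed
qed

end
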